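(* Let $\mathbb{C}$ be an isostable squares category. Then the simplicial space $[n]\mapsto BS^{\square}_n\mathbb{C}$ is a $2$-Segal space.
   Context: A double category $\mathbb{C}$ (an internal category in $\mathrm{Cat}$) has objects, horizontal morphisms $A\rightarrowtail B$ forming a category $\mathcal{H}_{\mathbb{C}}$, vertical morphisms $A\twoheadrightarrow B$ forming a category $\mathcal{V}_{\mathbb{C}}$, and squares with associative and unital compositions. It is flat if a square is uniquely determined by its boundary; we then say a boundary "is a square". A squares category is a flat double category with a distinguished object $O$ initial in $\mathcal{H}_{\mathbb{C}}$ and terminal in $\mathcal{V}_{\mathbb{C}}$. A vertical $f:A\twoheadrightarrow B$ is a vertical weak equivalence if the boundary (top $O\rightarrowtail A$, left $\mathrm{id}_O$, right $f$, bottom $O\rightarrowtail B$) is a square; a horizontal $g:A\rightarrowtail B$ is a horizontal weak equivalence if the boundary (top $g$, left $A\twoheadrightarrow O$, right $B\twoheadrightarrow O$, bottom $\mathrm{id}_O$) is a square. Vertical natural transformations between double functors of flat double categories: vertical components $\tau_A$ such that for each horizontal $f$ the boundary $(Ff,\tau_A,\tau_{A'},Gf)$ is a square and for each vertical $u$ the naturality square commutes in the vertical category. $\mathrm{Fun}^v$ denotes double functors and vertical natural transformations. Let $\boxdot$ be the flat double category generated by one square with corners $a$ (top left), $b$ (top right), $c$ (bottom left), $d$ (bottom right), horizontal $a\rightarrowtail b$, $c\rightarrowtail d$, vertical $a\twoheadrightarrow c$, $b\twoheadrightarrow d$; let $i:\mathrm{span}\hookrightarrow\boxdot$ be the sub-double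 category on $a\rightarrowtail b,a\twoheadrightarrow c$ and $j:\mathrm{cospan}\hookrightarrow\boxdot$ the one on $b\twoheadrightarrow d, c\rightarrowtail d$. A squares category is stable if: (i) $i^*:\mathrm{Fun}^v(\boxdot,\mathbb{C})\to\mathrm{Fun}^v(\mathrm{span},\mathbb{C})$ has a section functor $s$; (ii) there is a natural transformation $w:si^*\Rightarrow\mathrm{id}$ whose component at every square is the identity at $a,b,c$; (iii) $j^*:\mathrm{Fun}^v(\boxdot,\mathbb{C})\to\mathrm{Fun}^v(\mathrm{cospan},\mathbb{C})$ has a section functor $t$; (iv) there is a natural transformation $u:tj^*\Rightarrow\mathrm{id}$ whose component at every square is the identity at $b,c,d$ and whose component at $a$ is a vertical weak equivalence. It is isostable if it is stable, its (horizontal and vertical) weak equivalences are invertible, and for every boundary with top $f:A\rightarrowtail B$, bottom $k:C\rightarrowtail D$ and vertical isomorphisms $g:A\twoheadrightarrow C$, $h:B\twoheadrightarrow D$, this boundary is a square iff the boundary with top $k$, left $g^{-1}$, right $h^{-1}$, bottom $f$ is a square. $S^{\square}_n\mathbb{C}$: objects are families $(A_{jk})_{0\le j\le k\le n}$ with $A_{jj}=O$, horizontal morphisms $A_{jk}\rightarrowtail A_{j,k+1}$, vertical morphisms $A_{jk}\twoheadrightarrow A_{j+1,k}$ ($j<k$), each unit cell with corners $A_{jk},A_{j,k+1},A_{j+1,k},A_{j+1,k+1}$ ($j<k<n$) a square; morphisms are families of vertical morphisms $A_{jk}\twoheadrightarrow A'_{jk}$ forming a vertical natural transformation. For $\theta:[m]\to[n]$,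 $\theta^*(A)_{jk}=A_{\theta(j)\theta(k)}$ (with composite morphisms) makes $S^{\square}_\bullet\mathbb{C}$ a simplicial category. $B$ denotes the classifying space (realization of the nerve). A simplicial space $X$ is $2$-Segal if for every $n\ge3$ and $0\le i<j\le n$ the square with vertices $X_n$, $X_{\{i,\dots,j\}}$, $X_{\{0,\dots,i,j,\dots,n\}}$, $X_{\{i,j\}}$ (maps induced by the inclusions of these subsets of $[n]$, where $X_S$ means $X_{|S|-1}$) is a homotopy pullback. *)

theory Defs
  imports "HOL-Analysis.Analysis" "HOL-Homology.Simplices"
begin

text \<open>A flat double category: two categories (horizontal, vertical) on a common set
of objects, and a predicate saying which boundaries (top, left, right, bottom) are
squares. Composition convention: comp g f = g after f.\<close>

record ('o,'h,'v) dblcat =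
  dobj  :: "'o set"
  hmor  :: "'h set"
  hdom  :: "'h \<Rightarrow> 'o"
  hcod  :: "'h \<Rightarrow> 'o"
  hid   :: "'o \<Rightarrow> 'h"
  hcomp :: "'h \<Rightarrow> 'h \<Rightarrow> 'h"
  vmor  :: "'v set"
  vdom  :: "'v \<Rightarrow> 'o"
  vcod  :: "'v \<Rightarrow> 'o"
  vid   :: "'o \<Rightarrow> 'v"
  vcomp :: "'v \<Rightarrow> 'v \<Rightarrow> 'v"
  issq  :: "'h \<Rightarrow> 'v \<Rightarrow> 'v \<Rightarrow> 'h \<Rightarrow> bool"  \<comment> \<open>top, left, right, bottom\<close>
  zobj  :: "'o"

definition flat_double_category :: "('o,'h,'v) dblcat \<Rightarrow> bool" where
  "flat_double_category C \<longleftrightarrow>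
     \<comment> \<open>horizontal category\<close>
     (\<forall>f\<in>hmor C. hdom C f \<in> dobj C \<and> hcod C f \<in> dobj C) \<and>
     (\<forall>A\<in>dobj C. hid C A \<in> hmor C \<and> hdom C (hid C A) = A \<and> hcod C (hid C A) = A) \<and>
     (\<forall>f\<in>hmor C. \<forall>g\<in>hmor C. hcod C f = hdom C g \<longrightarrow>
        hcomp C g f \<in> hmor C \<and> hdom C (hcomp C g f) = hdom C f \<and> hcod C (hcomp C g f) = hcod C g) \<and>
     (\<forall>f\<in>hmor C. hcomp C f (hid C (hdom C f)) = f \<and> hcomp C (hid C (hcod C f)) f = f) \<and>
     (\<forall>f\<in>hmor C. \<forall>g\<in>hmor C. \<forall>h\<in>hmor C. hcod C f = hdom C g \<longrightarrow> hcod C g = hdom C h \<longrightarrow>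
        hcomp C h (hcomp C g f) = hcomp C (hcomp C h g) f) \<and>
     \<comment> \<open>vertical category\<close>
     (\<forall>f\<in>vmor C. vdom C f \<in> dobj C \<and> vcod C f \<in> dobj C) \<and>
     (\<forall>A\<in>dobj C. vid C A \<in> vmor C \<and> vdom C (vid C A) = A \<and> vcod C (vid C A) = A) \<and>
     (\<forall>f\<in>vmor C. \<forall>g\<in>vmor C. vcod C f = vdom C g \<longrightarrow>
        vcomp C g f \<in> vmor C \<and> vdom C (vcomp C g f) = vdom C f \<and> vcod C (vcomp C g f) = vcod C g) \<and>
     (\<forall>f\<in>vmor C. vcomp C f (vid C (vdom C f)) = f \<and> vcomp C (vid C (vcod C f)) f = f) \<and>
     (\<forall>f\<in>vmor C. \<forall>g\<in>vmor C. \<forall>h\<in>vmor C. vcod C f = vdom C g \<longrightarrow> vcod C g = vdom C h \<longrightarrow>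
        vcomp C h (vcomp C g f) = vcomp C (vcomp C h g) f) \<and>
     \<comment> \<open>squares have well-formed boundaries\<close>
     (\<forall>f u v g. issq C f u v g \<longrightarrow> f \<in> hmor C \<and> g \<in> hmor C \<and> u \<in> vmor C \<and> v \<in> vmor C \<and>
        hdom C f = vdom C u \<and> hcod C f = vdom C v \<and> hdom C g = vcod C u \<and> hcod C g = vcod C v) \<and>
     \<comment> \<open>identity squares\<close>
     (\<forall>f\<in>hmor C. issq C f (vid C (hdom C f)) (vid C (hcod C f)) f) \<and>
     (\<forall>u\<in>vmor C. issq C (hid C (vdom C u)) u u (hid C (vcod C u))) \<and>
     \<comment> \<open>horizontal and vertical composition of squares\<close>
     (\<forall>f u v g f' w g'. issq C f u v g \<longrightarrow> issq C f' v w g' \<longrightarrow>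
        issq C (hcomp C f' f) u w (hcomp C g' g)) \<and>
     (\<forall>f u v g u' v' k. issq C f u v g \<longrightarrow> issq C g u' v' k \<longrightarrow>
        issq C f (vcomp C u' u) (vcomp C v' v) k)"

definition squares_category :: "('o,'h,'v) dblcat \<Rightarrow> bool" where
  "squares_category C \<longleftrightarrow> flat_double_category C \<and> zobj C \<in> dobj C \<and>
     (\<forall>A\<in>dobj C. \<exists>!f. f \<in> hmor C \<and> hdom C f = zobj C \<and> hcod C f = A) \<and>
     (\<forall>A\<in>dobj C. \<exists>!u. u \<in> vmor C \<and> vdom C u = A \<and> vcod C u = zobj C)"

definition hinit :: "('o,'h,'v) dblcat \<Rightarrow> 'o \<Rightarrow> 'h" where
  "hinit C A = (THE f. f \<in> hmor C \<and> hdom C f = zobj C \<and> hcod C f = A)"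

definition vterm :: "('o,'h,'v) dblcat \<Rightarrow> 'o \<Rightarrow> 'v" where
  "vterm C A = (THE u. u \<in> vmor C \<and> vdom C u = A \<and> vcod C u = zobj C)"

definition vweq :: "('o,'h,'v) dblcat \<Rightarrow> 'v \<Rightarrow> bool" where
  "vweq C f \<longleftrightarrow> f \<in> vmor C \<and>
     issq C (hinit C (vdom C f)) (vid C (zobj C)) f (hinit C (vcod C f))"

definition hweq :: "('o,'h,'v) dblcat \<Rightarrow> 'h \<Rightarrow> bool" where
  "hweq C g \<longleftrightarrow> g \<in> hmor C \<and>
     issq C g (vterm C (hdom C g)) (vterm C (hcod C g)) (hid C (zobj C))"

definition vinverse :: "('o,'h,'v) dblcat \<Rightarrow> 'v \<Rightarrow> 'v \<Rightarrow> bool" where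
  "vinverse C g g' \<longleftrightarrow> g \<in> vmor C \<and> g' \<in> vmor C \<and> vdom C g' = vcod C g \<and> vcod C g' = vdom C g \<and>
     vcomp C g' g = vid C (vdom C g) \<and> vcomp C g g' = vid C (vcod C g)"

definition viso :: "('o,'h,'v) dblcat \<Rightarrow> 'v \<Rightarrow> bool" where
  "viso C g \<longleftrightarrow> (\<exists>g'. vinverse C g g')"

definition hiso :: "('o,'h,'v) dblcat \<Rightarrow> 'h \<Rightarrow> bool" where
  "hiso C f \<longleftrightarrow> f \<in> hmor C \<and> (\<exists>f'\<in>hmor C. hdom C f' = hcod C f \<and> hcod C f' = hdom C f \<and>
     hcomp C f' f = hid C (hdom C f) \<and> hcomp C f f' = hid C (hcod C f))"

record ('a,'m) catg =
  cob   :: "'a set"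
  cmor  :: "'m set"
  cdom  :: "'m \<Rightarrow> 'a"
  ccod  :: "'m \<Rightarrow> 'a"
  cid   :: "'a \<Rightarrow> 'm"
  ccomp :: "'m \<Rightarrow> 'm \<Rightarrow> 'm"

definition is_functor :: "('a,'m) catg \<Rightarrow> ('b,'n) catg \<Rightarrow> ('a \<Rightarrow> 'b) \<Rightarrow> ('m \<Rightarrow> 'n) \<Rightarrow> bool" where
  "is_functor C D Fo Fm \<longleftrightarrow>
     (\<forall>x\<in>cob C. Fo x \<in> cob D) \<and>
     (\<forall>m\<in>cmor C. Fm m \<in> cmor D \<and> cdom D (Fm m) = Fo (cdom C m) \<and> ccod D (Fm m) = Fo (ccod C m)) \<and>
     (\<forall>x\<in>cob C. Fm (cid C x) = cid D (Fo x)) \<and>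
     (\<forall>f\<in>cmor C. \<forall>g\<in>cmor C. ccod C f = cdom C g \<longrightarrow> Fm (ccomp C g f) = ccomp D (Fm g) (Fm f))"

definition is_nattrans :: "('a,'m) catg \<Rightarrow> ('b,'n) catg \<Rightarrow> ('a \<Rightarrow> 'b) \<Rightarrow> ('m \<Rightarrow> 'n) \<Rightarrow>
    ('a \<Rightarrow> 'b) \<Rightarrow> ('m \<Rightarrow> 'n) \<Rightarrow> ('a \<Rightarrow> 'n) \<Rightarrow> bool" where
  "is_nattrans C D Fo Fm Go Gm \<eta> \<longleftrightarrow>
     (\<forall>x\<in>cob C. \<eta> x \<in> cmor D \<and> cdom D (\<eta> x) = Fo x \<and> ccod D (\<eta> x) = Go x) \<and>
     (\<forall>m\<in>cmor C. ccomp D (\<eta> (ccod C m)) (Fm m) = ccomp D (Gm m) (\<eta> (cdom C m)))"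

text \<open>A double functor span -> C: horizontal f: a -> b and vertical u: a -> c.\<close>
record ('o,'h,'v) spn =
  sp_a :: 'o  sp_b :: 'o  sp_c :: 'o
  sp_f :: 'h  sp_u :: 'v

record ('o,'h,'v) spn_mor =
  spm_src :: "('o,'h,'v) spn"  spm_tgt :: "('o,'h,'v) spn"
  spm_a :: 'v  spm_b :: 'v  spm_c :: 'v

definition span_cat :: "('o,'h,'v) dblcat \<Rightarrow> (('o,'h,'v) spn, ('o,'h,'v) spn_mor) catg" where
  "span_cat C = \<lparr>
     cob = {X. sp_f X \<in> hmor C \<and> hdom C (sp_f X) = sp_a X \<and> hcod C (sp_f X) = sp_b X \<and>
               sp_u X \<in> vmor C \<and> vdom C (sp_u X) = sp_a X \<and> vcod C (sp_u X) = sp_c X},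
     cmor = {m. let X = spm_src m; Y = spm_tgt m in
               X \<in> {X. sp_f X \<in> hmor C \<and> hdom C (sp_f X) = sp_a X \<and> hcod C (sp_f X) = sp_b X \<and>
                      sp_u X \<in> vmor C \<and> vdom C (sp_u X) = sp_a X \<and> vcod C (sp_u X) = sp_c X} \<and>
               Y \<in> {X. sp_f X \<in> hmor C \<and> hdom C (sp_f X) = sp_a X \<and> hcod C (sp_f X) = sp_b X \<and>
                      sp_u X \<in> vmor C \<and> vdom C (sp_u X) = sp_a X \<and> vcod C (sp_u X) = sp_c X} \<and>
               spm_a m \<in> vmor C \<and> vdom C (spm_a m) = sp_a X \<and> vcod C (spm_a m) = sp_a Y \<and>
               spm_b m \<in> vmor C \<and> vdom C (spm_b m) = sp_b X \<and> vcod C (spm_b m) = sp_b Y \<and>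
               spm_c m \<in> vmor C \<and> vdom C (spm_c m) = sp_c X \<and> vcod C (spm_c m) = sp_c Y \<and>
               issq C (sp_f X) (spm_a m) (spm_b m) (sp_f Y) \<and>
               vcomp C (spm_c m) (sp_u X) = vcomp C (sp_u Y) (spm_a m)},
     cdom = spm_src, ccod = spm_tgt,
     cid = (\<lambda>X. \<lparr>spm_src = X, spm_tgt = X, spm_a = vid C (sp_a X), spm_b = vid C (sp_b X),
                 spm_c = vid C (sp_c X)\<rparr>),
     ccomp = (\<lambda>g f. \<lparr>spm_src = spm_src f, spm_tgt = spm_tgt g,
                 spm_a = vcomp C (spm_a g) (spm_a f), spm_b = vcomp C (spm_b g) (spm_b f),
                 spm_c = vcomp C (spm_c g) (spm_c f)\<rparr>) \<rparr>"

text \<open>A double functor cospan -> C: vertical v: b -> d and horizontal g: c -> d.\<close>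
record ('o,'h,'v) cspn =
  cs_b :: 'o  cs_c :: 'o  cs_d :: 'o
  cs_v :: 'v  cs_g :: 'h

record ('o,'h,'v) cspn_mor =
  csm_src :: "('o,'h,'v) cspn"  csm_tgt :: "('o,'h,'v) cspn"
  csm_b :: 'v  csm_c :: 'v  csm_d :: 'v

definition cospan_obj :: "('o,'h,'v) dblcat \<Rightarrow> ('o,'h,'v) cspn set" where
  "cospan_obj C = {X. cs_v X \<in> vmor C \<and> vdom C (cs_v X) = cs_b X \<and> vcod C (cs_v X) = cs_d X \<and>
                      cs_g X \<in> hmor C \<and> hdom C (cs_g X) = cs_c X \<and> hcod C (cs_g X) = cs_d X}"

definition cospan_cat :: "('o,'h,'v) dblcat \<Rightarrow> (('o,'h,'v) cspn, ('o,'h,'v) cspn_mor) catg" where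
  "cospan_cat C = \<lparr>
     cob = cospan_obj C,
     cmor = {m. let X = csm_src m; Y = csm_tgt m in
               X \<in> cospan_obj C \<and> Y \<in> cospan_obj C \<and>
               csm_b m \<in> vmor C \<and> vdom C (csm_b m) = cs_b X \<and> vcod C (csm_b m) = cs_b Y \<and>
               csm_c m \<in> vmor C \<and> vdom C (csm_c m) = cs_c X \<and> vcod C (csm_c m) = cs_c Y \<and>
               csm_d m \<in> vmor C \<and> vdom C (csm_d m) = cs_d X \<and> vcod C (csm_d m) = cs_d Y \<and>
               issq C (cs_g X) (csm_c m) (csm_d m) (cs_g Y) \<and>
               vcomp C (csm_d m) (cs_v X) = vcomp C (cs_v Y) (csm_b m)},
     cdom = csm_src, ccod = csm_tgt,
     cid = (\<lambda>X. \<lparr>csm_src = X, csm_tgt = X, csm_b = vid C (cs_b X), csm_c = vid C (cs_c X),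
                 csm_d = vid C (cs_d X)\<rparr>),
     ccomp = (\<lambda>g f. \<lparr>csm_src = csm_src f, csm_tgt = csm_tgt g,
                 csm_b = vcomp C (csm_b g) (csm_b f), csm_c = vcomp C (csm_c g) (csm_c f),
                 csm_d = vcomp C (csm_d g) (csm_d f)\<rparr>) \<rparr>"

text \<open>A double functor from the generic square to C: a square of C with corners a b c d,
top a -> b, bottom c -> d, left a -> c, right b -> d.\<close>
record ('o,'h,'v) sqr =
  q_a :: 'o  q_b :: 'o  q_c :: 'o  q_d :: 'o
  q_top :: 'h  q_bot :: 'h  q_left :: 'v  q_right :: 'v

record ('o,'h,'v) sqr_mor =
  qm_src :: "('o,'h,'v) sqr"  qm_tgt :: "('o,'h,'v) sqr"
  qm_a :: 'v  qm_b :: 'v  qm_c :: 'v  qm_d :: 'v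

definition square_obj :: "('o,'h,'v) dblcat \<Rightarrow> ('o,'h,'v) sqr set" where
  "square_obj C = {X. q_top X \<in> hmor C \<and> hdom C (q_top X) = q_a X \<and> hcod C (q_top X) = q_b X \<and>
                      q_bot X \<in> hmor C \<and> hdom C (q_bot X) = q_c X \<and> hcod C (q_bot X) = q_d X \<and>
                      q_left X \<in> vmor C \<and> vdom C (q_left X) = q_a X \<and> vcod C (q_left X) = q_c X \<and>
                      q_right X \<in> vmor C \<and> vdom C (q_right X) = q_b X \<and> vcod C (q_right X) = q_d X \<and>
                      issq C (q_top X) (q_left X) (q_right X) (q_bot X)}"

definition square_cat :: "('o,'h,'v) dblcat \<Rightarrow> (('o,'h,'v) sqr, ('o,'h,'v) sqr_mor) catg" where
  "square_cat C = \<lparr>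
     cob = square_obj C,
     cmor = {m. let X = qm_src m; Y = qm_tgt m in
               X \<in> square_obj C \<and> Y \<in> square_obj C \<and>
               qm_a m \<in> vmor C \<and> vdom C (qm_a m) = q_a X \<and> vcod C (qm_a m) = q_a Y \<and>
               qm_b m \<in> vmor C \<and> vdom C (qm_b m) = q_b X \<and> vcod C (qm_b m) = q_b Y \<and>
               qm_c m \<in> vmor C \<and> vdom C (qm_c m) = q_c X \<and> vcod C (qm_c m) = q_c Y \<and>
               qm_d m \<in> vmor C \<and> vdom C (qm_d m) = q_d X \<and> vcod C (qm_d m) = q_d Y \<and>
               issq C (q_top X) (qm_a m) (qm_b m) (q_top Y) \<and>
               issq C (q_bot X) (qm_c m) (qm_d m) (q_bot Y) \<and>
               vcomp C (qm_c m) (q_left X) = vcomp C (q_left Y) (qm_a m) \<and>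
               vcomp C (qm_d m) (q_right X) = vcomp C (q_right Y) (qm_b m)},
     cdom = qm_src, ccod = qm_tgt,
     cid = (\<lambda>X. \<lparr>qm_src = X, qm_tgt = X, qm_a = vid C (q_a X), qm_b = vid C (q_b X),
                 qm_c = vid C (q_c X), qm_d = vid C (q_d X)\<rparr>),
     ccomp = (\<lambda>g f. \<lparr>qm_src = qm_src f, qm_tgt = qm_tgt g,
                 qm_a = vcomp C (qm_a g) (qm_a f), qm_b = vcomp C (qm_b g) (qm_b f),
                 qm_c = vcomp C (qm_c g) (qm_c f), qm_d = vcomp C (qm_d g) (qm_d f)\<rparr>) \<rparr>"

definition i_obj :: "('o,'h,'v) sqr \<Rightarrow> ('o,'h,'v) spn" where
  "i_obj X = \<lparr>sp_a = q_a X, sp_b = q_b X, sp_c = q_c X, sp_f = q_top X, sp_u = q_left X\<rparr>"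
definition i_mor :: "('o,'h,'v) sqr_mor \<Rightarrow> ('o,'h,'v) spn_mor" where
  "i_mor m = \<lparr>spm_src = i_obj (qm_src m), spm_tgt = i_obj (qm_tgt m),
              spm_a = qm_a m, spm_b = qm_b m, spm_c = qm_c m\<rparr>"
definition j_obj :: "('o,'h,'v) sqr \<Rightarrow> ('o,'h,'v) cspn" where
  "j_obj X = \<lparr>cs_b = q_b X, cs_c = q_c X, cs_d = q_d X, cs_v = q_right X, cs_g = q_bot X\<rparr>"
definition j_mor :: "('o,'h,'v) sqr_mor \<Rightarrow> ('o,'h,'v) cspn_mor" where
  "j_mor m = \<lparr>csm_src = j_obj (qm_src m), csm_tgt = j_obj (qm_tgt m),
              csm_b = qm_b m, csm_c = qm_c m, csm_d = qm_d m\<rparr>"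

definition stable :: "('o,'h,'v) dblcat \<Rightarrow> bool" where
  "stable C \<longleftrightarrow> squares_category C \<and>
     (\<exists>sO sM w tO tM u.
        \<comment> \<open>(i) s is a section of i^*\<close>
        is_functor (span_cat C) (square_cat C) sO sM \<and>
        (\<forall>X\<in>cob (span_cat C). i_obj (sO X) = X) \<and>
        (\<forall>m\<in>cmor (span_cat C). i_mor (sM m) = m) \<and>
        \<comment> \<open>(ii) w : s i^* => id, identity at a, b, c\<close>
        is_nattrans (square_cat C) (square_cat C) (sO \<circ> i_obj) (sM \<circ> i_mor) id id w \<and>
        (\<forall>X\<in>square_obj C. qm_a (w X) = vid C (q_a X) \<and> qm_b (w X) = vid C (q_b X) \<and>
                           qm_c (w X) = vid C (q_c X)) \<and>
        \<comment> \<open>(iii) t is a section of j^*\<close>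
        is_functor (cospan_cat C) (square_cat C) tO tM \<and>
        (\<forall>X\<in>cob (cospan_cat C). j_obj (tO X) = X) \<and>
        (\<forall>m\<in>cmor (cospan_cat C). j_mor (tM m) = m) \<and>
        \<comment> \<open>(iv) u : t j^* => id, identity at b, c, d, vertical weak equivalence at a\<close>
        is_nattrans (square_cat C) (square_cat C) (tO \<circ> j_obj) (tM \<circ> j_mor) id id u \<and>
        (\<forall>X\<in>square_obj C. qm_b (u X) = vid C (q_b X) \<and> qm_c (u X) = vid C (q_c X) \<and>
                           qm_d (u X) = vid C (q_d X) \<and> vweq C (qm_a (u X))))"

definition isostable :: "('o,'h,'v) dblcat \<Rightarrow> bool" where
  "isostable C \<longleftrightarrow> stable C \<and>
     (\<forall>f. vweq C f \<longrightarrow> viso C f) \<and>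
     (\<forall>g. hweq C g \<longrightarrow> hiso C g) \<and>
     (\<forall>f k g g' h h'. f \<in> hmor C \<longrightarrow> k \<in> hmor C \<longrightarrow> vinverse C g g' \<longrightarrow> vinverse C h h' \<longrightarrow>
        vdom C g = hdom C f \<longrightarrow> vcod C g = hdom C k \<longrightarrow>
        vdom C h = hcod C f \<longrightarrow> vcod C h = hcod C k \<longrightarrow>
        (issq C f g h k \<longleftrightarrow> issq C k g' h' f))"

record ('o,'h,'v) sobj =
  sA :: "nat \<Rightarrow> nat \<Rightarrow> 'o"    \<comment> \<open>A_jk, 0 <= j <= k <= n\<close>
  sH :: "nat \<Rightarrow> nat \<Rightarrow> 'h"    \<comment> \<open>A_jk -> A_j(k+1), j <= k < n\<close>
  sV :: "nat \<Rightarrow> nat \<Rightarrow> 'v"    \<comment> \<open>A_jk -> A_(j+1)k, j < k <= n\<close>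

record ('o,'h,'v) smor =
  sm_src :: "('o,'h,'v) sobj"
  sm_tgt :: "('o,'h,'v) sobj"
  sm_c   :: "nat \<Rightarrow> nat \<Rightarrow> 'v"

text \<open>Objects are stored extensionally (undefined outside the index range), so that
equal families are equal elements.\<close>
definition S_obj :: "('o,'h,'v) dblcat \<Rightarrow> nat \<Rightarrow> ('o,'h,'v) sobj set" where
  "S_obj C n = {X.
     (\<forall>j k. \<not> (j \<le> k \<and> k \<le> n) \<longrightarrow> sA X j k = undefined) \<and>
     (\<forall>j k. \<not> (j \<le> k \<and> k < n) \<longrightarrow> sH X j k = undefined) \<and>
     (\<forall>j k. \<not> (j < k \<and> k \<le> n) \<longrightarrow> sV X j k = undefined) \<and>
     (\<forall>j k. j \<le> k \<and> k \<le> n \<longrightarrow> sA X j k \<in> dobj C) \<and>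
     (\<forall>j. j \<le> n \<longrightarrow> sA X j j = zobj C) \<and>
     (\<forall>j k. j \<le> k \<and> k < n \<longrightarrow> sH X j k \<in> hmor C \<and> hdom C (sH X j k) = sA X j k \<and>
                                 hcod C (sH X j k) = sA X j (Suc k)) \<and>
     (\<forall>j k. j < k \<and> k \<le> n \<longrightarrow> sV X j k \<in> vmor C \<and> vdom C (sV X j k) = sA X j k \<and>
                                 vcod C (sV X j k) = sA X (Suc j) k) \<and>
     (\<forall>j k. j < k \<and> k < n \<longrightarrow> issq C (sH X j k) (sV X j k) (sV X j (Suc k)) (sH X (Suc j) k))}"

definition S_cat :: "('o,'h,'v) dblcat \<Rightarrow> nat \<Rightarrow> (('o,'h,'v) sobj, ('o,'h,'v) smor) catg" where
  "S_cat C n = \<lparr>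
     cob = S_obj C n,
     cmor = {m. sm_src m \<in> S_obj C n \<and> sm_tgt m \<in> S_obj C n \<and>
              (\<forall>j k. \<not> (j \<le> k \<and> k \<le> n) \<longrightarrow> sm_c m j k = undefined) \<and>
              (\<forall>j k. j \<le> k \<and> k \<le> n \<longrightarrow> sm_c m j k \<in> vmor C \<and>
                  vdom C (sm_c m j k) = sA (sm_src m) j k \<and> vcod C (sm_c m j k) = sA (sm_tgt m) j k) \<and>
              (\<forall>j k. j \<le> k \<and> k < n \<longrightarrow>
                  issq C (sH (sm_src m) j k) (sm_c m j k) (sm_c m j (Suc k)) (sH (sm_tgt m) j k)) \<and>
              (\<forall>j k. j < k \<and> k \<le> n \<longrightarrow>
                  vcomp C (sm_c m (Suc j) k) (sV (sm_src m) j k) = vcomp C (sV (sm_tgt m) j k) (sm_c m j k))},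
     cdom = sm_src, ccod = sm_tgt,
     cid = (\<lambda>X. \<lparr>sm_src = X, sm_tgt = X,
                 sm_c = (\<lambda>j k. if j \<le> k \<and> k \<le> n then vid C (sA X j k) else undefined)\<rparr>),
     ccomp = (\<lambda>g f. \<lparr>sm_src = sm_src f, sm_tgt = sm_tgt g,
                 sm_c = (\<lambda>j k. if j \<le> k \<and> k \<le> n then vcomp C (sm_c g j k) (sm_c f j k) else undefined)\<rparr>) \<rparr>"

text \<open>Composite horizontal morphism A_jk -> A_jl (k <= l) and composite vertical
morphism A_jk -> A_lk (j <= l <= k) in an object of S_n.\<close>
primrec hpath :: "('o,'h,'v) dblcat \<Rightarrow> ('o,'h,'v) sobj \<Rightarrow> nat \<Rightarrow> nat \<Rightarrow> nat \<Rightarrow> 'h" where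
  "hpath C X j k 0 = hid C (sA X j k)"
| "hpath C X j k (Suc l) = (if Suc l \<le> k then hid C (sA X j k) else hcomp C (sH X j l) (hpath C X j k l))"

primrec vpath :: "('o,'h,'v) dblcat \<Rightarrow> ('o,'h,'v) sobj \<Rightarrow> nat \<Rightarrow> nat \<Rightarrow> nat \<Rightarrow> 'v" where
  "vpath C X k j 0 = vid C (sA X j k)"
| "vpath C X k j (Suc l) = (if Suc l \<le> j then vid C (sA X j k) else vcomp C (sV X l k) (vpath C X k j l))"

text \<open>theta^* : S_n -> S_m for a monotone theta : [m] -> [n].\<close>
definition theta_obj :: "('o,'h,'v) dblcat \<Rightarrow> (nat \<Rightarrow> nat) \<Rightarrow> nat \<Rightarrow> ('o,'h,'v) sobj \<Rightarrow> ('o,'h,'v) sobj" where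
  "theta_obj C \<theta> m X = \<lparr>
     sA = (\<lambda>j k. if j \<le> k \<and> k \<le> m then sA X (\<theta> j) (\<theta> k) else undefined),
     sH = (\<lambda>j k. if j \<le> k \<and> k < m then hpath C X (\<theta> j) (\<theta> k) (\<theta> (Suc k)) else undefined),
     sV = (\<lambda>j k. if j < k \<and> k \<le> m then vpath C X (\<theta> k) (\<theta> j) (\<theta> (Suc j)) else undefined)\<rparr>"

definition theta_mor :: "('o,'h,'v) dblcat \<Rightarrow> (nat \<Rightarrow> nat) \<Rightarrow> nat \<Rightarrow> ('o,'h,'v) smor \<Rightarrow> ('o,'h,'v) smor" where
  "theta_mor C \<theta> m f = \<lparr>
     sm_src = theta_obj C \<theta> m (sm_src f), sm_tgt = theta_obj C \<theta> m (sm_tgt f),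
     sm_c = (\<lambda>j k. if j \<le> k \<and> k \<le> m then sm_c f (\<theta> j) (\<theta> k) else undefined)\<rparr>"

definition nerve :: "('a,'m) catg \<Rightarrow> nat \<Rightarrow> ('a \<times> 'm list) set" where
  "nerve C p = {(x0, ms). x0 \<in> cob C \<and> length ms = p \<and> set ms \<subseteq> cmor C \<and>
     (\<forall>l<p. cdom C (ms ! l) = (if l = 0 then x0 else ccod C (ms ! (l - 1))))}"

definition nvert :: "('a,'m) catg \<Rightarrow> 'a \<times> 'm list \<Rightarrow> nat \<Rightarrow> 'a" where
  "nvert C s l = (if l = 0 then fst s else ccod C (snd s ! (l - 1)))"

primrec npath :: "('a,'m) catg \<Rightarrow> 'a \<times> 'm list \<Rightarrow> nat \<Rightarrow> nat \<Rightarrow> 'm" where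
  "npath C s a 0 = cid C (nvert C s a)"
| "npath C s a (Suc b) = (if Suc b \<le> a then cid C (nvert C s a) else ccomp C (snd s ! b) (npath C s a b))"

text \<open>Simplicial operator theta^* on the nerve, for theta : [q] -> [p].\<close>
definition nerve_op :: "('a,'m) catg \<Rightarrow> (nat \<Rightarrow> nat) \<Rightarrow> nat \<Rightarrow> 'a \<times> 'm list \<Rightarrow> 'a \<times> 'm list" where
  "nerve_op C \<theta> q s = (nvert C s (\<theta> 0), map (\<lambda>l. npath C s (\<theta> l) (\<theta> (Suc l))) [0..<q])"

definition coface :: "(nat \<Rightarrow> nat) \<Rightarrow> nat \<Rightarrow> (nat \<Rightarrow> real) \<Rightarrow> (nat \<Rightarrow> real)" where
  "coface \<theta> q t = (\<lambda>i. \<Sum>l\<in>{l. l \<le> q \<and> \<theta> l = i}. t l)"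

definition monotone_idx :: "(nat \<Rightarrow> nat) \<Rightarrow> nat \<Rightarrow> nat \<Rightarrow> bool" where
  "monotone_idx \<theta> q p \<longleftrightarrow> (\<forall>l\<le>q. \<theta> l \<le> p) \<and> (\<forall>l l'. l \<le> l' \<and> l' \<le> q \<longrightarrow> \<theta> l \<le> \<theta> l')"

definition real_sum :: "('a,'m) catg \<Rightarrow> ((nat \<times> ('a \<times> 'm list)) \<times> (nat \<Rightarrow> real)) topology" where
  "real_sum C = sum_topology (\<lambda>(p, s). subtopology (powertop_real UNIV) (standard_simplex p))
                             {(p, s). s \<in> nerve C p}"

definition real_gen :: "('a,'m) catg \<Rightarrow>
    (((nat \<times> ('a \<times> 'm list)) \<times> (nat \<Rightarrow> real)) \<times> ((nat \<times> ('a \<times> 'm list)) \<times> (nat \<Rightarrow> real))) set" where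
  "real_gen C = {(((q, nerve_op C \<theta> q s), t), ((p, s), coface \<theta> q t)) | p q \<theta> s t.
      s \<in> nerve C p \<and> monotone_idx \<theta> q p \<and> t \<in> standard_simplex q}"

definition real_eq :: "('a,'m) catg \<Rightarrow>
    (((nat \<times> ('a \<times> 'm list)) \<times> (nat \<Rightarrow> real)) \<times> ((nat \<times> ('a \<times> 'm list)) \<times> (nat \<Rightarrow> real))) set" where
  "real_eq C = (real_gen C \<union> (real_gen C)\<inverse>)\<^sup>*"

definition quotient_top :: "'a topology \<Rightarrow> ('a \<times> 'a) set \<Rightarrow> 'a set topology" where
  "quotient_top X E = topology (\<lambda>U. U \<subseteq> topspace X // E \<and> openin X {x \<in> topspace X. E `` {x} \<in> U})"

definition classifying_space :: "('a,'m) catg \<Rightarrow> ((nat \<times> ('a \<times> 'm list)) \<times> (nat \<Rightarrow> real)) set topology" where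
  "classifying_space C = quotient_top (real_sum C) (real_eq C)"

definition classifying_map :: "('b,'n) catg \<Rightarrow> ('a \<Rightarrow> 'b) \<Rightarrow> ('m \<Rightarrow> 'n) \<Rightarrow>
    ((nat \<times> ('a \<times> 'm list)) \<times> (nat \<Rightarrow> real)) set \<Rightarrow> ((nat \<times> ('b \<times> 'n list)) \<times> (nat \<Rightarrow> real)) set" where
  "classifying_map D Fo Fm c = (let x = (SOME x. x \<in> c) in
     real_eq D `` {((fst (fst x), (Fo (fst (snd (fst x))), map Fm (snd (snd (fst x))))), snd x)})"

definition sphere_base :: "nat \<Rightarrow> real" where
  "sphere_base = (\<lambda>i. if i = 0 then 1 else 0)"

text \<open>Weak homotopy equivalence: bijection on path components and on all homotopy
groups pi_k (k >= 1) at every base point (pointed homotopy classes of maps S^k -> X).\<close>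
definition weak_homotopy_equivalence :: "'a topology \<Rightarrow> 'b topology \<Rightarrow> ('a \<Rightarrow> 'b) \<Rightarrow> bool" where
  "weak_homotopy_equivalence X Y f \<longleftrightarrow> continuous_map X Y f \<and>
     (\<forall>y\<in>topspace Y. \<exists>x\<in>topspace X. path_component_of Y (f x) y) \<and>
     (\<forall>x\<in>topspace X. \<forall>x'\<in>topspace X. path_component_of Y (f x) (f x') \<longrightarrow> path_component_of X x x') \<and>
     (\<forall>k\<ge>1. \<forall>x\<in>topspace X.
        (\<forall>g. continuous_map (nsphere k) Y g \<and> g sphere_base = f x \<longrightarrow>
           (\<exists>h. continuous_map (nsphere k) X h \<and> h sphere_base = x \<and>
                homotopic_with (\<lambda>\<phi>. \<phi> sphere_base = f x) (nsphere k) Y (f \<circ> h) g)) \<and>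
        (\<forall>h h'. continuous_map (nsphere k) X h \<and> h sphere_base = x \<and>
                continuous_map (nsphere k) X h' \<and> h' sphere_base = x \<and>
                homotopic_with (\<lambda>\<phi>. \<phi> sphere_base = f x) (nsphere k) Y (f \<circ> h) (f \<circ> h') \<longrightarrow>
                homotopic_with (\<lambda>\<phi>. \<phi> sphere_base = x) (nsphere k) X h h'))"

definition path_space :: "'a topology \<Rightarrow> (real \<Rightarrow> 'a) topology" where
  "path_space Z = topology_generated_by
     {{\<gamma>. continuous_map (top_of_set {0..1}) Z \<gamma> \<and> (\<forall>t. t \<notin> {0..1} \<longrightarrow> \<gamma> t = undefined) \<and> \<gamma> ` K \<subseteq> U}
      | K U. compact K \<and> K \<subseteq> {0..1} \<and> openin Z U}"

definition hofiber_product :: "'x topology \<Rightarrow> 'y topology \<Rightarrow> 'z topology \<Rightarrow> ('x \<Rightarrow> 'z) \<Rightarrow> ('y \<Rightarrow> 'z) \<Rightarrow>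
    ('x \<times> (real \<Rightarrow> 'z) \<times> 'y) topology" where
  "hofiber_product X Y Z f g = subtopology (prod_topology X (prod_topology (path_space Z) Y))
     {(x, \<gamma>, y). \<gamma> 0 = f x \<and> \<gamma> 1 = g y}"

definition homotopy_pullback :: "'p topology \<Rightarrow> 'x topology \<Rightarrow> 'y topology \<Rightarrow> 'z topology \<Rightarrow>
    ('p \<Rightarrow> 'x) \<Rightarrow> ('p \<Rightarrow> 'y) \<Rightarrow> ('x \<Rightarrow> 'z) \<Rightarrow> ('y \<Rightarrow> 'z) \<Rightarrow> bool" where
  "homotopy_pullback P X Y Z p1 p2 f g \<longleftrightarrow>
     continuous_map P X p1 \<and> continuous_map P Y p2 \<and> continuous_map X Z f \<and> continuous_map Y Z g \<and>
     (\<forall>p\<in>topspace P. f (p1 p) = g (p2 p)) \<and>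
     weak_homotopy_equivalence P (hofiber_product X Y Z f g)
       (\<lambda>p. (p1 p, (\<lambda>t. if t \<in> {0..1} then f (p1 p) else undefined), p2 p))"

text \<open>A simplicial space is given by spaces X n and, for each monotone theta : [m] -> [n],
a map op m n theta : X n -> X m. For S a finite subset of [n], X_S = X (|S| - 1); the map
X_S -> X_T for T a subset of S is induced by the inclusion T -> S, i.e. by theta with
theta l = position in S of the l-th element of T.\<close>
definition incl_idx :: "nat set \<Rightarrow> nat set \<Rightarrow> nat \<Rightarrow> nat" where
  "incl_idx S T l = (LEAST r. sorted_list_of_set S ! r = sorted_list_of_set T ! l)"

definition face_map :: "(nat \<Rightarrow> nat \<Rightarrow> (nat \<Rightarrow> nat) \<Rightarrow> 'x \<Rightarrow> 'x) \<Rightarrow> nat set \<Rightarrow> nat set \<Rightarrow> 'x \<Rightarrow> 'x" where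
  "face_map op S T = op (card T - 1) (card S - 1) (incl_idx S T)"

definition two_segal :: "(nat \<Rightarrow> 'x topology) \<Rightarrow> (nat \<Rightarrow> nat \<Rightarrow> (nat \<Rightarrow> nat) \<Rightarrow> 'x \<Rightarrow> 'x) \<Rightarrow> bool" where
  "two_segal X op \<longleftrightarrow> (\<forall>n\<ge>3. \<forall>i j. i < j \<and> j \<le> n \<longrightarrow>
     (let Xs = (\<lambda>S. X (card S - 1));
          Snj = {..n}; Sij = {i..j}; Sout = {..i} \<union> {j..n}; Sb = {i, j} in
      homotopy_pullback (Xs Snj) (Xs Sij) (Xs Sout) (Xs Sb)
        (face_map op Snj Sij) (face_map op Snj Sout) (face_map op Sij Sb) (face_map op Sout Sb)))"

definition BS_space :: "('o,'h,'v) dblcat \<Rightarrow> nat \<Rightarrow>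
    ((nat \<times> (('o,'h,'v) sobj \<times> ('o,'h,'v) smor list)) \<times> (nat \<Rightarrow> real)) set topology" where
  "BS_space C n = classifying_space (S_cat C n)"

definition BS_op :: "('o,'h,'v) dblcat \<Rightarrow> nat \<Rightarrow> nat \<Rightarrow> (nat \<Rightarrow> nat) \<Rightarrow>
    ((nat \<times> (('o,'h,'v) sobj \<times> ('o,'h,'v) smor list)) \<times> (nat \<Rightarrow> real)) set \<Rightarrow>
    ((nat \<times> (('o,'h,'v) sobj \<times> ('o,'h,'v) smor list)) \<times> (nat \<Rightarrow> real)) set" where
  "BS_op C m n \<theta> = classifying_map (S_cat C m) (theta_obj C \<theta> m) (theta_mor C \<theta> m)"

end

theory Submission
  imports Defs
begin

text \<open>
  Isostability makes every \<open>S_n\<close> a groupoid: the diagonal components of a morphism are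
  identities of \<open>O\<close>, so all other components are vertical weak equivalences, hence invertible.
  A square is determined up to unique isomorphism by its span and by its cospan. Therefore
  \<open>S_n\<close> is equivalent to the groupoid of chains of horizontal morphisms (the first row) and to
  that of chains of vertical morphisms (the last column). The cases \<open>i = 0\<close> and \<open>j = n\<close> of the
  2-Segal condition are then 2-pullbacks of groupoids, and the general case follows by pasting them.

  It remains to see that the classifying space turns a 2-pullback of groupoids into a homotopy
  pullback. A point of the classifying space of a groupoid is a step function on \<open>[0,1)\<close> with values
  in arrows out of the leading vertex of its simplex. For a fixed object \<open>a\<close>, the arrows from \<open>a\<close>
  to the leading vertex form a covering, metrised by the measure of the set where two step functions
  disagree. Lifting along homotopies computes the components and fundamental groups,
  and splicing step functions contracts the coverings, so that the higher homotopy groups vanish.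
  The comparison with the homotopy fibre product is thus bijective on all homotopy groups.
\<close>

text \<open>A point of the realization has no preferred representative. Its step function forgets
  exactly what the relations identify, so it is a complete invariant and no nondegenerate simplices
  have to be chosen. Invertibility of arrows enters through cancellation: two different arrows from
  \<open>a\<close> over one point give step functions that differ everywhere on [0,1), so the fibres
  of the covering are discrete with distance 1. Hence over a given point at most one lift lies
  within 1/2 of a given element, and the local constructions use 1/4 so that two estimates add up to
  1/2. Inside one simplex the distance is bounded by the differences of the partial sums of the
  weights, which suits the quotient topology, where openness is tested simplex by simplex. No total
  space of the covering is formed; sections over a test space \<open>K\<close> carry all lifting
  arguments. On the categorical side weak equivalences pass through squares from left to right by
  initiality of \<open>O\<close> alone. The passage from right to left, needed for columns, is
  \<open>vweqI_right\<close>, and it rests on the comparison of cospan fillings by weak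
  equivalences.\<close>

definition chom :: "('a,'m) catg \<Rightarrow> 'a \<Rightarrow> 'a \<Rightarrow> 'm set" where
  "chom G x y = {m \<in> cmor G. cdom G m = x \<and> ccod G m = y}"

section \<open>Groupoids, with axioms stated through hom-sets\<close>

locale cgroupoid =
  fixes G :: "('a,'m) catg"
  assumes dom_ob: "m \<in> cmor G \<Longrightarrow> cdom G m \<in> cob G"
    and cod_ob: "m \<in> cmor G \<Longrightarrow> ccod G m \<in> cob G"
    and id_hom: "x \<in> cob G \<Longrightarrow> cid G x \<in> chom G x x"
    and comp_hom: "f \<in> chom G x y \<Longrightarrow> g \<in> chom G y z \<Longrightarrow> ccomp G g f \<in> chom G x z"
    and id_right: "f \<in> chom G x y \<Longrightarrow> ccomp G f (cid G x) = f"
    and id_left: "f \<in> chom G x y \<Longrightarrow> ccomp G (cid G y) f = f"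
    and assoc: "f \<in> chom G x y \<Longrightarrow> g \<in> chom G y z \<Longrightarrow> h \<in> chom G z w \<Longrightarrow>
        ccomp G h (ccomp G g f) = ccomp G (ccomp G h g) f"
    and inv_ex: "f \<in> chom G x y \<Longrightarrow> \<exists>g\<in>chom G y x. ccomp G g f = cid G x \<and> ccomp G f g = cid G y"
begin

abbreviation Hom where "Hom \<equiv> chom G"
abbreviation cmp (infixl "\<bullet>\<bullet>" 70) where "g \<bullet>\<bullet> f \<equiv> ccomp G g f"

lemma hom_ob: "f \<in> Hom x y \<Longrightarrow> x \<in> cob G" "f \<in> Hom x y \<Longrightarrow> y \<in> cob G"
  using dom_ob cod_ob by (auto simp: chom_def)

definition ginv where "ginv f = (SOME g. g \<in> chom G (ccod G f) (cdom G f) \<and>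
   ccomp G g f = cid G (cdom G f) \<and> ccomp G f g = cid G (ccod G f))"

lemma inv_props:
  assumes "f \<in> Hom x y"
  shows "ginv f \<in> Hom y x" "ginv f \<bullet>\<bullet> f = cid G x" "f \<bullet>\<bullet> ginv f = cid G y"
proof -
  have xy: "cdom G f = x" "ccod G f = y" using assms by (auto simp: chom_def)
  have "\<exists>g. g \<in> chom G (ccod G f) (cdom G f) \<and>
      ccomp G g f = cid G (cdom G f) \<and> ccomp G f g = cid G (ccod G f)"
    using inv_ex[OF assms] xy by auto
  from someI_ex[OF this] show "ginv f \<in> Hom y x" "ginv f \<bullet>\<bullet> f = cid G x" "f \<bullet>\<bullet> ginv f = cid G y"
    unfolding ginv_def xy by auto
qed

lemma cancel_left:
  assumes g: "g \<in> Hom y z" and f: "f \<in> Hom x y" "f' \<in> Hom x y" and eq: "g \<bullet>\<bullet> f = g \<bullet>\<bullet> f'"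
  shows "f = f'"
proof -
  have "ginv g \<bullet>\<bullet> (g \<bullet>\<bullet> f) = ginv g \<bullet>\<bullet> (g \<bullet>\<bullet> f')" by (simp add: eq)
  then show ?thesis
    using assoc[OF f(1) g inv_props(1)[OF g]] assoc[OF f(2) g inv_props(1)[OF g]] inv_props(2)[OF g]
      id_left[OF f(1)] id_left[OF f(2)] by simp
qed

lemma cancel_right:
  assumes g: "g \<in> Hom x y" and f: "f \<in> Hom y z" "f' \<in> Hom y z" and eq: "f \<bullet>\<bullet> g = f' \<bullet>\<bullet> g"
  shows "f = f'"
proof -
  have "(f \<bullet>\<bullet> g) \<bullet>\<bullet> ginv g = (f' \<bullet>\<bullet> g) \<bullet>\<bullet> ginv g" by (simp add: eq)
  then show ?thesis
    using assoc[OF inv_props(1)[OF g] g f(1)] assoc[OF inv_props(1)[OF g] g f(2)] inv_props(3)[OF g]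
      id_right[OF f(1)] id_right[OF f(2)] by simp
qed

lemma inv_comp_cancel: "g \<in> Hom y z \<Longrightarrow> f \<in> Hom x z \<Longrightarrow> g \<bullet>\<bullet> (ginv g \<bullet>\<bullet> f) = f"
  using assoc[of f x z "ginv g" y g z] inv_props id_left by metis

lemma comp_inv_cancel: "g \<in> Hom x y \<Longrightarrow> f \<in> Hom x z \<Longrightarrow> (f \<bullet>\<bullet> ginv g) \<bullet>\<bullet> g = f"
  using assoc[of g x y "ginv g" x f z] inv_props id_right by metis

subsection \<open>Nerve\<close>

lemma nerve_arrow:
  assumes "s \<in> nerve G p" "l < p"
  shows "snd s ! l \<in> Hom (nvert G s l) (nvert G s (Suc l))"
  using assms by (auto simp: nerve_def chom_def nvert_def subset_iff)

lemma nvert_ob: "s \<in> nerve G p \<Longrightarrow> l \<le> p \<Longrightarrow> nvert G s l \<in> cob G"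
  by (cases l) (use nerve_arrow[of s p "l - 1"] hom_ob in \<open>auto simp: nerve_def nvert_def\<close>)

lemma npath_refl: "npath G s a a = cid G (nvert G s a)"
  by (cases a) auto

lemma npath_Suc: "a \<le> b \<Longrightarrow> npath G s a (Suc b) = snd s ! b \<bullet>\<bullet> npath G s a b"
  by simp

lemma npath_hom:
  assumes "s \<in> nerve G p" "a \<le> b" "b \<le> p"
  shows "npath G s a b \<in> Hom (nvert G s a) (nvert G s b)"
  using assms(2,3)
proof (induction b rule: dec_induct)
  case base then show ?case using nvert_ob[OF assms(1)] id_hom npath_refl by auto
next
  case (step b)
  then show ?case using comp_hom[OF step.IH nerve_arrow[OF assms(1), of b]] by (simp del: npath.simps add: npath_Suc)
qed

lemma npath_comp:
  assumes "s \<in> nerve G p" "a \<le> b" "b \<le> c" "c \<le> p"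
  shows "npath G s b c \<bullet>\<bullet> npath G s a b = npath G s a c"
  using assms(3,4)
proof (induction c rule: dec_induct)
  case base then show ?case using id_left[OF npath_hom[OF assms(1,2)]] by (simp add: npath_refl)
next
  case (step c)
  then show ?case
    using assoc[OF npath_hom[OF assms(1,2)] npath_hom[OF assms(1), of b c] nerve_arrow[OF assms(1), of c]] assms(2)
    by (simp del: npath.simps add: npath_Suc)
qed

lemma nerve_eqI:
  assumes "s \<in> nerve G p" "s' \<in> nerve G p" "fst s = fst s'" "\<And>l. l < p \<Longrightarrow> snd s ! l = snd s' ! l"
  shows "s = s'"
  using assms by (auto simp: nerve_def intro: nth_equalityI)

lemma nerve_op_vert:
  assumes "s \<in> nerve G p" "monotone_idx \<theta> q p" "l \<le> q"
  shows "nvert G (nerve_op G \<theta> q s) l = nvert G s (\<theta> l)"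
proof (cases l)
  case 0 then show ?thesis by (simp add: nvert_def nerve_op_def)
next
  case (Suc k)
  have "npath G s (\<theta> k) (\<theta> (Suc k)) \<in> Hom (nvert G s (\<theta> k)) (nvert G s (\<theta> (Suc k)))"
    using assms Suc by (intro npath_hom[OF assms(1)]) (auto simp: monotone_idx_def)
  moreover have "nvert G (nerve_op G \<theta> q s) l = ccod G (snd (nerve_op G \<theta> q s) ! k)"
    using Suc by (simp add: nvert_def)
  ultimately show ?thesis using Suc assms(3) by (simp add: nerve_op_def chom_def)
qed

lemma nerve_op_arrow: "l < q \<Longrightarrow> snd (nerve_op G \<theta> q s) ! l = npath G s (\<theta> l) (\<theta> (Suc l))"
  by (simp add: nerve_op_def)

lemma nerve_op_nerve:
  assumes "s \<in> nerve G p" "monotone_idx \<theta> q p"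
  shows "nerve_op G \<theta> q s \<in> nerve G q"
proof -
  have h: "npath G s (\<theta> l) (\<theta> (Suc l)) \<in> Hom (nvert G s (\<theta> l)) (nvert G s (\<theta> (Suc l)))" if "l < q" for l
    using assms that by (intro npath_hom[OF assms(1)]) (auto simp: monotone_idx_def)
  have "cdom G (snd (nerve_op G \<theta> q s) ! l) = (if l = 0 then fst (nerve_op G \<theta> q s) else ccod G (snd (nerve_op G \<theta> q s) ! (l - 1)))"
    if "l < q" for l
  proof (cases l)
    case 0 then show ?thesis using h[of 0] that by (auto simp: nerve_op_def chom_def)
  next
    case (Suc k) then show ?thesis using h[of k] h[of l] that by (auto simp: nerve_op_def chom_def)
  qed
  moreover have "nvert G s (\<theta> 0) \<in> cob G" using nvert_ob[OF assms(1)] assms(2) by (auto simp: monotone_idx_def)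
  moreover have "set (snd (nerve_op G \<theta> q s)) \<subseteq> cmor G" using h by (auto simp: nerve_op_def chom_def)
  ultimately show ?thesis
    unfolding nerve_def by (auto simp: case_prod_unfold) (auto simp: nerve_op_def)
qed

lemma nerve_op_path:
  assumes "s \<in> nerve G p" "monotone_idx \<theta> q p" "a \<le> b" "b \<le> q"
  shows "npath G (nerve_op G \<theta> q s) a b = npath G s (\<theta> a) (\<theta> b)"
  using assms(3,4)
proof (induction b rule: dec_induct)
  case base then show ?case using nerve_op_vert[OF assms(1,2)] by (simp add: npath_refl)
next
  case (step b)
  have "npath G s (\<theta> b) (\<theta> (Suc b)) \<bullet>\<bullet> npath G s (\<theta> a) (\<theta> b) = npath G s (\<theta> a) (\<theta> (Suc b))"
    using assms step by (intro npath_comp[OF assms(1)]) (auto simp: monotone_idx_def)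
  then show ?case using step by (simp del: npath.simps add: npath_Suc nerve_op_arrow)
qed

end

subsection \<open>Barycentric coordinates as step functions on the unit interval\<close>

text \<open>Consecutive half-open intervals of lengths \<open>t 0\<close>, \<open>t 1\<close>, ...
  tile [0,1), and this is the number of the interval that contains \<open>r\<close>. A weight of
  zero gives an empty interval, so its index is never a value; this is what makes the step function
  blind to faces.\<close>

definition idx :: "(nat \<Rightarrow> real) \<Rightarrow> real \<Rightarrow> nat" where
  "idx t r = (LEAST j. r < (\<Sum>l\<le>j. t l))"

lemma idx_bounds:
  assumes "t \<in> standard_simplex p" "r \<in> {0..<1}"
  shows "idx t r \<le> p" "r < (\<Sum>l\<le>idx t r. t l)" "(\<Sum>l<idx t r. t l) \<le> r"
proof -
  have p: "r < (\<Sum>l\<le>p. t l)" using assms by (auto simp: standard_simplex_def)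
  show "idx t r \<le> p" unfolding idx_def by (rule Least_le) (rule p)
  show "r < (\<Sum>l\<le>idx t r. t l)" unfolding idx_def by (rule LeastI) (rule p)
  show "(\<Sum>l<idx t r. t l) \<le> r"
  proof (cases "idx t r")
    case 0 then show ?thesis using assms by auto
  next
    case (Suc k)
    then have "\<not> r < (\<Sum>l\<le>k. t l)" unfolding idx_def by (metis lessI not_less_Least)
    then show ?thesis using Suc by (simp add: lessThan_Suc_atMost)
  qed
qed

lemma partial_sum_mono:
  fixes t :: "nat \<Rightarrow> real"
  assumes "t \<in> standard_simplex p" "finite B" "A \<subseteq> B"
  shows "sum t A \<le> sum t B"
  using assms by (intro sum_mono2) (auto simp: standard_simplex_def)

lemma idx_eqI:
  assumes "t \<in> standard_simplex p" "r < (\<Sum>l\<le>j. t l)" "(\<Sum>l<j. t l) \<le> r"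
  shows "idx t r = j"
  unfolding idx_def
proof (rule Least_equality)
  fix y assume "r < sum t {..y}"
  then show "j \<le> y"
    using assms(3) partial_sum_mono[OF assms(1), of "{..<j}" "{..y}"] by (meson atMost_iff finite_lessThan lessThan_iff less_le_trans not_le order_le_less_trans subsetI)
qed (rule assms)

lemma idx_mono:
  assumes "t \<in> standard_simplex p" "r \<in> {0..<1}" "r' \<in> {0..<1}" "r \<le> r'"
  shows "idx t r \<le> idx t r'"
  unfolding idx_def[of t r] by (rule Least_le) (use idx_bounds(2)[OF assms(1,3)] assms(4) in linarith)

lemma coface_sum:
  assumes "finite A"
  shows "(\<Sum>i\<in>A. coface \<theta> q t i) = (\<Sum>l\<in>{l. l \<le> q \<and> \<theta> l \<in> A}. t l)"
proof -
  have "(\<Sum>l\<in>{l. l \<le> q \<and> \<theta> l \<in> A}. t l) = (\<Sum>i\<in>A. \<Sum>l\<in>{l\<in>{l. l \<le> q \<and> \<theta> l \<in> A}. \<theta> l = i}. t l)"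
    by (rule sum.group[symmetric]) (use assms in auto)
  also have "\<dots> = (\<Sum>i\<in>A. coface \<theta> q t i)"
    unfolding coface_def by (intro sum.cong) (auto intro: arg_cong)
  finally show ?thesis by simp
qed

lemma coface_simplex:
  assumes "monotone_idx \<theta> q p" "t \<in> standard_simplex q"
  shows "coface \<theta> q t \<in> standard_simplex p"
proof -
  have nn: "\<And>i. 0 \<le> t i" using assms(2) by (auto simp: standard_simplex_def)
  have one: "sum t {..q} = 1" using assms(2) by (auto simp: standard_simplex_def)
  have "coface \<theta> q t i \<le> 1" for i
  proof -
    have "coface \<theta> q t i \<le> sum t {..q}" unfolding coface_def by (rule sum_mono2) (auto simp: nn)
    then show ?thesis using one by simp
  qed
  moreover have "coface \<theta> q t i = 0" if "i > p" for i
    using assms(1) that unfolding coface_def by (intro sum.neutral) (auto simp: monotone_idx_def)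
  moreover have "(\<Sum>i\<le>p. coface \<theta> q t i) = 1"
  proof -
    have "{l. l \<le> q \<and> \<theta> l \<in> {..p}} = {..q}" using assms(1) by (auto simp: monotone_idx_def)
    then show ?thesis using coface_sum[of "{..p}" \<theta> q t] one by simp
  qed
  moreover have "0 \<le> coface \<theta> q t i" for i unfolding coface_def by (intro sum_nonneg) (auto simp: nn)
  ultimately show ?thesis by (auto simp: standard_simplex_def)
qed

text \<open>Since \<open>\<theta>\<close> is monotone, the intervals with a common label under
  \<open>\<theta>\<close> are neighbours. Pushing the weights forward merges them and adds empty
  intervals for labels that are not hit, so points of [0,1) stay where they are and only their
  labels change.\<close>

lemma idx_coface:
  assumes "monotone_idx \<theta> q p" "t \<in> standard_simplex q" "r \<in> {0..<1}"
  shows "idx (coface \<theta> q t) r = \<theta> (idx t r)"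
proof (rule idx_eqI[OF coface_simplex[OF assms(1,2)]])
  note b = idx_bounds[OF assms(2,3)]
  have "sum t {..idx t r} \<le> (\<Sum>l\<in>{l. l \<le> q \<and> \<theta> l \<in> {..\<theta> (idx t r)}}. t l)"
    by (rule partial_sum_mono[OF assms(2)]) (use assms(1) b in \<open>auto simp: monotone_idx_def\<close>)
  also have "\<dots> = sum (coface \<theta> q t) {..\<theta> (idx t r)}" using coface_sum by simp
  finally show "r < sum (coface \<theta> q t) {..\<theta> (idx t r)}" using b(2) by linarith
  have "sum (coface \<theta> q t) {..<\<theta> (idx t r)} = (\<Sum>l\<in>{l. l \<le> q \<and> \<theta> l \<in> {..<\<theta> (idx t r)}}. t l)"
    using coface_sum by simp
  also have "\<dots> \<le> sum t {..<idx t r}"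
  proof (rule partial_sum_mono[OF assms(2)])
    show "{l. l \<le> q \<and> \<theta> l \<in> {..<\<theta> (idx t r)}} \<subseteq> {..<idx t r}"
      using assms(1) unfolding monotone_idx_def by (auto simp: not_le[symmetric])
  qed auto
  finally show "sum (coface \<theta> q t) {..<\<theta> (idx t r)} \<le> r" using b(3) by linarith
qed

abbreviation U01 :: "real measure" where "U01 \<equiv> restrict_space lborel {0..<1}"

lemma space_U01 [simp]: "space U01 = {0..<1}"
  by (simp add: space_restrict_space)

lemma sets_U01: "A \<in> sets U01 \<longleftrightarrow> A \<subseteq> {0..<1} \<and> A \<in> sets borel"
  by (subst sets_restrict_space_iff) auto

lemma measure_U01: "A \<in> sets U01 \<Longrightarrow> measure U01 A = measure lborel A"
  by (subst measure_restrict_space) (auto simp: sets_U01)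

interpretation U01: finite_measure U01
proof
  have "emeasure U01 {0..<1} = emeasure lborel {0..<1::real}"
    by (rule emeasure_restrict_space) auto
  then show "emeasure U01 (space U01) \<noteq> \<infinity>" by simp
qed

lemma measure_U01_interval: "0 \<le> a \<Longrightarrow> a \<le> b \<Longrightarrow> b \<le> 1 \<Longrightarrow> measure U01 {a..<b} = b - a"
  by (subst measure_U01) (auto simp: sets_U01)

lemma interval_U01 [simp, intro]: "0 \<le> a \<Longrightarrow> b \<le> 1 \<Longrightarrow> {a..<b} \<in> sets U01"
  by (auto simp: sets_U01)

lemma partial_sum_bounds:
  assumes "t \<in> standard_simplex p"
  shows "0 \<le> sum t {..<j}" "sum t {..<j} \<le> sum t {..j}" "sum t {..j} \<le> 1"
proof -
  show "0 \<le> sum t {..<j}" using assms by (intro sum_nonneg) (auto simp: standard_simplex_def)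
  show "sum t {..<j} \<le> sum t {..j}" by (rule partial_sum_mono[OF assms]) auto
  have "sum t {..j} \<le> sum t {..max j p}" by (rule partial_sum_mono[OF assms]) auto
  also have "\<dots> = sum t {..p}"
    by (rule sum.mono_neutral_right) (use assms in \<open>auto simp: standard_simplex_def\<close>)
  finally show "sum t {..j} \<le> 1" using assms by (simp add: standard_simplex_def)
qed

lemma idx_level:
  assumes "t \<in> standard_simplex p"
  shows "{r \<in> {0..<1}. idx t r = j} = {sum t {..<j}..<sum t {..j}}"
proof safe
  fix r :: real assume r: "r \<in> {0..<1}"
  show "r \<in> {sum t {..<idx t r}..<sum t {..idx t r}}" using idx_bounds[OF assms r] by auto
next
  fix r assume r: "r \<in> {sum t {..<j}..<sum t {..j}}"
  show "idx t r = j" using r by (intro idx_eqI[OF assms]) auto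
  show "r \<in> {0..<1}" using r partial_sum_bounds[OF assms, of j] by auto
qed

lemma idx_level_sets [simp, intro]:
  assumes "t \<in> standard_simplex p"
  shows "{r \<in> {0..<1}. idx t r = j} \<in> sets U01"
  unfolding idx_level[OF assms] using partial_sum_bounds[OF assms, of j] by auto

lemma idx_level_measure:
  assumes "t \<in> standard_simplex p"
  shows "measure U01 {r \<in> {0..<1}. idx t r = j} = t j"
  unfolding idx_level[OF assms]
  using partial_sum_bounds[OF assms, of j] measure_U01_interval[of "sum t {..<j}" "sum t {..j}"]
  by (simp add: lessThan_Suc_atMost[symmetric])

text \<open>Both index functions take finitely many values, so any condition on the pair cuts out a
  finite union of intersections of level intervals.\<close>

lemma idx_pred_sets:
  assumes "t \<in> standard_simplex p" "t' \<in> standard_simplex p'"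
  shows "{r \<in> {0..<1}. P (idx t r) (idx t' r)} \<in> sets U01"
proof -
  let ?J = "{jj \<in> {..p} \<times> {..p'}. P (fst jj) (snd jj)}"
  let ?A = "\<lambda>jj. {r \<in> {0..<1}. idx t r = fst jj} \<inter> {r \<in> {0..<1}. idx t' r = snd jj}"
  have "?A jj \<in> sets U01" for jj using assms by (intro sets.Int idx_level_sets)
  then have "(\<Union>jj\<in>?J. ?A jj) \<in> sets U01" by (intro sets.finite_UN) auto
  also have "(\<Union>jj\<in>?J. ?A jj) = {r \<in> {0..<1}. P (idx t r) (idx t' r)}"
  proof (intro subset_antisym subsetI)
    fix r assume r: "r \<in> {r \<in> {0..<1}. P (idx t r) (idx t' r)}"
    show "r \<in> (\<Union>jj\<in>?J. ?A jj)"
      by (rule UN_I[of "(idx t r, idx t' r)"])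
        (use r idx_bounds(1)[OF assms(1), of r] idx_bounds(1)[OF assms(2), of r] in simp_all)
  qed auto
  finally show ?thesis .
qed

text \<open>If the two indices at \<open>r\<close> differ, then \<open>r\<close> lies between two
  corresponding partial sums, at the smaller of the two indices. Both orders of the endpoints are
  counted for every \<open>j\<close>, although one of the two intervals is empty; this gives the
  factor 2.\<close>

lemma idx_diff_measure:
  assumes "t \<in> standard_simplex p" "t' \<in> standard_simplex p"
  shows "measure U01 {r \<in> {0..<1}. idx t r \<noteq> idx t' r} \<le> 2 * (\<Sum>j\<le>p. \<bar>sum t {..j} - sum t' {..j}\<bar>)"
proof -
  let ?A = "\<lambda>j. {sum t' {..j}..<sum t {..j}}" let ?B = "\<lambda>j. {sum t {..j}..<sum t' {..j}}"
  have key: "\<exists>j\<le>p. sum t' {..j} \<le> r \<and> r < sum t {..j}"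
    if t: "t \<in> standard_simplex p" "t' \<in> standard_simplex p" and r: "r \<in> {0..<1}" and lt: "idx t r < idx t' r"
    for t t' r
  proof -
    have "sum t' {..idx t r} \<le> sum t' {..<idx t' r}" by (rule partial_sum_mono[OF t(2)]) (use lt in auto)
    then show ?thesis using idx_bounds[OF t(1) r] idx_bounds[OF t(2) r] by (intro exI[of _ "idx t r"]) auto
  qed
  have sub: "{r \<in> {0..<1}. idx t r \<noteq> idx t' r} \<subseteq> (\<Union>j\<in>{..p}. ?A j \<union> ?B j)"
  proof
    fix r assume r: "r \<in> {r \<in> {0..<1}. idx t r \<noteq> idx t' r}"
    then have "idx t r < idx t' r \<or> idx t' r < idx t r" by auto
    then show "r \<in> (\<Union>j\<in>{..p}. ?A j \<union> ?B j)"
      using key[OF assms, of r] key[OF assms(2,1), of r] r by fastforce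
  qed
  have AB: "?A j \<union> ?B j \<in> sets U01" for j
    using partial_sum_bounds[OF assms(1), of j] partial_sum_bounds[OF assms(2), of j] by (intro sets.Un) auto
  have m: "measure U01 {a..<b} \<le> \<bar>a - b\<bar>" if "0 \<le> a" "b \<le> 1" for a b
    using measure_U01_interval[of a b] that by (cases "a \<le> b") auto
  have "measure U01 {r \<in> {0..<1}. idx t r \<noteq> idx t' r} \<le> measure U01 (\<Union>j\<in>{..p}. ?A j \<union> ?B j)"
    by (rule U01.finite_measure_mono[OF sub]) (use AB in \<open>auto intro: sets.finite_UN\<close>)
  also have "\<dots> \<le> (\<Sum>j\<in>{..p}. measure U01 (?A j \<union> ?B j))"
    by (rule measure_UNION_le) (use AB in auto)
  also have "\<dots> \<le> (\<Sum>j\<in>{..p}. 2 * \<bar>sum t {..j} - sum t' {..j}\<bar>)"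
  proof (rule sum_mono)
    fix j
    note b = partial_sum_bounds[OF assms(1), of j] partial_sum_bounds[OF assms(2), of j]
    have "measure U01 (?A j \<union> ?B j) \<le> measure U01 (?A j) + measure U01 (?B j)"
      by (rule measure_Un_le) (use b in auto)
    also have "\<dots> \<le> 2 * \<bar>sum t {..j} - sum t' {..j}\<bar>"
      using add_mono[OF m[OF order_trans[OF b(4,5)] b(3)] m[OF order_trans[OF b(1,2)] b(6)]]
      by (simp only: abs_minus_commute[of "sum t' {..j}"] mult_2)
    finally show "measure U01 (?A j \<union> ?B j) \<le> 2 * \<bar>sum t {..j} - sum t' {..j}\<bar>" .
  qed
  finally show ?thesis by (simp add: sum_distrib_left)
qed

subsection \<open>Points of the classifying space\<close>

text \<open>\<open>idx t 0\<close> is the first vertex of positive weight. Earlier vertices can be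
  removed by the face relations, so this is the first vertex that the class of the point can
  know.\<close>

definition leadr :: "('a,'m) catg \<Rightarrow> (nat \<times> ('a \<times> 'm list)) \<times> (nat \<Rightarrow> real) \<Rightarrow> 'a" where
  "leadr G x = nvert G (snd (fst x)) (idx (snd x) 0)"

definition stepr :: "('a,'m) catg \<Rightarrow> (nat \<times> ('a \<times> 'm list)) \<times> (nat \<Rightarrow> real) \<Rightarrow> real \<Rightarrow> 'm" where
  "stepr G x r = npath G (snd (fst x)) (idx (snd x) 0) (idx (snd x) r)"

definition cls :: "('a,'m) catg \<Rightarrow> (nat \<times> ('a \<times> 'm list)) \<times> (nat \<Rightarrow> real) \<Rightarrow>
    ((nat \<times> ('a \<times> 'm list)) \<times> (nat \<Rightarrow> real)) set" where
  "cls G x = real_eq G `` {x}"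

text \<open>The same choice as in \<open>classifying_map\<close>, so that the induced map unfolds to
  this representative in \<open>BF_rep\<close>.\<close>

definition rep :: "'x set \<Rightarrow> 'x" where "rep c = (SOME x. x \<in> c)"

definition lead where "lead G c = leadr G (rep c)"
definition step where "step G c r = stepr G (rep c) r"

lemma topspace_real_sum: "topspace (real_sum G) = {((p,s),t). s \<in> nerve G p \<and> t \<in> standard_simplex p}"
  by (auto simp: real_sum_def case_prod_unfold)

lemma equiv_real_eq: "equiv UNIV (real_eq G)"
  unfolding real_eq_def
  by (intro equivI refl_rtrancl sym_rtrancl trans_rtrancl) (auto simp: sym_def)

lemma cls_eq_iff: "cls G x = cls G y \<longleftrightarrow> (x, y) \<in> real_eq G"
  unfolding cls_def by (rule eq_equiv_class_iff[OF equiv_real_eq]) auto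

lemma mem_cls: "x \<in> cls G x"
  unfolding cls_def by (rule equiv_class_self[OF equiv_real_eq]) auto

lemma mem_cls_iff: "y \<in> cls G x \<longleftrightarrow> (x, y) \<in> real_eq G"
  unfolding cls_def by auto

text \<open>\<open>quotient_top\<close> is given through the abstraction function
  \<open>topology\<close>; its open sets are the prescribed ones only once the axioms of a topology
  have been checked.\<close>

lemma istopology_quotient:
  "istopology (\<lambda>U. U \<subseteq> topspace X // E \<and> openin X {x \<in> topspace X. E `` {x} \<in> U})"
  unfolding istopology_def
proof (intro conjI allI impI)
  fix S T assume "S \<subseteq> topspace X // E \<and> openin X {x \<in> topspace X. E `` {x} \<in> S}"
     "T \<subseteq> topspace X // E \<and> openin X {x \<in> topspace X. E `` {x} \<in> T}"
  moreover have "{x \<in> topspace X. E `` {x} \<in> S \<inter> T} = {x \<in> topspace X. E `` {x} \<in> S} \<inter> {x \<in> topspace X. E `` {x} \<in> T}" by auto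
  ultimately show "openin X {x \<in> topspace X. E `` {x} \<in> S \<inter> T}" by (simp only:) (rule openin_Int, auto)
next
  fix K assume K: "\<forall>S\<in>K. S \<subseteq> topspace X // E \<and> openin X {x \<in> topspace X. E `` {x} \<in> S}"
  have "{x \<in> topspace X. E `` {x} \<in> \<Union>K} = \<Union>((\<lambda>S. {x \<in> topspace X. E `` {x} \<in> S}) ` K)" by auto
  then show "openin X {x \<in> topspace X. E `` {x} \<in> \<Union>K}" using K by (simp only:) (rule openin_Union, auto)
qed auto

lemma quotient_map_quotient_top: "quotient_map X (quotient_top X E) (\<lambda>x. E `` {x})"
proof -
  have o: "openin (quotient_top X E) U \<longleftrightarrow> U \<subseteq> topspace X // E \<and> openin X {x \<in> topspace X. E `` {x} \<in> U}" for U
    unfolding quotient_top_def using topology_inverse'[OF istopology_quotient[of X E]] by simp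
  have t: "topspace (quotient_top X E) = topspace X // E"
  proof
    show "topspace (quotient_top X E) \<subseteq> topspace X // E" using o openin_topspace by blast
    have "{x \<in> topspace X. E `` {x} \<in> topspace X // E} = topspace X" by (auto intro: quotientI)
    then have "openin (quotient_top X E) (topspace X // E)" unfolding o by auto
    then show "topspace X // E \<subseteq> topspace (quotient_top X E)" by (rule openin_subset)
  qed
  show ?thesis unfolding quotient_map_def t o by (auto simp: quotient_def)
qed

lemma quotient_map_cls: "quotient_map (real_sum G) (classifying_space G) (cls G)"
  unfolding classifying_space_def cls_def by (rule quotient_map_quotient_top)

lemma topspace_classifying: "topspace (classifying_space G) = cls G ` topspace (real_sum G)"
  by (rule quotient_imp_surjective_map[OF quotient_map_cls, symmetric])

context cgroupoid
begin

abbreviation (input) B where "B \<equiv> classifying_space G"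

lemma idx0: "t \<in> standard_simplex p \<Longrightarrow> r \<in> {0..<1} \<Longrightarrow> idx t 0 \<le> idx t r \<and> idx t r \<le> p"
  using idx_mono[of t p 0 r] idx_bounds(1)[of t p r] by simp

lemma stepr_hom:
  assumes "x \<in> topspace (real_sum G)" "r \<in> {0..<1}"
  shows "stepr G x r \<in> Hom (leadr G x) (nvert G (snd (fst x)) (idx (snd x) r))"
proof -
  obtain p s t where x: "x = ((p,s),t)" by (metis prod.collapse)
  then have "s \<in> nerve G p" "t \<in> standard_simplex p" using assms(1) by (simp_all add: topspace_real_sum)
  then show ?thesis using npath_hom[of s p] idx0[of t p r] assms(2) by (simp add: stepr_def leadr_def x)
qed

lemma real_gen_inv:
  assumes "(x, y) \<in> real_gen G"
  shows "x \<in> topspace (real_sum G)" "y \<in> topspace (real_sum G)"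
    "leadr G x = leadr G y" "\<And>r. r \<in> {0..<1} \<Longrightarrow> stepr G x r = stepr G y r"
proof -
  obtain p q \<theta> s t where x: "x = ((q, nerve_op G \<theta> q s), t)" and y: "y = ((p, s), coface \<theta> q t)"
    and s: "s \<in> nerve G p" and m: "monotone_idx \<theta> q p" and t: "t \<in> standard_simplex q"
    using assms unfolding real_gen_def by blast
  show "x \<in> topspace (real_sum G)" "y \<in> topspace (real_sum G)"
    using x y nerve_op_nerve[OF s m] coface_simplex[OF m t] s t by (auto simp: topspace_real_sum)
  have "idx t 0 \<le> q" using idx0[OF t, of 0] by auto
  then show "leadr G x = leadr G y"
    using nerve_op_vert[OF s m] idx_coface[OF m t, of 0] by (simp add: leadr_def x y)
  show "stepr G x r = stepr G y r" if "r \<in> {0..<1}" for r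
    using nerve_op_path[OF s m] idx_coface[OF m t, of 0] idx_coface[OF m t that] idx0[OF t that]
    by (simp add: stepr_def x y)
qed

text \<open>\<open>real_eq\<close> relates elements of the whole type, so invariance of the step
  function is carried together with membership: a class that meets \<open>real_sum G\<close> stays
  inside it. Both are checked on single generators, read in either direction.\<close>

lemma real_eq_inv:
  assumes "(x, y) \<in> real_eq G" "x \<in> topspace (real_sum G)"
  shows "y \<in> topspace (real_sum G) \<and> leadr G x = leadr G y \<and> (\<forall>r\<in>{0..<1}. stepr G x r = stepr G y r)"
  using assms(1) unfolding real_eq_def
proof (induction rule: rtrancl_induct)
  case base then show ?case using assms(2) by auto
next
  case (step y z)
  then consider "(y, z) \<in> real_gen G" | "(z, y) \<in> real_gen G" by blast
  then show ?case
  proof cases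
    case 1 show ?thesis using real_gen_inv[OF 1] step.IH by simp
  next
    case 2 show ?thesis using real_gen_inv[OF 2] step.IH by simp
  qed
qed

lemma step_zero:
  assumes "x \<in> topspace (real_sum G)"
  shows "stepr G x 0 = cid G (leadr G x)"
  by (simp add: stepr_def leadr_def npath_refl)

text \<open>Two points with the same step function agree: the level sets of the sum of the two
  index functions form a common refinement of both subdivisions of the unit interval.\<close>
lemma real_eq_stepI:
  assumes x: "x \<in> topspace (real_sum G)" and y: "y \<in> topspace (real_sum G)"
    and l: "leadr G x = leadr G y"
    and e: "\<And>r. r \<in> {0..<1} \<Longrightarrow> stepr G x r = stepr G y r"
  shows "(x, y) \<in> real_eq G"
proof -
  obtain p s t p' s' t' where xy: "x = ((p,s),t)" "y = ((p',s'),t')" by (metis surj_pair)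
  then have s: "s \<in> nerve G p" "s' \<in> nerve G p'" and t: "t \<in> standard_simplex p" "t' \<in> standard_simplex p'"
    using x y by (auto simp: topspace_real_sum)
  define I where "I = {0..<1::real}"
  define k where "k r = idx t r + idx t' r" for r
  have k_mono: "r \<le> r' \<Longrightarrow> k r \<le> k r'" if "r \<in> I" "r' \<in> I" for r r'
    using idx_mono[OF t(1)] idx_mono[OF t(2)] that by (auto simp: k_def I_def add_mono)
  have k_le: "idx t r \<le> idx t r' \<and> idx t' r \<le> idx t' r'" if "r \<in> I" "r' \<in> I" "k r \<le> k r'" for r r'
  proof (cases "r \<le> r'")
    case True then show ?thesis using idx_mono[OF t(1)] idx_mono[OF t(2)] that by (auto simp: I_def)
  next
    case False
    then have "idx t r' \<le> idx t r" "idx t' r' \<le> idx t' r"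
      using idx_mono[OF t(1)] idx_mono[OF t(2)] that by (auto simp: I_def)
    then show ?thesis using that(3) by (auto simp: k_def)
  qed
  have k_bd: "k r \<le> p + p'" if "r \<in> I" for r
    using idx_bounds(1)[OF t(1), of r] idx_bounds(1)[OF t(2), of r] that by (auto simp: k_def I_def)
  define N where "N = p + p'"
  define S where "S l = {k r |r. r \<in> I \<and> (k r \<le> l \<or> r = 0)}" for l
  have S: "finite (S l)" "S l \<noteq> {}" for l
  proof -
    have "S l \<subseteq> {..N}" using k_bd by (auto simp: S_def N_def)
    then show "finite (S l)" by (rule finite_subset) auto
    show "S l \<noteq> {}" by (auto simp: S_def I_def intro: exI[of _ 0])
  qed
  define R where "R l = (SOME r. r \<in> I \<and> k r = Max (S l))" for l
  have R: "R l \<in> I \<and> k (R l) = Max (S l)" for l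
  proof -
    have "Max (S l) \<in> S l" using S by simp
    then have "\<exists>r. r \<in> I \<and> k r = Max (S l)" by (auto simp: S_def)
    then show ?thesis unfolding R_def by (rule someI_ex)
  qed
  have RI: "R l \<in> I" for l using R by blast
  have Rmono: "k (R l) \<le> k (R l')" if "l \<le> l'" for l l'
  proof -
    have "S l \<subseteq> S l'" using that by (force simp: S_def)
    then have "Max (S l) \<le> Max (S l')" by (rule Max_mono[OF _ S(2) S(1)])
    then show ?thesis using R by simp
  qed
  have Rk: "k (R (k r)) = k r" if "r \<in> I" for r
  proof -
    have "k 0 \<le> k r" using k_mono[of 0 r] that by (auto simp: I_def)
    then have "Max (S (k r)) = k r" using that S[of "k r"] by (intro Max_eqI) (auto simp: S_def)
    then show ?thesis using R by simp
  qed
  \<comment> \<open>The weights of the common refinement; a value that \<open>k\<close> does not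
    attain receives weight zero.\<close>
  define u where "u l = measure U01 {r \<in> {0..<1}. k r = l}" for l
  have ksets: "{r \<in> {0..<1}. P (k r)} \<in> sets U01" for P
    using idx_pred_sets[OF t, of "\<lambda>a b. P (a + b)"] by (simp add: k_def)
  have un: "(\<Sum>l\<in>L. u l) = measure U01 {r \<in> {0..<1}. k r \<in> L}" if "finite L" for L
  proof -
    have "{r \<in> {0..<1}. k r \<in> L} = (\<Union>l\<in>L. {r \<in> {0..<1}. k r = l})" by auto
    moreover have "measure U01 (\<Union>l\<in>L. {r \<in> {0..<1}. k r = l}) = (\<Sum>l\<in>L. measure U01 {r \<in> {0..<1}. k r = l})"
      by (rule U01.finite_measure_finite_Union) (use that ksets in \<open>auto simp: disjoint_family_on_def\<close>)
    ultimately show ?thesis by (simp add: u_def)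
  qed
  have usimp: "u \<in> standard_simplex N"
    unfolding standard_simplex_def
  proof (intro CollectI conjI allI impI)
    fix i show "0 \<le> u i" by (simp add: u_def)
    have "u i \<le> measure U01 {0..<1}" unfolding u_def by (rule U01.finite_measure_mono) auto
    then show "u i \<le> 1" using measure_U01_interval[of 0 1] by simp
  next
    fix i assume i: "i > N"
    have "k r \<noteq> i" if "r \<in> {0..<1}" for r using k_bd[of r] that i by (auto simp: I_def N_def)
    then have "{r \<in> {0..<1}. k r = i} = {}" by blast
    then show "u i = 0" unfolding u_def by (simp only: measure_empty)
  next
    have "{r \<in> {0..<1}. k r \<in> {..N}} = {0..<1}" using k_bd by (auto simp: I_def N_def)
    then show "sum u {..N} = 1" using un[of "{..N}"] measure_U01_interval[of 0 1] by simp
  qed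
  have mono: "monotone_idx (\<lambda>l. idx t (R l)) N p" "monotone_idx (\<lambda>l. idx t' (R l)) N p'"
    unfolding monotone_idx_def
    using idx_bounds(1)[OF t(1)] idx_bounds(1)[OF t(2)] RI k_le[OF RI RI Rmono] by (auto simp: I_def)
  \<comment> \<open>\<open>k\<close> is a sum of two nondecreasing functions, so each summand is
    constant on the level sets of \<open>k\<close>. Pushing \<open>u\<close> forward along either
    summand therefore recovers the original weights.\<close>
  have cof: "coface (\<lambda>l. idx t (R l)) N u = t" if tt: "t \<in> standard_simplex p"
     and kk: "\<And>r r'. r \<in> I \<Longrightarrow> r' \<in> I \<Longrightarrow> k r = k r' \<Longrightarrow> idx t r = idx t r'" for t p
  proof
    fix i
    have "coface (\<lambda>l. idx t (R l)) N u i = measure U01 {r \<in> {0..<1}. k r \<in> {l. l \<le> N \<and> idx t (R l) = i}}"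
      unfolding coface_def by (rule un) auto
    also have "{r \<in> {0..<1}. k r \<in> {l. l \<le> N \<and> idx t (R l) = i}} = {r \<in> {0..<1}. idx t r = i}"
      using kk[OF RI _ Rk] k_bd by (auto simp: I_def N_def)
    also have "measure U01 \<dots> = t i" by (rule idx_level_measure[OF tt])
    finally show "coface (\<lambda>l. idx t (R l)) N u i = t i" .
  qed
  have c: "coface (\<lambda>l. idx t (R l)) N u = t" "coface (\<lambda>l. idx t' (R l)) N u = t'"
    by (rule cof[OF t(1)], use k_le in \<open>simp add: eq_iff\<close>) (rule cof[OF t(2)], use k_le in \<open>simp add: eq_iff\<close>)
  let ?n = "nerve_op G (\<lambda>l. idx t (R l)) N s" let ?n' = "nerve_op G (\<lambda>l. idx t' (R l)) N s'"
  have vert: "nvert G s (idx t r) = nvert G s' (idx t' r)" if "r \<in> {0..<1}" for r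
    using stepr_hom[OF x that] stepr_hom[OF y that] e[OF that] xy by (auto simp: chom_def)
  \<comment> \<open>An arrow of a refined simplex is determined by the step function at two
    consecutive times, through right cancellation. Equal step functions thus give equal
    arrows.\<close>
  have path: "npath G s (idx t (R l)) (idx t (R (Suc l))) = npath G s' (idx t' (R l)) (idx t' (R (Suc l)))" for l
  proof -
    have r: "R l \<in> {0..<1}" "R (Suc l) \<in> {0..<1}" using RI by (auto simp: I_def)
    have le: "idx t (R l) \<le> idx t (R (Suc l))" "idx t' (R l) \<le> idx t' (R (Suc l))"
      using k_le[OF RI RI Rmono] by auto
    note i1 = idx0[OF t(1) r(1)] idx0[OF t(1) r(2)] and i2 = idx0[OF t(2) r(1)] idx0[OF t(2) r(2)]
    have 1: "npath G s (idx t (R l)) (idx t (R (Suc l))) \<bullet>\<bullet> stepr G x (R l) = stepr G x (R (Suc l))"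
      using npath_comp[OF s(1)] i1 le by (simp add: stepr_def xy)
    have 2: "npath G s' (idx t' (R l)) (idx t' (R (Suc l))) \<bullet>\<bullet> stepr G y (R l) = stepr G y (R (Suc l))"
      using npath_comp[OF s(2)] i2 le by (simp add: stepr_def xy)
    have h1: "npath G s (idx t (R l)) (idx t (R (Suc l))) \<in> Hom (nvert G s (idx t (R l))) (nvert G s (idx t (R (Suc l))))"
      using npath_hom[OF s(1)] i1 le by auto
    have h2: "npath G s' (idx t' (R l)) (idx t' (R (Suc l))) \<in> Hom (nvert G s (idx t (R l))) (nvert G s (idx t (R (Suc l))))"
      using npath_hom[OF s(2)] i2 le vert[OF r(1)] vert[OF r(2)] by auto
    have h3: "stepr G x (R l) \<in> Hom (leadr G x) (nvert G s (idx t (R l)))" using stepr_hom[OF x r(1)] xy by simp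
    show ?thesis by (rule cancel_right[OF h3 h1 h2]) (use 1 2 e[OF r(1)] e[OF r(2)] in simp)
  qed
  have neq: "?n = ?n'"
  proof (rule nerve_eqI[OF nerve_op_nerve[OF s(1) mono(1)] nerve_op_nerve[OF s(2) mono(2)]])
    show "fst ?n = fst ?n'" using vert[of "R 0"] RI by (simp add: nerve_op_def I_def)
    show "\<And>l. l < N \<Longrightarrow> snd ?n ! l = snd ?n' ! l" using path by (simp add: nerve_op_arrow)
  qed
  have "(((N, ?n), u), ((p, s), coface (\<lambda>l. idx t (R l)) N u)) \<in> real_gen G"
    unfolding real_gen_def using s(1) mono(1) usimp by blast
  moreover have "(((N, ?n'), u), ((p', s'), coface (\<lambda>l. idx t' (R l)) N u)) \<in> real_gen G"
    unfolding real_gen_def using s(2) mono(2) usimp by blast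
  ultimately have g: "(((N, ?n), u), x) \<in> real_gen G" "(((N, ?n), u), y) \<in> real_gen G"
    unfolding c neq xy by auto
  then have "(x, ((N, ?n), u)) \<in> real_eq G" "(((N, ?n), u), y) \<in> real_eq G"
    unfolding real_eq_def by auto
  then show ?thesis unfolding real_eq_def by (rule rtrancl_trans)
qed

lemma rep_props:
  assumes "c \<in> topspace B"
  shows "rep c \<in> topspace (real_sum G)" "cls G (rep c) = c"
proof -
  obtain x where x: "x \<in> topspace (real_sum G)" "c = cls G x" using assms topspace_classifying by blast
  then have "rep c \<in> cls G x" unfolding rep_def using someI[of "\<lambda>y. y \<in> cls G x", OF mem_cls] by simp
  then have r: "(x, rep c) \<in> real_eq G" by (simp add: mem_cls_iff)
  show "rep c \<in> topspace (real_sum G)" using real_eq_inv[OF r x(1)] by blast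
  show "cls G (rep c) = c" using r x(2) cls_eq_iff[of G x "rep c"] by simp
qed

lemma cls_in: "x \<in> topspace (real_sum G) \<Longrightarrow> cls G x \<in> topspace B"
  using topspace_classifying by blast

lemma lead_cls: "x \<in> topspace (real_sum G) \<Longrightarrow> lead G (cls G x) = leadr G x"
  and step_cls: "x \<in> topspace (real_sum G) \<Longrightarrow> r \<in> {0..<1} \<Longrightarrow> step G (cls G x) r = stepr G x r"
proof -
  assume x: "x \<in> topspace (real_sum G)"
  have "(x, rep (cls G x)) \<in> real_eq G" using rep_props(2)[OF cls_in[OF x]] cls_eq_iff[of G x "rep (cls G x)"] by simp
  from real_eq_inv[OF this x] show "lead G (cls G x) = leadr G x"
    "r \<in> {0..<1} \<Longrightarrow> step G (cls G x) r = stepr G x r" by (auto simp: lead_def step_def)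
qed

lemma lead_ob: "q \<in> topspace B \<Longrightarrow> lead G q \<in> cob G"
  unfolding lead_def using hom_ob(1)[OF stepr_hom[OF rep_props(1), of q 0]] by simp

lemma step_hom: "q \<in> topspace B \<Longrightarrow> r \<in> {0..<1} \<Longrightarrow> \<exists>y. step G q r \<in> Hom (lead G q) y"
  unfolding lead_def step_def using stepr_hom[OF rep_props(1)] by blast

lemma step_0: "q \<in> topspace B \<Longrightarrow> step G q 0 = cid G (lead G q)"
  unfolding lead_def step_def using step_zero rep_props(1) by blast

lemma lift_cancel:
  assumes "q \<in> topspace B" "r \<in> {0..<1}" "n \<in> Hom a (lead G q)" "n' \<in> Hom a (lead G q)"
    "step G q r \<bullet>\<bullet> n = step G q r \<bullet>\<bullet> n'"
  shows "n = n'"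
  using cancel_left[OF _ assms(3,4,5)] step_hom[OF assms(1,2)] by blast

text \<open>A step function may be read from any object \<open>a\<close> instead of the leading
  vertex. At time 0 the step is an identity, so the hypothesis already gives \<open>n = n'\<close>,
  and right cancellation then recovers the step functions themselves.\<close>

lemma point_eqI:
  assumes q: "q \<in> topspace B" "q' \<in> topspace B" and n: "n \<in> Hom a (lead G q)" "n' \<in> Hom a (lead G q')"
    and e: "\<And>r. r \<in> {0..<1} \<Longrightarrow> step G q r \<bullet>\<bullet> n = step G q' r \<bullet>\<bullet> n'"
  shows "q = q'"
proof -
  have nn: "n = n'" using e[of 0] step_0[OF q(1)] step_0[OF q(2)] id_left[OF n(1)] id_left[OF n(2)] by simp
  then have l: "lead G q = lead G q'" using n by (auto simp: chom_def)
  have st: "step G q r = step G q' r" if r: "r \<in> {0..<1}" for r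
  proof -
    obtain y y' where y: "step G q r \<in> Hom (lead G q) y" "step G q' r \<in> Hom (lead G q') y'"
      using step_hom[OF q(1) r] step_hom[OF q(2) r] by blast
    have "step G q r \<bullet>\<bullet> n \<in> Hom a y" "step G q' r \<bullet>\<bullet> n' \<in> Hom a y'"
      using comp_hom[OF n(1) y(1)] comp_hom[OF n(2) y(2)] by auto
    then have "y = y'" using e[OF r] by (auto simp: chom_def)
    then show ?thesis using cancel_right[OF n(1) y(1), of "step G q' r"] y(2) l e[OF r] nn by simp
  qed
  have "(rep q, rep q') \<in> real_eq G"
    by (rule real_eq_stepI[OF rep_props(1)[OF q(1)] rep_props(1)[OF q(2)]])
       (use l st in \<open>simp_all add: lead_def step_def\<close>)
  then show ?thesis using rep_props(2)[OF q(1)] rep_props(2)[OF q(2)] cls_eq_iff[of G "rep q" "rep q'"] by simp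
qed

end

section \<open>The covering by arrows into the leading vertex, and its distance\<close>

definition ldist where
  "ldist G q m q' m' = measure U01 {r \<in> {0..<1}. ccomp G (step G q r) m \<noteq> ccomp G (step G q' r) m'}"

text \<open>Sections over \<open>K\<close> of the pullback along \<open>g\<close> of the covering with fibres
  \<open>Hom(a, lead q)\<close>.\<close>
definition sec where
  "sec G K g a m \<longleftrightarrow> continuous_map K (classifying_space G) g \<and>
     (\<forall>x\<in>topspace K. m x \<in> chom G a (lead G (g x))) \<and>
     (\<forall>x\<in>topspace K. \<forall>e>0. openin K {y \<in> topspace K. ldist G (g x) (m x) (g y) (m y) < e})"

abbreviation I01 :: "real topology" where "I01 \<equiv> top_of_set {0..1}"

context cgroupoid
begin

lemma ldist_sets:
  assumes "q \<in> topspace B" "q' \<in> topspace B"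
  shows "{r \<in> {0..<1}. step G q r \<bullet>\<bullet> m \<noteq> step G q' r \<bullet>\<bullet> m'} \<in> sets U01"
proof -
  obtain p s t where x: "rep q = ((p,s),t)" by (metis prod.collapse)
  obtain p' s' t' where y: "rep q' = ((p',s'),t')" by (metis prod.collapse)
  have t: "t \<in> standard_simplex p" "t' \<in> standard_simplex p'"
    using rep_props(1)[OF assms(1)] rep_props(1)[OF assms(2)] x y by (simp_all add: topspace_real_sum)
  show ?thesis
    using idx_pred_sets[OF t, of "\<lambda>j j'. npath G s (idx t 0) j \<bullet>\<bullet> m \<noteq> npath G s' (idx t' 0) j' \<bullet>\<bullet> m'"]
    by (simp add: step_def stepr_def x y)
qed

lemma ldist_sym: "ldist G q m q' m' = ldist G q' m' q m"
  by (simp add: ldist_def eq_commute)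

lemma ldist_self: "ldist G q m q m = 0"
  by (simp add: ldist_def)

lemma ldist_triangle:
  assumes "q \<in> topspace B" "q' \<in> topspace B" "q'' \<in> topspace B"
  shows "ldist G q m q'' m'' \<le> ldist G q m q' m' + ldist G q' m' q'' m''"
proof -
  let ?A = "{r \<in> {0..<1}. step G q r \<bullet>\<bullet> m \<noteq> step G q' r \<bullet>\<bullet> m'}"
  let ?C = "{r \<in> {0..<1}. step G q' r \<bullet>\<bullet> m' \<noteq> step G q'' r \<bullet>\<bullet> m''}"
  have "ldist G q m q'' m'' \<le> measure U01 (?A \<union> ?C)"
    unfolding ldist_def by (rule U01.finite_measure_mono) (use ldist_sets assms in \<open>auto intro!: sets.Un\<close>)
  also have "\<dots> \<le> measure U01 ?A + measure U01 ?C"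
    by (rule measure_Un_le) (use ldist_sets assms in auto)
  finally show ?thesis unfolding ldist_def .
qed

text \<open>By left cancellation two different arrows over one point disagree at every time, so
  their distance is the full length 1 of the interval.\<close>

lemma ldist_lt1:
  assumes "q \<in> topspace B" "n \<in> Hom a (lead G q)" "n' \<in> Hom a (lead G q)" "ldist G q n q n' < 1"
  shows "n = n'"
proof (rule ccontr)
  assume "n \<noteq> n'"
  then have "{r \<in> {0..<1}. step G q r \<bullet>\<bullet> n \<noteq> step G q r \<bullet>\<bullet> n'} = {0..<1}"
    using lift_cancel[OF assms(1) _ assms(2,3)] by blast
  then show False using assms(4) measure_U01_interval[of 0 1] unfolding ldist_def by simp
qed

text \<open>Two lifts over \<open>q\<close> within 1/2 of a common element are less than 1 apart.
  This is the discreteness of the fibres in the form in which it is used for local choices.\<close>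

lemma ldist_close:
  assumes "q \<in> topspace B" "q' \<in> topspace B" "n \<in> Hom a (lead G q)" "n' \<in> Hom a (lead G q)"
    "ldist G q' m q n < 1/2" "ldist G q' m q n' < 1/2"
  shows "n = n'"
proof (rule ldist_lt1[OF assms(1,3,4)])
  show "ldist G q n q n' < 1"
    using ldist_triangle[OF assms(1,2,1), of n n' m] assms(5,6) ldist_sym[of q n q' m] by linarith
qed

lemma ldist_comp:
  assumes "q \<in> topspace B" "q' \<in> topspace B" "m \<in> Hom a (lead G q)" "m' \<in> Hom a (lead G q')" "n \<in> Hom b a"
  shows "ldist G q (m \<bullet>\<bullet> n) q' (m' \<bullet>\<bullet> n) \<le> ldist G q m q' m'"
  unfolding ldist_def
proof (rule U01.finite_measure_mono[OF _ ldist_sets[OF assms(1,2)]])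
  have "step G q r \<bullet>\<bullet> (m \<bullet>\<bullet> n) = (step G q r \<bullet>\<bullet> m) \<bullet>\<bullet> n" "step G q' r \<bullet>\<bullet> (m' \<bullet>\<bullet> n) = (step G q' r \<bullet>\<bullet> m') \<bullet>\<bullet> n"
    if "r \<in> {0..<1}" for r
    using assoc[OF assms(5,3)] assoc[OF assms(5,4)] step_hom[OF assms(1) that] step_hom[OF assms(2) that] by blast+
  then show "{r \<in> {0..<1}. step G q r \<bullet>\<bullet> (m \<bullet>\<bullet> n) \<noteq> step G q' r \<bullet>\<bullet> (m' \<bullet>\<bullet> n)}
     \<subseteq> {r \<in> {0..<1}. step G q r \<bullet>\<bullet> m \<noteq> step G q' r \<bullet>\<bullet> m'}" by auto
qed

text \<open>An arrow \<open>k\<close> into vertex 0 yields a lift for every choice of weights on the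
  simplex. Read from \<open>a\<close>, the step function becomes \<open>npath G s 0\<close> along
  the index function, in which the varying leading vertex no longer occurs.\<close>

lemma lift_simplex:
  assumes "s \<in> nerve G p" "t \<in> standard_simplex p" "k \<in> Hom a (nvert G s 0)" "r \<in> {0..<1}"
  shows "step G (cls G ((p,s),t)) r \<bullet>\<bullet> (npath G s 0 (idx t 0) \<bullet>\<bullet> k) = npath G s 0 (idx t r) \<bullet>\<bullet> k"
    "npath G s 0 (idx t 0) \<bullet>\<bullet> k \<in> Hom a (lead G (cls G ((p,s),t)))"
proof -
  have x: "((p,s),t) \<in> topspace (real_sum G)" using assms by (simp add: topspace_real_sum)
  note i = idx0[OF assms(2,4)]
  have h1: "npath G s 0 (idx t 0) \<in> Hom (nvert G s 0) (nvert G s (idx t 0))" using npath_hom[OF assms(1)] i by simp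
  have h2: "npath G s (idx t 0) (idx t r) \<in> Hom (nvert G s (idx t 0)) (nvert G s (idx t r))"
    using npath_hom[OF assms(1)] i by simp
  have "step G (cls G ((p,s),t)) r = npath G s (idx t 0) (idx t r)"
    using step_cls[OF x assms(4)] by (simp add: stepr_def)
  moreover have "npath G s (idx t 0) (idx t r) \<bullet>\<bullet> npath G s 0 (idx t 0) = npath G s 0 (idx t r)"
    using npath_comp[OF assms(1)] i by simp
  ultimately show "step G (cls G ((p,s),t)) r \<bullet>\<bullet> (npath G s 0 (idx t 0) \<bullet>\<bullet> k) = npath G s 0 (idx t r) \<bullet>\<bullet> k"
    using assoc[OF assms(3) h1 h2] by simp
  show "npath G s 0 (idx t 0) \<bullet>\<bullet> k \<in> Hom a (lead G (cls G ((p,s),t)))"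
    using comp_hom[OF assms(3) h1] lead_cls[OF x] by (simp add: leadr_def)
qed

lemma ldist_simplex:
  assumes "s \<in> nerve G p" "t \<in> standard_simplex p" "t' \<in> standard_simplex p" "k \<in> Hom a (nvert G s 0)"
  shows "ldist G (cls G ((p,s),t)) (npath G s 0 (idx t 0) \<bullet>\<bullet> k) (cls G ((p,s),t')) (npath G s 0 (idx t' 0) \<bullet>\<bullet> k)
     \<le> 2 * (\<Sum>j\<le>p. \<bar>sum t {..j} - sum t' {..j}\<bar>)"
proof -
  have "ldist G (cls G ((p,s),t)) (npath G s 0 (idx t 0) \<bullet>\<bullet> k) (cls G ((p,s),t')) (npath G s 0 (idx t' 0) \<bullet>\<bullet> k)
     \<le> measure U01 {r \<in> {0..<1}. idx t r \<noteq> idx t' r}"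
    unfolding ldist_def
    by (rule U01.finite_measure_mono[OF _ idx_pred_sets[OF assms(2,3)]])
      (use lift_simplex(1)[OF assms(1,2,4)] lift_simplex(1)[OF assms(1,3,4)] in \<open>auto simp del: npath.simps\<close>)
  then show ?thesis using idx_diff_measure[OF assms(2,3)] by linarith
qed

lemma simplex_nbhd:
  assumes "t \<in> standard_simplex p" "e > 0"
  shows "openin (subtopology (powertop_real UNIV) (standard_simplex p))
     {t' \<in> standard_simplex p. 2 * (\<Sum>j\<le>p. \<bar>sum t {..j} - sum t' {..j}\<bar>) < e}"
proof -
  have c: "continuous_map (subtopology (powertop_real UNIV) (standard_simplex p)) euclideanreal
      (\<lambda>t'. 2 * (\<Sum>j\<le>p. \<bar>sum t {..j} - sum t' {..j}\<bar>))"
    by (intro continuous_intros continuous_map_from_subtopology continuous_map_product_projection) auto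
  show ?thesis using openin_continuous_map_preimage[OF c, of "{..<e}"] by simp
qed

lemma simplex_lift:
  assumes "s \<in> nerve G p" "t \<in> standard_simplex p" "n \<in> Hom a (lead G (cls G ((p,s),t)))"
  shows "\<exists>k\<in>Hom a (nvert G s 0). n = npath G s 0 (idx t 0) \<bullet>\<bullet> k"
proof -
  have x: "((p,s),t) \<in> topspace (real_sum G)" using assms by (simp add: topspace_real_sum)
  have h1: "npath G s 0 (idx t 0) \<in> Hom (nvert G s 0) (nvert G s (idx t 0))"
    using npath_hom[OF assms(1)] idx0[OF assms(2), of 0] by simp
  have n: "n \<in> Hom a (nvert G s (idx t 0))" using assms(3) lead_cls[OF x] by (simp add: leadr_def)
  show ?thesis
    by (rule bexI[of _ "ginv (npath G s 0 (idx t 0)) \<bullet>\<bullet> n"])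
      (use inv_comp_cancel[OF h1 n] comp_hom[OF n inv_props(1)[OF h1]] in simp_all)
qed

text \<open>Openness in the quotient is tested on each closed simplex. There a lift comes from an
  arrow \<open>k\<close> into vertex 0, and the same \<open>k\<close> lifts all nearby weights at
  small distance; the room left by the strict inequality absorbs this distance.\<close>

lemma openin_lift_nbhd:
  assumes q: "q \<in> topspace B"
  shows "openin B {q' \<in> topspace B. \<exists>n'\<in>Hom a (lead G q'). ldist G q n q' n' < e}" (is "openin B ?U")
proof -
  have "openin (real_sum G) {x \<in> topspace (real_sum G). cls G x \<in> ?U}"
    unfolding real_sum_def openin_sum_topology
  proof (intro conjI ballI)
    show "{x \<in> topspace (sum_topology (\<lambda>(p, s). subtopology (powertop_real UNIV) (standard_simplex p)) {(p, s). s \<in> nerve G p}). cls G x \<in> ?U}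
      \<subseteq> Sigma {(p, s). s \<in> nerve G p} (topspace \<circ> (\<lambda>(p, s). subtopology (powertop_real UNIV) (standard_simplex p)))"
      by auto
    fix i assume i: "i \<in> {(p, s). s \<in> nerve G p}"
    obtain p s where ps: "i = (p,s)" by (cases i)
    then have s: "s \<in> nerve G p" using i by simp
    let ?W = "{t. (i, t) \<in> {x \<in> topspace (sum_topology (\<lambda>(p, s). subtopology (powertop_real UNIV) (standard_simplex p)) {(p, s). s \<in> nerve G p}). cls G x \<in> ?U}}"
    have W: "t \<in> ?W \<longleftrightarrow> t \<in> standard_simplex p \<and> cls G ((p,s),t) \<in> ?U" for t
      using s by (simp add: ps)
    have "openin (subtopology (powertop_real UNIV) (standard_simplex p)) ?W"
    proof (subst openin_subopen, intro ballI)
      fix t assume "t \<in> ?W"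
      then have t: "t \<in> standard_simplex p" and "cls G ((p,s),t) \<in> ?U" using W by blast+
      then obtain n' where x: "cls G ((p,s),t) \<in> topspace B" and n': "n' \<in> Hom a (lead G (cls G ((p,s),t)))" "ldist G q n (cls G ((p,s),t)) n' < e"
        by blast
      obtain k where k: "k \<in> Hom a (nvert G s 0)" "n' = npath G s 0 (idx t 0) \<bullet>\<bullet> k"
        using simplex_lift[OF s t n'(1)] by blast
      define d where "d = e - ldist G q n (cls G ((p,s),t)) n'"
      have "d > 0" using n' d_def by simp
      let ?T = "{t' \<in> standard_simplex p. 2 * (\<Sum>j\<le>p. \<bar>sum t {..j} - sum t' {..j}\<bar>) < d}"
      have "?T \<subseteq> ?W"
      proof
        fix t' assume "t' \<in> ?T"
        then have t': "t' \<in> standard_simplex p" and l: "2 * (\<Sum>j\<le>p. \<bar>sum t {..j} - sum t' {..j}\<bar>) < d" by blast+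
        have y: "cls G ((p,s),t') \<in> topspace B" using s t' by (intro cls_in) (simp add: topspace_real_sum)
        have "ldist G q n (cls G ((p,s),t')) (npath G s 0 (idx t' 0) \<bullet>\<bullet> k) < e"
          using ldist_triangle[OF q x y, of n "npath G s 0 (idx t' 0) \<bullet>\<bullet> k" n'] ldist_simplex[OF s t t' k(1), folded k(2)] l
          unfolding d_def by linarith
        then have "cls G ((p,s),t') \<in> ?U" using y lift_simplex(2)[OF s t' k(1), of 0] by auto
        then show "t' \<in> ?W" using W t' by blast
      qed
      moreover have "t \<in> ?T" using t \<open>d > 0\<close> by simp
      ultimately show "\<exists>T. openin (subtopology (powertop_real UNIV) (standard_simplex p)) T \<and> t \<in> T \<and> T \<subseteq> ?W"
        using simplex_nbhd[OF t \<open>d > 0\<close>] by blast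
    qed
    then show "openin (case i of (p, s) \<Rightarrow> subtopology (powertop_real UNIV) (standard_simplex p)) ?W"
      unfolding ps by simp
  qed
  moreover have "?U \<subseteq> topspace B" by auto
  ultimately show ?thesis using quotient_map_cls[of G] unfolding quotient_map_def by blast
qed

subsection \<open>Sections\<close>

lemma secD:
  assumes "sec G K g a m"
  shows "continuous_map K B g" "x \<in> topspace K \<Longrightarrow> m x \<in> Hom a (lead G (g x))"
    "x \<in> topspace K \<Longrightarrow> e > 0 \<Longrightarrow> openin K {y \<in> topspace K. ldist G (g x) (m x) (g y) (m y) < e}"
    "x \<in> topspace K \<Longrightarrow> g x \<in> topspace B"
  using assms continuous_map_funspace[of K B g] unfolding sec_def by (blast, blast, blast, blast)

text \<open>\<open>sec\<close> asks for open balls about every point of \<open>K\<close>. By the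
  triangle inequality it is enough that each point has some neighbourhood on which the section is
  close to its value there.\<close>

lemma secI_local:
  assumes g: "continuous_map K B g" and m: "\<And>x. x \<in> topspace K \<Longrightarrow> m x \<in> Hom a (lead G (g x))"
    and l: "\<And>x e. x \<in> topspace K \<Longrightarrow> e > 0 \<Longrightarrow> \<exists>N. openin K N \<and> x \<in> N \<and> (\<forall>y\<in>N. ldist G (g x) (m x) (g y) (m y) < e)"
  shows "sec G K g a m"
  unfolding sec_def
proof (intro conjI ballI allI impI g m)
  fix x and e :: real assume x: "x \<in> topspace K" and "e > 0"
  let ?S = "{y \<in> topspace K. ldist G (g x) (m x) (g y) (m y) < e}"
  have gB: "g z \<in> topspace B" if "z \<in> topspace K" for z using g that continuous_map_funspace by blast
  show "openin K ?S"
  proof (subst openin_subopen, intro ballI)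
    fix y assume "y \<in> ?S"
    then have y: "y \<in> topspace K" "ldist G (g x) (m x) (g y) (m y) < e" by auto
    then obtain N where N: "openin K N" "y \<in> N" "\<forall>z\<in>N. ldist G (g y) (m y) (g z) (m z) < e - ldist G (g x) (m x) (g y) (m y)"
      using l[OF y(1), of "e - ldist G (g x) (m x) (g y) (m y)"] by auto
    have "N \<subseteq> ?S"
    proof
      fix z assume z: "z \<in> N"
      then have zK: "z \<in> topspace K" using N(1) openin_subset by blast
      show "z \<in> ?S" using ldist_triangle[OF gB[OF x] gB[OF y(1)] gB[OF zK], of "m x" "m z" "m y"] N(3) z zK by force
    qed
    then show "\<exists>T. openin K T \<and> y \<in> T \<and> T \<subseteq> ?S" using N by blast
  qed
qed

lemma sec_pull:
  assumes s: "sec G K g a m" and f: "continuous_map K' K f"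
  shows "sec G K' (\<lambda>x. g (f x)) a (\<lambda>x. m (f x))"
  unfolding sec_def
proof (intro conjI ballI allI impI)
  have fK: "f x \<in> topspace K" if "x \<in> topspace K'" for x using f that continuous_map_funspace by blast
  show "continuous_map K' B (\<lambda>x. g (f x))" using continuous_map_compose[OF f secD(1)[OF s]] by (simp add: o_def)
  fix x assume x: "x \<in> topspace K'"
  show "m (f x) \<in> Hom a (lead G (g (f x)))" using secD(2)[OF s fK[OF x]] .
  fix e :: real assume "e > 0"
  from openin_continuous_map_preimage[OF f secD(3)[OF s fK[OF x] this]]
  show "openin K' {y \<in> topspace K'. ldist G (g (f x)) (m (f x)) (g (f y)) (m (f y)) < e}"
    using fK by (auto elim!: back_subst[of "openin K'"])
qed

lemma sec_sub: "sec G K g a m \<Longrightarrow> sec G (subtopology K S) g a m"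
  using sec_pull[of K g a m "subtopology K S" "\<lambda>x. x"] by (simp add: continuous_map_from_subtopology)

lemma sec_cong:
  assumes s: "sec G K g a m" and e: "\<And>x. x \<in> topspace K \<Longrightarrow> g x = g' x" "\<And>x. x \<in> topspace K \<Longrightarrow> m x = m' x"
  shows "sec G K g' a m'"
  unfolding sec_def
proof (intro conjI ballI allI impI)
  show "continuous_map K B g'" using continuous_map_eq[OF secD(1)[OF s]] e by auto
  fix x assume x: "x \<in> topspace K"
  show "m' x \<in> Hom a (lead G (g' x))" using secD(2)[OF s x] e x by simp
  fix d :: real assume "d > 0"
  have "{y \<in> topspace K. ldist G (g' x) (m' x) (g' y) (m' y) < d} = {y \<in> topspace K. ldist G (g x) (m x) (g y) (m y) < d}"
    using e x by auto
  then show "openin K {y \<in> topspace K. ldist G (g' x) (m' x) (g' y) (m' y) < d}" using secD(3)[OF s x \<open>d > 0\<close>] by simp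
qed

lemma sec_translate:
  assumes s: "sec G K g a m" and n: "n \<in> Hom b a"
  shows "sec G K g b (\<lambda>x. m x \<bullet>\<bullet> n)"
proof (rule secI_local)
  show "continuous_map K B g" using secD(1)[OF s] .
  fix x assume x: "x \<in> topspace K"
  show "m x \<bullet>\<bullet> n \<in> Hom b (lead G (g x))" using comp_hom[OF n secD(2)[OF s x]] .
  fix e :: real assume e: "e > 0"
  show "\<exists>N. openin K N \<and> x \<in> N \<and> (\<forall>y\<in>N. ldist G (g x) (m x \<bullet>\<bullet> n) (g y) (m y \<bullet>\<bullet> n) < e)"
  proof (rule exI[of _ "{y \<in> topspace K. ldist G (g x) (m x) (g y) (m y) < e}"], intro conjI ballI)
    show "openin K {y \<in> topspace K. ldist G (g x) (m x) (g y) (m y) < e}" using secD(3)[OF s x e] .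
    show "x \<in> {y \<in> topspace K. ldist G (g x) (m x) (g y) (m y) < e}" using x e ldist_self by simp
    fix y assume "y \<in> {y \<in> topspace K. ldist G (g x) (m x) (g y) (m y) < e}"
    then have y: "y \<in> topspace K" "ldist G (g x) (m x) (g y) (m y) < e" by auto
    show "ldist G (g x) (m x \<bullet>\<bullet> n) (g y) (m y \<bullet>\<bullet> n) < e"
      using ldist_comp[OF secD(4)[OF s x] secD(4)[OF s y(1)] secD(2)[OF s x] secD(2)[OF s y(1)] n] y(2) by linarith
  qed
qed

text \<open>Near \<open>x\<close> both sections stay within 1/2 of their values at \<open>x\<close>.
  If these values agree, then \<open>ldist_close\<close> makes the sections agree nearby; read from
  \<open>y\<close> to \<open>x\<close>, the same argument shows that disagreement is open
  too.\<close>

lemma sec_agree_open: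
  assumes s: "sec G K g a m" and s': "sec G K g a m'"
  shows "openin K {x \<in> topspace K. m x = m' x}" "openin K {x \<in> topspace K. m x \<noteq> m' x}"
proof -
  let ?N = "\<lambda>x. {y \<in> topspace K. ldist G (g x) (m x) (g y) (m y) < 1/2} \<inter> {y \<in> topspace K. ldist G (g x) (m' x) (g y) (m' y) < 1/2}"
  have N: "openin K (?N x)" "x \<in> ?N x" if "x \<in> topspace K" for x
    using secD(3)[OF s that, of "1/2"] secD(3)[OF s' that, of "1/2"] that ldist_self by (auto intro!: openin_Int)
  have e1: "m y = m' y" if x: "x \<in> topspace K" "m x = m' x" "y \<in> ?N x" for x y
    by (rule ldist_close[of "g y" "g x" _ a _ "m x"])
      (use x secD(4)[OF s] secD(2)[OF s] secD(2)[OF s'] in auto)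
  have e2: "m x = m' x" if x: "x \<in> topspace K" "m y = m' y" "y \<in> ?N x" for x y
    by (rule ldist_close[of "g x" "g y" _ a _ "m y"])
      (use x secD(4)[OF s] secD(2)[OF s] secD(2)[OF s'] ldist_sym[of "g y"] in auto)
  show "openin K {x \<in> topspace K. m x = m' x}"
  proof (subst openin_subopen, intro ballI)
    fix x assume "x \<in> {x \<in> topspace K. m x = m' x}"
    then have x: "x \<in> topspace K" "m x = m' x" by auto
    show "\<exists>T. openin K T \<and> x \<in> T \<and> T \<subseteq> {x \<in> topspace K. m x = m' x}"
      by (rule exI[of _ "?N x"]) (use N[OF x(1)] e1[OF x] in blast)
  qed
  show "openin K {x \<in> topspace K. m x \<noteq> m' x}"
  proof (subst openin_subopen, intro ballI)
    fix x assume "x \<in> {x \<in> topspace K. m x \<noteq> m' x}"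
    then have x: "x \<in> topspace K" "m x \<noteq> m' x" by auto
    show "\<exists>T. openin K T \<and> x \<in> T \<and> T \<subseteq> {x \<in> topspace K. m x \<noteq> m' x}"
      by (rule exI[of _ "?N x"]) (use N[OF x(1)] e2[OF x(1)] x(2) in blast)
  qed
qed

lemma sec_unique:
  assumes s: "sec G K g a m" "sec G K g a m'" and c: "connected_space K"
    and x: "x \<in> topspace K" "m x = m' x" and y: "y \<in> topspace K"
  shows "m y = m' y"
proof (rule ccontr)
  assume ne: "m y \<noteq> m' y"
  have "topspace K \<subseteq> {x \<in> topspace K. m x = m' x} \<union> {x \<in> topspace K. m x \<noteq> m' x}"
    "{x \<in> topspace K. m x = m' x} \<inter> {x \<in> topspace K. m x \<noteq> m' x} = {}"
    "{x \<in> topspace K. m x = m' x} \<noteq> {}" "{x \<in> topspace K. m x \<noteq> m' x} \<noteq> {}" using x y ne by blast+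
  with c sec_agree_open[OF s] show False unfolding connected_space_def by blast
qed

lemma sec_const:
  assumes "q \<in> topspace B" "n \<in> Hom a (lead G q)"
  shows "sec G K (\<lambda>_. q) a (\<lambda>_. n)"
  using assms ldist_self by (auto simp: sec_def)

text \<open>Over the open set of points that admit a lift within 1/4 of \<open>n\<close>, that lift
  is unique. An arbitrary choice is therefore a definite function, and continuity follows from
  uniqueness.\<close>

lemma sec_local:
  assumes g: "continuous_map K B g" and x: "x \<in> topspace K" and n: "n \<in> Hom a (lead G (g x))"
  obtains N m where "openin K N" "x \<in> N" "m x = n" "sec G (subtopology K N) g a m"
proof -
  have gB: "g z \<in> topspace B" if "z \<in> topspace K" for z using g that continuous_map_funspace by blast
  let ?U = "\<lambda>q n e. {q' \<in> topspace B. \<exists>n'\<in>Hom a (lead G q'). ldist G q n q' n' < e}"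
  define N where "N = {y \<in> topspace K. g y \<in> ?U (g x) n (1/4)}"
  define P where "P y n' \<longleftrightarrow> n' \<in> Hom a (lead G (g y)) \<and> ldist G (g x) n (g y) n' < 1/4" for y n'
  define m where "m y = (SOME n'. P y n')" for y
  have No: "openin K N" unfolding N_def by (rule openin_continuous_map_preimage[OF g openin_lift_nbhd[OF gB[OF x]]])
  have xN: "x \<in> N" using x n gB[OF x] ldist_self[of "g x" n] by (auto simp: N_def intro!: bexI[of _ n])
  have NK: "y \<in> topspace K" if "y \<in> N" for y using that by (simp add: N_def)
  have P: "P y (m y)" if "y \<in> N" for y
  proof -
    have "\<exists>n'. P y n'" using that by (auto simp: N_def P_def)
    then show ?thesis unfolding m_def by (rule someI_ex)
  qed
  have mx: "m x = n"
    using P[OF xN] n ldist_self[of "g x" n] ldist_close[OF gB[OF x] gB[OF x], of "m x" a n n] by (simp add: P_def)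
  have t: "topspace (subtopology K N) = N" using NK by auto
  have "sec G (subtopology K N) g a m"
  proof (rule secI_local)
    show "continuous_map (subtopology K N) B g" using g continuous_map_from_subtopology by blast
    fix y assume "y \<in> topspace (subtopology K N)"
    then have y: "y \<in> N" using t by simp
    show "m y \<in> Hom a (lead G (g y))" using P[OF y] by (simp add: P_def)
    fix e :: real assume "e > 0"
    \<comment> \<open>The cap 1/4 makes a lift close to \<open>m y\<close> lie within 1/2 of
      \<open>n\<close>, so that it has to be the chosen lift \<open>m z\<close>.\<close>
    define d where "d = min e (1/4)"
    have "d > 0" using \<open>e > 0\<close> by (simp add: d_def)
    let ?V = "{z \<in> topspace K. g z \<in> ?U (g y) (m y) d} \<inter> N"
    have "openin K ?V" by (intro openin_Int No openin_continuous_map_preimage[OF g openin_lift_nbhd[OF gB[OF NK[OF y]]]])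
    then have "openin (subtopology K N) ?V" by (simp add: openin_subset_topspace_eq openin_subtopology_Int openin_open_subtopology No)
    moreover have "y \<in> ?V" using y NK[OF y] gB[OF NK[OF y]] P[OF y] \<open>d > 0\<close> ldist_self[of "g y" "m y"]
      by (auto simp: P_def intro!: bexI[of _ "m y"])
    moreover have "ldist G (g y) (m y) (g z) (m z) < e" if zV: "z \<in> ?V" for z
    proof -
      have z: "z \<in> N" using zV by blast
      obtain n' where n': "n' \<in> Hom a (lead G (g z))" "ldist G (g y) (m y) (g z) n' < d" using zV by blast
      have "ldist G (g x) n (g z) n' < 1/2"
        using ldist_triangle[OF gB[OF x] gB[OF NK[OF y]] gB[OF NK[OF z]], of n n' "m y"] P[OF y] n'(2)
        unfolding P_def d_def by auto
      then have "n' = m z"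
        using ldist_close[OF gB[OF NK[OF z]] gB[OF x], of n' a "m z" n] n'(1) P[OF z] by (simp add: P_def)
      then show ?thesis using n'(2) by (simp add: d_def)
    qed
    ultimately show "\<exists>N'. openin (subtopology K N) N' \<and> y \<in> N' \<and> (\<forall>z\<in>N'. ldist G (g y) (m y) (g z) (m z) < e)" by blast
  qed
  then show ?thesis by (rule that[of N m, OF No xN mx])
qed

lemma sec_glue_open:
  assumes g: "continuous_map K B g"
    and l: "\<And>x. x \<in> topspace K \<Longrightarrow> \<exists>N. openin K N \<and> x \<in> N \<and> sec G (subtopology K N) g a m"
  shows "sec G K g a m"
proof (rule secI_local[OF g])
  fix x assume x: "x \<in> topspace K"
  obtain N where N: "openin K N" "x \<in> N" "sec G (subtopology K N) g a m" using l[OF x] by blast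
  have xN: "x \<in> topspace (subtopology K N)" using x N by simp
  show "m x \<in> Hom a (lead G (g x))" using secD(2)[OF N(3) xN] .
  fix e :: real assume "e > 0"
  then show "\<exists>N. openin K N \<and> x \<in> N \<and> (\<forall>y\<in>N. ldist G (g x) (m x) (g y) (m y) < e)"
    using secD(3)[OF N(3) xN \<open>e > 0\<close>] xN ldist_self[of "g x" "m x"] openin_trans_full[OF _ N(1)]
    by (intro exI[of _ "{y \<in> topspace (subtopology K N). ldist G (g x) (m x) (g y) (m y) < e}"]) auto
qed

text \<open>At a point outside one of the two closed sets its complement is a neighbourhood on which
  that set imposes nothing, so a neighbourhood exists for each set separately and the two are
  intersected.\<close>

lemma sec_glue_closed:
  assumes g: "continuous_map K B g" and S: "closedin K S" "closedin K T" "S \<union> T = topspace K"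
    and s: "sec G (subtopology K S) g a m" "sec G (subtopology K T) g a m"
  shows "sec G K g a m"
proof (rule secI_local[OF g])
  have key: "\<exists>A. openin K A \<and> x \<in> A \<and> (\<forall>y\<in>A \<inter> S. ldist G (g x) (m x) (g y) (m y) < e)"
    if S: "closedin K S" and s: "sec G (subtopology K S) g a m" and x: "x \<in> topspace K" and e: "e > 0" for S x and e :: real
  proof (cases "x \<in> S")
    case True
    then have xS: "x \<in> topspace (subtopology K S)" using x by simp
    from secD(3)[OF s xS e, unfolded openin_subtopology]
    obtain A where A: "openin K A \<and> {y \<in> topspace (subtopology K S). ldist G (g x) (m x) (g y) (m y) < e} = A \<inter> S" ..
    then have eq: "\<And>y. y \<in> A \<inter> S \<longleftrightarrow> y \<in> topspace (subtopology K S) \<and> ldist G (g x) (m x) (g y) (m y) < e" by blast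
    have "x \<in> A" using eq[of x] xS e ldist_self[of "g x" "m x"] by simp
    then show ?thesis using A eq by (intro exI[of _ A]) simp
  next
    case False
    show ?thesis by (rule exI[of _ "topspace K - S"]) (use False x S in auto)
  qed
  fix x assume x: "x \<in> topspace K"
  then consider "x \<in> topspace (subtopology K S)" | "x \<in> topspace (subtopology K T)" using S(3) by auto
  then show "m x \<in> Hom a (lead G (g x))" using secD(2)[OF s(1)] secD(2)[OF s(2)] by cases auto
  fix e :: real assume e: "e > 0"
  obtain A A' where A: "openin K A" "x \<in> A" "\<forall>y\<in>A \<inter> S. ldist G (g x) (m x) (g y) (m y) < e"
    and A': "openin K A'" "x \<in> A'" "\<forall>y\<in>A' \<inter> T. ldist G (g x) (m x) (g y) (m y) < e"
    using key[OF S(1) s(1) x e] key[OF S(2) s(2) x e] by blast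
  have "\<forall>y\<in>A \<inter> A'. ldist G (g x) (m x) (g y) (m y) < e" using A A' S(3) openin_subset[OF A(1)] by blast
  then show "\<exists>N. openin K N \<and> x \<in> N \<and> (\<forall>y\<in>N. ldist G (g x) (m x) (g y) (m y) < e)"
    using A(1,2) A'(1,2) by (intro exI[of _ "A \<inter> A'"]) auto
qed

end

section \<open>Lifting over cylinders, contractible spaces and spheres\<close>

lemma connected_I01: "connected_space I01"
  by (intro contractible_imp_connected_space) (simp add: convex_imp_contractible)

text \<open>The two closed hemispheres are contractible, and for \<open>k\<close> at least 1 they
  share a point of the equator.\<close>

lemma connected_nsphere:
  assumes "k \<ge> 1"
  shows "connected_space (nsphere k)"
proof -
  have 1: "connectedin (nsphere k) (topspace (nsphere k) \<inter> {x. x k \<ge> 0})"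
    using contractible_imp_connected_space[OF contractible_space_upper_hemisphere[of k k]]
    by (subst connectedin_def) (simp add: subtopology_restrict)
  have 2: "connectedin (nsphere k) (topspace (nsphere k) \<inter> {x. x k \<le> 0})"
    using contractible_imp_connected_space[OF contractible_space_lower_hemisphere[of k k]]
    by (subst connectedin_def) (simp add: subtopology_restrict)
  have "(\<lambda>n. if n = 0 then 1 else 0) \<in> (topspace (nsphere k) \<inter> {x. x k \<ge> 0}) \<inter> (topspace (nsphere k) \<inter> {x. x k \<le> 0})"
    using in_topspace_nsphere[of k] assms by auto
  then have "connectedin (nsphere k) ((topspace (nsphere k) \<inter> {x. x k \<ge> 0}) \<union> (topspace (nsphere k) \<inter> {x. x k \<le> 0}))"
    by (intro connectedin_Un 1 2) blast
  moreover have "(topspace (nsphere k) \<inter> {x. x k \<ge> 0}) \<union> (topspace (nsphere k) \<inter> {x. x k \<le> 0}) = topspace (nsphere k)"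
    by auto
  ultimately show ?thesis by (simp add: connectedin_topspace)
qed

context cgroupoid
begin

lemma sec_mono:
  assumes "sec G (subtopology K S) g a m" "S' \<subseteq> S"
  shows "sec G (subtopology K S') g a m"
proof -
  have "subtopology (subtopology K S) S' = subtopology K S'"
    using assms(2) by (simp add: subtopology_subtopology inf_absorb2)
  then show ?thesis using sec_sub[OF assms(1), of S'] by simp
qed

lemma slice_continuous:
  assumes "openin K N" "t \<in> {0..1}" "t \<in> J"
  shows "continuous_map (subtopology K N) (subtopology (prod_topology K I01) (N \<times> J)) (\<lambda>x. (x, t))"
  using assms
  by (auto simp: continuous_map_in_subtopology continuous_map_pairwise o_def
     intro: continuous_map_from_subtopology)

text \<open>Agreement of sections is an open condition on the slice at height \<open>t\<close>. This
  provides the smaller neighbourhood on which two tubes can be joined at that height.\<close>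

lemma sec_slices_agree:
  assumes N: "openin K N" "y \<in> N" and t: "t \<in> {0..1}" "t \<in> J" "t \<in> J'"
    and s1: "sec G (subtopology (prod_topology K I01) (N \<times> J)) g a M"
    and s2: "sec G (subtopology (prod_topology K I01) (N \<times> J')) g a M'"
    and e: "M (y,t) = M' (y,t)"
  shows "\<exists>N'\<subseteq>N. openin K N' \<and> y \<in> N' \<and> (\<forall>x\<in>N'. M (x,t) = M' (x,t))"
proof -
  have s: "sec G (subtopology K N) (\<lambda>x. g (x,t)) a (\<lambda>x. M (x,t))" "sec G (subtopology K N) (\<lambda>x. g (x,t)) a (\<lambda>x. M' (x,t))"
    using sec_pull[OF s1 slice_continuous[OF N(1) t(1,2)]] sec_pull[OF s2 slice_continuous[OF N(1) t(1,3)]] by auto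
  have "openin K {x \<in> topspace (subtopology K N). M (x,t) = M' (x,t)}"
    by (rule openin_trans_full[OF sec_agree_open(1)[OF s] N(1)])
  then show ?thesis
    using N e openin_subset[OF N(1)] by (intro exI[of _ "{x \<in> topspace (subtopology K N). M (x,t) = M' (x,t)}"]) auto
qed

text \<open>Precomposition with a fixed arrow turns a section into a section. So the value at one
  point may be prescribed, and the base object of a section is never an obstruction.\<close>

lemma sec_rebase:
  assumes s: "sec G K g a M" and x: "x \<in> topspace K" and n: "n \<in> Hom b (lead G (g x))"
  shows "\<exists>M'. sec G K g b M' \<and> M' x = n"
proof -
  note h = secD(2)[OF s x]
  have k: "ginv (M x) \<bullet>\<bullet> n \<in> Hom b a" using comp_hom[OF n inv_props(1)[OF h]] .
  show ?thesis by (rule exI[of _ "\<lambda>z. M z \<bullet>\<bullet> (ginv (M x) \<bullet>\<bullet> n)"]) (use sec_translate[OF s k] inv_comp_cancel[OF h n] in simp)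
qed

text \<open>Compactness of the interval enters through \<open>Bolzano\<close>. Sections over
  \<open>N1\<close> times [c,b] and \<open>N2\<close> times [b,d] are made to agree at
  \<open>(y,b)\<close> by rebasing, then on a whole slice after shrinking the neighbourhood, and are
  glued along that slice.\<close>

lemma sec_tube:
  assumes g: "continuous_map (prod_topology K I01) B g" and y: "y \<in> topspace K"
  shows "\<exists>N a M. openin K N \<and> y \<in> N \<and> sec G (subtopology (prod_topology K I01) (N \<times> {0..1})) g a M"
proof -
  let ?KI = "prod_topology K I01"
  define P where "P c d \<longleftrightarrow> (0 \<le> c \<and> d \<le> 1 \<longrightarrow>
     (\<exists>N a M. openin K N \<and> y \<in> N \<and> sec G (subtopology ?KI (N \<times> {c..d})) g a M))" for c d :: real
  have "P 0 1"
  proof (rule Bolzano)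
    show "(0::real) \<le> 1" by simp
  next
    fix c b d assume P: "P c b" "P b d" and le: "c \<le> b" "b \<le> d"
    show "P c d" unfolding P_def
    proof
      assume cd: "0 \<le> c \<and> d \<le> 1"
      obtain N1 a1 M1 where 1: "openin K N1" "y \<in> N1" "sec G (subtopology ?KI (N1 \<times> {c..b})) g a1 M1"
        using P(1) cd le unfolding P_def by auto
      obtain N2 a2 M2 where 2: "openin K N2" "y \<in> N2" "sec G (subtopology ?KI (N2 \<times> {b..d})) g a2 M2"
        using P(2) cd le unfolding P_def by auto
      have b: "b \<in> {0..1}" using cd le by auto
      have z1: "(y,b) \<in> topspace (subtopology ?KI (N1 \<times> {c..b}))" and z2: "(y,b) \<in> topspace (subtopology ?KI (N2 \<times> {b..d}))"
        using y 1(2) 2(2) b le by auto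
      obtain M2' where M2': "sec G (subtopology ?KI (N2 \<times> {b..d})) g a1 M2'" "M2' (y,b) = M1 (y,b)"
        using sec_rebase[OF 2(3) z2 secD(2)[OF 1(3) z1]] by blast
      define N where "N = N1 \<inter> N2"
      have N: "openin K N" "y \<in> N" using 1 2 by (auto simp: N_def)
      have s1: "sec G (subtopology ?KI (N \<times> {c..b})) g a1 M1" by (rule sec_mono[OF 1(3)]) (auto simp: N_def)
      have s2: "sec G (subtopology ?KI (N \<times> {b..d})) g a1 M2'" by (rule sec_mono[OF M2'(1)]) (auto simp: N_def)
      obtain N3 where N3: "N3 \<subseteq> N" "openin K N3" "y \<in> N3" "\<And>x. x \<in> N3 \<Longrightarrow> M1 (x,b) = M2' (x,b)"
        using sec_slices_agree[OF N b _ _ s1 s2 M2'(2)[symmetric]] le by auto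
      define M where "M z = (if snd z \<le> b then M1 z else M2' z)" for z
      let ?T = "subtopology ?KI (N3 \<times> {c..d})"
      have "N3 \<times> {c..d} \<subseteq> topspace ?KI" using openin_subset[OF N3(2)] cd by (simp add: Times_subset_cancel2 Sigma_mono)
      then have tT: "topspace ?T = N3 \<times> {c..d}" by (simp only: topspace_subtopology inf_absorb2)
      have cbd: "{c..b} \<union> {b..d} = {c..d}" using le by (rule ivl_disj_un_two_touch(4))
      have cl: "closedin ?T (N3 \<times> {c..b})" "closedin ?T (N3 \<times> {b..d})"
      proof -
        have s: "continuous_map ?T euclideanreal snd"
          by (intro continuous_map_from_subtopology continuous_map_into_fulltopology[OF continuous_map_snd])
        have "N3 \<times> {c..b} = {z \<in> topspace ?T. snd z \<in> {..b}}" unfolding tT using le by auto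
        then show "closedin ?T (N3 \<times> {c..b})" using closedin_continuous_map_preimage[OF s, of "{..b}"] by simp
        have "N3 \<times> {b..d} = {z \<in> topspace ?T. snd z \<in> {b..}}" unfolding tT using le by auto
        then show "closedin ?T (N3 \<times> {b..d})" using closedin_continuous_map_preimage[OF s, of "{b..}"] by simp
      qed
      have "sec G ?T g a1 M"
      proof (rule sec_glue_closed[OF _ cl])
        show "continuous_map ?T B g" using g by (rule continuous_map_from_subtopology)
        show "N3 \<times> {c..b} \<union> N3 \<times> {b..d} = topspace ?T" by (simp only: tT cbd Sigma_Un_distrib2[symmetric])
        have i: "N3 \<times> {c..d} \<inter> N3 \<times> {c..b} = N3 \<times> {c..b}" "N3 \<times> {c..d} \<inter> N3 \<times> {b..d} = N3 \<times> {b..d}"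
          using le by (simp_all add: Times_Int_Times min_def max_def)
        have "sec G (subtopology ?KI (N3 \<times> {c..b})) g a1 M1" by (rule sec_mono[OF s1]) (use N3 in auto)
        then show "sec G (subtopology ?T (N3 \<times> {c..b})) g a1 M"
          unfolding subtopology_subtopology i by (rule sec_cong) (auto simp: M_def)
        have "sec G (subtopology ?KI (N3 \<times> {b..d})) g a1 M2'" by (rule sec_mono[OF s2]) (use N3 in auto)
        then show "sec G (subtopology ?T (N3 \<times> {b..d})) g a1 M"
          unfolding subtopology_subtopology i
          by (rule sec_cong) (use N3(4) in \<open>auto simp: M_def dest!: antisym\<close>)
      qed
      then show "\<exists>N a M. openin K N \<and> y \<in> N \<and> sec G (subtopology ?KI (N \<times> {c..d})) g a M" using N3 by blast
    qed
  next
    fix t :: real assume t: "0 \<le> t" "t \<le> 1"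
    have z: "(y,t) \<in> topspace ?KI" using y t by simp
    have gz: "g (y,t) \<in> topspace B" using g z continuous_map_funspace by blast
    have n: "cid G (lead G (g (y,t))) \<in> Hom (lead G (g (y,t))) (lead G (g (y,t)))"
      by (rule id_hom[OF lead_ob[OF gz]])
    note L = sec_local[OF g z n]
    obtain W M where W: "openin ?KI W" "(y,t) \<in> W" "sec G (subtopology ?KI W) g (lead G (g (y,t))) M"
    proof (rule L)
      fix N m assume A: "openin ?KI N" "(y,t) \<in> N" "sec G (subtopology ?KI N) g (lead G (g (y,t))) m"
      show thesis by (rule that[of N m, OF A])
    qed
    have "\<exists>U V. openin K U \<and> openin I01 V \<and> y \<in> U \<and> t \<in> V \<and> U \<times> V \<subseteq> W"
      using W(1)[unfolded openin_prod_topology_alt, THEN spec, THEN spec, THEN mp, OF W(2)] .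
    then obtain U V where UV: "openin K U" "openin I01 V" "y \<in> U" "t \<in> V" "U \<times> V \<subseteq> W" by (elim exE conjE)
    have "\<exists>d>0. \<forall>r\<in>{0..1}. dist r t < d \<longrightarrow> r \<in> V"
      using UV(2)[unfolded openin_euclidean_subtopology_iff, THEN conjunct2, THEN bspec, OF UV(4)] .
    then obtain d where d: "d > 0" "\<And>r. r \<in> {0..1} \<Longrightarrow> dist r t < d \<Longrightarrow> r \<in> V" by blast
    show "\<exists>d>0. \<forall>a b. a \<le> t \<and> t \<le> b \<and> b - a < d \<longrightarrow> P a b"
    proof (intro exI[of _ d] conjI allI impI d)
      fix a b assume ab: "a \<le> t \<and> t \<le> b \<and> b - a < d"
      show "P a b" unfolding P_def
      proof
        assume b: "0 \<le> a \<and> b \<le> 1"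
        have "{a..b} \<subseteq> V" using ab b d(2) by (auto simp: dist_real_def)
        then have "sec G (subtopology ?KI (U \<times> {a..b})) g (lead G (g (y,t))) M"
          by (intro sec_mono[OF W(3)]) (use UV(5) in blast)
        then show "\<exists>N a' M. openin K N \<and> y \<in> N \<and> sec G (subtopology ?KI (N \<times> {a..b})) g a' M" using UV by blast
      qed
    qed
  qed
  then show ?thesis unfolding P_def by simp
qed

text \<open>Homotopy lifting. Tubes over neighbourhoods of the points of \<open>K\<close> are
  rebased so that they start with \<open>m0\<close>. Over a common point they agree at time 0, hence
  along the whole connected segment, so they glue.\<close>

lemma sec_homotopy:
  assumes g: "continuous_map (prod_topology K I01) B g" and s0: "sec G K (\<lambda>x. g (x,0)) a m0"
  shows "\<exists>M. sec G (prod_topology K I01) g a M \<and> (\<forall>x\<in>topspace K. M (x,0) = m0 x)"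
proof -
  let ?KI = "prod_topology K I01"
  have ex: "\<exists>N M. openin K N \<and> y \<in> N \<and> sec G (subtopology ?KI (N \<times> {0..1})) g a M \<and> (\<forall>x\<in>N. M (x,0) = m0 x)"
    if y: "y \<in> topspace K" for y
  proof -
    obtain N a' M where N: "openin K N" "y \<in> N" "sec G (subtopology ?KI (N \<times> {0..1})) g a' M"
      using sec_tube[OF g y] by blast
    have z: "(y,0) \<in> topspace (subtopology ?KI (N \<times> {0..1}))" using y N by simp
    obtain M' where M': "sec G (subtopology ?KI (N \<times> {0..1})) g a M'" "M' (y,0) = m0 y"
      using sec_rebase[OF N(3) z, of "m0 y" a] secD(2)[OF s0 y] by blast
    have "continuous_map (subtopology ?KI (N \<times> {0})) K fst"
      by (intro continuous_map_from_subtopology continuous_map_fst)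
    from sec_pull[OF s0 this] have s1: "sec G (subtopology ?KI (N \<times> {0})) g a (\<lambda>z. m0 (fst z))"
      by (rule sec_cong) auto
    obtain N' where "N' \<subseteq> N" "openin K N'" "y \<in> N'" "\<forall>x\<in>N'. M' (x,0) = m0 (fst (x,0::real))"
      using sec_slices_agree[OF N(1,2) _ _ _ M'(1) s1, of 0] M'(2) by auto
    moreover have "sec G (subtopology ?KI (N' \<times> {0..1})) g a M'"
      by (rule sec_mono[OF M'(1)]) (use calculation in auto)
    ultimately show ?thesis by auto
  qed
  then obtain NN MM where NM: "\<And>y. y \<in> topspace K \<Longrightarrow> openin K (NN y)" "\<And>y. y \<in> topspace K \<Longrightarrow> y \<in> NN y"
    "\<And>y. y \<in> topspace K \<Longrightarrow> sec G (subtopology ?KI (NN y \<times> {0..1})) g a (MM y)"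
    "\<And>y x. y \<in> topspace K \<Longrightarrow> x \<in> NN y \<Longrightarrow> MM y (x,0) = m0 x"
    by metis
  define M where "M z = MM (fst z) z" for z
  have eq: "MM x (x,t) = MM y (x,t)" if y: "y \<in> topspace K" and x: "x \<in> NN y" and t: "t \<in> {0..1}" for x y t
  proof -
    have xK: "x \<in> topspace K" using x NM(1)[OF y] openin_subset by blast
    have c: "continuous_map I01 (subtopology ?KI (NN w \<times> {0..1})) (\<lambda>t. (x,t))" if "x \<in> NN w" for w
      using that xK by (auto simp: continuous_map_in_subtopology continuous_map_pairwise o_def)
    note s1 = sec_pull[OF NM(3)[OF xK] c[OF NM(2)[OF xK]]] and s2 = sec_pull[OF NM(3)[OF y] c[OF x]]
    show ?thesis
      by (rule sec_unique[OF s1 s2 connected_I01, of 0 t]) (use NM(4)[OF xK NM(2)[OF xK]] NM(4)[OF y x] t in simp_all)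
  qed
  have "sec G ?KI g a M"
  proof (rule sec_glue_open[OF g])
    fix z assume z: "z \<in> topspace ?KI"
    let ?N = "NN (fst z) \<times> {0..1::real}"
    have f: "fst z \<in> topspace K" using z by auto
    have "openin ?KI ?N" using NM(1)[OF f] by (simp add: openin_prod_Times_iff)
    moreover have "z \<in> ?N" using z NM(2)[OF f] by (auto simp: mem_Times_iff)
    moreover have "sec G (subtopology ?KI ?N) g a M"
      by (rule sec_cong[OF NM(3)[OF f]]) (use eq[OF f] in \<open>auto simp: M_def\<close>)
    ultimately show "\<exists>N. openin ?KI N \<and> z \<in> N \<and> sec G (subtopology ?KI N) g a M" by blast
  qed
  moreover have "\<forall>x\<in>topspace K. M (x,0) = m0 x" using NM(4) NM(2) by (simp add: M_def)
  ultimately show ?thesis by blast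
qed

text \<open>The contraction is run backwards: at time 0 the map is constant and an identity arrow is
  a section over it, and lifting to time 1 gives a section over \<open>g\<close>. Rebasing adjusts
  its value at \<open>x\<close>.\<close>

lemma sec_contractible:
  assumes K: "contractible_space K" and g: "continuous_map K B g" and x: "x \<in> topspace K"
    and n: "n \<in> Hom a (lead G (g x))"
  shows "\<exists>m. sec G K g a m \<and> m x = n"
proof -
  obtain c h where h: "continuous_map (prod_topology I01 K) K h" "\<And>y. h (0,y) = y" "\<And>y. h (1,y) = c"
    using K unfolding contractible_space_def homotopic_with_def by auto
  have "(1::real,x) \<in> topspace (prod_topology I01 K)" using x by simp
  then have c: "c \<in> topspace K" using h(1,3) continuous_map_funspace by (metis Pi_iff)
  have f: "continuous_map (prod_topology K I01) (prod_topology I01 K) (\<lambda>z. (1 - snd z, fst z))"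
  proof -
    have "continuous_map (prod_topology K I01) euclideanreal (\<lambda>z. 1 - snd z)"
      by (intro continuous_intros continuous_map_into_fulltopology[OF continuous_map_snd])
    then show ?thesis by (auto simp: continuous_map_pairwise o_def continuous_map_in_subtopology continuous_map_fst)
  qed
  have g': "continuous_map (prod_topology K I01) B (\<lambda>z. g (h (1 - snd z, fst z)))"
    using continuous_map_compose[OF continuous_map_compose[OF f h(1)] g] by (simp add: o_def)
  have gc: "g c \<in> topspace B" using c g continuous_map_funspace by blast
  have "sec G K (\<lambda>y. (\<lambda>z. g (h (1 - snd z, fst z))) (y,0)) (lead G (g c)) (\<lambda>_. cid G (lead G (g c)))"
    using sec_const[OF gc id_hom[OF lead_ob[OF gc]], of K] by (simp add: h)
  from sec_homotopy[OF g' this] obtain M where M: "sec G (prod_topology K I01) (\<lambda>z. g (h (1 - snd z, fst z))) (lead G (g c)) M"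
    by blast
  have "continuous_map K (prod_topology K I01) (\<lambda>y. (y,1))" by (simp add: continuous_map_pairwise o_def)
  from sec_pull[OF M this] have "sec G K g (lead G (g c)) (\<lambda>y. M (y,1))" by (simp add: h)
  from sec_rebase[OF this x n] show ?thesis .
qed

lemma sphere_base_in: "sphere_base \<in> topspace (nsphere k)"
  using in_topspace_nsphere by (simp add: sphere_base_def)

text \<open>Both hemispheres are contractible and carry sections with value \<open>n\<close> at the
  base point, which lies on the equator. The two sections agree on the equator because it is
  connected, and this is where \<open>k\<close> at least 2 enters.\<close>

lemma sec_sphere:
  assumes k: "k \<ge> 2" and g: "continuous_map (nsphere k) B g" and n: "n \<in> Hom a (lead G (g sphere_base))"
  shows "\<exists>m. sec G (nsphere k) g a m \<and> m sphere_base = n"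
proof -
  let ?S = "nsphere k"
  let ?U = "{x. x k \<ge> 0} \<inter> topspace ?S" and ?L = "{x. x k \<le> 0} \<inter> topspace ?S"
  have bk: "sphere_base k = 0" using k by (simp add: sphere_base_def)
  have b: "sphere_base \<in> topspace (subtopology ?S {x. x k \<ge> 0})" "sphere_base \<in> topspace (subtopology ?S {x. x k \<le> 0})"
    using sphere_base_in[of k] bk by auto
  obtain m1 where m1: "sec G (subtopology ?S {x. x k \<ge> 0}) g a m1" "m1 sphere_base = n"
    using sec_contractible[where g = g and x = sphere_base, OF contractible_space_upper_hemisphere[OF order_refl]
        continuous_map_from_subtopology[OF g] b(1) n] by blast
  obtain m2 where m2: "sec G (subtopology ?S {x. x k \<le> 0}) g a m2" "m2 sphere_base = n"
    using sec_contractible[where g = g and x = sphere_base, OF contractible_space_lower_hemisphere[OF order_refl]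
        continuous_map_from_subtopology[OF g] b(2) n] by blast
  have eq: "subtopology ?S {x. x k = 0} = nsphere (k - 1)"
    using subtopology_nsphere_equator[of "k - 1"] k by simp
  have con: "connected_space (subtopology ?S {x. x k = 0})" unfolding eq by (rule connected_nsphere) (use k in simp)
  have s: "sec G (subtopology ?S {x. x k = 0}) g a m1" "sec G (subtopology ?S {x. x k = 0}) g a m2"
    by (rule sec_mono[OF m1(1)], force) (rule sec_mono[OF m2(1)], force)
  have agree: "m1 x = m2 x" if "x \<in> topspace ?S" "x k = 0" for x
    by (rule sec_unique[OF s con, of sphere_base x]) (use that bk sphere_base_in[of k] m1 m2 in auto)
  define m where "m x = (if x k \<ge> 0 then m1 x else m2 x)" for x
  have p: "continuous_map ?S euclideanreal (\<lambda>x. x k)" by (rule continuous_map_nsphere_projection)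
  have "sec G ?S g a m"
  proof (rule sec_glue_closed[OF g])
    show "closedin ?S ?U" "closedin ?S ?L"
      using closedin_continuous_map_preimage[OF p, of "{0..}"] closedin_continuous_map_preimage[OF p, of "{..0}"]
      by (auto simp: Int_def conj_commute elim!: back_subst[of "closedin ?S"])
    show "?U \<union> ?L = topspace ?S" by auto
    have "sec G (subtopology ?S ?U) g a m1" by (rule sec_mono[OF m1(1)]) blast
    then show "sec G (subtopology ?S ?U) g a m" by (rule sec_cong) (simp_all add: m_def)
    have "sec G (subtopology ?S ?L) g a m2" by (rule sec_mono[OF m2(1)]) blast
    then show "sec G (subtopology ?S ?L) g a m"
    proof (rule sec_cong)
      fix x assume "x \<in> topspace (subtopology ?S ?L)"
      then have "x \<in> topspace ?S" "x k \<le> 0" by auto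
      then show "m2 x = m x" using agree[of x] by (cases "x k = 0") (simp_all add: m_def)
    qed simp
  qed
  then show ?thesis using m1(2) bk by (intro exI[of _ m]) (simp add: m_def)
qed

end

subsection \<open>Functors\<close>

definition fpt :: "('a \<Rightarrow> 'b) \<Rightarrow> ('m \<Rightarrow> 'n) \<Rightarrow> (nat \<times> ('a \<times> 'm list)) \<times> (nat \<Rightarrow> real) \<Rightarrow> (nat \<times> ('b \<times> 'n list)) \<times> (nat \<Rightarrow> real)" where
  "fpt Fo Fm x = ((fst (fst x), (Fo (fst (snd (fst x))), map Fm (snd (snd (fst x))))), snd x)"

locale cfunctor = X: cgroupoid X + Z: cgroupoid Z
  for X :: "('a,'m) catg" and Z :: "('b,'n) catg" +
  fixes Fo :: "'a \<Rightarrow> 'b" and Fm :: "'m \<Rightarrow> 'n"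
  assumes functor_ax: "is_functor X Z Fo Fm"
begin

abbreviation (input) BF where "BF \<equiv> classifying_map Z Fo Fm"

lemma F_ob: "x \<in> cob X \<Longrightarrow> Fo x \<in> cob Z"
  and F_hom: "m \<in> chom X x y \<Longrightarrow> Fm m \<in> chom Z (Fo x) (Fo y)"
  and F_id: "x \<in> cob X \<Longrightarrow> Fm (cid X x) = cid Z (Fo x)"
  and F_comp: "f \<in> chom X x y \<Longrightarrow> g \<in> chom X y z \<Longrightarrow> Fm (ccomp X g f) = ccomp Z (Fm g) (Fm f)"
  using functor_ax unfolding is_functor_def chom_def by auto

lemma F_nerve:
  assumes s: "s \<in> nerve X p"
  shows "(Fo (fst s), map Fm (snd s)) \<in> nerve Z p"
proof -
  have "\<forall>m\<in>cmor X. Fm m \<in> cmor Z \<and> cdom Z (Fm m) = Fo (cdom X m) \<and> ccod Z (Fm m) = Fo (ccod X m)"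
    using functor_ax unfolding is_functor_def by blast
  then show ?thesis using s F_ob by (auto simp: nerve_def subset_iff)
qed

lemma F_nvert:
  assumes s: "s \<in> nerve X p" and l: "l \<le> p"
  shows "nvert Z (Fo (fst s), map Fm (snd s)) l = Fo (nvert X s l)"
proof (cases l)
  case 0 then show ?thesis by (simp add: nvert_def)
next
  case (Suc k)
  then have "k < length (snd s)" "snd s ! k \<in> chom X (nvert X s k) (nvert X s (Suc k))"
    using X.nerve_arrow[OF s, of k] l s by (auto simp: nerve_def)
  then show ?thesis using Suc F_hom[of "snd s ! k"] by (auto simp: nvert_def[of Z] chom_def)
qed

lemma F_npath:
  assumes s: "s \<in> nerve X p" and ab: "a \<le> b" "b \<le> p"
  shows "npath Z (Fo (fst s), map Fm (snd s)) a b = Fm (npath X s a b)"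
  using ab
proof (induction b rule: dec_induct)
  case base
  then show ?case using F_nvert[OF s, of a] F_id[OF X.nvert_ob[OF s, of a]] by (simp add: X.npath_refl Z.npath_refl)
next
  case (step b)
  have "length (snd s) = p" using s by (auto simp: nerve_def)
  then show ?case
    using step F_comp[OF X.npath_hom[OF s, of a b] X.nerve_arrow[OF s, of b]]
    by (simp del: npath.simps add: X.npath_Suc Z.npath_Suc)
qed

lemma fpt_in: "x \<in> topspace (real_sum X) \<Longrightarrow> fpt Fo Fm x \<in> topspace (real_sum Z)"
  using F_nerve by (auto simp: topspace_real_sum fpt_def)

lemma fpt_step:
  assumes x: "x \<in> topspace (real_sum X)"
  shows "leadr Z (fpt Fo Fm x) = Fo (leadr X x)" "r \<in> {0..<1} \<Longrightarrow> stepr Z (fpt Fo Fm x) r = Fm (stepr X x r)"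
proof -
  obtain p s t where xx: "x = ((p,s),t)" by (metis prod.collapse)
  then have s: "s \<in> nerve X p" and t: "t \<in> standard_simplex p" using x by (simp_all add: topspace_real_sum)
  show "leadr Z (fpt Fo Fm x) = Fo (leadr X x)"
    using F_nvert[OF s] X.idx0[OF t, of 0] by (simp add: leadr_def fpt_def xx)
  show "stepr Z (fpt Fo Fm x) r = Fm (stepr X x r)" if "r \<in> {0..<1}"
    using F_npath[OF s] X.idx0[OF t that] by (simp add: stepr_def fpt_def xx)
qed

lemma BF_rep: "BF c = cls Z (fpt Fo Fm (rep c))"
  by (simp add: classifying_map_def cls_def fpt_def rep_def Let_def)

lemma BF_in: "c \<in> topspace X.B \<Longrightarrow> BF c \<in> topspace Z.B"
  unfolding BF_rep by (intro Z.cls_in fpt_in X.rep_props(1))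

lemma lead_BF: "c \<in> topspace X.B \<Longrightarrow> lead Z (BF c) = Fo (lead X c)"
  unfolding BF_rep using Z.lead_cls[OF fpt_in[OF X.rep_props(1)]] fpt_step(1)[OF X.rep_props(1)]
  by (simp add: lead_def[of X])

lemma step_BF: "c \<in> topspace X.B \<Longrightarrow> r \<in> {0..<1} \<Longrightarrow> step Z (BF c) r = Fm (step X c r)"
  unfolding BF_rep using Z.step_cls[OF fpt_in[OF X.rep_props(1)]] fpt_step(2)[OF X.rep_props(1)]
  by (simp add: step_def[of X])

text \<open>Any two representatives of a class have the same step function, hence so have their
  images, and the step function determines the class.\<close>

lemma BF_cls:
  assumes x: "x \<in> topspace (real_sum X)"
  shows "BF (cls X x) = cls Z (fpt Fo Fm x)"
proof -
  let ?c = "cls X x"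
  have c: "?c \<in> topspace X.B" using X.cls_in[OF x] .
  have r: "rep ?c \<in> topspace (real_sum X)" using X.rep_props(1)[OF c] .
  have "(fpt Fo Fm (rep ?c), fpt Fo Fm x) \<in> real_eq Z"
  proof (rule Z.real_eq_stepI[OF fpt_in[OF r] fpt_in[OF x]])
    show "leadr Z (fpt Fo Fm (rep ?c)) = leadr Z (fpt Fo Fm x)"
      using fpt_step(1)[OF r] fpt_step(1)[OF x] X.lead_cls[OF x] by (simp add: lead_def)
    show "stepr Z (fpt Fo Fm (rep ?c)) r = stepr Z (fpt Fo Fm x) r" if "r \<in> {0..<1}" for r
      using fpt_step(2)[OF X.rep_props(1)[OF c] that] fpt_step(2)[OF x that] X.step_cls[OF x that] by (simp add: step_def)
  qed
  then show ?thesis unfolding BF_rep using cls_eq_iff[of Z "fpt Fo Fm (rep ?c)" "fpt Fo Fm x"] by simp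
qed

lemma fpt_continuous: "continuous_map (real_sum X) (real_sum Z) (fpt Fo Fm)"
  unfolding continuous_map_def
proof (intro conjI allI impI)
  show "fpt Fo Fm \<in> topspace (real_sum X) \<rightarrow> topspace (real_sum Z)" using fpt_in by blast
  fix U assume U: "openin (real_sum Z) U"
  show "openin (real_sum X) {x \<in> topspace (real_sum X). fpt Fo Fm x \<in> U}"
    unfolding real_sum_def openin_sum_topology
  proof (intro conjI ballI)
    fix i assume i: "i \<in> {(p, s). s \<in> nerve X p}"
    obtain p s where ps: "i = (p,s)" by (cases i)
    then have s: "s \<in> nerve X p" using i by simp
    have "openin (subtopology (powertop_real UNIV) (standard_simplex p)) {t. ((p, (Fo (fst s), map Fm (snd s))), t) \<in> U}"
      using U F_nerve[OF s] unfolding real_sum_def openin_sum_topology by fastforce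
    moreover have "{t. ((p, (Fo (fst s), map Fm (snd s))), t) \<in> U} =
      {t. (i, t) \<in> {x \<in> topspace (sum_topology (\<lambda>(p, s). subtopology (powertop_real UNIV) (standard_simplex p)) {(p, s). s \<in> nerve X p}). fpt Fo Fm x \<in> U}}"
      using s openin_subset[OF U] by (auto simp: ps fpt_def topspace_real_sum)
    ultimately show "openin (case i of (p, s) \<Rightarrow> subtopology (powertop_real UNIV) (standard_simplex p))
       {t. (i, t) \<in> {x \<in> topspace (sum_topology (\<lambda>(p, s). subtopology (powertop_real UNIV) (standard_simplex p)) {(p, s). s \<in> nerve X p}). fpt Fo Fm x \<in> U}}"
      by (simp add: ps)
  qed auto
qed

lemma BF_continuous: "continuous_map X.B Z.B BF"
proof -
  have "continuous_map (real_sum X) Z.B (cls Z \<circ> fpt Fo Fm)"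
    by (intro continuous_map_compose[OF fpt_continuous] quotient_imp_continuous_map quotient_map_cls)
  then have "continuous_map (real_sum X) Z.B (BF \<circ> cls X)"
    by (rule continuous_map_eq) (simp add: BF_cls)
  then show ?thesis by (simp add: continuous_compose_quotient_map_eq[OF quotient_map_cls])
qed

text \<open>A functor can only enlarge the set on which two step functions agree, so it does not
  increase distances.\<close>

lemma sec_BF:
  assumes s: "sec X K g a m"
  shows "sec Z K (\<lambda>x. BF (g x)) (Fo a) (\<lambda>x. Fm (m x))"
proof (rule Z.secI_local)
  show "continuous_map K Z.B (\<lambda>x. BF (g x))" using continuous_map_compose[OF X.secD(1)[OF s] BF_continuous] by (simp add: o_def)
  fix x assume x: "x \<in> topspace K"
  show "Fm (m x) \<in> chom Z (Fo a) (lead Z (BF (g x)))" using F_hom[OF X.secD(2)[OF s x]] lead_BF[OF X.secD(4)[OF s x]] by simp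
  fix e :: real assume e: "e > 0"
  let ?N = "{y \<in> topspace K. ldist X (g x) (m x) (g y) (m y) < e}"
  have "ldist Z (BF (g x)) (Fm (m x)) (BF (g y)) (Fm (m y)) < e" if "y \<in> ?N" for y
  proof -
    have y: "y \<in> topspace K" using that by blast
    have st: "ccomp Z (step Z (BF (g w)) r) (Fm (m w)) = Fm (ccomp X (step X (g w) r) (m w))" if r: "r \<in> {0..<1}" and w: "w \<in> topspace K" for r w
    proof -
      obtain z where "step X (g w) r \<in> chom X (lead X (g w)) z" using X.step_hom[OF X.secD(4)[OF s w] r] by blast
      then show ?thesis using F_comp[OF X.secD(2)[OF s w]] step_BF[OF X.secD(4)[OF s w] r] by simp
    qed
    have "ldist Z (BF (g x)) (Fm (m x)) (BF (g y)) (Fm (m y)) \<le> ldist X (g x) (m x) (g y) (m y)"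
      unfolding ldist_def
      by (rule U01.finite_measure_mono[OF _ X.ldist_sets[OF X.secD(4)[OF s x] X.secD(4)[OF s y]]])
        (use st[OF _ x] st[OF _ y] in auto)
    then show ?thesis using that by simp
  qed
  then show "\<exists>N. openin K N \<and> x \<in> N \<and> (\<forall>y\<in>N. ldist Z (BF (g x)) (Fm (m x)) (BF (g y)) (Fm (m y)) < e)"
    using X.secD(3)[OF s x e] x e X.ldist_self[of "g x" "m x"] by (intro exI[of _ ?N]) auto
qed

end

lemma continuous_map_local:
  assumes "\<And>x. x \<in> topspace X \<Longrightarrow> \<exists>N. openin X N \<and> x \<in> N \<and> continuous_map (subtopology X N) Y f"
  shows "continuous_map X Y f"
  unfolding continuous_map_def
proof (intro conjI allI impI)
  show "f \<in> topspace X \<rightarrow> topspace Y"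
  proof
    fix x assume x: "x \<in> topspace X"
    obtain N where N: "openin X N" "x \<in> N" "continuous_map (subtopology X N) Y f" using assms[OF x] by blast
    then have "x \<in> topspace (subtopology X N)" using x by simp
    then show "f x \<in> topspace Y" using continuous_map_funspace[OF N(3)] by blast
  qed
  fix U assume U: "openin Y U"
  show "openin X {x \<in> topspace X. f x \<in> U}"
  proof (subst openin_subopen, intro ballI)
    fix x assume "x \<in> {x \<in> topspace X. f x \<in> U}"
    then have x: "x \<in> topspace X" "f x \<in> U" by auto
    obtain N where N: "openin X N" "x \<in> N" "continuous_map (subtopology X N) Y f" using assms[OF x(1)] by blast
    have "openin X {y \<in> topspace (subtopology X N). f y \<in> U}"
      by (rule openin_trans_full[OF openin_continuous_map_preimage[OF N(3) U] N(1)])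
    then show "\<exists>T. openin X T \<and> x \<in> T \<and> T \<subseteq> {x \<in> topspace X. f x \<in> U}"
      using x N(2) by (intro exI[of _ "{y \<in> topspace (subtopology X N). f y \<in> U}"]) auto
  qed
qed

section \<open>Joins of simplices, and continuity of splicing\<close>

definition jsim :: "'a \<times> 'm list \<Rightarrow> 'm \<Rightarrow> 'a \<times> 'm list \<Rightarrow> 'a \<times> 'm list" where
  "jsim s0 k s = (fst s0, snd s0 @ k # snd s)"

text \<open>Weights on the join whose tiling of [0,1) follows \<open>t0\<close> before time
  \<open>c\<close> and \<open>t\<close> afterwards: the intervals of \<open>t0\<close> are cut down
  to [0,c), those of \<open>t\<close> to [c,1). The vertices of the second simplex are shifted by
  \<open>Suc p0\<close>.\<close>

definition jw :: "nat \<Rightarrow> (nat \<Rightarrow> real) \<Rightarrow> (nat \<Rightarrow> real) \<Rightarrow> real \<Rightarrow> nat \<Rightarrow> real" where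
  "jw p0 t0 t c l = (if l \<le> p0 then min (sum t0 {..l}) c - min (sum t0 {..<l}) c
     else max (sum t {..l - Suc p0}) c - max (sum t {..<l - Suc p0}) c)"

lemma simplex_full_sum:
  assumes "t \<in> standard_simplex p" "p \<le> l"
  shows "sum t {..l} = 1"
proof -
  have "sum t {..l} = sum t {..p}"
    by (rule sum.mono_neutral_right) (use assms in \<open>auto simp: standard_simplex_def\<close>)
  then show ?thesis using assms by (simp add: standard_simplex_def)
qed

lemma jw_sum1:
  assumes "c \<ge> 0" "l \<le> p0"
  shows "sum (jw p0 t0 t c) {..l} = min (sum t0 {..l}) c"
  using assms(2)
proof (induction l)
  case 0 then show ?case using assms(1) by (simp add: jw_def)
next
  case (Suc l) then show ?case by (simp add: jw_def lessThan_Suc_atMost)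
qed

text \<open>The whole first block contributes \<open>c\<close>, because the weights
  \<open>t0\<close> add up to 1 at \<open>p0\<close>; from there on the maxima telescope.\<close>

lemma jw_sum2:
  assumes "t0 \<in> standard_simplex p0" "0 \<le> c" "c \<le> 1"
  shows "sum (jw p0 t0 t c) {..Suc (p0 + l)} = max (sum t {..l}) c"
proof (induction l)
  case 0
  then show ?case using jw_sum1[of c p0 p0 t0 t] assms simplex_full_sum[OF assms(1), of p0] by (simp add: jw_def)
next
  case (Suc l) then show ?case by (simp add: jw_def lessThan_Suc_atMost)
qed

lemma jw_simplex:
  assumes t0: "t0 \<in> standard_simplex p0" and t: "t \<in> standard_simplex p" and c: "0 \<le> c" "c \<le> 1"
  shows "jw p0 t0 t c \<in> standard_simplex (Suc (p0 + p))"
  unfolding standard_simplex_def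
proof (intro CollectI conjI allI impI)
  fix l
  note b0 = partial_sum_bounds[OF t0, of l] and b = partial_sum_bounds[OF t, of "l - Suc p0"]
  show "0 \<le> jw p0 t0 t c l" using b0 b c by (auto simp: jw_def)
  show "jw p0 t0 t c l \<le> 1" using b0 b c by (auto simp: jw_def)
next
  fix l assume l: "Suc (p0 + p) < l"
  then have 1: "sum t {..l - Suc p0} = 1" by (intro simplex_full_sum[OF t]) simp
  have k: "l - Suc p0 = Suc (l - Suc (Suc p0))" "p \<le> l - Suc (Suc p0)" using l by simp_all
  have "sum t {..<l - Suc p0} = 1" using simplex_full_sum[OF t k(2)] k(1) by (simp add: lessThan_Suc_atMost)
  then show "jw p0 t0 t c l = 0" using l 1 by (simp add: jw_def)
next
  show "sum (jw p0 t0 t c) {..Suc (p0 + p)} = 1"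
    using jw_sum2[OF t0 c, of t p] simplex_full_sum[OF t, of p] c by simp
qed

lemma idx_jw:
  assumes t0: "t0 \<in> standard_simplex p0" and t: "t \<in> standard_simplex p" and c: "0 \<le> c" "c \<le> 1"
    and r: "r \<in> {0..<1}"
  shows "idx (jw p0 t0 t c) r = (if r < c then idx t0 r else Suc (p0 + idx t r))"
proof (cases "r < c")
  case True
  note b = idx_bounds[OF t0 r]
  have "idx (jw p0 t0 t c) r = idx t0 r"
  proof (rule idx_eqI[OF jw_simplex[OF t0 t c]])
    show "r < sum (jw p0 t0 t c) {..idx t0 r}" using jw_sum1[OF c(1) b(1)] b(2) True by simp
    show "sum (jw p0 t0 t c) {..<idx t0 r} \<le> r"
    proof (cases "idx t0 r")
      case (Suc k)
      then show ?thesis using jw_sum1[OF c(1), of k p0 t0 t] b by (simp add: lessThan_Suc_atMost)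
    qed (use r in simp)
  qed
  then show ?thesis using True by simp
next
  case False
  note b = idx_bounds[OF t r]
  have "idx (jw p0 t0 t c) r = Suc (p0 + idx t r)"
  proof (rule idx_eqI[OF jw_simplex[OF t0 t c]])
    show "r < sum (jw p0 t0 t c) {..Suc (p0 + idx t r)}" using jw_sum2[OF t0 c, of t "idx t r"] b(2) by simp
    show "sum (jw p0 t0 t c) {..<Suc (p0 + idx t r)} \<le> r"
    proof (cases "idx t r")
      case 0
      then show ?thesis using jw_sum1[OF c(1), of p0 p0 t0 t] False by (simp add: lessThan_Suc_atMost)
    next
      case (Suc k)
      then show ?thesis using jw_sum2[OF t0 c, of t k] b False by (simp add: lessThan_Suc_atMost)
    qed
  qed
  then show ?thesis using False by simp
qed

text \<open>Replacing a step function from time \<open>1 - \<rho>\<close> on, instead of coning off, keeps base points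
  fixed: splicing a point with itself along the identity is constant in \<open>\<rho>\<close>.\<close>
definition splice where
  "splice G p0 q m \<rho> = (THE w. w \<in> topspace (classifying_space G) \<and>
     (\<exists>n\<in>chom G (lead G p0) (lead G w). \<forall>r\<in>{0..<1}.
        ccomp G (step G w r) n = (if r < 1 - \<rho> then step G p0 r else ccomp G (step G q r) m)))"

context cgroupoid
begin

lemma jsim_arrow:
  assumes "s0 \<in> nerve G p0"
  shows "l < p0 \<Longrightarrow> snd (jsim s0 k s) ! l = snd s0 ! l" "snd (jsim s0 k s) ! p0 = k"
    "snd (jsim s0 k s) ! Suc (p0 + l) = snd s ! l"
  using assms by (auto simp: jsim_def nerve_def nth_append)

lemma jsim_nvert:
  assumes s0: "s0 \<in> nerve G p0" and s: "s \<in> nerve G p" and k: "k \<in> Hom (nvert G s0 p0) (nvert G s 0)"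
  shows "l \<le> p0 \<Longrightarrow> nvert G (jsim s0 k s) l = nvert G s0 l" "nvert G (jsim s0 k s) (Suc (p0 + l)) = nvert G s l"
proof -
  show "nvert G (jsim s0 k s) l = nvert G s0 l" if "l \<le> p0"
    using jsim_arrow(1)[OF s0, of "l - 1" k s] that by (cases l) (auto simp: nvert_def jsim_def)
  show "nvert G (jsim s0 k s) (Suc (p0 + l)) = nvert G s l"
    using jsim_arrow(3)[OF s0, of k s "l - 1"] jsim_arrow(2)[OF s0, of k s] k
    by (cases l) (auto simp: nvert_def chom_def)
qed

lemma jsim_nerve:
  assumes s0: "s0 \<in> nerve G p0" and s: "s \<in> nerve G p" and k: "k \<in> Hom (nvert G s0 p0) (nvert G s 0)"
  shows "jsim s0 k s \<in> nerve G (Suc (p0 + p))"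
proof -
  let ?j = "jsim s0 k s"
  have ar: "snd ?j ! l \<in> Hom (nvert G ?j l) (nvert G ?j (Suc l))" if lt: "l < Suc (p0 + p)" for l
  proof -
    consider "l < p0" | "l = p0" | i where "l = Suc (p0 + i)" "i < p"
    proof -
      assume a: "l < p0 \<Longrightarrow> thesis" "l = p0 \<Longrightarrow> thesis" "\<And>i. l = Suc (p0 + i) \<Longrightarrow> i < p \<Longrightarrow> thesis"
      show thesis
      proof (cases "l \<le> p0")
        case True then show thesis using a(1,2) by linarith
      next
        case False
        then have "l = Suc (p0 + (l - Suc p0))" by simp
        moreover have "l - Suc p0 < p" using False lt by simp
        ultimately show thesis by (rule a(3))
      qed
    qed
    then show ?thesis
    proof cases
      case 1 then show ?thesis using nerve_arrow[OF s0 1] jsim_arrow(1)[OF s0 1] jsim_nvert(1)[OF s0 s k] by simp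
    next
      case 2 then show ?thesis using k jsim_arrow(2)[OF s0] jsim_nvert(1)[OF s0 s k, of p0] jsim_nvert(2)[OF s0 s k, of 0] by simp
    next
      case 3 then show ?thesis using nerve_arrow[OF s 3(2)] jsim_arrow(3)[OF s0] jsim_nvert(2)[OF s0 s k, of i] jsim_nvert(2)[OF s0 s k, of "Suc i"] by simp
    qed
  qed
  have len: "length (snd ?j) = Suc (p0 + p)" using s0 s by (auto simp: jsim_def nerve_def)
  have "fst ?j \<in> cob G" using s0 by (auto simp: jsim_def nerve_def)
  moreover have "set (snd ?j) \<subseteq> cmor G" using ar len by (auto simp: in_set_conv_nth chom_def)
  moreover have "cdom G (snd ?j ! l) = (if l = 0 then fst ?j else ccod G (snd ?j ! (l - 1)))" if "l < Suc (p0 + p)" for l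
    using ar[OF that] by (simp add: chom_def nvert_def)
  ultimately show ?thesis using len unfolding nerve_def by (simp add: case_prod_unfold)
qed

lemma jsim_npath:
  assumes s0: "s0 \<in> nerve G p0" and s: "s \<in> nerve G p" and k: "k \<in> Hom (nvert G s0 p0) (nvert G s 0)"
  shows "l \<le> p0 \<Longrightarrow> npath G (jsim s0 k s) 0 l = npath G s0 0 l"
    "l \<le> p \<Longrightarrow> npath G (jsim s0 k s) 0 (Suc (p0 + l)) = npath G s 0 l \<bullet>\<bullet> (k \<bullet>\<bullet> npath G s0 0 p0)"
proof -
  show 1: "npath G (jsim s0 k s) 0 l = npath G s0 0 l" if "l \<le> p0" for l
    using that
  proof (induction l)
    case 0 then show ?case using jsim_nvert(1)[OF s0 s k, of 0] by simp
  next
    case (Suc l) then show ?case using jsim_arrow(1)[OF s0, of l k s] by simp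
  qed
  have h: "k \<bullet>\<bullet> npath G s0 0 p0 \<in> Hom (nvert G s0 0) (nvert G s 0)"
    using comp_hom[OF npath_hom[OF s0, of 0 p0] k] by simp
  show "npath G (jsim s0 k s) 0 (Suc (p0 + l)) = npath G s 0 l \<bullet>\<bullet> (k \<bullet>\<bullet> npath G s0 0 p0)" if "l \<le> p"
    using that
  proof (induction l)
    case 0
    then show ?case using id_left[OF h] 1[of p0] jsim_arrow(2)[OF s0, of k s] by simp
  next
    case (Suc l)
    have "npath G (jsim s0 k s) 0 (Suc (p0 + Suc l)) = snd s ! l \<bullet>\<bullet> npath G (jsim s0 k s) 0 (Suc (p0 + l))"
      using jsim_arrow(3)[OF s0, of k s l] by simp
    also have "\<dots> = snd s ! l \<bullet>\<bullet> (npath G s 0 l \<bullet>\<bullet> (k \<bullet>\<bullet> npath G s0 0 p0))" using Suc by simp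
    also have "\<dots> = (snd s ! l \<bullet>\<bullet> npath G s 0 l) \<bullet>\<bullet> (k \<bullet>\<bullet> npath G s0 0 p0)"
      using assoc[OF h npath_hom[OF s, of 0 l] nerve_arrow[OF s, of l]] Suc.prems by simp
    finally show ?case by simp
  qed
qed

text \<open>The join realises the spliced step function. The leading vertex of the join depends on
  \<open>c\<close>, so all values are compared from vertex 0 of the join.\<close>

lemma join_point:
  assumes s0: "s0 \<in> nerve G p0" and t0: "t0 \<in> standard_simplex p0" and s: "s \<in> nerve G p" and t: "t \<in> standard_simplex p"
    and k: "k \<in> Hom (nvert G s0 p0) (nvert G s 0)" and c: "0 \<le> c" "c \<le> 1"
  defines "y \<equiv> ((Suc (p0 + p), jsim s0 k s), jw p0 t0 t c)"
    and "m \<equiv> npath G s 0 (idx t 0) \<bullet>\<bullet> (k \<bullet>\<bullet> npath G s0 (idx t0 0) p0)"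
    and "q0 \<equiv> cls G ((p0,s0),t0)" and "q \<equiv> cls G ((p,s),t)"
  shows "y \<in> topspace (real_sum G)"
    "\<exists>n\<in>Hom (lead G q0) (lead G (cls G y)). \<forall>r\<in>{0..<1}.
        step G (cls G y) r \<bullet>\<bullet> n = (if r < c then step G q0 r else step G q r \<bullet>\<bullet> m)"
proof -
  note js = jsim_nerve[OF s0 s k] and jt = jw_simplex[OF t0 t c]
  show "y \<in> topspace (real_sum G)" unfolding y_def using js jt by (simp add: topspace_real_sum)
  have i0: "idx t0 0 \<le> p0" using idx0[OF t0, of 0] by simp
  have P: "npath G s0 0 (idx t0 0) \<in> Hom (nvert G s0 0) (nvert G s0 (idx t0 0))" using npath_hom[OF s0] i0 by simp
  \<comment> \<open>Goes back from the leading vertex of the first point to vertex 0, so that steps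
    of the join, counted from vertex 0, become steps counted from that leading vertex.\<close>
  define e where "e = ginv (npath G s0 0 (idx t0 0))"
  have e: "e \<in> Hom (nvert G s0 (idx t0 0)) (nvert G s0 0)" unfolding e_def by (rule inv_props(1)[OF P])
  have x0: "((p0,s0),t0) \<in> topspace (real_sum G)" using s0 t0 by (simp add: topspace_real_sum)
  have x: "((p,s),t) \<in> topspace (real_sum G)" using s t by (simp add: topspace_real_sum)
  have lq0: "lead G q0 = nvert G s0 (idx t0 0)" unfolding q0_def using lead_cls[OF x0] by (simp add: leadr_def)
  have pe: "npath G s0 0 j \<bullet>\<bullet> e = npath G s0 (idx t0 0) j" if "idx t0 0 \<le> j" "j \<le> p0" for j
  proof -
    have h: "npath G s0 (idx t0 0) j \<in> Hom (nvert G s0 (idx t0 0)) (nvert G s0 j)" using npath_hom[OF s0 that] .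
    have "npath G s0 0 j = npath G s0 (idx t0 0) j \<bullet>\<bullet> npath G s0 0 (idx t0 0)" using npath_comp[OF s0 _ that] by simp
    then show ?thesis using assoc[OF e P h] inv_props(3)[OF P] id_right[OF h] by (simp add: e_def)
  qed
  have kP: "k \<bullet>\<bullet> npath G s0 0 p0 \<in> Hom (nvert G s0 0) (nvert G s 0)" using comp_hom[OF npath_hom[OF s0, of 0 p0] k] by simp
  have kPe: "(k \<bullet>\<bullet> npath G s0 0 p0) \<bullet>\<bullet> e = k \<bullet>\<bullet> npath G s0 (idx t0 0) p0"
    using assoc[OF e npath_hom[OF s0, of 0 p0] k] pe[OF i0] by simp
  have kh: "k \<bullet>\<bullet> npath G s0 (idx t0 0) p0 \<in> Hom (nvert G s0 (idx t0 0)) (nvert G s 0)"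
    using comp_hom[OF npath_hom[OF s0 i0 order_refl] k] .
  have e': "e \<in> Hom (nvert G s0 (idx t0 0)) (nvert G (jsim s0 k s) 0)" using e jsim_nvert(1)[OF s0 s k, of 0] by simp
  show "\<exists>n\<in>Hom (lead G q0) (lead G (cls G y)). \<forall>r\<in>{0..<1}.
        step G (cls G y) r \<bullet>\<bullet> n = (if r < c then step G q0 r else step G q r \<bullet>\<bullet> m)"
  proof (intro bexI[of _ "npath G (jsim s0 k s) 0 (idx (jw p0 t0 t c) 0) \<bullet>\<bullet> e"] ballI)
    show "npath G (jsim s0 k s) 0 (idx (jw p0 t0 t c) 0) \<bullet>\<bullet> e \<in> Hom (lead G q0) (lead G (cls G y))"
      using lift_simplex(2)[OF js jt e', of 0] lq0 y_def by simp
    fix r :: real assume r: "r \<in> {0..<1}"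
    have eq: "step G (cls G y) r \<bullet>\<bullet> (npath G (jsim s0 k s) 0 (idx (jw p0 t0 t c) 0) \<bullet>\<bullet> e)
        = npath G (jsim s0 k s) 0 (idx (jw p0 t0 t c) r) \<bullet>\<bullet> e"
      unfolding y_def by (rule lift_simplex(1)[OF js jt e' r])
    show "step G (cls G y) r \<bullet>\<bullet> (npath G (jsim s0 k s) 0 (idx (jw p0 t0 t c) 0) \<bullet>\<bullet> e)
       = (if r < c then step G q0 r else step G q r \<bullet>\<bullet> m)"
    proof (cases "r < c")
      case True
      have "npath G (jsim s0 k s) 0 (idx (jw p0 t0 t c) r) \<bullet>\<bullet> e = npath G s0 0 (idx t0 r) \<bullet>\<bullet> e"
        using idx_jw[OF t0 t c r] True jsim_npath(1)[OF s0 s k, of "idx t0 r"] idx0[OF t0 r] by simp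
      also have "\<dots> = npath G s0 (idx t0 0) (idx t0 r)" using pe[of "idx t0 r"] idx0[OF t0 r] by simp
      also have "\<dots> = step G q0 r" unfolding q0_def using step_cls[OF x0 r] by (simp add: stepr_def)
      finally show ?thesis using eq True by simp
    next
      case False
      have "npath G (jsim s0 k s) 0 (idx (jw p0 t0 t c) r) \<bullet>\<bullet> e = (npath G s 0 (idx t r) \<bullet>\<bullet> (k \<bullet>\<bullet> npath G s0 0 p0)) \<bullet>\<bullet> e"
        using idx_jw[OF t0 t c r] False jsim_npath(2)[OF s0 s k, of "idx t r"] idx0[OF t r] by (simp del: npath.simps)
      also have "\<dots> = npath G s 0 (idx t r) \<bullet>\<bullet> (k \<bullet>\<bullet> npath G s0 (idx t0 0) p0)"
        using assoc[OF e kP npath_hom[OF s, of 0 "idx t r"]] kPe idx0[OF t r] by simp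
      also have "\<dots> = step G q r \<bullet>\<bullet> m" unfolding q_def m_def using lift_simplex(1)[OF s t kh r] by simp
      finally show ?thesis using eq False by simp
    qed
  qed
qed

text \<open>Uniqueness for the description in \<open>splice\<close> is \<open>point_eqI\<close>: the
  spliced function, read from \<open>lead G p0\<close>, determines the point.\<close>

lemma splice_eqI:
  assumes "w \<in> topspace B" "n \<in> Hom (lead G p0) (lead G w)"
    "\<And>r. r \<in> {0..<1} \<Longrightarrow> step G w r \<bullet>\<bullet> n = (if r < 1 - \<rho> then step G p0 r else step G q r \<bullet>\<bullet> m)"
  shows "splice G p0 q m \<rho> = w"
  unfolding splice_def
proof (rule the_equality)
  show "w \<in> topspace B \<and> (\<exists>n\<in>Hom (lead G p0) (lead G w). \<forall>r\<in>{0..<1}.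
     step G w r \<bullet>\<bullet> n = (if r < 1 - \<rho> then step G p0 r else step G q r \<bullet>\<bullet> m))" using assms by blast
  fix w' assume "w' \<in> topspace B \<and> (\<exists>n\<in>Hom (lead G p0) (lead G w'). \<forall>r\<in>{0..<1}.
     step G w' r \<bullet>\<bullet> n = (if r < 1 - \<rho> then step G p0 r else step G q r \<bullet>\<bullet> m))"
  then obtain n' where n': "w' \<in> topspace B" "n' \<in> Hom (lead G p0) (lead G w')"
    "\<forall>r\<in>{0..<1}. step G w' r \<bullet>\<bullet> n' = (if r < 1 - \<rho> then step G p0 r else step G q r \<bullet>\<bullet> m)" by blast
  show "w' = w" by (rule point_eqI[OF n'(1) assms(1) n'(2) assms(2)]) (use n'(3) assms(3) in simp)
qed

lemma splice_simplex:
  assumes s0: "s0 \<in> nerve G p0" and t0: "t0 \<in> standard_simplex p0" and s: "s \<in> nerve G p" and t: "t \<in> standard_simplex p"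
    and k: "k \<in> Hom (nvert G s0 p0) (nvert G s 0)" and \<rho>: "\<rho> \<in> {0..1}"
  shows "splice G (cls G ((p0,s0),t0)) (cls G ((p,s),t)) (npath G s 0 (idx t 0) \<bullet>\<bullet> (k \<bullet>\<bullet> npath G s0 (idx t0 0) p0)) \<rho>
     = cls G ((Suc (p0 + p), jsim s0 k s), jw p0 t0 t (1 - \<rho>))"
proof -
  have c: "0 \<le> 1 - \<rho>" "1 - \<rho> \<le> 1" using \<rho> by auto
  note jp = join_point[OF s0 t0 s t k c]
  show ?thesis using jp(2) splice_eqI[OF cls_in[OF jp(1)]] by blast
qed

lemma splice_props:
  assumes p0: "p0 \<in> topspace B" and q: "q \<in> topspace B" and m: "m \<in> Hom (lead G p0) (lead G q)" and \<rho>: "\<rho> \<in> {0..1}"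
  shows "splice G p0 q m \<rho> \<in> topspace B" "\<exists>n\<in>Hom (lead G p0) (lead G (splice G p0 q m \<rho>)). \<forall>r\<in>{0..<1}.
     step G (splice G p0 q m \<rho>) r \<bullet>\<bullet> n = (if r < 1 - \<rho> then step G p0 r else step G q r \<bullet>\<bullet> m)"
proof -
  obtain a0 s0 t0 where x0: "rep p0 = ((a0,s0),t0)" by (metis prod.collapse)
  obtain a s t where x: "rep q = ((a,s),t)" by (metis prod.collapse)
  have s: "s0 \<in> nerve G a0" "t0 \<in> standard_simplex a0" "s \<in> nerve G a" "t \<in> standard_simplex a"
    using rep_props(1)[OF p0] rep_props(1)[OF q] x0 x by (simp_all add: topspace_real_sum)
  have cl: "p0 = cls G ((a0,s0),t0)" "q = cls G ((a,s),t)" using rep_props(2)[OF p0] rep_props(2)[OF q] x0 x by simp_all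
  obtain k' where k': "k' \<in> Hom (lead G p0) (nvert G s 0)" "m = npath G s 0 (idx t 0) \<bullet>\<bullet> k'"
    using simplex_lift[OF s(3,4)] m cl(2) by blast
  have l0: "lead G p0 = nvert G s0 (idx t0 0)" by (simp add: lead_def leadr_def x0)
  have P: "npath G s0 (idx t0 0) a0 \<in> Hom (lead G p0) (nvert G s0 a0)"
    using npath_hom[OF s(1), of "idx t0 0" a0] idx0[OF s(2), of 0] l0 by simp
  \<comment> \<open>\<open>m\<close> joins the two leading vertices; stripping off the paths inside
    the two simplices leaves the arrow from the last vertex of the first to vertex 0 of the second,
    along which the join is formed.\<close>
  define k where "k = k' \<bullet>\<bullet> ginv (npath G s0 (idx t0 0) a0)"
  have k: "k \<in> Hom (nvert G s0 a0) (nvert G s 0)" unfolding k_def using comp_hom[OF inv_props(1)[OF P] k'(1)] .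
  have mk: "m = npath G s 0 (idx t 0) \<bullet>\<bullet> (k \<bullet>\<bullet> npath G s0 (idx t0 0) a0)"
    unfolding k_def using comp_inv_cancel[OF P k'(1)] k'(2) by simp
  have c: "0 \<le> 1 - \<rho>" "1 - \<rho> \<le> 1" using \<rho> by auto
  note jp = join_point[OF s k c, folded cl mk] and js = splice_simplex[OF s k \<rho>, folded cl mk]
  show "splice G p0 q m \<rho> \<in> topspace B" unfolding js by (rule cls_in[OF jp(1)])
  show "\<exists>n\<in>Hom (lead G p0) (lead G (splice G p0 q m \<rho>)). \<forall>r\<in>{0..<1}.
     step G (splice G p0 q m \<rho>) r \<bullet>\<bullet> n = (if r < 1 - \<rho> then step G p0 r else step G q r \<bullet>\<bullet> m)"
    unfolding js by (rule jp(2))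
qed

lemma splice_0: "p0 \<in> topspace B \<Longrightarrow> splice G p0 q m 0 = p0"
  using id_right step_hom by (intro splice_eqI[of _ "cid G (lead G p0)"] id_hom lead_ob) fastforce+

lemma splice_1:
  assumes "q \<in> topspace B" "m \<in> Hom (lead G p0) (lead G q)"
  shows "splice G p0 q m 1 = q"
  by (rule splice_eqI[OF assms]) simp

lemma splice_id: "p0 \<in> topspace B \<Longrightarrow> splice G p0 p0 (cid G (lead G p0)) \<rho> = p0"
  using id_right step_hom by (intro splice_eqI[of _ "cid G (lead G p0)"] id_hom lead_ob) fastforce+

lemma continuous_map_snd_real_sum: "continuous_map (real_sum G) (powertop_real UNIV) snd"
  unfolding continuous_map_def
proof (intro conjI allI impI)
  fix U :: "(nat \<Rightarrow> real) set" assume U: "openin (powertop_real UNIV) U"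
  show "openin (real_sum G) {x \<in> topspace (real_sum G). snd x \<in> U}"
    unfolding real_sum_def openin_sum_topology
  proof (intro conjI ballI)
    fix i assume i: "i \<in> {(p, s). s \<in> nerve G p}"
    obtain p s where ps: "i = (p,s)" by (cases i)
    then have s: "s \<in> nerve G p" using i by simp
    have "{t. (i, t) \<in> {x \<in> topspace (sum_topology (\<lambda>(p, s). subtopology (powertop_real UNIV) (standard_simplex p)) {(p, s). s \<in> nerve G p}). snd x \<in> U}} = U \<inter> standard_simplex p"
      using s by (auto simp: ps)
    then show "openin (case i of (p, s) \<Rightarrow> subtopology (powertop_real UNIV) (standard_simplex p))
      {t. (i, t) \<in> {x \<in> topspace (sum_topology (\<lambda>(p, s). subtopology (powertop_real UNIV) (standard_simplex p)) {(p, s). s \<in> nerve G p}). snd x \<in> U}}"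
      using U by (auto simp: ps openin_subtopology)
  qed auto
qed auto

lemma openin_component:
  assumes s: "s \<in> nerve G p" and T: "openin (subtopology (powertop_real UNIV) (standard_simplex p)) T"
  shows "openin (real_sum G) (Pair (p,s) ` T)"
proof -
  have "open_map (subtopology (powertop_real UNIV) (standard_simplex p)) (real_sum G) (Pair (p,s))"
    using open_map_component_injection[of "(p,s)" "{(p, s). s \<in> nerve G p}" "\<lambda>(p, s). subtopology (powertop_real UNIV) (standard_simplex p)"] s
    by (simp add: real_sum_def)
  then show ?thesis using T by (simp add: open_map_def)
qed

text \<open>For a fixed connecting arrow \<open>k\<close> all spliced points lie in one simplex, and
  their weights are built from partial sums by minima, maxima and differences.\<close>

lemma splice_simplex_continuous:
  assumes s0: "s0 \<in> nerve G p0" and t0: "t0 \<in> standard_simplex p0" and s: "s \<in> nerve G p"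
    and k: "k \<in> Hom (nvert G s0 p0) (nvert G s 0)"
  shows "continuous_map (subtopology (prod_topology (real_sum G) I01) ((Pair (p,s) ` standard_simplex p) \<times> UNIV)) B
    (\<lambda>z. cls G ((Suc (p0 + p), jsim s0 k s), jw p0 t0 (snd (fst z)) (1 - snd z)))"
proof -
  let ?D = "subtopology (prod_topology (real_sum G) I01) ((Pair (p,s) ` standard_simplex p) \<times> UNIV)"
  have c1: "continuous_map ?D (powertop_real UNIV) (\<lambda>z. snd (fst z))"
    using continuous_map_compose[OF continuous_map_fst continuous_map_snd_real_sum, of I01]
    by (intro continuous_map_from_subtopology) (simp add: o_def)
  have c2: "continuous_map ?D euclideanreal (\<lambda>z. 1 - snd z)"
    by (intro continuous_intros continuous_map_from_subtopology continuous_map_into_fulltopology[OF continuous_map_snd])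
  have c3: "continuous_map ?D euclideanreal (\<lambda>z. sum (snd (fst z)) S)" if "finite S" for S
    using c1 that by (intro continuous_intros) (auto simp: continuous_map_componentwise_UNIV)
  have "continuous_map ?D euclideanreal (\<lambda>z. jw p0 t0 (snd (fst z)) (1 - snd z) l)" for l
    unfolding jw_def
    by (cases "l \<le> p0") (auto intro!: continuous_map_diff continuous_map_real_min continuous_map_real_max c2 c3 continuous_map_const[THEN iffD2])
  then have "continuous_map ?D (powertop_real UNIV) (\<lambda>z. jw p0 t0 (snd (fst z)) (1 - snd z))"
    by (simp add: continuous_map_componentwise_UNIV)
  moreover have "jw p0 t0 (snd (fst z)) (1 - snd z) \<in> standard_simplex (Suc (p0 + p))" if "z \<in> topspace ?D" for z
    using that by (intro jw_simplex[OF t0]) auto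
  ultimately have c4: "continuous_map ?D (subtopology (powertop_real UNIV) (standard_simplex (Suc (p0 + p)))) (\<lambda>z. jw p0 t0 (snd (fst z)) (1 - snd z))"
    by (simp add: continuous_map_in_subtopology image_subset_iff_funcset)
  have "continuous_map (subtopology (powertop_real UNIV) (standard_simplex (Suc (p0 + p)))) (real_sum G) (Pair (Suc (p0 + p), jsim s0 k s))"
    using continuous_map_component_injection[of "(Suc (p0 + p), jsim s0 k s)" "{(p, s). s \<in> nerve G p}" "\<lambda>(p, s). subtopology (powertop_real UNIV) (standard_simplex p)"]
      jsim_nerve[OF s0 s k] by (simp add: real_sum_def)
  from continuous_map_compose[OF continuous_map_compose[OF c4 this] quotient_imp_continuous_map[OF quotient_map_cls]]
  show ?thesis by (simp add: o_def)
qed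

text \<open>The interval is locally compact and Hausdorff, so its product with the quotient map is
  again a quotient map and continuity can be tested on simplices. There the lift with a constant
  \<open>k'\<close> moves by less than 1/4; by \<open>ldist_close\<close> it is the lift
  \<open>\<mu>\<close>, so near a given point all splices use the same connecting arrow
  \<open>k\<close>.\<close>

lemma splice_local_continuous:
  assumes p0: "p0 \<in> topspace B" and q0: "q0 \<in> topspace B" and a: "a = lead G p0"
    and U: "U = {q \<in> topspace B. \<exists>n'\<in>Hom a (lead G q). ldist G q0 m0 q n' < 1/4}"
    and \<mu>: "\<And>q. q \<in> U \<Longrightarrow> \<mu> q \<in> Hom a (lead G q) \<and> ldist G q0 m0 q (\<mu> q) < 1/4"
  shows "continuous_map (prod_topology (subtopology B U) I01) B (\<lambda>z. splice G p0 (fst z) (\<mu> (fst z)) (snd z))"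
proof -
  let ?\<Psi> = "\<lambda>z. splice G p0 (fst z) (\<mu> (fst z)) (snd z)"
  define V where "V = {x \<in> topspace (real_sum G). cls G x \<in> U}"
  have UB: "openin B U" unfolding U by (rule openin_lift_nbhd[OF q0])
  have q1: "quotient_map (subtopology (real_sum G) V) (subtopology B U) (cls G)"
    by (rule quotient_map_restriction[OF quotient_map_cls]) (use UB in \<open>auto simp: V_def\<close>)
  have "compact_space I01" by (simp add: compact_space_subtopology)
  then have lc: "locally_compact_space I01" and Hd: "Hausdorff_space I01"
    by (auto simp: compact_imp_locally_compact_space Hausdorff_space_subtopology)
  have q2: "quotient_map (prod_topology (subtopology (real_sum G) V) I01) (prod_topology (subtopology B U) I01) (\<lambda>(x,y). (cls G x, y))"
    by (rule quotient_map_prod_left[OF lc _ q1]) (use Hd in blast)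
  obtain a0 s0 t0 where x0: "rep p0 = ((a0,s0),t0)" by (metis prod.collapse)
  have s0: "s0 \<in> nerve G a0" "t0 \<in> standard_simplex a0"
    using rep_props(1)[OF p0] x0 by (simp_all add: topspace_real_sum)
  have cl0: "p0 = cls G ((a0,s0),t0)" using rep_props(2)[OF p0] x0 by simp
  have l0: "a = nvert G s0 (idx t0 0)" by (simp add: a lead_def leadr_def x0)
  have P: "npath G s0 (idx t0 0) a0 \<in> Hom a (nvert G s0 a0)"
    using npath_hom[OF s0(1), of "idx t0 0" a0] idx0[OF s0(2), of 0] l0 by simp
  have Vo: "openin (real_sum G) V" unfolding V_def
    by (rule openin_continuous_map_preimage[OF quotient_imp_continuous_map[OF quotient_map_cls] UB])
  have "continuous_map (prod_topology (subtopology (real_sum G) V) I01) B (?\<Psi> \<circ> (\<lambda>(x,y). (cls G x, y)))"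
  proof (rule continuous_map_local)
    fix z assume z: "z \<in> topspace (prod_topology (subtopology (real_sum G) V) I01)"
    then have "fst z \<in> V" by auto
    obtain p s t1 where ps: "fst z = ((p,s),t1)" by (metis prod.collapse)
    have s: "s \<in> nerve G p" "t1 \<in> standard_simplex p" and u1: "cls G ((p,s),t1) \<in> U"
      using \<open>fst z \<in> V\<close> ps by (simp_all add: V_def topspace_real_sum)
    obtain k' where k': "k' \<in> Hom a (nvert G s 0)" "\<mu> (cls G ((p,s),t1)) = npath G s 0 (idx t1 0) \<bullet>\<bullet> k'"
      using simplex_lift[OF s] \<mu>[OF u1] by blast
    define k where "k = k' \<bullet>\<bullet> ginv (npath G s0 (idx t0 0) a0)"
    have k: "k \<in> Hom (nvert G s0 a0) (nvert G s 0)" unfolding k_def using comp_hom[OF inv_props(1)[OF P] k'(1)] .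
    have kk: "k \<bullet>\<bullet> npath G s0 (idx t0 0) a0 = k'" unfolding k_def using comp_inv_cancel[OF P k'(1)] .
    define T where "T = {t' \<in> standard_simplex p. 2 * (\<Sum>j\<le>p. \<bar>sum t1 {..j} - sum t' {..j}\<bar>) < 1/4}"
    define W where "W = Pair (p,s) ` T \<inter> V"
    have W: "openin (subtopology (real_sum G) V) W"
      unfolding W_def by (rule openin_subtopology_Int[OF openin_component[OF s(1)]]) (unfold T_def, rule simplex_nbhd[OF s(2)], simp)
    have xi: "((p,s),t1) \<in> topspace (real_sum G)" "\<And>t. t \<in> T \<Longrightarrow> cls G ((p,s),t) \<in> topspace B"
      using s by (auto simp: topspace_real_sum T_def intro!: cls_in)
    have mu: "\<mu> (cls G ((p,s),t)) = npath G s 0 (idx t 0) \<bullet>\<bullet> k'" if t: "t \<in> T" "((p,s),t) \<in> V" for t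
    proof -
      have ts: "t \<in> standard_simplex p" and d: "2 * (\<Sum>j\<le>p. \<bar>sum t1 {..j} - sum t {..j}\<bar>) < 1/4" using t(1) by (simp_all add: T_def)
      have tU: "cls G ((p,s),t) \<in> U" using t(2) by (simp add: V_def)
      have "ldist G q0 m0 (cls G ((p,s),t)) (npath G s 0 (idx t 0) \<bullet>\<bullet> k') < 1/2"
        using ldist_triangle[OF q0 cls_in[OF xi(1)] xi(2)[OF t(1)], of m0 "npath G s 0 (idx t 0) \<bullet>\<bullet> k'" "\<mu> (cls G ((p,s),t1))"]
          ldist_simplex[OF s ts k'(1), folded k'(2)] d \<mu>[OF u1] by linarith
      then show ?thesis
        using ldist_close[OF xi(2)[OF t(1)] q0, of "\<mu> (cls G ((p,s),t))" a "npath G s 0 (idx t 0) \<bullet>\<bullet> k'" m0]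
          \<mu>[OF tU] lift_simplex(2)[OF s(1) ts k'(1), of 0] by simp
    qed
    let ?N = "W \<times> {0..1::real}"
    have "openin (prod_topology (subtopology (real_sum G) V) I01) ?N"
      using W by (simp add: openin_prod_Times_iff)
    moreover have "z \<in> ?N"
    proof -
      have "fst z \<in> W" using ps \<open>fst z \<in> V\<close> s(2) by (auto simp: W_def T_def)
      then show ?thesis using z by (auto simp: mem_Times_iff)
    qed
    moreover have "continuous_map (subtopology (prod_topology (subtopology (real_sum G) V) I01) ?N) B (?\<Psi> \<circ> (\<lambda>(x,y). (cls G x, y)))"
    proof -
      have sub: "subtopology (prod_topology (subtopology (real_sum G) V) I01) ?N =
        subtopology (subtopology (prod_topology (real_sum G) I01) ((Pair (p,s) ` standard_simplex p) \<times> UNIV)) ?N"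
      proof -
        have "prod_topology (subtopology (real_sum G) V) I01 = subtopology (prod_topology (real_sum G) I01) (V \<times> {0..1})"
          by (simp only: prod_topology_subtopology(1) topspace_euclidean_subtopology)
        moreover have "V \<times> {0..1} \<inter> ?N = ?N" "((Pair (p,s) ` standard_simplex p) \<times> UNIV) \<inter> ?N = ?N"
          by (auto simp: W_def T_def)
        ultimately show ?thesis by (simp only: subtopology_subtopology)
      qed
      have "continuous_map (subtopology (prod_topology (subtopology (real_sum G) V) I01) ?N) B
         (\<lambda>z. cls G ((Suc (a0 + p), jsim s0 k s), jw a0 t0 (snd (fst z)) (1 - snd z)))"
        unfolding sub by (rule continuous_map_from_subtopology[OF splice_simplex_continuous[OF s0 s(1) k]])
      then show ?thesis
      proof (rule continuous_map_eq)
        fix y assume "y \<in> topspace (subtopology (prod_topology (subtopology (real_sum G) V) I01) ?N)"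
        then have y: "fst y \<in> W" "snd y \<in> {0..1}" by (auto simp: mem_Times_iff)
        then obtain t where t: "fst y = ((p,s),t)" "t \<in> T" "((p,s),t) \<in> V" by (auto simp: W_def)
        have ts: "t \<in> standard_simplex p" using t(2) by (simp add: T_def)
        have "splice G p0 (cls G ((p,s),t)) (npath G s 0 (idx t 0) \<bullet>\<bullet> (k \<bullet>\<bullet> npath G s0 (idx t0 0) a0)) (snd y)
          = cls G ((Suc (a0 + p), jsim s0 k s), jw a0 t0 t (1 - snd y))"
          unfolding cl0 by (rule splice_simplex[OF s0 s(1) ts k y(2)])
        then show "cls G ((Suc (a0 + p), jsim s0 k s), jw a0 t0 (snd (fst y)) (1 - snd y)) = (?\<Psi> \<circ> (\<lambda>(x,y). (cls G x, y))) y"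
          using mu[OF t(2,3)] t(1) kk by (simp add: case_prod_unfold)
      qed
    qed
    ultimately show "\<exists>N. openin (prod_topology (subtopology (real_sum G) V) I01) N \<and> z \<in> N \<and>
      continuous_map (subtopology (prod_topology (subtopology (real_sum G) V) I01) N) B (?\<Psi> \<circ> (\<lambda>(x,y). (cls G x, y)))" by blast
  qed
  then show ?thesis by (simp add: continuous_compose_quotient_map_eq[OF q2])
qed

text \<open>Near a point of \<open>K\<close> the value of the section is the unique lift close to
  the value at that point, hence a function of \<open>g\<close> alone. This reduces the claim to a
  statement on an open set of the classifying space.\<close>

lemma splice_continuous:
  assumes p0: "p0 \<in> topspace B" and s: "sec G K g (lead G p0) m"
  shows "continuous_map (prod_topology K I01) B (\<lambda>z. splice G p0 (g (fst z)) (m (fst z)) (snd z))"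
proof (rule continuous_map_local)
  fix z assume z: "z \<in> topspace (prod_topology K I01)"
  then have x: "fst z \<in> topspace K" by auto
  let ?x = "fst z" let ?a = "lead G p0"
  define U where "U = {q \<in> topspace B. \<exists>n'\<in>Hom ?a (lead G q). ldist G (g ?x) (m ?x) q n' < 1/4}"
  define \<mu> where "\<mu> q = (SOME n'. n' \<in> Hom ?a (lead G q) \<and> ldist G (g ?x) (m ?x) q n' < 1/4)" for q
  have \<mu>: "\<mu> q \<in> Hom ?a (lead G q) \<and> ldist G (g ?x) (m ?x) q (\<mu> q) < 1/4" if "q \<in> U" for q
  proof -
    have "\<exists>n'. n' \<in> Hom ?a (lead G q) \<and> ldist G (g ?x) (m ?x) q n' < 1/4" using that by (auto simp: U_def)
    then show ?thesis unfolding \<mu>_def by (rule someI_ex)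
  qed
  note jc = splice_local_continuous[OF p0 secD(4)[OF s x] refl U_def \<mu>]
  define N where "N = {y \<in> topspace K. ldist G (g ?x) (m ?x) (g y) (m y) < 1/4}"
  have N: "openin K N" unfolding N_def using secD(3)[OF s x, of "1/4"] by simp
  have NU: "g y \<in> U" "\<mu> (g y) = m y" if "y \<in> N" for y
  proof -
    have y: "y \<in> topspace K" "ldist G (g ?x) (m ?x) (g y) (m y) < 1/4" using that by (auto simp: N_def)
    show u: "g y \<in> U" using y secD(4)[OF s y(1)] secD(2)[OF s y(1)] by (auto simp: U_def)
    show "\<mu> (g y) = m y"
      using ldist_close[OF secD(4)[OF s y(1)] secD(4)[OF s x], of "\<mu> (g y)" ?a "m y" "m ?x"] \<mu>[OF u] y(2) secD(2)[OF s y(1)] by simp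
  qed
  have "openin (prod_topology K I01) (N \<times> {0..1})" using N by (simp add: openin_prod_Times_iff)
  moreover have "z \<in> N \<times> {0..1}" using z x ldist_self[of "g ?x" "m ?x"] by (auto simp: N_def mem_Times_iff)
  moreover have "continuous_map (subtopology (prod_topology K I01) (N \<times> {0..1})) B (\<lambda>z. splice G p0 (g (fst z)) (m (fst z)) (snd z))"
  proof -
    have "continuous_map (subtopology (prod_topology K I01) (N \<times> {0..1})) (subtopology B U) (\<lambda>z. g (fst z))"
      using continuous_map_compose[OF continuous_map_fst secD(1)[OF s], of I01] NU(1)
      by (auto simp: continuous_map_in_subtopology o_def continuous_map_from_subtopology)
    moreover have "continuous_map (subtopology (prod_topology K I01) (N \<times> {0..1})) I01 snd"
      by (intro continuous_map_from_subtopology continuous_map_snd)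
    ultimately have "continuous_map (subtopology (prod_topology K I01) (N \<times> {0..1})) (prod_topology (subtopology B U) I01) (\<lambda>z. (g (fst z), snd z))"
      by (simp add: continuous_map_pairwise o_def)
    from continuous_map_compose[OF this jc]
    show ?thesis by (rule continuous_map_eq) (use NU(2) in auto)
  qed
  ultimately show "\<exists>N. openin (prod_topology K I01) N \<and> z \<in> N \<and>
    continuous_map (subtopology (prod_topology K I01) N) B (\<lambda>z. splice G p0 (g (fst z)) (m (fst z)) (snd z))" by blast
qed

end

text \<open>A splice is characterised by its step function, on which a functor acts
  pointwise.\<close>

lemma (in cfunctor) BF_splice:
  assumes p0: "p0 \<in> topspace X.B" and q: "q \<in> topspace X.B" and m: "m \<in> chom X (lead X p0) (lead X q)" and \<rho>: "\<rho> \<in> {0..1}"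
  shows "BF (splice X p0 q m \<rho>) = splice Z (BF p0) (BF q) (Fm m) \<rho>"
proof -
  let ?j = "splice X p0 q m \<rho>"
  have j: "?j \<in> topspace X.B" using X.splice_props(1)[OF assms] .
  obtain n where n: "n \<in> chom X (lead X p0) (lead X ?j)"
    and e: "\<And>r. r \<in> {0..<1} \<Longrightarrow> ccomp X (step X ?j r) n = (if r < 1 - \<rho> then step X p0 r else ccomp X (step X q r) m)"
    using X.splice_props(2)[OF assms] by blast
  show ?thesis
  proof (rule Z.splice_eqI[symmetric])
    show "BF ?j \<in> topspace Z.B" using BF_in[OF j] .
    show "Fm n \<in> chom Z (lead Z (BF p0)) (lead Z (BF ?j))" using F_hom[OF n] lead_BF[OF p0] lead_BF[OF j] by simp
    fix r :: real assume r: "r \<in> {0..<1}"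
    obtain y where y: "step X ?j r \<in> chom X (lead X ?j) y" using X.step_hom[OF j r] by blast
    obtain y' where y': "step X q r \<in> chom X (lead X q) y'" using X.step_hom[OF q r] by blast
    have "ccomp Z (step Z (BF ?j) r) (Fm n) = Fm (ccomp X (step X ?j r) n)"
      using F_comp[OF n y] step_BF[OF j r] by simp
    then show "ccomp Z (step Z (BF ?j) r) (Fm n) = (if r < 1 - \<rho> then step Z (BF p0) r else ccomp Z (step Z (BF q) r) (Fm m))"
      using e[OF r] F_comp[OF m y'] step_BF[OF p0 r] step_BF[OF q r] by simp
  qed
qed

subsection \<open>Path spaces\<close>

lemma topspace_path_space:
  "topspace (path_space Z) = {\<gamma>. continuous_map I01 Z \<gamma> \<and> (\<forall>t. t \<notin> {0..1} \<longrightarrow> \<gamma> t = undefined)}"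
proof -
  have "\<gamma> \<in> \<Union> {{\<gamma>. continuous_map I01 Z \<gamma> \<and> (\<forall>t. t \<notin> {0..1} \<longrightarrow> \<gamma> t = undefined) \<and> \<gamma> ` K \<subseteq> U} |K U. compact K \<and> K \<subseteq> {0..1} \<and> openin Z U}"
    if "continuous_map I01 Z \<gamma>" "\<forall>t. t \<notin> {0..1} \<longrightarrow> \<gamma> t = undefined" for \<gamma> :: "real \<Rightarrow> 'a"
  proof (rule UnionI)
    \<comment> \<open>The empty set of times imposes no condition, so this subbasic set consists of
      all paths.\<close>
    show "{\<gamma>. continuous_map I01 Z \<gamma> \<and> (\<forall>t. t \<notin> {0..1} \<longrightarrow> \<gamma> t = undefined) \<and> \<gamma> ` {} \<subseteq> {}} \<in>
      {{\<gamma>. continuous_map I01 Z \<gamma> \<and> (\<forall>t. t \<notin> {0..1} \<longrightarrow> \<gamma> t = undefined) \<and> \<gamma> ` K \<subseteq> U} |K U. compact K \<and> K \<subseteq> {0..1} \<and> openin Z U}"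
      by (rule CollectI, rule exI[of _ "{}"], rule exI[of _ "{}"]) simp
    show "\<gamma> \<in> {\<gamma>. continuous_map I01 Z \<gamma> \<and> (\<forall>t. t \<notin> {0..1} \<longrightarrow> \<gamma> t = undefined) \<and> \<gamma> ` {} \<subseteq> {}}"
      using that by simp
  qed
  then show ?thesis unfolding path_space_def topology_generated_by_topspace by auto
qed

lemma continuous_map_slice:
  assumes "continuous_map (prod_topology K I01) Z h" "x \<in> topspace K"
  shows "continuous_map I01 Z (\<lambda>t. h (x,t))"
proof -
  have "continuous_map I01 (prod_topology K I01) (\<lambda>t. (x,t))" using assms(2) by (simp add: continuous_map_pairwise o_def)
  from continuous_map_compose[OF this assms(1)] show ?thesis by (simp add: o_def)
qed

text \<open>A subbasic condition concerns a compact set of times, so by the tube lemma it holds for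
  all nearby parameters as soon as it holds for one.\<close>

lemma path_space_curry:
  assumes h: "continuous_map (prod_topology K I01) Z h"
  shows "continuous_map K (path_space Z) (\<lambda>x t. if t \<in> {0..1} then h (x,t) else undefined)"
    (is "continuous_map K _ ?f")
  unfolding path_space_def
proof (rule continuous_on_generated_topo)
  have c: "continuous_map I01 Z (?f x)" if "x \<in> topspace K" for x
    by (rule continuous_map_eq[OF continuous_map_slice[OF h that]]) simp
  fix S assume "S \<in> {{\<gamma>. continuous_map I01 Z \<gamma> \<and> (\<forall>t. t \<notin> {0..1} \<longrightarrow> \<gamma> t = undefined) \<and> \<gamma> ` C \<subseteq> U} |C U. compact C \<and> C \<subseteq> {0..1} \<and> openin Z U}"
  then obtain C U where S: "S = {\<gamma>. continuous_map I01 Z \<gamma> \<and> (\<forall>t. t \<notin> {0..1} \<longrightarrow> \<gamma> t = undefined) \<and> \<gamma> ` C \<subseteq> U}"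
    and C: "compact C" "C \<subseteq> {0..1}" and U: "openin Z U" by blast
  have eq: "?f -` S \<inter> topspace K = {x \<in> topspace K. \<forall>t\<in>C. h (x,t) \<in> U}"
    using c C(2) by (auto simp: S image_subset_iff subset_iff)
  show "openin K (?f -` S \<inter> topspace K)"
    unfolding eq
  proof (subst openin_subopen, intro ballI)
    fix x assume x: "x \<in> {x \<in> topspace K. \<forall>t\<in>C. h (x,t) \<in> U}"
    let ?W = "{z \<in> topspace (prod_topology K I01). h z \<in> U}"
    have W: "openin (prod_topology K I01) ?W" by (rule openin_continuous_map_preimage[OF h U])
    have cC: "compactin I01 C" using C by (simp add: compactin_subtopology)
    have xC: "{x} \<times> C \<subseteq> ?W" using x C(2) by auto
    have xK: "x \<in> topspace K" using x by blast
    obtain N V where N: "openin K N" "x \<in> N" "C \<subseteq> V" "N \<times> V \<subseteq> ?W"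
      using tube_lemma_right[OF W cC xK xC] by (elim exE conjE)
    have "N \<subseteq> {x \<in> topspace K. \<forall>t\<in>C. h (x,t) \<in> U}" using N(3,4) openin_subset[OF N(1)] by blast
    then show "\<exists>T. openin K T \<and> x \<in> T \<and> T \<subseteq> {x \<in> topspace K. \<forall>t\<in>C. h (x,t) \<in> U}" using N(1,2) by blast
  qed
next
  have c: "continuous_map I01 Z (?f x)" if "x \<in> topspace K" for x
    by (rule continuous_map_eq[OF continuous_map_slice[OF h that]]) simp
  have "?f ` topspace K \<subseteq> topspace (path_space Z)" unfolding topspace_path_space using c by auto
  then show "?f ` topspace K \<subseteq> \<Union> {{\<gamma>. continuous_map I01 Z \<gamma> \<and> (\<forall>t. t \<notin> {0..1} \<longrightarrow> \<gamma> t = undefined) \<and> \<gamma> ` C \<subseteq> U} |C U. compact C \<and> C \<subseteq> {0..1} \<and> openin Z U}"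
    unfolding path_space_def topology_generated_by_topspace .
qed

text \<open>Evaluation is continuous because the interval is locally compact: a closed ball of times
  about the given one, of half the admissible radius, is compact and gives a subbasic neighbourhood
  of the path.\<close>

lemma path_space_uncurry:
  assumes g: "continuous_map K (path_space Z) \<gamma>"
  shows "continuous_map (prod_topology K I01) Z (\<lambda>z. \<gamma> (fst z) (snd z))"
  unfolding continuous_map_def
proof (intro conjI allI impI)
  have c: "continuous_map I01 Z (\<gamma> x)" if "x \<in> topspace K" for x
    using continuous_map_funspace[OF g] that unfolding topspace_path_space by blast
  show "(\<lambda>z. \<gamma> (fst z) (snd z)) \<in> topspace (prod_topology K I01) \<rightarrow> topspace Z"
    using continuous_map_funspace[OF c] by fastforce
  fix U assume U: "openin Z U"
  show "openin (prod_topology K I01) {z \<in> topspace (prod_topology K I01). \<gamma> (fst z) (snd z) \<in> U}"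
  proof (subst openin_subopen, intro ballI)
    fix z assume "z \<in> {z \<in> topspace (prod_topology K I01). \<gamma> (fst z) (snd z) \<in> U}"
    then have x: "fst z \<in> topspace K" and t: "snd z \<in> {0..1}" and u: "\<gamma> (fst z) (snd z) \<in> U" by auto
    have V: "openin I01 {r \<in> {0..1}. \<gamma> (fst z) r \<in> U}"
      using openin_continuous_map_preimage[OF c[OF x] U] by simp
    have "snd z \<in> {r \<in> {0..1}. \<gamma> (fst z) r \<in> U}" using t u by simp
    from V[unfolded openin_euclidean_subtopology_iff, THEN conjunct2, THEN bspec, OF this]
    obtain d where d: "d > 0" "\<And>r. r \<in> {0..1} \<Longrightarrow> dist r (snd z) < d \<Longrightarrow> \<gamma> (fst z) r \<in> U" by blast
    define C where "C = {0..1} \<inter> cball (snd z) (d/2)"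
    have C: "compact C" "C \<subseteq> {0..1}" unfolding C_def by (auto intro: compact_Int)
    have Cu: "\<gamma> (fst z) ` C \<subseteq> U" using d by (auto simp: C_def dist_commute)
    let ?S = "{\<gamma>. continuous_map I01 Z \<gamma> \<and> (\<forall>t. t \<notin> {0..1} \<longrightarrow> \<gamma> t = undefined) \<and> \<gamma> ` C \<subseteq> U}"
    have So: "openin (path_space Z) ?S" unfolding path_space_def
      by (rule topology_generated_by_Basis) (use C U in blast)
    let ?N = "{x \<in> topspace K. \<gamma> x \<in> ?S}" let ?V = "{0..1} \<inter> ball (snd z) (d/2)"
    have N: "openin K ?N" by (rule openin_continuous_map_preimage[OF g So])
    have "openin I01 ?V" by (simp add: openin_open_Int)
    then have "openin (prod_topology K I01) (?N \<times> ?V)" using N by (simp add: openin_prod_Times_iff)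
    moreover have "fst z \<in> ?N"
      using x Cu continuous_map_funspace[OF g] unfolding topspace_path_space by blast
    then have "z \<in> ?N \<times> ?V" using t d(1) by (simp add: mem_Times_iff)
    moreover have "?N \<times> ?V \<subseteq> {z \<in> topspace (prod_topology K I01). \<gamma> (fst z) (snd z) \<in> U}"
      by (auto simp: C_def image_subset_iff)
    ultimately show "\<exists>T. openin (prod_topology K I01) T \<and> z \<in> T \<and> T \<subseteq> {z \<in> topspace (prod_topology K I01). \<gamma> (fst z) (snd z) \<in> U}" by blast
  qed
qed

text \<open>With \<open>hofiber_mapD\<close> this is the exponential law for the homotopy fibre
  product: a map into it is a pair of maps together with a homotopy in \<open>Z\<close> between
  their images. All later arguments use this form only.\<close>

lemma hofiber_mapI:
  assumes "continuous_map K X \<alpha>" "continuous_map (prod_topology K I01) Z \<Gamma>" "continuous_map K Y \<beta>"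
    and "\<And>x. x \<in> topspace K \<Longrightarrow> \<Gamma> (x,0) = f (\<alpha> x)" "\<And>x. x \<in> topspace K \<Longrightarrow> \<Gamma> (x,1) = g (\<beta> x)"
  shows "continuous_map K (hofiber_product X Y Z f g) (\<lambda>x. (\<alpha> x, (\<lambda>t. if t \<in> {0..1} then \<Gamma> (x,t) else undefined), \<beta> x))"
  unfolding hofiber_product_def continuous_map_in_subtopology
  using assms path_space_curry[OF assms(2)] by (auto simp: continuous_map_pairwise o_def)

lemma hofiber_mapD:
  assumes "continuous_map K (hofiber_product X Y Z f g) \<phi>"
  shows "continuous_map K X (\<lambda>x. fst (\<phi> x))" "continuous_map (prod_topology K I01) Z (\<lambda>z. fst (snd (\<phi> (fst z))) (snd z))"
    "continuous_map K Y (\<lambda>x. snd (snd (\<phi> x)))"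
    "x \<in> topspace K \<Longrightarrow> fst (snd (\<phi> x)) 0 = f (fst (\<phi> x))" "x \<in> topspace K \<Longrightarrow> fst (snd (\<phi> x)) 1 = g (snd (snd (\<phi> x)))"
    "x \<in> topspace K \<Longrightarrow> t \<notin> {0..1} \<Longrightarrow> fst (snd (\<phi> x)) t = undefined"
proof -
  have "continuous_map K (prod_topology X (prod_topology (path_space Z) Y)) \<phi> \<and>
      \<phi> \<in> topspace K \<rightarrow> {(x, \<gamma>, y). \<gamma> 0 = f x \<and> \<gamma> 1 = g y}"
    using assms unfolding hofiber_product_def continuous_map_in_subtopology .
  then have a0: "continuous_map K (prod_topology X (prod_topology (path_space Z) Y)) \<phi>"
    and a3: "\<phi> \<in> topspace K \<rightarrow> {(x, \<gamma>, y). \<gamma> 0 = f x \<and> \<gamma> 1 = g y}" by simp_all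
  note a = a0[unfolded continuous_map_pairwise[of K X], THEN conjunct1]
    a0[unfolded continuous_map_pairwise[of K X], THEN conjunct2] Pi_mem[OF a3]
  have b: "continuous_map K (path_space Z) (fst \<circ> (snd \<circ> \<phi>))" "continuous_map K Y (snd \<circ> (snd \<circ> \<phi>))"
    using a(2) unfolding continuous_map_pairwise by auto
  show "continuous_map K X (\<lambda>x. fst (\<phi> x))" using a(1) by (simp add: o_def)
  show "continuous_map (prod_topology K I01) Z (\<lambda>z. fst (snd (\<phi> (fst z))) (snd z))" using path_space_uncurry[OF b(1)] by (simp add: o_def)
  show "continuous_map K Y (\<lambda>x. snd (snd (\<phi> x)))" using b(2) by (simp add: o_def)
  show "fst (snd (\<phi> x)) 0 = f (fst (\<phi> x))" "fst (snd (\<phi> x)) 1 = g (snd (snd (\<phi> x)))" if "x \<in> topspace K"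
    using a(3)[OF that] by (auto simp: case_prod_unfold)
  show "fst (snd (\<phi> x)) t = undefined" if "x \<in> topspace K" "t \<notin> {0..1}"
    using continuous_map_funspace[OF b(1)] that unfolding topspace_path_space by (simp add: Pi_iff)
qed

subsection \<open>The circle\<close>

definition circ :: "real \<Rightarrow> nat \<Rightarrow> real" where
  "circ r = (\<lambda>i. if i = 0 then cos (2 * pi * r) else if i = 1 then sin (2 * pi * r) else 0)"

lemma circ_continuous: "continuous_map I01 (nsphere 1) circ"
proof -
  have "continuous_map I01 euclideanreal (\<lambda>r. circ r i)" for i
    unfolding circ_def by (cases "i = 0"; cases "i = 1") (auto intro!: continuous_intros)
  moreover have "(\<Sum>i\<le>1. (circ r i)\<^sup>2) = 1" for r by (simp add: circ_def)
  ultimately show ?thesis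
    unfolding nsphere by (auto simp: continuous_map_in_subtopology continuous_map_componentwise_UNIV circ_def)
qed

lemma circ_01: "circ 0 = sphere_base" "circ 1 = sphere_base"
  by (auto simp: circ_def sphere_base_def)

lemma circ_inj:
  assumes "circ r = circ r'" "r \<in> {0..1}" "r' \<in> {0..1}"
  shows "r = r' \<or> (r \<in> {0,1} \<and> r' \<in> {0,1})"
proof -
  have "cos (2 * pi * r) = cos (2 * pi * r')" "sin (2 * pi * r) = sin (2 * pi * r')"
    using fun_cong[OF assms(1), of 0] fun_cong[OF assms(1), of 1] by (simp_all add: circ_def)
  then obtain n :: int where "2 * pi * r = 2 * pi * r' + 2 * pi * n" using sin_cos_eq_iff by metis
  then have "2 * pi * r = 2 * pi * (r' + n)" by (simp add: distrib_left)
  then have n: "r = r' + n" by simp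
  then have "n \<le> 1" "-1 \<le> n" using assms(2,3) by auto
  then consider "n = 0" | "n = 1" | "n = -1" by linarith
  then show ?thesis using n assms(2,3) by cases auto
qed

lemma circ_surj: "circ ` {0..1} = topspace (nsphere 1)"
proof
  show "circ ` {0..1} \<subseteq> topspace (nsphere 1)" using circ_continuous continuous_map_funspace by fastforce
  show "topspace (nsphere 1) \<subseteq> circ ` {0..1}"
  proof
    fix x :: "nat \<Rightarrow> real" assume "x \<in> topspace (nsphere 1)"
    then have x: "(x 0)\<^sup>2 + (x 1)\<^sup>2 = 1" "\<And>i. i > 1 \<Longrightarrow> x i = 0" by (auto simp: nsphere)
    obtain t where t: "0 \<le> t" "t < 2*pi" "x 0 = cos t" "x 1 = sin t" using sincos_total_2pi[OF x(1)] by blast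
    have "x = circ (t / (2*pi))"
    proof
      fix i show "x i = circ (t / (2*pi)) i" using t x(2)[of i] by (auto simp: circ_def not_less)
    qed
    moreover have "t / (2*pi) \<in> {0..1}" using t by auto
    ultimately show "x \<in> circ ` {0..1}" by blast
  qed
qed

lemma circ_quotient: "quotient_map I01 (nsphere 1) circ"
proof (rule continuous_imp_quotient_map[OF circ_continuous])
  show "compact_space I01" by (simp add: compact_space_subtopology)
  show "Hausdorff_space (nsphere 1)" unfolding nsphere_def by (intro Hausdorff_space_subtopology Hausdorff_Euclidean_space)
  show "circ ` topspace I01 = topspace (nsphere 1)" using circ_surj by simp
qed

text \<open>The choice of a preimage under \<open>circ\<close> matters only at the base point, whose
  two preimages 0 and 1 have the same value under \<open>\<gamma>\<close>.\<close>

lemma circle_lift: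
  assumes c: "continuous_map I01 T \<gamma>" and e: "\<gamma> 0 = \<gamma> 1"
  shows "\<exists>h. continuous_map (nsphere 1) T h \<and> (\<forall>r\<in>{0..1}. h (circ r) = \<gamma> r)"
proof -
  define h where "h x = \<gamma> (SOME r. r \<in> {0..1} \<and> circ r = x)" for x
  have h: "h (circ r) = \<gamma> r" if r: "r \<in> {0..1}" for r
  proof -
    have "\<exists>r'. r' \<in> {0..1} \<and> circ r' = circ r" using r by blast
    from someI_ex[OF this] have "(SOME r'. r' \<in> {0..1} \<and> circ r' = circ r) = r \<or>
      ((SOME r'. r' \<in> {0..1} \<and> circ r' = circ r) \<in> {0,1} \<and> r \<in> {0,1})" using circ_inj r by blast
    then show ?thesis using e unfolding h_def by (elim disjE) auto
  qed
  have "continuous_map I01 T (h \<circ> circ)" by (rule continuous_map_eq[OF c]) (simp add: h)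
  then have "continuous_map (nsphere 1) T h" by (simp add: continuous_compose_quotient_map_eq[OF circ_quotient])
  then show ?thesis using h by blast
qed

text \<open>The product of \<open>circ\<close> with the locally compact Hausdorff interval is still
  a quotient map, so a map of the square that is constant on two opposite sides descends to a
  pointed homotopy on the circle.\<close>

lemma circle_homotopy:
  assumes H: "continuous_map (prod_topology I01 I01) T H"
    and e: "\<And>\<sigma>. \<sigma> \<in> {0..1} \<Longrightarrow> H (\<sigma>,0) = y" "\<And>\<sigma>. \<sigma> \<in> {0..1} \<Longrightarrow> H (\<sigma>,1) = y"
    and g0: "\<And>r. r \<in> {0..1} \<Longrightarrow> g0 (circ r) = H (0,r)" and g1: "\<And>r. r \<in> {0..1} \<Longrightarrow> g1 (circ r) = H (1,r)"
  shows "homotopic_with (\<lambda>\<phi>. \<phi> sphere_base = y) (nsphere 1) T g0 g1"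
proof -
  have "compact_space I01" by (simp add: compact_space_subtopology)
  then have lc: "locally_compact_space I01" and Hd: "Hausdorff_space I01"
    by (auto simp: compact_imp_locally_compact_space Hausdorff_space_subtopology)
  have q: "quotient_map (prod_topology I01 I01) (prod_topology I01 (nsphere 1)) (\<lambda>(x,y). (x, circ y))"
    by (rule quotient_map_prod_right[OF lc _ circ_quotient]) (use Hd in blast)
  define h where "h z = H (fst z, (SOME r. r \<in> {0..1} \<and> circ r = snd z))" for z
  have h: "h (\<sigma>, circ r) = H (\<sigma>, r)" if r: "r \<in> {0..1}" and s: "\<sigma> \<in> {0..1}" for r \<sigma>
  proof -
    have "\<exists>r'. r' \<in> {0..1} \<and> circ r' = circ r" using r by blast
    from someI_ex[OF this] have "(SOME r'. r' \<in> {0..1} \<and> circ r' = circ r) = r \<or>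
      ((SOME r'. r' \<in> {0..1} \<and> circ r' = circ r) \<in> {0,1} \<and> r \<in> {0,1})" using circ_inj r by blast
    then show ?thesis using e[OF s] unfolding h_def by (elim disjE) auto
  qed
  have "continuous_map (prod_topology I01 I01) T (h \<circ> (\<lambda>(x,y). (x, circ y)))"
    by (rule continuous_map_eq[OF H]) (auto simp: h)
  then have hc: "continuous_map (prod_topology I01 (nsphere 1)) T h"
    by (rule continuous_compose_quotient_map_eq[OF q, THEN iffD1])
  have b: "sphere_base \<in> topspace (nsphere 1)" using in_topspace_nsphere by (simp add: sphere_base_def)
  have ex: "\<exists>r\<in>{0..1}. x = circ r" if "x \<in> topspace (nsphere 1)" for x using that circ_surj by blast
  show ?thesis
  proof (subst homotopic_with, use b in simp, intro exI[of _ h] conjI ballI hc)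
    fix x assume "x \<in> topspace (nsphere 1)"
    then obtain r where r: "r \<in> {0..1}" "x = circ r" using ex by blast
    show "h (0,x) = g0 x" "h (1,x) = g1 x" using h[OF r(1), of 0] h[OF r(1), of 1] g0[OF r(1)] g1[OF r(1)] r(2) by auto
  next
    fix t :: real assume "t \<in> {0..1}"
    then show "h (t, sphere_base) = y" using h[of 0 t] e(1) circ_01(1) by simp
  qed
qed

text \<open>Both edges are deformed to the diagonal of the square, the edge at height 1 by lowering
  the second coordinate, the right edge by lowering the first. The end points of the loops then move
  along the bottom and left edges, where \<open>Q\<close> is \<open>y\<close>, or stay at the corner
  (1,1).\<close>

lemma square_homotopy:
  assumes Q: "continuous_map (prod_topology I01 I01) T Q"
    and e: "\<And>\<sigma>. \<sigma> \<in> {0..1} \<Longrightarrow> Q (\<sigma>,0) = y" "\<And>\<sigma>. \<sigma> \<in> {0..1} \<Longrightarrow> Q (0,\<sigma>) = y" "Q (1,1) = y"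
    and g0: "\<And>r. r \<in> {0..1} \<Longrightarrow> g0 (circ r) = Q (r,1)" and g1: "\<And>r. r \<in> {0..1} \<Longrightarrow> g1 (circ r) = Q (1,r)"
  shows "homotopic_with (\<lambda>\<phi>. \<phi> sphere_base = y) (nsphere 1) T g0 g1"
proof -
  have pc: "continuous_map (prod_topology I01 I01) T (\<lambda>z. Q (u z, v z))"
    if "continuous_on ({0..1} \<times> {0..1}) u" "continuous_on ({0..1} \<times> {0..1}) v"
      "\<And>z. z \<in> {0..1} \<times> {0..1} \<Longrightarrow> u z \<in> {0..1}" "\<And>z. z \<in> {0..1} \<times> {0..1} \<Longrightarrow> v z \<in> {0..1}" for u v :: "real \<times> real \<Rightarrow> real"
  proof -
    have "continuous_map (prod_topology I01 I01) (prod_topology I01 I01) (\<lambda>z. (u z, v z))"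
      using that by (auto simp: continuous_map_pairwise o_def continuous_map_in_subtopology
        prod_topology_subtopology_eu euclidean_product_topology intro!: continuous_intros)
    from continuous_map_compose[OF this Q] show ?thesis by (simp add: o_def)
  qed
  have sm: "0 \<le> s * (1 - r)" "s * (1 - r) \<le> 1 - r" "s * (1-r) \<le> 1" if "s \<in> {0..1}" "r \<in> {0..1}" for s r :: real
    using that mult_left_le_one_le[of "1 - r" s] by auto
  have cQ: "continuous_map I01 T (\<lambda>r. Q (r,r))"
  proof -
    have "continuous_map I01 (prod_topology I01 I01) (\<lambda>r. (r,r))"
      by (auto simp: continuous_map_pairwise o_def intro!: continuous_intros)
    from continuous_map_compose[OF this Q] show ?thesis by (simp add: o_def)
  qed
  have "Q (0,0) = Q (1,1)" using e(1)[of 0] e(3) by simp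
  from circle_lift[OF cQ this] obtain d where "\<forall>r\<in>{0..1}. d (circ r) = Q (r,r)" by blast
  note d = bspec[OF this]
  have 1: "homotopic_with (\<lambda>\<phi>. \<phi> sphere_base = y) (nsphere 1) T g0 d"
  proof (rule circle_homotopy[where H = "\<lambda>z. Q (snd z, 1 - fst z * (1 - snd z))"])
    show "continuous_map (prod_topology I01 I01) T (\<lambda>z. Q (snd z, 1 - fst z * (1 - snd z)))"
      by (rule pc) (auto intro!: continuous_intros simp: sm)
  qed (use e d g0 in auto)
  have 2: "homotopic_with (\<lambda>\<phi>. \<phi> sphere_base = y) (nsphere 1) T d g1"
  proof (rule circle_homotopy[where H = "\<lambda>z. Q (snd z + fst z * (1 - snd z), snd z)"])
    show "continuous_map (prod_topology I01 I01) T (\<lambda>z. Q (snd z + fst z * (1 - snd z), snd z))"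
    proof (rule pc)
      fix z :: "real \<times> real" assume "z \<in> {0..1} \<times> {0..1}"
      then show "snd z + fst z * (1 - snd z) \<in> {0..1}" using sm[of "fst z" "snd z"] by (auto simp: mem_Times_iff)
    qed (auto intro!: continuous_intros)
  qed (use e d g1 in auto)
  show ?thesis by (rule homotopic_with_trans[OF 1 2])
qed

context cgroupoid
begin

lemma contractible_square: "contractible_space (prod_topology I01 I01)"
  by (simp add: convex_imp_contractible convex_Times)

text \<open>A section over the whole contractible square restricts to a constant one along each side
  on which \<open>\<alpha>\<close> is constant. It agrees with \<open>m0\<close> and
  \<open>m1\<close> on the other two sides, so their end values coincide.\<close>

lemma monodromy_invariant:
  assumes \<alpha>: "continuous_map (prod_topology I01 I01) B \<alpha>"
    and e: "\<And>\<sigma>. \<sigma> \<in> {0..1} \<Longrightarrow> \<alpha> (\<sigma>,0) = q" "\<And>\<sigma>. \<sigma> \<in> {0..1} \<Longrightarrow> \<alpha> (\<sigma>,1) = q"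
    and m0: "sec G I01 (\<lambda>r. \<alpha> (0,r)) a m0" and m1: "sec G I01 (\<lambda>r. \<alpha> (1,r)) a m1" and m: "m0 0 = m1 0"
  shows "m0 1 = m1 1"
proof -
  have z: "(0,0) \<in> topspace (prod_topology I01 I01)" by simp
  have "m0 0 \<in> Hom a (lead G (\<alpha> (0,0)))" using secD(2)[OF m0, of 0] by simp
  then obtain M where M: "sec G (prod_topology I01 I01) \<alpha> a M" "M (0,0) = m0 0"
    using sec_contractible[OF contractible_square \<alpha> z] by blast
  have cs: "continuous_map I01 (prod_topology I01 I01) (\<lambda>r. (c,r))" "continuous_map I01 (prod_topology I01 I01) (\<lambda>r. (r,c))" if "c \<in> {0..1}" for c
    using that by (auto simp: continuous_map_pairwise o_def intro!: continuous_intros)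
  have col: "M (\<sigma>,c) = M (0,c)" if "c \<in> {0,1}" "\<sigma> \<in> {0..1}" for c \<sigma>
  proof -
    have c: "c \<in> {0..1}" using that by auto
    have s: "sec G I01 (\<lambda>_. q) a (\<lambda>r. M (r,c))"
      by (rule sec_cong[OF sec_pull[OF M(1) cs(2)[OF c]]]) (use e that in auto)
    have q: "q \<in> topspace B" using secD(4)[OF s, of 0] by simp
    have h: "M (0,c) \<in> Hom a (lead G q)" using secD(2)[OF s, of 0] by simp
    show ?thesis by (rule sec_unique[OF s sec_const[OF q h] connected_I01, of 0 \<sigma>]) (use that in auto)
  qed
  have r0: "M (0,1) = m0 1"
    by (rule sec_unique[OF sec_pull[OF M(1) cs(1)[of 0]] m0 connected_I01, of 0 1]) (use M(2) in auto)
  have r1: "M (1,1) = m1 1"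
    by (rule sec_unique[OF sec_pull[OF M(1) cs(1)[of 1]] m1 connected_I01, of 0 1]) (use M(2) m col[of 0 1] in auto)
  show ?thesis using r0 r1 col[of 1 1] by simp
qed

lemma splice_path:
  assumes p: "p \<in> topspace B" and q: "q \<in> topspace B" and m: "m \<in> Hom (lead G p) (lead G q)"
  shows "continuous_map I01 B (splice G p q m)"
proof -
  have "continuous_map I01 (prod_topology I01 I01) (\<lambda>r. (0,r))"
    by (auto simp: continuous_map_pairwise o_def intro!: continuous_intros)
  from continuous_map_compose[OF this splice_continuous[OF p sec_const[OF q m]]] show ?thesis by (simp add: o_def)
qed

lemma sec_interval:
  assumes g: "continuous_map I01 B g" and n: "n \<in> Hom a (lead G (g 0))"
  shows "\<exists>m. sec G I01 g a m \<and> m 0 = n"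
  by (rule sec_contractible[where g = g and x = 0, OF _ g _ n]) (auto simp: convex_imp_contractible)

text \<open>A section over the sphere that is the identity at the base point lets every
  \<open>g x\<close> be spliced with \<open>p\<close>. At time 0 this is \<open>p\<close>, at time 1
  it is \<open>g x\<close>, and over the base point it is constant.\<close>

lemma sphere_null:
  assumes k: "k \<ge> 2" and g: "continuous_map (nsphere k) B g" "g sphere_base = p" and p: "p \<in> topspace B"
  shows "homotopic_with (\<lambda>\<phi>. \<phi> sphere_base = p) (nsphere k) B (\<lambda>_. p) g"
proof -
  have id: "cid G (lead G p) \<in> Hom (lead G p) (lead G (g sphere_base))" using g(2) id_hom[OF lead_ob[OF p]] by simp
  obtain m where m: "sec G (nsphere k) g (lead G p) m" "m sphere_base = cid G (lead G p)"
    using sec_sphere[OF k g(1) id] by blast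
  note jc = splice_continuous[OF p m(1)]
  have "continuous_map (prod_topology I01 (nsphere k)) (prod_topology (nsphere k) I01) (\<lambda>z. (snd z, fst z))"
    by (simp add: continuous_map_pairwise o_def continuous_map_fst continuous_map_snd)
  from continuous_map_compose[OF this jc]
  have c: "continuous_map (prod_topology I01 (nsphere k)) B (\<lambda>z. splice G p (g (snd z)) (m (snd z)) (fst z))" by (simp add: o_def)
  show ?thesis
  proof (subst homotopic_with, use sphere_base_in in simp, intro exI conjI ballI, rule c)
    fix x assume x: "x \<in> topspace (nsphere k)"
    show "splice G p (g (snd (0::real,x))) (m (snd (0::real,x))) (fst (0,x)) = p" using splice_0[OF p] by simp
    show "splice G p (g (snd (1::real,x))) (m (snd (1::real,x))) (fst (1,x)) = g x" using splice_1[OF secD(4)[OF m(1) x] secD(2)[OF m(1) x]] by simp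
  next
    fix t :: real
    show "splice G p (g (snd (t,sphere_base))) (m (snd (t,sphere_base))) (fst (t,sphere_base)) = p" using splice_id[OF p] g(2) m(2) by simp
  qed
qed

text \<open>Every loop is homotopic to a standard one that depends only on its monodromy
  \<open>m 1\<close>. The splices of \<open>p\<close> with the points of \<open>h\<close> form a
  square with \<open>p\<close> on the bottom and left sides, \<open>h\<close> on top, and the
  splices along the monodromy on the right.\<close>

lemma loop_splice:
  assumes h: "continuous_map (nsphere 1) B h" "h sphere_base = p" and p: "p \<in> topspace B"
    and m: "sec G I01 (\<lambda>r. h (circ r)) (lead G p) m" "m 0 = cid G (lead G p)"
    and j: "\<And>r. r \<in> {0..1} \<Longrightarrow> j (circ r) = splice G p p (m 1) r"
  shows "homotopic_with (\<lambda>\<phi>. \<phi> sphere_base = p) (nsphere 1) B h j"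
proof (rule square_homotopy[OF splice_continuous[OF p m(1)]])
  have m1: "m 1 \<in> Hom (lead G p) (lead G p)" using secD(2)[OF m(1), of 1] circ_01 h(2) by simp
  fix r :: real assume r: "r \<in> {0..1}"
  show "splice G p (h (circ (fst (r,0)))) (m (fst (r,0::real))) (snd (r,0)) = p" using splice_0[OF p] by simp
  show "splice G p (h (circ (fst (0,r)))) (m (fst (0,r))) (snd (0,r)) = p" using splice_id[OF p] circ_01 h(2) m(2) by simp
  show "h (circ r) = splice G p (h (circ (fst (r,1)))) (m (fst (r,1::real))) (snd (r,1))"
    using splice_1[OF secD(4)[OF m(1)] secD(2)[OF m(1)], of r] r by simp
  show "j (circ r) = splice G p (h (circ (fst (1,r)))) (m (fst (1,r))) (snd (1,r))" using j[OF r] circ_01 h(2) by simp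
next
  have m1: "m 1 \<in> Hom (lead G p) (lead G p)" using secD(2)[OF m(1), of 1] circ_01 h(2) by simp
  show "splice G p (h (circ (fst (1,1)))) (m (fst (1,1::real))) (snd (1,1)) = p" using splice_1[OF p m1] circ_01 h(2) by simp
qed

end

section \<open>2-pullbacks of groupoids give homotopy pullbacks\<close>

lemma (in cgroupoid) vertex_point:
  assumes "w \<in> cob G"
  shows "\<exists>p\<in>topspace B. lead G p = w"
proof -
  define t :: "nat \<Rightarrow> real" where "t = (\<lambda>i. if i = 0 then 1 else 0)"
  have t: "t \<in> standard_simplex 0" by (auto simp: standard_simplex_def t_def)
  have x: "((0, (w, [])), t) \<in> topspace (real_sum G)" using assms t by (simp add: topspace_real_sum nerve_def)
  have "idx t 0 = 0" using idx0[OF t, of 0] by simp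
  then show ?thesis using cls_in[OF x] lead_cls[OF x] by (auto simp: leadr_def nvert_def)
qed

lemma continuous_map_pairI:
  "continuous_map K X f \<Longrightarrow> continuous_map K Y g \<Longrightarrow> continuous_map K (prod_topology X Y) (\<lambda>x. (f x, g x))"
  by (simp add: continuous_map_pairwise o_def)

text \<open>The last two axioms say that \<open>G\<close> is equivalent, by its two projections, to
  the groupoid of triples of an object of \<open>X\<close>, an object of \<open>Y\<close> and an
  arrow of \<open>Z\<close> between their images. The square commutes strictly, so objects of
  \<open>G\<close> give triples with an identity arrow, and a morphism between such triples is a
  pair \<open>a\<close>, \<open>b\<close> with equal images.\<close>

locale gpd_pullback =
  P1: cfunctor G X p1o p1m + P2: cfunctor G Y p2o p2m + F1: cfunctor X Z fo fm + F2: cfunctor Y Z go gm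
  for G :: "('a,'m) catg" and X :: "('b,'n) catg" and Y :: "('c,'k) catg" and Z :: "('d,'l) catg"
    and p1o p1m p2o p2m fo fm go gm +
  assumes comm_o: "w \<in> cob G \<Longrightarrow> fo (p1o w) = go (p2o w)"
    and comm_m: "m \<in> cmor G \<Longrightarrow> fm (p1m m) = gm (p2m m)"
    and ess_surj: "x \<in> cob X \<Longrightarrow> y \<in> cob Y \<Longrightarrow> \<phi> \<in> chom Z (fo x) (go y) \<Longrightarrow>
      \<exists>w\<in>cob G. \<exists>a\<in>chom X (p1o w) x. \<exists>b\<in>chom Y (p2o w) y. ccomp Z \<phi> (fm a) = gm b"
    and fully_faithful: "w \<in> cob G \<Longrightarrow> w' \<in> cob G \<Longrightarrow> a \<in> chom X (p1o w) (p1o w') \<Longrightarrow>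
      b \<in> chom Y (p2o w) (p2o w') \<Longrightarrow> fm a = gm b \<Longrightarrow> \<exists>!c. c \<in> chom G w w' \<and> p1m c = a \<and> p2m c = b"
begin

abbreviation "BG \<equiv> classifying_space G"
abbreviation "BX \<equiv> classifying_space X"
abbreviation "BY \<equiv> classifying_space Y"
abbreviation "BZ \<equiv> classifying_space Z"
abbreviation "b1 \<equiv> classifying_map X p1o p1m"
abbreviation "b2 \<equiv> classifying_map Y p2o p2m"
abbreviation "bf \<equiv> classifying_map Z fo fm"
abbreviation "bg \<equiv> classifying_map Z go gm"
abbreviation "E \<equiv> hofiber_product BX BY BZ bf bg"

definition ept where "ept p = (b1 p, (\<lambda>t::real. if t \<in> {0..1} then bf (b1 p) else undefined), b2 p)"

lemma comm_point:
  assumes p: "p \<in> topspace BG"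
  shows "bf (b1 p) = bg (b2 p)"
proof -
  let ?x = "rep p"
  have x: "?x \<in> topspace (real_sum G)" using P1.X.rep_props(1)[OF p] .
  have eq: "fpt fo fm (fpt p1o p1m ?x) = fpt go gm (fpt p2o p2m ?x)"
  proof -
    obtain n s t where xx: "?x = ((n,s),t)" by (metis prod.collapse)
    have "fst s \<in> cob G" "set (snd s) \<subseteq> cmor G" using x xx by (auto simp: topspace_real_sum nerve_def)
    then show ?thesis using comm_o comm_m by (auto simp: fpt_def xx)
  qed
  have "bf (b1 p) = cls Z (fpt fo fm (fpt p1o p1m ?x))"
    unfolding P1.BF_rep using F1.BF_cls[OF P1.fpt_in[OF x]] .
  moreover have "bg (b2 p) = cls Z (fpt go gm (fpt p2o p2m ?x))"
    unfolding P2.BF_rep using F2.BF_cls[OF P2.fpt_in[OF x]] .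
  ultimately show ?thesis using eq by simp
qed

lemma leads:
  assumes p: "p \<in> topspace BG"
  shows "lead X (b1 p) = p1o (lead G p)" "lead Y (b2 p) = p2o (lead G p)"
    "lead Z (bf (b1 p)) = fo (p1o (lead G p))" "lead Z (bf (b1 p)) = go (p2o (lead G p))"
    "b1 p \<in> topspace BX" "b2 p \<in> topspace BY" "bf (b1 p) \<in> topspace BZ" "lead G p \<in> cob G"
  using P1.lead_BF[OF p] P2.lead_BF[OF p] F1.lead_BF[OF P1.BF_in[OF p]] P1.BF_in[OF p] P2.BF_in[OF p]
    F1.BF_in[OF P1.BF_in[OF p]] P1.X.lead_ob[OF p] comm_o[OF P1.X.lead_ob[OF p]] by simp_all

lemma ept_continuous: "continuous_map BG E ept"
proof -
  have "continuous_map (prod_topology BG I01) BZ (\<lambda>z. bf (b1 (fst z)))"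
    using continuous_map_compose[OF continuous_map_compose[OF continuous_map_fst P1.BF_continuous] F1.BF_continuous]
    by (simp add: o_def)
  from hofiber_mapI[OF P1.BF_continuous this P2.BF_continuous, of bf bg]
  show ?thesis unfolding ept_def[abs_def] using comm_point by (simp cong: if_cong)
qed

text \<open>Lifts of all three components of a map into \<open>E\<close>, with base objects taken
  from one point \<open>p\<close> of the classifying space of \<open>G\<close>. Compatibility at
  both ends of the path is what allows the three components to be spliced simultaneously.\<close>

definition trivialised where
  "trivialised K \<phi> p mX M mY \<longleftrightarrow> continuous_map K E \<phi> \<and> p \<in> topspace BG \<and>
     sec X K (\<lambda>x. fst (\<phi> x)) (lead X (b1 p)) mX \<and>
     sec Y K (\<lambda>x. snd (snd (\<phi> x))) (lead Y (b2 p)) mY \<and>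
     sec Z (prod_topology K I01) (\<lambda>z. fst (snd (\<phi> (fst z))) (snd z)) (lead Z (bf (b1 p))) M \<and>
     (\<forall>x\<in>topspace K. M (x,0) = fm (mX x) \<and> M (x,1) = gm (mY x))"

text \<open>The deformation of the constant value \<open>ept p\<close> at time 0 into
  \<open>\<phi>\<close> at time 1, by splicing in all three spaces at once; the path component is
  spliced separately at each of its times \<open>t\<close>.\<close>

definition Q where
  "Q \<phi> p mX M mY z = (splice X (b1 p) (fst (\<phi> (fst z))) (mX (fst z)) (snd z),
     (\<lambda>t::real. if t \<in> {0..1} then splice Z (bf (b1 p)) (fst (snd (\<phi> (fst z))) t) (M (fst z, t)) (snd z) else undefined),
     splice Y (b2 p) (snd (snd (\<phi> (fst z)))) (mY (fst z)) (snd z))"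

lemma trivialisedD:
  assumes "trivialised K \<phi> p mX M mY"
  shows "continuous_map K E \<phi>" "p \<in> topspace BG"
     "sec X K (\<lambda>x. fst (\<phi> x)) (lead X (b1 p)) mX"
     "sec Y K (\<lambda>x. snd (snd (\<phi> x))) (lead Y (b2 p)) mY"
     "sec Z (prod_topology K I01) (\<lambda>z. fst (snd (\<phi> (fst z))) (snd z)) (lead Z (bf (b1 p))) M"
     "x \<in> topspace K \<Longrightarrow> M (x,0) = fm (mX x)" "x \<in> topspace K \<Longrightarrow> M (x,1) = gm (mY x)"
  using assms unfolding trivialised_def by blast+

text \<open>The spliced paths end at the images of the spliced points because functors commute with
  splicing and the lift over \<open>Z\<close> restricts at both ends to the images of the lifts over
  \<open>X\<close> and \<open>Y\<close>.\<close>

lemma Q_continuous: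
  assumes T: "trivialised K \<phi> p mX M mY"
  shows "continuous_map (prod_topology K I01) E (Q \<phi> p mX M mY)"
proof -
  note d = trivialisedD[OF T] and e = hofiber_mapD[OF trivialisedD(1)[OF T]] and l = leads[OF trivialisedD(2)[OF T]]
  note c1 = P1.Z.splice_continuous[OF l(5) d(3)] and c2 = P2.Z.splice_continuous[OF l(6) d(4)]
    and c3 = F1.Z.splice_continuous[OF l(7) d(5)]
  \<comment> \<open>The path time is a lifting parameter for the section over \<open>Z\<close> but
    the outermost variable of the path component, so it has to change places with the splicing
    time.\<close>
  have re: "continuous_map (prod_topology (prod_topology K I01) I01) (prod_topology (prod_topology K I01) I01)
     (\<lambda>w. ((fst (fst w), snd w), snd (fst w)))"
  proof -
    have f: "continuous_map (prod_topology (prod_topology K I01) I01) K (\<lambda>w. fst (fst w))"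
      "continuous_map (prod_topology (prod_topology K I01) I01) I01 (\<lambda>w. snd (fst w))"
      using continuous_map_compose[OF continuous_map_fst continuous_map_fst, of K I01 I01]
        continuous_map_compose[OF continuous_map_fst continuous_map_snd, of K I01 I01] by (simp_all add: o_def)
    have "continuous_map (prod_topology (prod_topology K I01) I01) (prod_topology K I01) (\<lambda>w. (fst (fst w), snd w))"
      by (rule continuous_map_pairI[OF f(1) continuous_map_snd])
    then show ?thesis using f(2) by (rule continuous_map_pairI)
  qed
  let ?\<Gamma> = "\<lambda>w. splice Z (bf (b1 p)) (fst (snd (\<phi> (fst (fst w)))) (snd w)) (M (fst (fst w), snd w)) (snd (fst w))"
  have c4: "continuous_map (prod_topology (prod_topology K I01) I01) BZ ?\<Gamma>"
    using continuous_map_compose[OF re c3] by (simp add: o_def)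
  have "continuous_map (prod_topology K I01) E (\<lambda>z. (splice X (b1 p) (fst (\<phi> (fst z))) (mX (fst z)) (snd z),
     (\<lambda>t. if t \<in> {0..1} then ?\<Gamma> (z,t) else undefined),
     splice Y (b2 p) (snd (snd (\<phi> (fst z)))) (mY (fst z)) (snd z)))"
  proof (rule hofiber_mapI[OF c1 c4 c2])
    fix z assume z: "z \<in> topspace (prod_topology K I01)"
    then have x: "fst z \<in> topspace K" and t: "snd z \<in> {0..1}" by auto
    show "?\<Gamma> (z,0) = bf (splice X (b1 p) (fst (\<phi> (fst z))) (mX (fst z)) (snd z))"
      using F1.BF_splice[OF l(5) P1.Z.secD(4)[OF d(3) x] P1.Z.secD(2)[OF d(3) x] t] e(4)[OF x] d(6)[OF x] by simp
    show "?\<Gamma> (z,1) = bg (splice Y (b2 p) (snd (snd (\<phi> (fst z)))) (mY (fst z)) (snd z))"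
      using F2.BF_splice[OF l(6) P2.Z.secD(4)[OF d(4) x] P2.Z.secD(2)[OF d(4) x] t] e(5)[OF x] d(7)[OF x] comm_point[OF d(2)] by simp
  qed
  then show ?thesis unfolding Q_def[abs_def] by (simp only: fst_conv snd_conv)
qed

lemma Q_0:
  assumes T: "trivialised K \<phi> p mX M mY"
  shows "Q \<phi> p mX M mY (x,0) = ept p"
  using leads[OF trivialisedD(2)[OF T]] P1.Z.splice_0 P2.Z.splice_0 F1.Z.splice_0 by (simp add: Q_def ept_def cong: if_cong)

lemma Q_1:
  assumes T: "trivialised K \<phi> p mX M mY" and x: "x \<in> topspace K"
  shows "Q \<phi> p mX M mY (x,1) = \<phi> x"
proof -
  note d = trivialisedD[OF T] and e = hofiber_mapD[OF trivialisedD(1)[OF T]]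
  have m: "(\<lambda>t. if t \<in> {0..1} then splice Z (bf (b1 p)) (fst (snd (\<phi> x)) t) (M (x, t)) 1 else undefined) = fst (snd (\<phi> x))"
  proof
    fix t :: real
    show "(if t \<in> {0..1} then splice Z (bf (b1 p)) (fst (snd (\<phi> x)) t) (M (x, t)) 1 else undefined) = fst (snd (\<phi> x)) t"
    proof (cases "t \<in> {0..1}")
      case True
      then have z: "(x,t) \<in> topspace (prod_topology K I01)" using x by simp
      show ?thesis using F1.Z.splice_1[OF F1.Z.secD(4)[OF d(5) z] F1.Z.secD(2)[OF d(5) z]] True by simp
    next
      case False show ?thesis by (simp only: False if_False e(6)[OF x False])
    qed
  qed
  have "splice X (b1 p) (fst (\<phi> x)) (mX x) 1 = fst (\<phi> x)" by (rule P1.Z.splice_1[OF P1.Z.secD(4)[OF d(3) x] P1.Z.secD(2)[OF d(3) x]])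
  moreover have "splice Y (b2 p) (snd (snd (\<phi> x))) (mY x) 1 = snd (snd (\<phi> x))" by (rule P2.Z.splice_1[OF P2.Z.secD(4)[OF d(4) x] P2.Z.secD(2)[OF d(4) x]])
  ultimately show ?thesis unfolding Q_def fst_conv snd_conv m by simp
qed

text \<open>Over a point in the image of \<open>ept\<close> the path is constant, so the lift along
  it is constant. Hence the lifts in \<open>X\<close> and \<open>Y\<close> have the same image in
  \<open>Z\<close>, and \<open>fully_faithful\<close> produces an arrow of \<open>G\<close>.\<close>

lemma end_morphism:
  assumes T: "trivialised K \<phi> p mX M mY" and x: "x \<in> topspace K" and p': "p' \<in> topspace BG" and \<phi>: "\<phi> x = ept p'"
  shows "\<exists>c\<in>chom G (lead G p) (lead G p'). mX x = p1m c \<and> mY x = p2m c \<and> (\<forall>t\<in>{0..1}. M (x,t) = fm (p1m c))"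
proof -
  note d = trivialisedD[OF T] and l = leads[OF trivialisedD(2)[OF T]] and l' = leads[OF p']
  have "continuous_map I01 (prod_topology K I01) (\<lambda>t. (x,t))" using x by (simp add: continuous_map_pairwise o_def)
  note s = F1.Z.sec_pull[OF d(5) this]
  have s': "sec Z I01 (\<lambda>_. bf (b1 p')) (lead Z (bf (b1 p))) (\<lambda>t. M (x,t))"
    by (rule F1.Z.sec_cong[OF s]) (simp_all add: \<phi> ept_def)
  have h: "M (x,0) \<in> chom Z (lead Z (bf (b1 p))) (lead Z (bf (b1 p')))" using F1.Z.secD(2)[OF s', of 0] by simp
  have const: "M (x,t) = M (x,0)" if "t \<in> {0..1}" for t
    by (rule F1.Z.sec_unique[OF s' F1.Z.sec_const[OF l'(7) h] connected_I01, of 0 t]) (use that in auto)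
  have a: "mX x \<in> chom X (p1o (lead G p)) (p1o (lead G p'))" using P1.Z.secD(2)[OF d(3) x] l(1) l'(1) by (simp add: \<phi> ept_def)
  have b: "mY x \<in> chom Y (p2o (lead G p)) (p2o (lead G p'))" using P2.Z.secD(2)[OF d(4) x] l(2) l'(2) by (simp add: \<phi> ept_def)
  have "fm (mX x) = gm (mY x)" using d(6)[OF x] d(7)[OF x] const[of 1] by simp
  from fully_faithful[OF l(8) l'(8) a b this]
  obtain c where c: "c \<in> chom G (lead G p) (lead G p')" "p1m c = mX x" "p2m c = mY x" by blast
  then show ?thesis using const d(6)[OF x] by (intro bexI[of _ c]) simp_all
qed

text \<open>When the three lifts come from one arrow of \<open>G\<close>, the deformation stays in
  the image of \<open>ept\<close>, since functors commute with splicing.\<close>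

lemma Q_ept:
  assumes T: "trivialised K \<phi> p mX M mY" and x: "x \<in> topspace K" and p': "p' \<in> topspace BG" and \<phi>: "\<phi> x = ept p'"
    and c: "c \<in> chom G (lead G p) (lead G p')" "mX x = p1m c" "mY x = p2m c" "\<forall>t\<in>{0..1}. M (x,t) = fm (p1m c)"
    and \<tau>: "\<tau> \<in> {0..1}"
  shows "Q \<phi> p mX M mY (x,\<tau>) = ept (splice G p p' c \<tau>)"
proof -
  note d = trivialisedD[OF T] and l = leads[OF trivialisedD(2)[OF T]] and l' = leads[OF p']
  have 1: "b1 (splice G p p' c \<tau>) = splice X (b1 p) (b1 p') (p1m c) \<tau>" by (rule P1.BF_splice[OF d(2) p' c(1) \<tau>])
  have 2: "b2 (splice G p p' c \<tau>) = splice Y (b2 p) (b2 p') (p2m c) \<tau>" by (rule P2.BF_splice[OF d(2) p' c(1) \<tau>])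
  have m: "p1m c \<in> chom X (lead X (b1 p)) (lead X (b1 p'))" using P1.F_hom[OF c(1)] l(1) l'(1) by simp
  have 3: "bf (splice X (b1 p) (b1 p') (p1m c) \<tau>) = splice Z (bf (b1 p)) (bf (b1 p')) (fm (p1m c)) \<tau>" by (rule F1.BF_splice[OF l(5) l'(5) m \<tau>])
  show ?thesis using c(2-4) unfolding Q_def ept_def fst_conv snd_conv \<phi> 1 2 3 by (auto simp: fun_eq_iff)
qed

text \<open>The arrow of \<open>G\<close> behind the lifts has identity components in
  \<open>X\<close> and \<open>Y\<close>. By the uniqueness in \<open>fully_faithful\<close> it is
  the identity, and splicing along it is constant.\<close>

lemma Q_base:
  assumes T: "trivialised K \<phi> p mX M mY" and x: "x \<in> topspace K" and \<phi>: "\<phi> x = ept p"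
    and id: "mX x = cid X (lead X (b1 p))" "mY x = cid Y (lead Y (b2 p))" and \<tau>: "\<tau> \<in> {0..1}"
  shows "Q \<phi> p mX M mY (x,\<tau>) = ept p"
proof -
  note p = trivialisedD(2)[OF T] and l = leads[OF trivialisedD(2)[OF T]]
  obtain c where c: "c \<in> chom G (lead G p) (lead G p)" "mX x = p1m c" "mY x = p2m c" "\<forall>t\<in>{0..1}. M (x,t) = fm (p1m c)"
    using end_morphism[OF T x p \<phi>] by blast
  have i: "cid G (lead G p) \<in> chom G (lead G p) (lead G p)" "p1m (cid G (lead G p)) = p1m c" "p2m (cid G (lead G p)) = p2m c"
    using P1.X.id_hom[OF l(8)] P1.F_id[OF l(8)] P2.F_id[OF l(8)] l(1,2) c(2,3) id by simp_all
  have "fm (p1m c) = gm (p2m c)" using comm_m c(1) by (simp add: chom_def)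
  from fully_faithful[OF l(8) l(8) P1.F_hom[OF c(1)] P2.F_hom[OF c(1)] this] have "c = cid G (lead G p)" using c(1) i by blast
  then show ?thesis using Q_ept[OF T x p \<phi> c \<tau>] P1.X.splice_id[OF p] by simp
qed

text \<open>The lift over \<open>X\<close> is mapped to \<open>Z\<close> and continued along the
  paths by homotopy lifting. At their ends it has to match the image of the lift over
  \<open>Y\<close>: both are sections over the connected space \<open>K\<close>, and they agree at
  \<open>x\<close>, where the path is constant and both lifts are identities.\<close>

lemma trivialisation_exists:
  assumes K: "connected_space K" and x: "x \<in> topspace K" and \<phi>: "continuous_map K E \<phi>" "\<phi> x = ept p" and p: "p \<in> topspace BG"
    and mX: "sec X K (\<lambda>x. fst (\<phi> x)) (lead X (b1 p)) mX" "mX x = cid X (lead X (b1 p))"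
    and mY: "sec Y K (\<lambda>x. snd (snd (\<phi> x))) (lead Y (b2 p)) mY" "mY x = cid Y (lead Y (b2 p))"
  shows "\<exists>M. trivialised K \<phi> p mX M mY"
proof -
  note e = hofiber_mapD[OF \<phi>(1)] and l = leads[OF p]
  let ?g = "\<lambda>z. fst (snd (\<phi> (fst z))) (snd z)" let ?a = "lead Z (bf (b1 p))"
  have s0: "sec Z K (\<lambda>x. ?g (x,0)) ?a (\<lambda>x. fm (mX x))"
  proof -
    have "sec Z K (\<lambda>x. bf (fst (\<phi> x))) ?a (\<lambda>x. fm (mX x))" using F1.sec_BF[OF mX(1)] l(1,3) by simp
    then show ?thesis by (rule F1.Z.sec_cong) (simp_all add: e(4))
  qed
  obtain M where M: "sec Z (prod_topology K I01) ?g ?a M" "\<forall>x\<in>topspace K. M (x,0) = fm (mX x)"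
    using F1.Z.sec_homotopy[OF e(2) s0] by blast
  have "continuous_map I01 (prod_topology K I01) (\<lambda>t. (x,t))" using x by (simp add: continuous_map_pairwise o_def)
  note s = F1.Z.sec_pull[OF M(1) this]
  have s': "sec Z I01 (\<lambda>_. bf (b1 p)) ?a (\<lambda>t. M (x,t))"
    by (rule F1.Z.sec_cong[OF s]) (simp_all add: \<phi> ept_def)
  have h: "M (x,0) \<in> chom Z ?a ?a" using F1.Z.secD(2)[OF s', of 0] by simp
  have "M (x,1) = M (x,0)"
    by (rule F1.Z.sec_unique[OF s' F1.Z.sec_const[OF l(7) h] connected_I01, of 0 1]) auto
  also have "\<dots> = cid Z ?a" using M(2) x mX(2) F1.F_id[OF P1.Z.lead_ob[OF l(5)]] l(1,3) by simp
  also have "\<dots> = gm (mY x)" using mY(2) F2.F_id[OF P2.Z.lead_ob[OF l(6)]] l(2,4) by simp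
  finally have ag: "M (x,1) = gm (mY x)" .
  have "continuous_map K (prod_topology K I01) (\<lambda>x. (x,1))" by (simp add: continuous_map_pairwise o_def)
  from F1.Z.sec_pull[OF M(1) this]
  have t1: "sec Z K (\<lambda>x. bg (snd (snd (\<phi> x)))) ?a (\<lambda>x. M (x,1))" by (rule F1.Z.sec_cong) (simp_all add: e(5))
  have t2: "sec Z K (\<lambda>x. bg (snd (snd (\<phi> x)))) ?a (\<lambda>x. gm (mY x))" using F2.sec_BF[OF mY(1)] l(2,4) by simp
  have "M (y,1) = gm (mY y)" if "y \<in> topspace K" for y
    by (rule F1.Z.sec_unique[OF t1 t2 K x ag that])
  then show ?thesis using M \<phi>(1) p mX(1) mY(1) unfolding trivialised_def by blast
qed

lemma id_homs:
  assumes p: "p \<in> topspace BG" and \<phi>: "\<phi> x = ept p"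
  shows "cid X (lead X (b1 p)) \<in> chom X (lead X (b1 p)) (lead X (fst (\<phi> x)))"
    "cid Y (lead Y (b2 p)) \<in> chom Y (lead Y (b2 p)) (lead Y (snd (snd (\<phi> x))))"
  using leads(5,6)[OF p] P1.Z.id_hom P1.Z.lead_ob P2.Z.id_hom P2.Z.lead_ob by (simp_all add: \<phi> ept_def)

lemma trivialise_interval:
  assumes \<phi>: "continuous_map I01 E \<phi>" "\<phi> 0 = ept p" and p: "p \<in> topspace BG"
  shows "\<exists>mX M mY. trivialised I01 \<phi> p mX M mY \<and> mX 0 = cid X (lead X (b1 p)) \<and> mY 0 = cid Y (lead Y (b2 p))"
proof -
  note e = hofiber_mapD[OF \<phi>(1)]
  obtain mX where mX: "sec X I01 (\<lambda>x. fst (\<phi> x)) (lead X (b1 p)) mX" "mX 0 = cid X (lead X (b1 p))"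
    using P1.Z.sec_interval[OF e(1) id_homs(1)[where \<phi> = \<phi> and x = "0::real", OF p \<phi>(2)]] by blast
  obtain mY where mY: "sec Y I01 (\<lambda>x. snd (snd (\<phi> x))) (lead Y (b2 p)) mY" "mY 0 = cid Y (lead Y (b2 p))"
    using P2.Z.sec_interval[OF e(3) id_homs(2)[where \<phi> = \<phi> and x = "0::real", OF p \<phi>(2)]] by blast
  have "(0::real) \<in> topspace I01" by simp
  from trivialisation_exists[OF connected_I01 this \<phi> p mX mY] show ?thesis using mX(2) mY(2) by blast
qed

lemma swap_homotopy:
  assumes Q: "continuous_map (prod_topology K I01) T Q'"
    and e: "\<And>x. x \<in> topspace K \<Longrightarrow> Q' (x,0) = f x" "\<And>x. x \<in> topspace K \<Longrightarrow> Q' (x,1) = g x"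
    and b: "b \<in> topspace K" "\<And>t. t \<in> {0..1} \<Longrightarrow> Q' (b,t) = y"
  shows "homotopic_with (\<lambda>\<phi>. \<phi> b = y) K T f g"
proof -
  have "continuous_map (prod_topology I01 K) (prod_topology K I01) (\<lambda>z. (snd z, fst z))"
    by (simp add: continuous_map_pairwise o_def continuous_map_fst continuous_map_snd)
  from continuous_map_compose[OF this Q]
  have c: "continuous_map (prod_topology I01 K) T (\<lambda>z. Q' (snd z, fst z))" by (simp add: o_def)
  show ?thesis
    by (subst homotopic_with, use b in simp, intro exI conjI ballI, rule c) (use e b in auto)
qed

text \<open>Every clause but one deforms a map by \<open>Q\<close> or turns a path into an arrow of
  \<open>G\<close> by \<open>end_morphism\<close>. Injectivity on homotopy groups is read off inside
  the classifying space of \<open>G\<close> from monodromies and null homotopies.\<close>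

lemma weak_equiv: "weak_homotopy_equivalence BG E ept"
  unfolding weak_homotopy_equivalence_def
proof (intro conjI ballI allI impI)
  show "continuous_map BG E ept" by (rule ept_continuous)
next
  fix v assume v: "v \<in> topspace E"
  \<comment> \<open>The point is treated as a constant family over the interval, so that the results
    on maps into \<open>E\<close> apply to it; only the parameter 0 is used in the end.\<close>
  have vc: "continuous_map I01 E (\<lambda>_. v)" using v by simp
  note e = hofiber_mapD[OF vc]
  have x: "fst v \<in> topspace BX" and y: "snd (snd v) \<in> topspace BY" using v by (auto simp: hofiber_product_def)
  have v0: "fst (snd v) 0 = bf (fst v)" "fst (snd v) 1 = bg (snd (snd v))" using e(4)[of 0] e(5)[of 0] by auto
  have g: "continuous_map I01 BZ (fst (snd v))" using continuous_map_slice[OF e(2), of 0] by simp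
  let ?a = "lead Z (bf (fst v))"
  have "cid Z ?a \<in> chom Z ?a (lead Z (fst (snd v) 0))" using v0 F1.Z.id_hom[OF F1.Z.lead_ob[OF F1.BF_in[OF x]]] by simp
  then obtain n where n: "sec Z I01 (fst (snd v)) ?a n" "n 0 = cid Z ?a" using F1.Z.sec_interval[OF g] by blast
  \<comment> \<open>Transporting an identity along the path of \<open>v\<close> gives an arrow
    between the images of the two leading vertices, which is the input of
    \<open>ess_surj\<close>.\<close>
  have n1: "n 1 \<in> chom Z (fo (lead X (fst v))) (go (lead Y (snd (snd v))))"
    using F1.Z.secD(2)[OF n(1), of 1] v0 F1.lead_BF[OF x] F2.lead_BF[OF y] by simp
  obtain w a b where w: "w \<in> cob G" "a \<in> chom X (p1o w) (lead X (fst v))" "b \<in> chom Y (p2o w) (lead Y (snd (snd v)))"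
    "ccomp Z (n 1) (fm a) = gm b"
    using ess_surj[OF P1.Z.lead_ob[OF x] P2.Z.lead_ob[OF y] n1] by blast
  obtain p where p: "p \<in> topspace BG" "lead G p = w" using P1.X.vertex_point[OF w(1)] by blast
  note l = leads[OF p(1), unfolded p(2)]
  have fa: "fm a \<in> chom Z (lead Z (bf (b1 p))) ?a" using F1.F_hom[OF w(2)] l(3) F1.lead_BF[OF x] by simp
  have "sec Z (prod_topology I01 I01) (\<lambda>z. fst (snd v) (snd z)) (lead Z (bf (b1 p))) (\<lambda>z. ccomp Z (n (snd z)) (fm a))"
    by (rule F1.Z.sec_pull[OF F1.Z.sec_translate[OF n(1) fa] continuous_map_snd])
  moreover have "sec X I01 (\<lambda>_. fst v) (lead X (b1 p)) (\<lambda>_. a)" using P1.Z.sec_const[OF x] w(2) l(1) by simp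
  moreover have "sec Y I01 (\<lambda>_. snd (snd v)) (lead Y (b2 p)) (\<lambda>_. b)" using P2.Z.sec_const[OF y] w(3) l(2) by simp
  ultimately have T: "trivialised I01 (\<lambda>_. v) p (\<lambda>_. a) (\<lambda>z. ccomp Z (n (snd z)) (fm a)) (\<lambda>_. b)"
    unfolding trivialised_def using vc p(1) n(2) w(4) F1.Z.id_left[OF fa] by simp
  let ?\<gamma> = "\<lambda>t. Q (\<lambda>_. v) p (\<lambda>_. a) (\<lambda>z. ccomp Z (n (snd z)) (fm a)) (\<lambda>_. b) (0::real,t)"
  have "pathin E ?\<gamma>" unfolding pathin_def by (rule continuous_map_slice[OF Q_continuous[OF T]]) simp
  moreover have "?\<gamma> 0 = ept p" "?\<gamma> 1 = v" using Q_0[OF T] Q_1[OF T, of 0] by simp_all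
  ultimately show "\<exists>x\<in>topspace BG. path_component_of E (ept x) v"
    unfolding path_component_of_def using p(1) by blast
next
  fix p p' assume p: "p \<in> topspace BG" "p' \<in> topspace BG" and "path_component_of E (ept p) (ept p')"
  then obtain \<phi> where \<phi>: "continuous_map I01 E \<phi>" "\<phi> 0 = ept p" "\<phi> 1 = ept p'"
    unfolding path_component_of_def pathin_def by blast
  obtain mX M mY where T: "trivialised I01 \<phi> p mX M mY" using trivialise_interval[OF \<phi>(1,2) p(1)] by blast
  \<comment> \<open>Lifting the path in \<open>E\<close> gives an arrow between the leading vertices
    in \<open>G\<close>; splicing along it is a path that joins the two points.\<close>
  obtain c where c: "c \<in> chom G (lead G p) (lead G p')" using end_morphism[OF T _ p(2) \<phi>(3)] by auto
  have "pathin BG (splice G p p' c)" "splice G p p' c 0 = p" "splice G p p' c 1 = p'"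
    unfolding pathin_def using P1.X.splice_path[OF p c] P1.X.splice_0[OF p(1)] P1.X.splice_1[OF p(2) c] by auto
  then show "path_component_of BG p p'" unfolding path_component_of_def by blast
next
  fix k :: nat and p \<phi>
  assume k: "1 \<le> k" and p: "p \<in> topspace BG" and "continuous_map (nsphere k) E \<phi> \<and> \<phi> sphere_base = ept p"
  then have \<phi>: "continuous_map (nsphere k) E \<phi>" "\<phi> sphere_base = ept p" by auto
  note e = hofiber_mapD[OF \<phi>(1)]
  show "\<exists>h. continuous_map (nsphere k) BG h \<and> h sphere_base = p \<and>
      homotopic_with (\<lambda>\<phi>. \<phi> sphere_base = ept p) (nsphere k) E (ept \<circ> h) \<phi>"
  proof (cases "k = 1")
    case False
    then have k2: "k \<ge> 2" using k by simp
    obtain mX where mX: "sec X (nsphere k) (\<lambda>x. fst (\<phi> x)) (lead X (b1 p)) mX" "mX sphere_base = cid X (lead X (b1 p))"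
      using P1.Z.sec_sphere[OF k2 e(1) id_homs(1)[where \<phi> = \<phi> and x = sphere_base, OF p \<phi>(2)]] by blast
    obtain mY where mY: "sec Y (nsphere k) (\<lambda>x. snd (snd (\<phi> x))) (lead Y (b2 p)) mY" "mY sphere_base = cid Y (lead Y (b2 p))"
      using P2.Z.sec_sphere[OF k2 e(3) id_homs(2)[where \<phi> = \<phi> and x = sphere_base, OF p \<phi>(2)]] by blast
    note b = P1.X.sphere_base_in[of k]
    obtain M where T: "trivialised (nsphere k) \<phi> p mX M mY"
      using trivialisation_exists[where x = sphere_base and \<phi> = \<phi> and mX = mX and mY = mY, OF connected_nsphere[OF k] b \<phi> p mX mY] by blast
    have "homotopic_with (\<lambda>\<phi>. \<phi> sphere_base = ept p) (nsphere k) E (\<lambda>_. ept p) \<phi>"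
      by (rule swap_homotopy[OF Q_continuous[OF T]])
        (use Q_0[OF T] Q_1[OF T] b Q_base[where x = sphere_base and \<phi> = \<phi> and mX = mX and mY = mY, OF T b \<phi>(2) mX(2) mY(2)] in auto)
    then show ?thesis using p by (intro exI[of _ "\<lambda>_. p"]) (simp add: o_def)
  next
    case True
    let ?f = "\<lambda>r. \<phi> (circ r)"
    have f: "continuous_map I01 E ?f" "?f 0 = ept p" "?f 1 = ept p"
      using continuous_map_compose[OF circ_continuous] \<phi> True circ_01 by (auto simp: o_def)
    obtain mX M mY where T: "trivialised I01 ?f p mX M mY" "mX 0 = cid X (lead X (b1 p))" "mY 0 = cid Y (lead Y (b2 p))"
      using trivialise_interval[OF f(1,2) p] by blast
    \<comment> \<open>The monodromy of the loop is an automorphism in \<open>G\<close>. Splicing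
      \<open>p\<close> with itself along it gives a loop whose image is the right edge of the square
      \<open>Q\<close>, while the given loop is the top edge.\<close>
    obtain c where c: "c \<in> chom G (lead G p) (lead G p)" "mX 1 = p1m c" "mY 1 = p2m c" "\<forall>t\<in>{0..1}. M (1,t) = fm (p1m c)"
      using end_morphism[OF T(1) _ p f(3)] by auto
    have "splice G p p c 0 = splice G p p c 1" using P1.X.splice_0[OF p] P1.X.splice_1[OF p c(1)] by simp
    then obtain h where h: "continuous_map (nsphere 1) BG h" "\<forall>r\<in>{0..1}. h (circ r) = splice G p p c r"
      using circle_lift[OF P1.X.splice_path[OF p p c(1)]] by blast
    have hb: "h sphere_base = p" using bspec[OF h(2), of 0] circ_01 P1.X.splice_0[OF p] by simp
    have "homotopic_with (\<lambda>\<phi>. \<phi> sphere_base = ept p) (nsphere 1) E \<phi> (ept \<circ> h)"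
    proof (rule square_homotopy[OF Q_continuous[OF T(1)]])
      fix r :: real assume r: "r \<in> {0..1}"
      then have rI: "r \<in> topspace I01" by simp
      show "Q ?f p mX M mY (r,0) = ept p" by (rule Q_0[OF T(1)])
      show "Q ?f p mX M mY (0,r) = ept p" by (rule Q_base[OF T(1) _ f(2) T(2,3) r]) simp
      show "\<phi> (circ r) = Q ?f p mX M mY (r,1)" using Q_1[OF T(1) rI] by simp
      show "(ept \<circ> h) (circ r) = Q ?f p mX M mY (1,r)"
        using Q_ept[OF T(1) _ p f(3) c r] bspec[OF h(2) r] by simp
    next
      show "Q ?f p mX M mY (1,1) = ept p" using Q_1[OF T(1), of 1] f(3) by simp
    qed
    then show ?thesis using h(1) hb True homotopic_with_symD by blast
  qed
next
  fix k :: nat and p h h'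
  assume k: "1 \<le> k" and p: "p \<in> topspace BG"
    and A: "continuous_map (nsphere k) BG h \<and> h sphere_base = p \<and> continuous_map (nsphere k) BG h' \<and> h' sphere_base = p \<and>
      homotopic_with (\<lambda>\<phi>. \<phi> sphere_base = ept p) (nsphere k) E (ept \<circ> h) (ept \<circ> h')"
  show "homotopic_with (\<lambda>\<phi>. \<phi> sphere_base = p) (nsphere k) BG h h'"
  proof (cases "k = 1")
    case False
    then have k2: "k \<ge> 2" using k by simp
    have "homotopic_with (\<lambda>\<phi>. \<phi> sphere_base = p) (nsphere k) BG (\<lambda>_. p) h"
      "homotopic_with (\<lambda>\<phi>. \<phi> sphere_base = p) (nsphere k) BG (\<lambda>_. p) h'"
      using P1.X.sphere_null[OF k2 _ _ p] A by auto
    then show ?thesis using homotopic_with_trans homotopic_with_symD by blast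
  next
    case True
    have idp: "cid G (lead G p) \<in> chom G (lead G p) (lead G p)" using P1.X.id_hom[OF P1.X.lead_ob[OF p]] .
    have ex: "\<exists>m. sec G I01 (\<lambda>r. h (circ r)) (lead G p) m \<and> m 0 = cid G (lead G p)"
      if "continuous_map (nsphere 1) BG h" "h sphere_base = p" for h
    proof -
      have "continuous_map I01 BG (\<lambda>r. h (circ r))" using continuous_map_compose[OF circ_continuous that(1)] by (simp add: o_def)
      then show ?thesis using P1.X.sec_interval[of "\<lambda>r. h (circ r)" "cid G (lead G p)"] idp circ_01 that(2) by simp
    qed
    have hc: "continuous_map (nsphere 1) BG h" "h sphere_base = p" "continuous_map (nsphere 1) BG h'" "h' sphere_base = p"
      using A True by auto
    obtain m where m: "sec G I01 (\<lambda>r. h (circ r)) (lead G p) m" "m 0 = cid G (lead G p)" using ex[OF hc(1,2)] by blast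
    obtain m' where m': "sec G I01 (\<lambda>r. h' (circ r)) (lead G p) m'" "m' 0 = cid G (lead G p)" using ex[OF hc(3,4)] by blast
    have c: "m 1 \<in> chom G (lead G p) (lead G p)" "m' 1 \<in> chom G (lead G p) (lead G p)"
      using P1.X.secD(2)[OF m(1), of 1] P1.X.secD(2)[OF m'(1), of 1] circ_01 hc by simp_all
    obtain H where H: "continuous_map (prod_topology I01 (nsphere 1)) E H" "\<And>x. H (0,x) = ept (h x)" "\<And>x. H (1,x) = ept (h' x)"
      "\<And>t. t \<in> {0..1} \<Longrightarrow> H (t, sphere_base) = ept p"
      using A True unfolding homotopic_with_def by (auto simp: o_def)
    have cc: "continuous_map (prod_topology I01 I01) (prod_topology I01 (nsphere 1)) (\<lambda>z. (fst z, circ (snd z)))"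
      by (rule continuous_map_pairI[OF continuous_map_fst])
        (use continuous_map_compose[OF continuous_map_snd[of I01 I01] circ_continuous] in \<open>simp add: o_def\<close>)
    have "continuous_map (prod_topology I01 I01) E (\<lambda>z. H (fst z, circ (snd z)))"
      using continuous_map_compose[OF cc H(1)] by (simp add: o_def)
    note e = hofiber_mapD[OF this]
    \<comment> \<open>The images of the two monodromies in \<open>X\<close> and in \<open>Y\<close>
      are invariant under the homotopy in \<open>E\<close>. Faithfulness then identifies the
      monodromies in \<open>G\<close>, so both loops are homotopic to the same standard loop
      \<open>j\<close>.\<close>
    have "p1m (m 1) = p1m (m' 1)"
    proof (rule P1.Z.monodromy_invariant[OF e(1)])
      show "sec X I01 (\<lambda>r. fst (H (fst (0,r), circ (snd (0,r))))) (p1o (lead G p)) (\<lambda>r. p1m (m r))"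
        using P1.sec_BF[OF m(1)] by (simp add: H ept_def)
      show "sec X I01 (\<lambda>r. fst (H (fst (1,r), circ (snd (1,r))))) (p1o (lead G p)) (\<lambda>r. p1m (m' r))"
        using P1.sec_BF[OF m'(1)] by (simp add: H ept_def)
    qed (use H(4) circ_01 m(2) m'(2) in \<open>auto simp: ept_def\<close>)
    moreover have "p2m (m 1) = p2m (m' 1)"
    proof (rule P2.Z.monodromy_invariant[OF e(3)])
      show "sec Y I01 (\<lambda>r. snd (snd (H (fst (0,r), circ (snd (0,r)))))) (p2o (lead G p)) (\<lambda>r. p2m (m r))"
        using P2.sec_BF[OF m(1)] by (simp add: H ept_def)
      show "sec Y I01 (\<lambda>r. snd (snd (H (fst (1,r), circ (snd (1,r)))))) (p2o (lead G p)) (\<lambda>r. p2m (m' r))"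
        using P2.sec_BF[OF m'(1)] by (simp add: H ept_def)
    qed (use H(4) circ_01 m(2) m'(2) in \<open>auto simp: ept_def\<close>)
    moreover have "fm (p1m (m 1)) = gm (p2m (m 1))" using comm_m c(1) by (simp add: chom_def)
    ultimately have mm: "m 1 = m' 1"
      using fully_faithful[OF P1.X.lead_ob[OF p] P1.X.lead_ob[OF p] P1.F_hom[OF c(1)] P2.F_hom[OF c(1)]] c by metis
    have "splice G p p (m 1) 0 = splice G p p (m 1) 1" using P1.X.splice_0[OF p] P1.X.splice_1[OF p c(1)] by simp
    then obtain j where "\<forall>r\<in>{0..1}. j (circ r) = splice G p p (m 1) r"
      using circle_lift[OF P1.X.splice_path[OF p p c(1)]] by blast
    then have j: "\<And>r. r \<in> {0..1} \<Longrightarrow> j (circ r) = splice G p p (m 1) r" by blast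
    have 1: "homotopic_with (\<lambda>\<phi>. \<phi> sphere_base = p) (nsphere 1) BG h j"
      by (rule P1.X.loop_splice[OF hc(1,2) p m j])
    have 2: "homotopic_with (\<lambda>\<phi>. \<phi> sphere_base = p) (nsphere 1) BG h' j"
      by (rule P1.X.loop_splice[OF hc(3,4) p m' j[unfolded mm]])
    show ?thesis unfolding True by (rule homotopic_with_trans[OF 1 homotopic_with_symD[OF 2]])
  qed
qed

theorem pullback: "homotopy_pullback BG BX BY BZ b1 b2 bf bg"
  unfolding homotopy_pullback_def
  using P1.BF_continuous P2.BF_continuous F1.BF_continuous F2.BF_continuous comm_point weak_equiv
  unfolding ept_def[abs_def] by blast

end

section \<open>Isostable squares categories\<close>

lemma cat_sels:
  "cob (square_cat C) = square_obj C" "cdom (square_cat C) = qm_src" "ccod (square_cat C) = qm_tgt"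
  "qm_a (ccomp (square_cat C) m' m) = vcomp C (qm_a m') (qm_a m)" "qm_d (ccomp (square_cat C) m' m) = vcomp C (qm_d m') (qm_d m)"
  "cdom (span_cat C) = spm_src" "ccod (span_cat C) = spm_tgt" "cdom (cospan_cat C) = csm_src" "ccod (cospan_cat C) = csm_tgt"
  by (simp_all add: square_cat_def span_cat_def cospan_cat_def)

locale isostable_dc =
  fixes C :: "('o,'h,'v) dblcat"
  assumes isostable: "isostable C"
begin

abbreviation (input) zo where "zo \<equiv> zobj C"

lemma stable: "stable C" using isostable unfolding isostable_def by (rule conjunct1)
lemma squares: "squares_category C" using stable unfolding stable_def by (rule conjunct1)
lemma flat: "flat_double_category C" using squares unfolding squares_category_def by (rule conjunct1)

lemma h_ob: "f \<in> hmor C \<Longrightarrow> hdom C f \<in> dobj C" "f \<in> hmor C \<Longrightarrow> hcod C f \<in> dobj C"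
  and hid_mor: "A \<in> dobj C \<Longrightarrow> hid C A \<in> hmor C" "A \<in> dobj C \<Longrightarrow> hdom C (hid C A) = A" "A \<in> dobj C \<Longrightarrow> hcod C (hid C A) = A"
  and hcomp_mor: "f \<in> hmor C \<Longrightarrow> g \<in> hmor C \<Longrightarrow> hcod C f = hdom C g \<Longrightarrow> hcomp C g f \<in> hmor C"
    "f \<in> hmor C \<Longrightarrow> g \<in> hmor C \<Longrightarrow> hcod C f = hdom C g \<Longrightarrow> hdom C (hcomp C g f) = hdom C f"
    "f \<in> hmor C \<Longrightarrow> g \<in> hmor C \<Longrightarrow> hcod C f = hdom C g \<Longrightarrow> hcod C (hcomp C g f) = hcod C g"
  and hid_right: "f \<in> hmor C \<Longrightarrow> hcomp C f (hid C (hdom C f)) = f"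
  and hid_left: "f \<in> hmor C \<Longrightarrow> hcomp C (hid C (hcod C f)) f = f"
  and hassoc: "f \<in> hmor C \<Longrightarrow> g \<in> hmor C \<Longrightarrow> h \<in> hmor C \<Longrightarrow> hcod C f = hdom C g \<Longrightarrow> hcod C g = hdom C h \<Longrightarrow>
        hcomp C h (hcomp C g f) = hcomp C (hcomp C h g) f"
  using flat unfolding flat_double_category_def by simp_all

lemma v_ob: "u \<in> vmor C \<Longrightarrow> vdom C u \<in> dobj C" "u \<in> vmor C \<Longrightarrow> vcod C u \<in> dobj C"
  and vid_mor: "A \<in> dobj C \<Longrightarrow> vid C A \<in> vmor C" "A \<in> dobj C \<Longrightarrow> vdom C (vid C A) = A" "A \<in> dobj C \<Longrightarrow> vcod C (vid C A) = A"
  and vcomp_mor: "u \<in> vmor C \<Longrightarrow> v \<in> vmor C \<Longrightarrow> vcod C u = vdom C v \<Longrightarrow> vcomp C v u \<in> vmor C"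
    "u \<in> vmor C \<Longrightarrow> v \<in> vmor C \<Longrightarrow> vcod C u = vdom C v \<Longrightarrow> vdom C (vcomp C v u) = vdom C u"
    "u \<in> vmor C \<Longrightarrow> v \<in> vmor C \<Longrightarrow> vcod C u = vdom C v \<Longrightarrow> vcod C (vcomp C v u) = vcod C v"
  and vid_right: "u \<in> vmor C \<Longrightarrow> vcomp C u (vid C (vdom C u)) = u"
  and vid_left: "u \<in> vmor C \<Longrightarrow> vcomp C (vid C (vcod C u)) u = u"
  and vassoc: "u \<in> vmor C \<Longrightarrow> v \<in> vmor C \<Longrightarrow> w \<in> vmor C \<Longrightarrow> vcod C u = vdom C v \<Longrightarrow> vcod C v = vdom C w \<Longrightarrow>
        vcomp C w (vcomp C v u) = vcomp C (vcomp C w v) u"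
  using flat unfolding flat_double_category_def by simp_all

lemma sqD:
  assumes "issq C f u v g"
  shows "f \<in> hmor C" "g \<in> hmor C" "u \<in> vmor C" "v \<in> vmor C"
    "hdom C f = vdom C u" "hcod C f = vdom C v" "hdom C g = vcod C u" "hcod C g = vcod C v"
  using flat assms unfolding flat_double_category_def by blast+

lemma sq_hid: "f \<in> hmor C \<Longrightarrow> issq C f (vid C (hdom C f)) (vid C (hcod C f)) f"
  and sq_vid: "u \<in> vmor C \<Longrightarrow> issq C (hid C (vdom C u)) u u (hid C (vcod C u))"
  and sq_h: "issq C f u v g \<Longrightarrow> issq C f' v w g' \<Longrightarrow> issq C (hcomp C f' f) u w (hcomp C g' g)"
  and sq_v: "issq C f u v g \<Longrightarrow> issq C g u' v' k \<Longrightarrow> issq C f (vcomp C u' u) (vcomp C v' v) k"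
  using flat unfolding flat_double_category_def by (blast, blast, blast, blast)

lemma zob: "zo \<in> dobj C" using squares unfolding squares_category_def by blast

lemma hinit_mor:
  assumes "A \<in> dobj C"
  shows "hinit C A \<in> hmor C" "hdom C (hinit C A) = zo" "hcod C (hinit C A) = A"
proof -
  have "\<exists>!f. f \<in> hmor C \<and> hdom C f = zo \<and> hcod C f = A" using squares assms unfolding squares_category_def by blast
  from theI'[OF this] show "hinit C A \<in> hmor C" "hdom C (hinit C A) = zo" "hcod C (hinit C A) = A"
    unfolding hinit_def by auto
qed

lemma hinit_unique: "f \<in> hmor C \<Longrightarrow> hdom C f = zo \<Longrightarrow> f = hinit C (hcod C f)"
proof -
  assume f: "f \<in> hmor C" "hdom C f = zo"
  have "\<exists>!g. g \<in> hmor C \<and> hdom C g = zo \<and> hcod C g = hcod C f" using squares h_ob(2)[OF f(1)] unfolding squares_category_def by blast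
  then show ?thesis using hinit_mor[OF h_ob(2)[OF f(1)]] f by blast
qed

lemma vterm_mor:
  assumes "A \<in> dobj C"
  shows "vterm C A \<in> vmor C" "vdom C (vterm C A) = A" "vcod C (vterm C A) = zo"
proof -
  have "\<exists>!u. u \<in> vmor C \<and> vdom C u = A \<and> vcod C u = zo" using squares assms unfolding squares_category_def by blast
  from theI'[OF this] show "vterm C A \<in> vmor C" "vdom C (vterm C A) = A" "vcod C (vterm C A) = zo"
    unfolding vterm_def by auto
qed

lemma to_zero_unique:
  assumes "u \<in> vmor C" "v \<in> vmor C" "vdom C u = vdom C v" "vcod C u = zo" "vcod C v = zo"
  shows "u = v"
proof -
  have "\<exists>!w. w \<in> vmor C \<and> vdom C w = vdom C v \<and> vcod C w = zo" using squares v_ob(1)[OF assms(2)] unfolding squares_category_def by blast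
  then show ?thesis using assms by blast
qed

lemma zero_endo: "u \<in> vmor C \<Longrightarrow> vdom C u = zo \<Longrightarrow> vcod C u = zo \<Longrightarrow> u = vid C zo"
  using to_zero_unique[of u "vid C zo"] vid_mor[OF zob] by simp

lemma vinverse_id: "A \<in> dobj C \<Longrightarrow> vinverse C (vid C A) (vid C A)"
  unfolding vinverse_def using vid_mor[of A] vid_left[of "vid C A"] by simp

lemma vinverse_sym: "vinverse C g g' \<Longrightarrow> vinverse C g' g"
  unfolding vinverse_def by simp

lemma sq_inverse:
  assumes s: "issq C f g h k" and g: "vinverse C g g'" and h: "vinverse C h h'"
  shows "issq C k g' h' f"
proof -
  have "\<forall>f k g g' h h'. f \<in> hmor C \<longrightarrow> k \<in> hmor C \<longrightarrow> vinverse C g g' \<longrightarrow> vinverse C h h' \<longrightarrow>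
        vdom C g = hdom C f \<longrightarrow> vcod C g = hdom C k \<longrightarrow>
        vdom C h = hcod C f \<longrightarrow> vcod C h = hcod C k \<longrightarrow>
        (issq C f g h k \<longleftrightarrow> issq C k g' h' f)"
    using isostable unfolding isostable_def by blast
  then show ?thesis using sqD[OF s] g h s by simp
qed

lemma vweq_mor: "vweq C f \<Longrightarrow> f \<in> vmor C" by (simp add: vweq_def)

lemma vweq_id: "A \<in> dobj C \<Longrightarrow> vweq C (vid C A)"
  unfolding vweq_def using sq_hid[OF hinit_mor(1)] hinit_mor vid_mor by simp

text \<open>Paste the defining square of \<open>a\<close> to the left of the given one. The
  composite top and bottom start at \<open>O\<close>, so they are the initial arrows and the result
  is the defining square of \<open>b\<close>.\<close>

lemma vweqI_left:
  assumes s: "issq C f a b k" and a: "vweq C a"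
  shows "vweq C b"
proof -
  note d = sqD[OF s]
  have o: "vdom C a \<in> dobj C" "vcod C a \<in> dobj C" using v_ob[OF d(3)] by auto
  have "issq C (hcomp C f (hinit C (vdom C a))) (vid C zo) b (hcomp C k (hinit C (vcod C a)))"
    using a s unfolding vweq_def by (blast intro: sq_h)
  moreover have "hcomp C f (hinit C (vdom C a)) = hinit C (vdom C b)"
    using hinit_unique[of "hcomp C f (hinit C (vdom C a))"] hcomp_mor[OF hinit_mor(1)[OF o(1)] d(1)] hinit_mor[OF o(1)] d by simp
  moreover have "hcomp C k (hinit C (vcod C a)) = hinit C (vcod C b)"
    using hinit_unique[of "hcomp C k (hinit C (vcod C a))"] hcomp_mor[OF hinit_mor(1)[OF o(2)] d(2)] hinit_mor[OF o(2)] d by simp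
  ultimately show ?thesis unfolding vweq_def using d by simp
qed

text \<open>The defining square has an identity on the left and the invertible \<open>f\<close> on
  the right, so the inversion condition of isostability yields the defining square of the
  inverse.\<close>

lemma vweq_inverse:
  assumes "vweq C f"
  shows "\<exists>f'. vinverse C f f' \<and> vweq C f'"
proof -
  obtain f' where f': "vinverse C f f'" using isostable assms unfolding isostable_def viso_def by blast
  have "issq C (hinit C (vcod C f)) (vid C zo) f' (hinit C (vdom C f))"
    by (rule sq_inverse[OF _ vinverse_id[OF zob] f']) (use assms in \<open>simp add: vweq_def\<close>)
  then have "vweq C f'" using f' unfolding vweq_def vinverse_def by simp
  then show ?thesis using f' by blast
qed

lemma vweq_comp:
  assumes "vweq C f" "vweq C g" "vcod C f = vdom C g"
  shows "vweq C (vcomp C g f)"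
proof -
  have "issq C (hinit C (vdom C f)) (vcomp C (vid C zo) (vid C zo)) (vcomp C g f) (hinit C (vcod C g))"
    by (rule sq_v[of _ _ _ "hinit C (vcod C f)"]) (use assms in \<open>auto simp: vweq_def\<close>)
  moreover have "vcomp C (vid C zo) (vid C zo) = vid C zo" using vid_right[OF vid_mor(1)[OF zob]] vid_mor[OF zob] by simp
  ultimately show ?thesis using assms vcomp_mor[of f g] unfolding vweq_def by simp
qed

lemma inv_cancel_left:
  assumes g: "vinverse C g g'" and u: "u \<in> vmor C" "vcod C u = vdom C g"
  shows "vcomp C g' (vcomp C g u) = u"
  using g u vassoc[of u g g'] vid_left[OF u(1)] unfolding vinverse_def by simp

lemma inv_cancel_right:
  assumes g: "vinverse C g g'" and u: "u \<in> vmor C" "vdom C u = vcod C g"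
  shows "vcomp C (vcomp C u g) g' = u"
  using g u vassoc[of g' g u] vid_right[OF u(1)] unfolding vinverse_def by simp

subsection \<open>Filling spans and cospans\<close>

lemma span_square:
  assumes f: "f \<in> hmor C" and u: "u \<in> vmor C" "hdom C f = vdom C u"
  shows "\<exists>v g. issq C f u v g"
proof -
  obtain sO sM where s: "is_functor (span_cat C) (square_cat C) sO sM" "\<forall>X\<in>cob (span_cat C). i_obj (sO X) = X"
    using stable unfolding stable_def by blast
  let ?X = "\<lparr>sp_a = hdom C f, sp_b = hcod C f, sp_c = vcod C u, sp_f = f, sp_u = u\<rparr>"
  have X: "?X \<in> cob (span_cat C)" using f u by (simp add: span_cat_def)
  then have "sO ?X \<in> square_obj C" using s(1) unfolding is_functor_def cat_sels by blast
  moreover have "i_obj (sO ?X) = ?X" using s(2) X by blast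
  then have "q_top (sO ?X) = f" "q_left (sO ?X) = u" by (simp_all add: i_obj_def)
  ultimately show ?thesis by (auto simp: square_obj_def)
qed

lemma cospan_square:
  assumes g: "g \<in> hmor C" and v: "v \<in> vmor C" "vcod C v = hcod C g"
  shows "\<exists>f u. issq C f u v g"
proof -
  obtain tO tM where s: "is_functor (cospan_cat C) (square_cat C) tO tM" "\<forall>X\<in>cob (cospan_cat C). j_obj (tO X) = X"
    using stable unfolding stable_def by blast
  let ?X = "\<lparr>cs_b = vdom C v, cs_c = hdom C g, cs_d = vcod C v, cs_v = v, cs_g = g\<rparr>"
  have X: "?X \<in> cob (cospan_cat C)" using g v by (simp add: cospan_cat_def cospan_obj_def)
  then have "tO ?X \<in> square_obj C" using s(1) unfolding is_functor_def cat_sels by blast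
  moreover have "j_obj (tO ?X) = ?X" using s(2) X by blast
  then have "q_right (tO ?X) = v" "q_bot (tO ?X) = g" by (simp_all add: j_obj_def)
  ultimately show ?thesis by (auto simp: square_obj_def)
qed

definition mksq where
  "mksq f u v g = \<lparr>q_a = hdom C f, q_b = hcod C f, q_c = hdom C g, q_d = hcod C g,
     q_top = f, q_bot = g, q_left = u, q_right = v\<rparr>"

lemma mksq_obj: "issq C f u v g \<Longrightarrow> mksq f u v g \<in> square_obj C"
  using sqD[of f u v g] by (simp add: mksq_def square_obj_def)

lemma square_mor_iff:
  "m \<in> cmor (square_cat C) \<longleftrightarrow> (qm_src m \<in> square_obj C \<and> qm_tgt m \<in> square_obj C \<and>
     issq C (q_top (qm_src m)) (qm_a m) (qm_b m) (q_top (qm_tgt m)) \<and>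
     issq C (q_bot (qm_src m)) (qm_c m) (qm_d m) (q_bot (qm_tgt m)) \<and>
     vcomp C (qm_c m) (q_left (qm_src m)) = vcomp C (q_left (qm_tgt m)) (qm_a m) \<and>
     vcomp C (qm_d m) (q_right (qm_src m)) = vcomp C (q_right (qm_tgt m)) (qm_b m))" (is "?L \<longleftrightarrow> ?R")
proof
  assume ?L then show ?R unfolding square_cat_def Let_def by simp
next
  assume R: ?R
  have 1: "issq C (q_top (qm_src m)) (qm_a m) (qm_b m) (q_top (qm_tgt m))"
    and 2: "issq C (q_bot (qm_src m)) (qm_c m) (qm_d m) (q_bot (qm_tgt m))" using R by blast+
  show ?L using R sqD[OF 1] sqD[OF 2] unfolding square_cat_def Let_def by (simp add: square_obj_def)
qed

text \<open>The section functor extends the map of spans to the chosen squares, and the components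
  of \<open>w\<close> at \<open>d\<close> carry the extension to the given squares. These components
  are invertible: they are right sides of squares with an identity on the left, hence weak
  equivalences by \<open>vweqI_left\<close>. Any candidate restricts to the same map of spans, so
  naturality of \<open>w\<close> forces its value.\<close>

lemma square_from_span:
  assumes s: "issq C f u v g" and s': "issq C f' u' v' g'"
    and ab: "issq C f a b f'" and c: "c \<in> vmor C" "vdom C c = vcod C u" "vcod C c = vcod C u'" "vcomp C c u = vcomp C u' a"
  shows "\<exists>!d. issq C g c d g' \<and> vcomp C d v = vcomp C v' b"
proof -
  obtain sO sM w where st: "is_functor (span_cat C) (square_cat C) sO sM" "\<forall>X\<in>cob (span_cat C). i_obj (sO X) = X"
    "\<forall>m\<in>cmor (span_cat C). i_mor (sM m) = m"
    "is_nattrans (square_cat C) (square_cat C) (sO \<circ> i_obj) (sM \<circ> i_mor) id id w"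
    "\<forall>X\<in>square_obj C. qm_a (w X) = vid C (q_a X) \<and> qm_b (w X) = vid C (q_b X) \<and> qm_c (w X) = vid C (q_c X)"
    using stable unfolding stable_def by blast
  note d = sqD[OF s] and d' = sqD[OF s'] and dab = sqD[OF ab]
  let ?X = "mksq f u v g" let ?Y = "mksq f' u' v' g'"
  have X: "?X \<in> square_obj C" "?Y \<in> square_obj C" using mksq_obj s s' by auto
  let ?n = "\<lparr>spm_src = i_obj ?X, spm_tgt = i_obj ?Y, spm_a = a, spm_b = b, spm_c = c\<rparr>"
  have n: "?n \<in> cmor (span_cat C)" using d d' dab ab c by (simp add: span_cat_def i_obj_def mksq_def)
  let ?m = "sM ?n"
  have m: "?m \<in> cmor (square_cat C)" "qm_src ?m = sO (i_obj ?X)" "qm_tgt ?m = sO (i_obj ?Y)"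
    using st(1) n unfolding is_functor_def cat_sels by auto
  have im: "i_mor ?m = ?n" using st(3) n by blast
  then have mc: "qm_a ?m = a" "qm_b ?m = b" "qm_c ?m = c" by (simp_all add: i_mor_def)
  have wX: "w Z \<in> cmor (square_cat C) \<and> qm_src (w Z) = sO (i_obj Z) \<and> qm_tgt (w Z) = Z" if "Z \<in> square_obj C" for Z
    using st(4) that unfolding is_nattrans_def cat_sels by simp
  have key: "vweq C (qm_d (w Z)) \<and> issq C (q_bot (sO (i_obj Z))) (vid C (q_c Z)) (qm_d (w Z)) (q_bot Z) \<and>
      vcomp C (qm_d (w Z)) (q_right (sO (i_obj Z))) = q_right Z" if Z: "Z \<in> square_obj C" for Z
  proof -
    have r: "issq C (q_bot (sO (i_obj Z))) (qm_c (w Z)) (qm_d (w Z)) (q_bot Z)"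
       "vcomp C (qm_d (w Z)) (q_right (sO (i_obj Z))) = vcomp C (q_right Z) (qm_b (w Z))"
      using wX[OF Z] square_mor_iff[of "w Z"] by auto
    have i: "qm_c (w Z) = vid C (q_c Z)" "qm_b (w Z) = vid C (q_b Z)" using st(5) Z by auto
    have zc: "q_right Z \<in> vmor C" "vdom C (q_right Z) = q_b Z" "q_c Z \<in> dobj C"
      using Z v_ob(2)[of "q_left Z"] by (auto simp: square_obj_def)
    show ?thesis using r vweqI_left[OF r(1)] vweq_id[OF zc(3)] vid_right[OF zc(1)] zc(2) unfolding i by simp
  qed
  note kX = key[OF X(1)] and kY = key[OF X(2)]
  let ?wX = "qm_d (w ?X)" let ?wY = "qm_d (w ?Y)" let ?sX = "sO (i_obj ?X)" let ?sY = "sO (i_obj ?Y)"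
  obtain wi where wi: "vinverse C ?wX wi" using vweq_inverse kX by blast
  have mm: "issq C (q_bot ?sX) c (qm_d ?m) (q_bot ?sY)" "vcomp C (qm_d ?m) (q_right ?sX) = vcomp C (q_right ?sY) b"
    using square_mor_iff[of ?m] m mc by auto
  have sXo: "?sX \<in> square_obj C" "?sY \<in> square_obj C" using square_mor_iff[of ?m] m by auto
  have "i_obj ?X \<in> cob (span_cat C)" "i_obj ?Y \<in> cob (span_cat C)"
    using d d' by (simp_all add: span_cat_def i_obj_def mksq_def)
  then have isX: "i_obj ?sX = i_obj ?X" "i_obj ?sY = i_obj ?Y" using st(2) by blast+
  have qX: "q_right ?sX \<in> vmor C" "q_right ?sY \<in> vmor C" "vcod C (q_right ?sX) = hcod C (q_bot ?sX)"
    "vcod C (q_right ?sY) = hcod C (q_bot ?sY)" "vdom C (q_right ?sX) = vdom C v" "vdom C (q_right ?sY) = vdom C v'"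
    using sXo isX d d' by (auto simp: square_obj_def i_obj_def mksq_def)
  have sel: "q_bot ?X = g" "q_right ?X = v" "q_c ?X = vcod C u" "q_bot ?Y = g'" "q_right ?Y = v'" "q_c ?Y = vcod C u'"
    using d d' by (simp_all add: mksq_def)
  note kX' = kX[unfolded sel] and kY' = kY[unfolded sel]
  have kXs: "issq C (q_bot ?sX) (vid C (vcod C u)) ?wX g" and kXe: "vcomp C ?wX (q_right ?sX) = v"
    and kYs: "issq C (q_bot ?sY) (vid C (vcod C u')) ?wY g'" and kYe: "vcomp C ?wY (q_right ?sY) = v'" using kX' kY' by blast+
  note dX = sqD[OF kXs] and dY = sqD[OF kYs] and dm = sqD[OF mm(1)]
  have uo: "vcod C u \<in> dobj C" "vcod C u' \<in> dobj C" using v_ob d d' by auto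
  have kXi: "issq C g (vid C (vcod C u)) wi (q_bot ?sX)" by (rule sq_inverse[OF kXs vinverse_id[OF uo(1)] wi])
  note dXi = sqD[OF kXi]
  define dd where "dd = vcomp C ?wY (vcomp C (qm_d ?m) wi)"
  have s1: "issq C g (vcomp C c (vid C (vcod C u))) (vcomp C (qm_d ?m) wi) (q_bot ?sY)" by (rule sq_v[OF kXi mm(1)])
  have s2: "issq C g c (vcomp C (qm_d ?m) wi) (q_bot ?sY)" using s1 vid_right[OF c(1)] c(2) by simp
  have s3: "issq C g (vcomp C (vid C (vcod C u')) c) dd g'" unfolding dd_def by (rule sq_v[OF s2 kYs])
  have dsq: "issq C g c dd g'" using s3 vid_left[OF c(1)] c(3) by simp
  have mor: "wi \<in> vmor C" "qm_d ?m \<in> vmor C" "?wY \<in> vmor C" "?wX \<in> vmor C" using dXi dm dY dX by auto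
  have wiv: "vcomp C wi v = q_right ?sX"
    using inv_cancel_left[OF wi qX(1)] kXe qX(3) dX(6) dX by simp
  have "vcomp C dd v = vcomp C ?wY (vcomp C (vcomp C (qm_d ?m) wi) v)"
    unfolding dd_def using vassoc[of v "vcomp C (qm_d ?m) wi" ?wY] sqD[OF s2] mor d dY by simp
  also have "vcomp C (vcomp C (qm_d ?m) wi) v = vcomp C (qm_d ?m) (vcomp C wi v)"
    using vassoc[of v wi "qm_d ?m"] mor d dXi dm by simp
  also have "vcomp C ?wY (vcomp C (qm_d ?m) (vcomp C wi v)) = vcomp C ?wY (vcomp C (q_right ?sY) b)" using wiv mm(2) by simp
  also have "\<dots> = vcomp C v' b"
    using vassoc[of b "q_right ?sY" ?wY] mor dab qX dY d' kYe by simp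
  finally have dcomm: "vcomp C dd v = vcomp C v' b" .
  show ?thesis
  proof (rule ex1I[of _ dd])
    show "issq C g c dd g' \<and> vcomp C dd v = vcomp C v' b" using dsq dcomm by blast
    fix e assume e: "issq C g c e g' \<and> vcomp C e v = vcomp C v' b"
    let ?p = "\<lparr>qm_src = ?X, qm_tgt = ?Y, qm_a = a, qm_b = b, qm_c = c, qm_d = e\<rparr>"
    have p: "?p \<in> cmor (square_cat C)" using square_mor_iff[of ?p] X ab c e d d' by (simp add: mksq_def)
    have ip: "i_mor ?p = ?n" by (simp add: i_mor_def)
    have "ccomp (square_cat C) (w ?Y) (sM ?n) = ccomp (square_cat C) ?p (w ?X)"
      using st(4) p ip unfolding is_nattrans_def cat_sels by auto
    from arg_cong[OF this, of qm_d] have eq: "vcomp C ?wY (qm_d ?m) = vcomp C e ?wX" by (simp add: cat_sels)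
    have em: "e \<in> vmor C" "vdom C e = hcod C g" using sqD[of g c e g'] e by auto
    have "e = vcomp C (vcomp C e ?wX) wi" using inv_cancel_right[OF wi em(1)] em(2) dX by simp
    also have "\<dots> = dd" unfolding eq[symmetric] dd_def using vassoc[of wi "qm_d ?m" ?wY] mor dXi dm dY by simp
    finally show "e = dd" .
  qed
qed

text \<open>Dual to \<open>square_from_span\<close>. Here the comparison components sit at
  \<open>a\<close>, on the left of squares whose right side is an identity; that they are weak
  equivalences is the last clause of stability.\<close>

lemma square_from_cospan:
  assumes s: "issq C f u v g" and s': "issq C f' u' v' g'"
    and cd: "issq C g c d g'" and b: "b \<in> vmor C" "vdom C b = vdom C v" "vcod C b = vdom C v'" "vcomp C d v = vcomp C v' b"
  shows "\<exists>!a. issq C f a b f' \<and> vcomp C c u = vcomp C u' a"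
proof -
  obtain tO tM w where st: "is_functor (cospan_cat C) (square_cat C) tO tM" "\<forall>X\<in>cob (cospan_cat C). j_obj (tO X) = X"
    "\<forall>m\<in>cmor (cospan_cat C). j_mor (tM m) = m"
    "is_nattrans (square_cat C) (square_cat C) (tO \<circ> j_obj) (tM \<circ> j_mor) id id w"
    "\<forall>X\<in>square_obj C. qm_b (w X) = vid C (q_b X) \<and> qm_c (w X) = vid C (q_c X) \<and> qm_d (w X) = vid C (q_d X) \<and> vweq C (qm_a (w X))"
    using stable unfolding stable_def by blast
  note d = sqD[OF s] and d' = sqD[OF s'] and dcd = sqD[OF cd]
  let ?X = "mksq f u v g" let ?Y = "mksq f' u' v' g'"
  have X: "?X \<in> square_obj C" "?Y \<in> square_obj C" using mksq_obj s s' by auto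
  let ?n = "\<lparr>csm_src = j_obj ?X, csm_tgt = j_obj ?Y, csm_b = b, csm_c = c, csm_d = d\<rparr>"
  have n: "?n \<in> cmor (cospan_cat C)" using d d' dcd cd b by (simp add: cospan_cat_def cospan_obj_def j_obj_def mksq_def)
  let ?m = "tM ?n"
  have m: "?m \<in> cmor (square_cat C)" "qm_src ?m = tO (j_obj ?X)" "qm_tgt ?m = tO (j_obj ?Y)"
    using st(1) n unfolding is_functor_def cat_sels by auto
  have im: "j_mor ?m = ?n" using st(3) n by blast
  then have mc: "qm_b ?m = b" "qm_c ?m = c" "qm_d ?m = d" by (simp_all add: j_mor_def)
  have wX: "w Z \<in> cmor (square_cat C) \<and> qm_src (w Z) = tO (j_obj Z) \<and> qm_tgt (w Z) = Z" if "Z \<in> square_obj C" for Z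
    using st(4) that unfolding is_nattrans_def cat_sels by simp
  have key: "vweq C (qm_a (w Z)) \<and> issq C (q_top (tO (j_obj Z))) (qm_a (w Z)) (vid C (q_b Z)) (q_top Z) \<and>
      vcomp C (q_left Z) (qm_a (w Z)) = q_left (tO (j_obj Z))" if Z: "Z \<in> square_obj C" for Z
  proof -
    have r: "issq C (q_top (tO (j_obj Z))) (qm_a (w Z)) (qm_b (w Z)) (q_top Z)"
       "vcomp C (qm_c (w Z)) (q_left (tO (j_obj Z))) = vcomp C (q_left Z) (qm_a (w Z))" "tO (j_obj Z) \<in> square_obj C"
      using wX[OF Z] square_mor_iff[of "w Z"] by auto
    have i: "qm_c (w Z) = vid C (q_c Z)" "qm_b (w Z) = vid C (q_b Z)" "vweq C (qm_a (w Z))" using st(5) Z by auto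
    have "j_obj Z \<in> cob (cospan_cat C)" using Z by (simp add: cospan_cat_def cospan_obj_def j_obj_def square_obj_def)
    then have "j_obj (tO (j_obj Z)) = j_obj Z" using st(2) by blast
    then have "q_c (tO (j_obj Z)) = q_c Z" by (simp add: j_obj_def)
    then have zc: "q_left (tO (j_obj Z)) \<in> vmor C" "vcod C (q_left (tO (j_obj Z))) = q_c Z"
      using r(3) by (auto simp: square_obj_def)
    show ?thesis using r i(3) vid_left[OF zc(1)] zc(2) unfolding i by simp
  qed
  note kX = key[OF X(1)] and kY = key[OF X(2)]
  let ?wX = "qm_a (w ?X)" let ?wY = "qm_a (w ?Y)" let ?sX = "tO (j_obj ?X)" let ?sY = "tO (j_obj ?Y)"
  obtain wi where wi: "vinverse C ?wX wi" using vweq_inverse kX by blast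
  have mm: "issq C (q_top ?sX) (qm_a ?m) b (q_top ?sY)" "vcomp C c (q_left ?sX) = vcomp C (q_left ?sY) (qm_a ?m)"
    using square_mor_iff[of ?m] m mc by auto
  have sXo: "?sX \<in> square_obj C" "?sY \<in> square_obj C" using square_mor_iff[of ?m] m by auto
  have sel: "q_top ?X = f" "q_left ?X = u" "q_b ?X = vdom C v" "q_top ?Y = f'" "q_left ?Y = u'" "q_b ?Y = vdom C v'"
    using d d' by (simp_all add: mksq_def)
  note kX' = kX[unfolded sel] and kY' = kY[unfolded sel]
  have kXs: "issq C (q_top ?sX) ?wX (vid C (vdom C v)) f" and kXe: "vcomp C u ?wX = q_left ?sX"
    and kYs: "issq C (q_top ?sY) ?wY (vid C (vdom C v')) f'" and kYe: "vcomp C u' ?wY = q_left ?sY" using kX' kY' by blast+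
  note dX = sqD[OF kXs] and dY = sqD[OF kYs] and dm = sqD[OF mm(1)]
  have uo: "vdom C v \<in> dobj C" "vdom C v' \<in> dobj C" using v_ob d d' by auto
  have kXi: "issq C f wi (vid C (vdom C v)) (q_top ?sX)" by (rule sq_inverse[OF kXs wi vinverse_id[OF uo(1)]])
  note dXi = sqD[OF kXi]
  define aa where "aa = vcomp C ?wY (vcomp C (qm_a ?m) wi)"
  have s1: "issq C f (vcomp C (qm_a ?m) wi) (vcomp C b (vid C (vdom C v))) (q_top ?sY)" by (rule sq_v[OF kXi mm(1)])
  have s2: "issq C f (vcomp C (qm_a ?m) wi) b (q_top ?sY)" using s1 vid_right[OF b(1)] b(2) by simp
  have s3: "issq C f aa (vcomp C (vid C (vdom C v')) b) f'" unfolding aa_def by (rule sq_v[OF s2 kYs])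
  have asq: "issq C f aa b f'" using s3 vid_left[OF b(1)] b(3) by simp
  have mor: "wi \<in> vmor C" "qm_a ?m \<in> vmor C" "?wY \<in> vmor C" "?wX \<in> vmor C" using dXi dm dY dX by auto
  have uw: "vcomp C (q_left ?sX) wi = u"
    using inv_cancel_right[OF wi d(3)] kXe dX d by simp
  have ql: "q_left ?sX \<in> vmor C" "vdom C (q_left ?sX) = hdom C (q_top ?sX)" "vcod C (q_left ?sX) = vcod C u"
    using kXe[symmetric] vcomp_mor[of ?wX u] mor d dX by auto
  have "vcomp C u' aa = vcomp C (vcomp C u' ?wY) (vcomp C (qm_a ?m) wi)"
    unfolding aa_def using vassoc[of "vcomp C (qm_a ?m) wi" ?wY u'] sqD[OF s2] mor d' dY by simp
  also have "\<dots> = vcomp C (vcomp C (q_left ?sY) (qm_a ?m)) wi"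
    using vassoc[of wi "qm_a ?m" "q_left ?sY"] kYe[symmetric] vcomp_mor[of ?wY u'] mor d' dY dXi dm by simp
  also have "\<dots> = vcomp C c (vcomp C (q_left ?sX) wi)"
    using vassoc[of wi "q_left ?sX" c] mm(2) mor ql dXi dcd d by simp
  also have "\<dots> = vcomp C c u" using uw by simp
  finally have acomm: "vcomp C c u = vcomp C u' aa" by simp
  show ?thesis
  proof (rule ex1I[of _ aa])
    show "issq C f aa b f' \<and> vcomp C c u = vcomp C u' aa" using asq acomm by blast
    fix e assume e: "issq C f e b f' \<and> vcomp C c u = vcomp C u' e"
    let ?p = "\<lparr>qm_src = ?X, qm_tgt = ?Y, qm_a = e, qm_b = b, qm_c = c, qm_d = d\<rparr>"
    have p: "?p \<in> cmor (square_cat C)" using square_mor_iff[of ?p] X cd b e d d' by (simp add: mksq_def)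
    have ip: "j_mor ?p = ?n" by (simp add: j_mor_def)
    have "ccomp (square_cat C) (w ?Y) (tM ?n) = ccomp (square_cat C) ?p (w ?X)"
      using st(4) p ip unfolding is_nattrans_def cat_sels by auto
    from arg_cong[OF this, of qm_a] have eq: "vcomp C ?wY (qm_a ?m) = vcomp C e ?wX" by (simp add: cat_sels)
    have em: "e \<in> vmor C" "vdom C e = hdom C f" using sqD[of f e b f'] e by auto
    have "e = vcomp C (vcomp C e ?wX) wi" using inv_cancel_right[OF wi em(1)] em(2) dX by simp
    also have "\<dots> = aa" unfolding eq[symmetric] aa_def using vassoc[of wi "qm_a ?m" ?wY] mor dXi dm dY by simp
    finally show "e = aa" .
  qed
qed

text \<open>Both squares are compared with the chosen filling of their common cospan; one comparison
  is inverted and composed with the other.\<close>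

lemma cospan_compare:
  assumes s: "issq C f u v g" and s': "issq C f' u' v g"
  shows "\<exists>a. vweq C a \<and> vdom C a = hdom C f \<and> vcod C a = hdom C f'"
proof -
  obtain tO tM w where st: 
    "is_nattrans (square_cat C) (square_cat C) (tO \<circ> j_obj) (tM \<circ> j_mor) id id w"
    "\<forall>X\<in>square_obj C. qm_b (w X) = vid C (q_b X) \<and> qm_c (w X) = vid C (q_c X) \<and> qm_d (w X) = vid C (q_d X) \<and> vweq C (qm_a (w X))"
    using stable unfolding stable_def by blast
  let ?X = "mksq f u v g" let ?Y = "mksq f' u' v g"
  have X: "?X \<in> square_obj C" "?Y \<in> square_obj C" using mksq_obj s s' by auto
  have wX: "w Z \<in> cmor (square_cat C) \<and> qm_src (w Z) = tO (j_obj Z) \<and> qm_tgt (w Z) = Z" if "Z \<in> square_obj C" for Z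
    using st(1) that unfolding is_nattrans_def cat_sels by simp
  have r: "issq C (q_top (tO (j_obj Z))) (qm_a (w Z)) (qm_b (w Z)) (q_top Z)" if "Z \<in> square_obj C" for Z
    using wX[OF that] square_mor_iff[of "w Z"] by auto
  have jj: "j_obj ?X = j_obj ?Y" using sqD[OF s] sqD[OF s'] by (simp add: j_obj_def mksq_def)
  note dX = sqD[OF r[OF X(1)]] and dY = sqD[OF r[OF X(2)]]
  have v: "vweq C (qm_a (w ?X))" "vweq C (qm_a (w ?Y))" using st(2) X by auto
  obtain i where i: "vinverse C (qm_a (w ?X)) i" "vweq C i" using vweq_inverse[OF v(1)] by blast
  have "vweq C (vcomp C (qm_a (w ?Y)) i)" "vdom C (vcomp C (qm_a (w ?Y)) i) = hdom C f" "vcod C (vcomp C (qm_a (w ?Y)) i) = hdom C f'"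
    using vweq_comp[OF i(2) v(2)] vcomp_mor[of i "qm_a (w ?Y)"] i(1) dX dY jj unfolding vinverse_def by (auto simp: mksq_def)
  then show ?thesis by blast
qed

text \<open>Fill the cospan of \<open>a\<close> and the initial arrow into its codomain, with some
  left side \<open>z\<close> into \<open>O\<close>. Pasted with the given square it fills the cospan
  of \<open>b\<close> and an initial arrow, which the defining square of \<open>b\<close> fills as
  well, with corner \<open>O\<close>. So a weak equivalence joins the two corners, and it equals
  \<open>z\<close> because \<open>O\<close> is vertically terminal. From \<open>z\<close> the
  property passes to \<open>a\<close> by \<open>vweqI_left\<close>.\<close>

lemma vweqI_right:
  assumes s: "issq C f a b k" and b: "vweq C b"
  shows "vweq C a"
proof -
  note d = sqD[OF s]
  have ob: "vcod C a \<in> dobj C" "vcod C b \<in> dobj C" using v_ob d by auto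
  obtain l z where l: "issq C l z a (hinit C (vcod C a))"
    using cospan_square[OF hinit_mor(1)[OF ob(1)] d(3)] hinit_mor(3)[OF ob(1)] by auto
  note dl = sqD[OF l]
  have "hcomp C k (hinit C (vcod C a)) = hinit C (vcod C b)"
    using hinit_unique[of "hcomp C k (hinit C (vcod C a))"] hcomp_mor[OF hinit_mor(1)[OF ob(1)] d(2)] hinit_mor[OF ob(1)] d by simp
  then have 1: "issq C (hcomp C f l) z b (hinit C (vcod C b))" using sq_h[OF l s] by simp
  have 2: "issq C (hinit C (vdom C b)) (vid C zo) b (hinit C (vcod C b))" using b by (simp add: vweq_def)
  obtain e where e: "vweq C e" "vdom C e = hdom C (hcomp C f l)" "vcod C e = hdom C (hinit C (vdom C b))"
    using cospan_compare[OF 1 2] by blast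
  have "z = e"
    using to_zero_unique[of z e] dl vweq_mor[OF e(1)] e hcomp_mor(2)[of l f] d hinit_mor(2) ob v_ob(1)[OF d(4)] by simp
  then show ?thesis using vweqI_left[OF l] e(1) by simp
qed

end

section \<open>The categories \<open>S_cat C n\<close> are groupoids\<close>

definition mkm :: "nat \<Rightarrow> ('o,'h,'v) sobj \<Rightarrow> ('o,'h,'v) sobj \<Rightarrow> (nat \<Rightarrow> nat \<Rightarrow> 'v) \<Rightarrow> ('o,'h,'v) smor" where
  "mkm n X Y \<sigma> = \<lparr>sm_src = X, sm_tgt = Y, sm_c = (\<lambda>j k. if j \<le> k \<and> k \<le> n then \<sigma> j k else undefined)\<rparr>"

lemma S_sels:
  "cob (S_cat C n) = S_obj C n" "cdom (S_cat C n) = sm_src" "ccod (S_cat C n) = sm_tgt"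
  "cid (S_cat C n) X = mkm n X X (\<lambda>j k. vid C (sA X j k))"
  "ccomp (S_cat C n) g f = mkm n (sm_src f) (sm_tgt g) (\<lambda>j k. vcomp C (sm_c g j k) (sm_c f j k))"
  by (simp_all add: S_cat_def mkm_def)

lemma mkm_sels [simp]:
  "sm_src (mkm n X Y \<sigma>) = X" "sm_tgt (mkm n X Y \<sigma>) = Y" "j \<le> k \<Longrightarrow> k \<le> n \<Longrightarrow> sm_c (mkm n X Y \<sigma>) j k = \<sigma> j k"
  by (simp_all add: mkm_def)

lemma S_objD:
  assumes "X \<in> S_obj C n"
  shows "j \<le> k \<Longrightarrow> k \<le> n \<Longrightarrow> sA X j k \<in> dobj C" "j \<le> n \<Longrightarrow> sA X j j = zobj C"
    "j \<le> k \<Longrightarrow> k < n \<Longrightarrow> sH X j k \<in> hmor C" "j \<le> k \<Longrightarrow> k < n \<Longrightarrow> hdom C (sH X j k) = sA X j k"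
    "j \<le> k \<Longrightarrow> k < n \<Longrightarrow> hcod C (sH X j k) = sA X j (Suc k)"
    "j < k \<Longrightarrow> k \<le> n \<Longrightarrow> sV X j k \<in> vmor C" "j < k \<Longrightarrow> k \<le> n \<Longrightarrow> vdom C (sV X j k) = sA X j k"
    "j < k \<Longrightarrow> k \<le> n \<Longrightarrow> vcod C (sV X j k) = sA X (Suc j) k"
    "j < k \<Longrightarrow> k < n \<Longrightarrow> issq C (sH X j k) (sV X j k) (sV X j (Suc k)) (sH X (Suc j) k)"
  using assms unfolding S_obj_def by simp_all

lemma S_homD:
  assumes "m \<in> chom (S_cat C n) X Y"
  shows "X \<in> S_obj C n" "Y \<in> S_obj C n" "sm_src m = X" "sm_tgt m = Y"
    "j \<le> k \<Longrightarrow> k \<le> n \<Longrightarrow> sm_c m j k \<in> vmor C" "j \<le> k \<Longrightarrow> k \<le> n \<Longrightarrow> vdom C (sm_c m j k) = sA X j k"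
    "j \<le> k \<Longrightarrow> k \<le> n \<Longrightarrow> vcod C (sm_c m j k) = sA Y j k"
    "j \<le> k \<Longrightarrow> k < n \<Longrightarrow> issq C (sH X j k) (sm_c m j k) (sm_c m j (Suc k)) (sH Y j k)"
    "j < k \<Longrightarrow> k \<le> n \<Longrightarrow> vcomp C (sm_c m (Suc j) k) (sV X j k) = vcomp C (sV Y j k) (sm_c m j k)"
    "\<not> (j \<le> k \<and> k \<le> n) \<Longrightarrow> sm_c m j k = undefined"
  using assms unfolding chom_def S_cat_def by auto

lemma S_homI:
  assumes "X \<in> S_obj C n" "Y \<in> S_obj C n"
    "\<And>j k. j \<le> k \<Longrightarrow> k \<le> n \<Longrightarrow> \<sigma> j k \<in> vmor C \<and> vdom C (\<sigma> j k) = sA X j k \<and> vcod C (\<sigma> j k) = sA Y j k"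
    "\<And>j k. j \<le> k \<Longrightarrow> k < n \<Longrightarrow> issq C (sH X j k) (\<sigma> j k) (\<sigma> j (Suc k)) (sH Y j k)"
    "\<And>j k. j < k \<Longrightarrow> k \<le> n \<Longrightarrow> vcomp C (\<sigma> (Suc j) k) (sV X j k) = vcomp C (sV Y j k) (\<sigma> j k)"
  shows "mkm n X Y \<sigma> \<in> chom (S_cat C n) X Y"
  using assms unfolding chom_def S_cat_def by (auto simp: mkm_def)

lemma S_hom_eqI:
  assumes "m \<in> chom (S_cat C n) X Y" "m' \<in> chom (S_cat C n) X Y" "\<And>j k. j \<le> k \<Longrightarrow> k \<le> n \<Longrightarrow> sm_c m j k = sm_c m' j k"
  shows "m = m'"
proof (rule smor.equality)
  show "sm_c m = sm_c m'" using assms(3) S_homD(10)[OF assms(1)] S_homD(10)[OF assms(2)] by (metis ext)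
qed (use S_homD(3,4)[OF assms(1)] S_homD(3,4)[OF assms(2)] in auto)

lemma hpath_refl: "hpath C X j k k = hid C (sA X j k)" by (cases k) auto
lemma vpath_refl: "vpath C X k j j = vid C (sA X j k)" by (cases j) auto
lemma hpath_Suc: "k \<le> l \<Longrightarrow> hpath C X j k (Suc l) = hcomp C (sH X j l) (hpath C X j k l)" by simp
lemma vpath_Suc: "j \<le> l \<Longrightarrow> vpath C X k j (Suc l) = vcomp C (sV X l k) (vpath C X k j l)" by simp

context isostable_dc
begin

abbreviation (input) SS where "SS n \<equiv> S_cat C n"

text \<open>The property starts on the diagonal and spreads to the right along row \<open>j\<close>,
  because consecutive components are the sides of a square.\<close>

lemma S_vweq:
  assumes m: "m \<in> chom (SS n) X Y" and jk: "j \<le> k" "k \<le> n"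
  shows "vweq C (sm_c m j k)"
  using jk
proof (induction k rule: dec_induct)
  case base
  have "sm_c m j j = vid C zo"
    by (rule zero_endo) (use S_homD(5-7)[OF m, of j j] S_objD(2)[OF S_homD(1)[OF m]] S_objD(2)[OF S_homD(2)[OF m]] base in auto)
  then show ?case using vweq_id[OF zob] by simp
next
  case (step k)
  then show ?case using vweqI_left[OF S_homD(8)[OF m, of j k]] by simp
qed

lemma S_diag: "m \<in> chom (SS n) X Y \<Longrightarrow> j \<le> n \<Longrightarrow> sm_c m j j = vid C zo"
  by (rule zero_endo) (use S_homD(5-7)[of m C n X Y j j] S_objD(2)[OF S_homD(1)] S_objD(2)[OF S_homD(2)] in auto)

text \<open>Inverses are taken componentwise. That the inverse components again form squares with
  the horizontal arrows is the inversion condition in \<open>isostable\<close>, used as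
  \<open>sq_inverse\<close>.\<close>

lemma S_groupoid: "cgroupoid (SS n)"
proof
  fix m assume "m \<in> cmor (SS n)"
  then have "m \<in> chom (SS n) (sm_src m) (sm_tgt m)" by (simp add: chom_def S_sels)
  from S_homD(1,2)[OF this] show "cdom (SS n) m \<in> cob (SS n)" "ccod (SS n) m \<in> cob (SS n)" by (simp_all add: S_sels)
next
  fix X assume "X \<in> cob (SS n)"
  then have X: "X \<in> S_obj C n" by (simp add: S_sels)
  note d = S_objD[OF X]
  show "cid (SS n) X \<in> chom (SS n) X X"
    unfolding S_sels
  proof (rule S_homI[OF X X])
    fix j k assume jk: "j \<le> k" "k \<le> n"
    show "vid C (sA X j k) \<in> vmor C \<and> vdom C (vid C (sA X j k)) = sA X j k \<and> vcod C (vid C (sA X j k)) = sA X j k"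
      using vid_mor[OF d(1)[OF jk]] by simp
  next
    fix j k assume jk: "j \<le> k" "k < n"
    show "issq C (sH X j k) (vid C (sA X j k)) (vid C (sA X j (Suc k))) (sH X j k)"
      using sq_hid[OF d(3)[OF jk]] d(4,5)[OF jk] by simp
  next
    fix j k assume jk: "j < k" "k \<le> n"
    show "vcomp C (vid C (sA X (Suc j) k)) (sV X j k) = vcomp C (sV X j k) (vid C (sA X j k))"
      using vid_left[OF d(6)[OF jk]] vid_right[OF d(6)[OF jk]] d(7,8)[OF jk] by simp
  qed
next
  fix f g X Y Z assume f: "f \<in> chom (SS n) X Y" and g: "g \<in> chom (SS n) Y Z"
  note df = S_homD[OF f] and dg = S_homD[OF g]
  show "ccomp (SS n) g f \<in> chom (SS n) X Z"
    unfolding S_sels df(3) dg(4)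
  proof (rule S_homI[OF df(1) dg(2)])
    fix j k assume jk: "j \<le> k" "k \<le> n"
    show "vcomp C (sm_c g j k) (sm_c f j k) \<in> vmor C \<and> vdom C (vcomp C (sm_c g j k) (sm_c f j k)) = sA X j k \<and>
        vcod C (vcomp C (sm_c g j k) (sm_c f j k)) = sA Z j k"
      using vcomp_mor[of "sm_c f j k" "sm_c g j k"] df(5-7)[OF jk] dg(5-7)[OF jk] by simp
  next
    fix j k assume jk: "j \<le> k" "k < n"
    show "issq C (sH X j k) (vcomp C (sm_c g j k) (sm_c f j k)) (vcomp C (sm_c g j (Suc k)) (sm_c f j (Suc k))) (sH Z j k)"
      by (rule sq_v[OF df(8)[OF jk] dg(8)[OF jk]])
  next
    fix j k assume jk: "j < k" "k \<le> n"
    have jk': "j \<le> k" "Suc j \<le> k" using jk by auto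
    note a = df(5-7)[OF jk'(1) jk(2)] df(5-7)[OF jk'(2) jk(2)] dg(5-7)[OF jk'(1) jk(2)] dg(5-7)[OF jk'(2) jk(2)]
      S_objD(6-8)[OF df(1) jk] S_objD(6-8)[OF df(2) jk] S_objD(6-8)[OF dg(2) jk]
    have "vcomp C (vcomp C (sm_c g (Suc j) k) (sm_c f (Suc j) k)) (sV X j k) = vcomp C (sm_c g (Suc j) k) (vcomp C (sm_c f (Suc j) k) (sV X j k))"
      using vassoc[of "sV X j k" "sm_c f (Suc j) k" "sm_c g (Suc j) k"] a by simp
    also have "\<dots> = vcomp C (sm_c g (Suc j) k) (vcomp C (sV Y j k) (sm_c f j k))" using df(9)[OF jk] by simp
    also have "\<dots> = vcomp C (vcomp C (sm_c g (Suc j) k) (sV Y j k)) (sm_c f j k)"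
      using vassoc[of "sm_c f j k" "sV Y j k" "sm_c g (Suc j) k"] a by simp
    also have "\<dots> = vcomp C (vcomp C (sV Z j k) (sm_c g j k)) (sm_c f j k)" using dg(9)[OF jk] by simp
    also have "\<dots> = vcomp C (sV Z j k) (vcomp C (sm_c g j k) (sm_c f j k))"
      using vassoc[of "sm_c f j k" "sm_c g j k" "sV Z j k"] a by simp
    finally show "vcomp C (vcomp C (sm_c g (Suc j) k) (sm_c f (Suc j) k)) (sV X j k) = vcomp C (sV Z j k) (vcomp C (sm_c g j k) (sm_c f j k))" .
  qed
next
  fix f X Y assume f: "f \<in> chom (SS n) X Y"
  note df = S_homD[OF f]
  have e: "mkm n X Y (sm_c f) = f"
  proof (rule smor.equality)
    show "sm_c (mkm n X Y (sm_c f)) = sm_c f" using df(10) by (auto simp: mkm_def fun_eq_iff)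
  qed (use df in auto)
  have r: "vcomp C (sm_c f j k) (vid C (sA X j k)) = sm_c f j k" "vcomp C (vid C (sA Y j k)) (sm_c f j k) = sm_c f j k"
    if "j \<le> k" "k \<le> n" for j k
    using vid_right[OF df(5)[OF that]] vid_left[OF df(5)[OF that]] df(6,7)[OF that] by simp_all
  have c: "mkm n X Y \<sigma> = mkm n X Y \<tau>" if "\<And>j k. j \<le> k \<Longrightarrow> k \<le> n \<Longrightarrow> \<sigma> j k = \<tau> j k" for \<sigma> \<tau> :: "nat \<Rightarrow> nat \<Rightarrow> 'v"
    using that by (auto simp: mkm_def fun_eq_iff)
  show "ccomp (SS n) f (cid (SS n) X) = f"
    unfolding S_sels(5) df(4) using c[of "\<lambda>j k. vcomp C (sm_c f j k) (sm_c (cid (SS n) X) j k)" "sm_c f"] r e by (simp add: S_sels(4))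
  show "ccomp (SS n) (cid (SS n) Y) f = f"
    unfolding S_sels(5) df(3) using c[of "\<lambda>j k. vcomp C (sm_c (cid (SS n) Y) j k) (sm_c f j k)" "sm_c f"] r e by (simp add: S_sels(4))
next
  fix f g h X Y Z W assume f: "f \<in> chom (SS n) X Y" and g: "g \<in> chom (SS n) Y Z" and h: "h \<in> chom (SS n) Z W"
  note df = S_homD[OF f] and dg = S_homD[OF g] and dh = S_homD[OF h]
  have "vcomp C (sm_c h j k) (vcomp C (sm_c g j k) (sm_c f j k)) = vcomp C (vcomp C (sm_c h j k) (sm_c g j k)) (sm_c f j k)"
    if "j \<le> k" "k \<le> n" for j k
    using vassoc[of "sm_c f j k" "sm_c g j k" "sm_c h j k"] df(5-7)[OF that] dg(5-7)[OF that] dh(5-7)[OF that] by simp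
  then show "ccomp (SS n) h (ccomp (SS n) g f) = ccomp (SS n) (ccomp (SS n) h g) f"
    unfolding S_sels by (auto simp: mkm_def fun_eq_iff)
next
  fix f X Y assume f: "f \<in> chom (SS n) X Y"
  note df = S_homD[OF f]
  define \<sigma> where "\<sigma> j k = (SOME i. vinverse C (sm_c f j k) i)" for j k
  have i: "vinverse C (sm_c f j k) (\<sigma> j k)" if "j \<le> k" "k \<le> n" for j k
    unfolding \<sigma>_def using vweq_inverse[OF S_vweq[OF f that]] by (metis someI_ex)
  have g: "mkm n Y X \<sigma> \<in> chom (SS n) Y X"
  proof (rule S_homI[OF df(2,1)])
    fix j k assume jk: "j \<le> k" "k \<le> n"
    show "\<sigma> j k \<in> vmor C \<and> vdom C (\<sigma> j k) = sA Y j k \<and> vcod C (\<sigma> j k) = sA X j k"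
      using i[OF jk] df(6,7)[OF jk] by (simp add: vinverse_def)
  next
    fix j k assume jk: "j \<le> k" "k < n"
    show "issq C (sH Y j k) (\<sigma> j k) (\<sigma> j (Suc k)) (sH X j k)"
      by (rule sq_inverse[OF df(8)[OF jk] i i]) (use jk in auto)
  next
    fix j k assume jk: "j < k" "k \<le> n"
    have jk': "j \<le> k" "Suc j \<le> k" using jk by auto
    note i0 = i[OF jk'(1) jk(2)] and i1 = i[OF jk'(2) jk(2)]
    note a = df(5-7)[OF jk'(1) jk(2)] df(5-7)[OF jk'(2) jk(2)] S_objD(6-8)[OF df(1) jk] S_objD(6-8)[OF df(2) jk]
    have v: "\<sigma> j k \<in> vmor C" "\<sigma> (Suc j) k \<in> vmor C" "vdom C (\<sigma> j k) = sA Y j k" "vcod C (\<sigma> j k) = sA X j k"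
      "vdom C (\<sigma> (Suc j) k) = sA Y (Suc j) k" "vcod C (\<sigma> (Suc j) k) = sA X (Suc j) k"
      using i0 i1 a by (auto simp: vinverse_def)
    have "sV X j k = vcomp C (\<sigma> (Suc j) k) (vcomp C (sm_c f (Suc j) k) (sV X j k))"
      using inv_cancel_left[OF i1, of "sV X j k"] a by simp
    also have "\<dots> = vcomp C (\<sigma> (Suc j) k) (vcomp C (sV Y j k) (sm_c f j k))" using df(9)[OF jk] by simp
    also have "\<dots> = vcomp C (vcomp C (\<sigma> (Suc j) k) (sV Y j k)) (sm_c f j k)"
      using vassoc[of "sm_c f j k" "sV Y j k" "\<sigma> (Suc j) k"] a v by simp
    finally have "vcomp C (sV X j k) (\<sigma> j k) = vcomp C (vcomp C (vcomp C (\<sigma> (Suc j) k) (sV Y j k)) (sm_c f j k)) (\<sigma> j k)" by simp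
    also have "\<dots> = vcomp C (\<sigma> (Suc j) k) (sV Y j k)"
      using inv_cancel_right[OF i0, of "vcomp C (\<sigma> (Suc j) k) (sV Y j k)"] vcomp_mor[of "sV Y j k" "\<sigma> (Suc j) k"] a v by simp
    finally show "vcomp C (\<sigma> (Suc j) k) (sV Y j k) = vcomp C (sV X j k) (\<sigma> j k)" by simp
  qed
  have "vcomp C (\<sigma> j k) (sm_c f j k) = vid C (sA X j k)" "vcomp C (sm_c f j k) (\<sigma> j k) = vid C (sA Y j k)" if "j \<le> k" "k \<le> n" for j k
    using i[OF that] df(6,7)[OF that] by (simp_all add: vinverse_def)
  then have "ccomp (SS n) (mkm n Y X \<sigma>) f = cid (SS n) X \<and> ccomp (SS n) f (mkm n Y X \<sigma>) = cid (SS n) Y"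
    unfolding S_sels using df(3,4) by (auto simp: mkm_def fun_eq_iff)
  then show "\<exists>g\<in>chom (SS n) Y X. ccomp (SS n) g f = cid (SS n) X \<and> ccomp (SS n) f g = cid (SS n) Y" using g by blast
qed

subsection \<open>Simplicial operators\<close>

lemma hpath_mor:
  assumes X: "X \<in> S_obj C n" and jk: "j \<le> k" "k \<le> l" "l \<le> n"
  shows "hpath C X j k l \<in> hmor C \<and> hdom C (hpath C X j k l) = sA X j k \<and> hcod C (hpath C X j k l) = sA X j l"
  using jk(2,3)
proof (induction l rule: dec_induct)
  case base then show ?case using hid_mor[OF S_objD(1)[OF X jk(1)]] by (simp add: hpath_refl)
next
  case (step l)
  then show ?case using hcomp_mor[of "hpath C X j k l" "sH X j l"] S_objD(3-5)[OF X, of j l] jk by (simp add: hpath_Suc del: hpath.simps)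
qed

lemma vpath_mor:
  assumes X: "X \<in> S_obj C n" and jk: "j \<le> l" "l \<le> k" "k \<le> n"
  shows "vpath C X k j l \<in> vmor C \<and> vdom C (vpath C X k j l) = sA X j k \<and> vcod C (vpath C X k j l) = sA X l k"
  using jk(1,2)
proof (induction l rule: dec_induct)
  case base then show ?case using vid_mor[OF S_objD(1)[OF X, of j k]] jk by (simp add: vpath_refl)
next
  case (step l)
  then show ?case using vcomp_mor[of "vpath C X k j l" "sV X l k"] S_objD(6-8)[OF X, of l k] jk by (simp add: vpath_Suc del: vpath.simps)
qed

lemma hpath_comp:
  assumes X: "X \<in> S_obj C n" and jk: "j \<le> k" "k \<le> l" "l \<le> l'" "l' \<le> n"
  shows "hcomp C (hpath C X j l l') (hpath C X j k l) = hpath C X j k l'"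
  using jk(3,4)
proof (induction l' rule: dec_induct)
  case base then show ?case using hpath_mor[OF X jk(1,2)] hid_left[of "hpath C X j k l"] by (simp add: hpath_refl)
next
  case (step l')
  then show ?case
    using hassoc[of "hpath C X j k l" "hpath C X j l l'" "sH X j l'"] hpath_mor[OF X jk(1,2)] hpath_mor[OF X, of j l l']
      S_objD(3-5)[OF X, of j l'] jk by (simp add: hpath_Suc del: hpath.simps)
qed

lemma vpath_comp:
  assumes X: "X \<in> S_obj C n" and jk: "j \<le> l" "l \<le> l'" "l' \<le> k" "k \<le> n"
  shows "vcomp C (vpath C X k l l') (vpath C X k j l) = vpath C X k j l'"
  using jk(2,3)
proof (induction l' rule: dec_induct)
  case base then show ?case using vpath_mor[OF X jk(1) _ jk(4)] vid_left[of "vpath C X k j l"] by (simp add: vpath_refl)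
next
  case (step l')
  then show ?case
    using vassoc[of "vpath C X k j l" "vpath C X k l l'" "sV X l' k"] vpath_mor[OF X jk(1) _ jk(4)] vpath_mor[OF X, of l l' k]
      S_objD(6-8)[OF X, of l' k] jk by (simp add: vpath_Suc del: vpath.simps)
qed

lemma strip_square:
  assumes X: "X \<in> S_obj C n" and jk: "j < k" "k \<le> l" "l \<le> n"
  shows "issq C (hpath C X j k l) (sV X j k) (sV X j l) (hpath C X (Suc j) k l)"
  using jk(2,3)
proof (induction l rule: dec_induct)
  case base then show ?case using sq_vid[OF S_objD(6)[OF X jk(1)]] S_objD(7,8)[OF X jk(1)] by (simp add: hpath_refl)
next
  case (step l)
  then show ?case using sq_h[OF step.IH S_objD(9)[OF X, of j l]] jk(1) by (simp add: hpath_Suc del: hpath.simps)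
qed

lemma rectangle_square:
  assumes X: "X \<in> S_obj C n" and jk: "j \<le> j'" "j' \<le> k" "k \<le> l" "l \<le> n"
  shows "issq C (hpath C X j k l) (vpath C X k j j') (vpath C X l j j') (hpath C X j' k l)"
  using jk(1,2)
proof (induction j' rule: dec_induct)
  case base
  then show ?case using sq_hid[of "hpath C X j k l"] hpath_mor[OF X _ jk(3,4), of j] jk by (simp add: vpath_refl)
next
  case (step j')
  then show ?case using sq_v[OF step.IH strip_square[OF X, of j' k l]] jk by (simp add: vpath_Suc del: vpath.simps)
qed

lemma theta_obj_in:
  assumes X: "X \<in> S_obj C n" and \<theta>: "monotone_idx \<theta> m n"
  shows "theta_obj C \<theta> m X \<in> S_obj C m"
proof -
  have t: "\<theta> j \<le> \<theta> k" "\<theta> k \<le> n" if "j \<le> k" "k \<le> m" for j k using \<theta> that by (auto simp: monotone_idx_def)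
  have t2: "\<theta> k \<le> n" if "k \<le> m" for k using \<theta> that by (auto simp: monotone_idx_def)
  show ?thesis unfolding S_obj_def
  proof (intro CollectI conjI allI impI)
    fix j k assume jk: "j \<le> k \<and> k < m"
    have "hpath C X (\<theta> j) (\<theta> k) (\<theta> (Suc k)) \<in> hmor C \<and> hdom C (hpath C X (\<theta> j) (\<theta> k) (\<theta> (Suc k))) = sA X (\<theta> j) (\<theta> k) \<and>
      hcod C (hpath C X (\<theta> j) (\<theta> k) (\<theta> (Suc k))) = sA X (\<theta> j) (\<theta> (Suc k))"
      by (rule hpath_mor[OF X]) (use t(1) t2 jk in auto)
    then show "sH (theta_obj C \<theta> m X) j k \<in> hmor C" "hdom C (sH (theta_obj C \<theta> m X) j k) = sA (theta_obj C \<theta> m X) j k"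
      "hcod C (sH (theta_obj C \<theta> m X) j k) = sA (theta_obj C \<theta> m X) j (Suc k)" using jk by (simp_all add: theta_obj_def)
  next
    fix j k assume jk: "j < k \<and> k \<le> m"
    have "vpath C X (\<theta> k) (\<theta> j) (\<theta> (Suc j)) \<in> vmor C \<and> vdom C (vpath C X (\<theta> k) (\<theta> j) (\<theta> (Suc j))) = sA X (\<theta> j) (\<theta> k) \<and>
      vcod C (vpath C X (\<theta> k) (\<theta> j) (\<theta> (Suc j))) = sA X (\<theta> (Suc j)) (\<theta> k)"
      by (rule vpath_mor[OF X]) (use t(1) t2 jk in auto)
    then show "sV (theta_obj C \<theta> m X) j k \<in> vmor C" "vdom C (sV (theta_obj C \<theta> m X) j k) = sA (theta_obj C \<theta> m X) j k"
      "vcod C (sV (theta_obj C \<theta> m X) j k) = sA (theta_obj C \<theta> m X) (Suc j) k" using jk by (simp_all add: theta_obj_def)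
  next
    fix j k assume jk: "j < k \<and> k < m"
    have "issq C (hpath C X (\<theta> j) (\<theta> k) (\<theta> (Suc k))) (vpath C X (\<theta> k) (\<theta> j) (\<theta> (Suc j))) (vpath C X (\<theta> (Suc k)) (\<theta> j) (\<theta> (Suc j))) (hpath C X (\<theta> (Suc j)) (\<theta> k) (\<theta> (Suc k)))"
      by (rule rectangle_square[OF X]) (use t(1) t2 jk in auto)
    then show "issq C (sH (theta_obj C \<theta> m X) j k) (sV (theta_obj C \<theta> m X) j k) (sV (theta_obj C \<theta> m X) j (Suc k)) (sH (theta_obj C \<theta> m X) (Suc j) k)"
      using jk by (simp add: theta_obj_def)
  qed (use S_objD(1,2)[OF X] t(1) t2 in \<open>auto simp: theta_obj_def\<close>)
qed

lemma theta_mor_in: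
  assumes f: "f \<in> chom (SS n) X Y" and \<theta>: "monotone_idx \<theta> m n"
  shows "theta_mor C \<theta> m f \<in> chom (SS m) (theta_obj C \<theta> m X) (theta_obj C \<theta> m Y)"
proof -
  note d = S_homD[OF f]
  have t: "\<theta> j \<le> \<theta> k" "\<theta> k \<le> n" if "j \<le> k" "k \<le> m" for j k using \<theta> that by (auto simp: monotone_idx_def)
  have hp: "issq C (hpath C X j k l) (sm_c f j k) (sm_c f j l) (hpath C Y j k l)" if "j \<le> k" "k \<le> l" "l \<le> n" for j k l
    using that(2,3)
  proof (induction l rule: dec_induct)
    case base then show ?case using sq_vid[OF d(5)[OF that(1)]] d(6,7)[OF that(1)] by (simp add: hpath_refl)
  next
    case (step l)
    then show ?case using sq_h[OF step.IH d(8)[of j l]] that(1) by (simp add: hpath_Suc del: hpath.simps)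
  qed
  have vp: "vcomp C (sm_c f l k) (vpath C X k j l) = vcomp C (vpath C Y k j l) (sm_c f j k)" if "j \<le> l" "l \<le> k" "k \<le> n" for j k l
    using that(1,2)
  proof (induction l rule: dec_induct)
    case base then show ?case using vid_left[OF d(5), of j k] vid_right[OF d(5), of j k] d(6,7)[of j k] that by (simp add: vpath_refl)
  next
    case (step l)
    have lk: "l \<le> k" "l < k" "Suc l \<le> k" "j \<le> k" using step that by auto
    note a = d(5-7)[OF lk(1) that(3)] d(5-7)[OF lk(3) that(3)] d(5-7)[OF lk(4) that(3)] S_objD(6-8)[OF d(1) lk(2) that(3)]
      S_objD(6-8)[OF d(2) lk(2) that(3)] vpath_mor[OF d(1) step.hyps(1) lk(1) that(3)] vpath_mor[OF d(2) step.hyps(1) lk(1) that(3)]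
    have "vcomp C (sm_c f (Suc l) k) (vcomp C (sV X l k) (vpath C X k j l)) = vcomp C (vcomp C (sm_c f (Suc l) k) (sV X l k)) (vpath C X k j l)"
      using vassoc[of "vpath C X k j l" "sV X l k" "sm_c f (Suc l) k"] a by simp
    also have "\<dots> = vcomp C (vcomp C (sV Y l k) (sm_c f l k)) (vpath C X k j l)" using d(9)[OF lk(2) that(3)] by simp
    also have "\<dots> = vcomp C (sV Y l k) (vcomp C (sm_c f l k) (vpath C X k j l))"
      using vassoc[of "vpath C X k j l" "sm_c f l k" "sV Y l k"] a by simp
    also have "\<dots> = vcomp C (sV Y l k) (vcomp C (vpath C Y k j l) (sm_c f j k))" using step lk by simp
    also have "\<dots> = vcomp C (vcomp C (sV Y l k) (vpath C Y k j l)) (sm_c f j k)"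
      using vassoc[of "sm_c f j k" "vpath C Y k j l" "sV Y l k"] a by simp
    finally show ?case using step.hyps(1) by (simp add: vpath_Suc del: vpath.simps)
  qed
  have eq: "theta_mor C \<theta> m f = mkm m (theta_obj C \<theta> m X) (theta_obj C \<theta> m Y) (\<lambda>j k. sm_c f (\<theta> j) (\<theta> k))"
    using d(3,4) by (simp add: theta_mor_def mkm_def)
  show ?thesis unfolding eq
  proof (rule S_homI[OF theta_obj_in[OF d(1) \<theta>] theta_obj_in[OF d(2) \<theta>]])
    fix j k assume jk: "j \<le> k" "k \<le> m"
    show "sm_c f (\<theta> j) (\<theta> k) \<in> vmor C \<and> vdom C (sm_c f (\<theta> j) (\<theta> k)) = sA (theta_obj C \<theta> m X) j k \<and> vcod C (sm_c f (\<theta> j) (\<theta> k)) = sA (theta_obj C \<theta> m Y) j k"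
      using d(5-7)[OF t[OF jk]] jk by (simp add: theta_obj_def)
  next
    fix j k assume jk: "j \<le> k" "k < m"
    show "issq C (sH (theta_obj C \<theta> m X) j k) (sm_c f (\<theta> j) (\<theta> k)) (sm_c f (\<theta> j) (\<theta> (Suc k))) (sH (theta_obj C \<theta> m Y) j k)"
      using hp[of "\<theta> j" "\<theta> k" "\<theta> (Suc k)"] t[of j k] t[of k "Suc k"] jk by (simp add: theta_obj_def)
  next
    fix j k assume jk: "j < k" "k \<le> m"
    show "vcomp C (sm_c f (\<theta> (Suc j)) (\<theta> k)) (sV (theta_obj C \<theta> m X) j k) = vcomp C (sV (theta_obj C \<theta> m Y) j k) (sm_c f (\<theta> j) (\<theta> k))"
      using vp[of "\<theta> j" "\<theta> (Suc j)" "\<theta> k"] t[of j "Suc j"] t[of "Suc j" k] jk by (simp add: theta_obj_def)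
  qed
qed

lemma theta_functor:
  assumes \<theta>: "monotone_idx \<theta> m n"
  shows "cfunctor (SS n) (SS m) (theta_obj C \<theta> m) (theta_mor C \<theta> m)"
proof (intro cfunctor.intro cfunctor_axioms.intro S_groupoid)
  have t: "\<theta> j \<le> \<theta> k" "\<theta> k \<le> n" if "j \<le> k" "k \<le> m" for j k using \<theta> that by (auto simp: monotone_idx_def)
  have th: "theta_mor C \<theta> m f \<in> chom (SS m) (theta_obj C \<theta> m (sm_src f)) (theta_obj C \<theta> m (sm_tgt f))" if "f \<in> cmor (SS n)" for f
    by (rule theta_mor_in[OF _ \<theta>]) (use that in \<open>simp add: chom_def S_sels\<close>)
  show "is_functor (SS n) (SS m) (theta_obj C \<theta> m) (theta_mor C \<theta> m)"
    unfolding is_functor_def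
  proof (intro conjI ballI impI)
    fix x assume "x \<in> cob (SS n)"
    then have x: "x \<in> S_obj C n" by (simp add: S_sels)
    show "theta_obj C \<theta> m x \<in> cob (SS m)" using theta_obj_in[OF x \<theta>] by (simp add: S_sels)
    show "theta_mor C \<theta> m (cid (SS n) x) = cid (SS m) (theta_obj C \<theta> m x)"
      using t by (auto simp: S_sels mkm_def theta_mor_def theta_obj_def fun_eq_iff)
  next
    fix f assume f: "f \<in> cmor (SS n)"
    show "theta_mor C \<theta> m f \<in> cmor (SS m)" using th[OF f] by (simp add: chom_def)
    show "cdom (SS m) (theta_mor C \<theta> m f) = theta_obj C \<theta> m (cdom (SS n) f)"
      "ccod (SS m) (theta_mor C \<theta> m f) = theta_obj C \<theta> m (ccod (SS n) f)" by (simp_all add: S_sels theta_mor_def)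
  next
    fix f g assume "f \<in> cmor (SS n)" "g \<in> cmor (SS n)" "ccod (SS n) f = cdom (SS n) g"
    show "theta_mor C \<theta> m (ccomp (SS n) g f) = ccomp (SS m) (theta_mor C \<theta> m g) (theta_mor C \<theta> m f)"
      using t by (auto simp: S_sels mkm_def theta_mor_def fun_eq_iff)
  qed
qed

lemma theta_hpath:
  assumes X: "X \<in> S_obj C n" and \<theta>: "monotone_idx \<theta> m n" and jk: "j \<le> k" "k \<le> l" "l \<le> m"
  shows "hpath C (theta_obj C \<theta> m X) j k l = hpath C X (\<theta> j) (\<theta> k) (\<theta> l)"
  using jk(2,3)
proof (induction l rule: dec_induct)
  case base then show ?case using jk by (simp add: hpath_refl theta_obj_def)
next
  case (step l)
  have "hcomp C (hpath C X (\<theta> j) (\<theta> l) (\<theta> (Suc l))) (hpath C X (\<theta> j) (\<theta> k) (\<theta> l)) = hpath C X (\<theta> j) (\<theta> k) (\<theta> (Suc l))"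
    by (rule hpath_comp[OF X]) (use \<theta> step jk in \<open>auto simp: monotone_idx_def\<close>)
  then show ?case using step jk by (simp add: hpath_Suc theta_obj_def del: hpath.simps)
qed

lemma theta_vpath:
  assumes X: "X \<in> S_obj C n" and \<theta>: "monotone_idx \<theta> m n" and jk: "j \<le> l" "l \<le> k" "k \<le> m"
  shows "vpath C (theta_obj C \<theta> m X) k j l = vpath C X (\<theta> k) (\<theta> j) (\<theta> l)"
  using jk(1,2)
proof (induction l rule: dec_induct)
  case base then show ?case using jk by (simp add: vpath_refl theta_obj_def)
next
  case (step l)
  have "vcomp C (vpath C X (\<theta> k) (\<theta> l) (\<theta> (Suc l))) (vpath C X (\<theta> k) (\<theta> j) (\<theta> l)) = vpath C X (\<theta> k) (\<theta> j) (\<theta> (Suc l))"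
    by (rule vpath_comp[OF X]) (use \<theta> step jk in \<open>auto simp: monotone_idx_def\<close>)
  then show ?case using step jk by (simp add: vpath_Suc theta_obj_def del: vpath.simps)
qed

lemma theta_obj_cong: "(\<And>l. l \<le> m \<Longrightarrow> \<theta> l = \<theta>' l) \<Longrightarrow> theta_obj C \<theta> m X = theta_obj C \<theta>' m X"
  by (auto simp: theta_obj_def fun_eq_iff)

text \<open>The composite is compared with \<open>\<psi>\<close> on \<open>{..m}\<close> only. Index
  maps such as \<open>incl_idx\<close> have no controlled values beyond their range, so equality of
  functions would ask too much.\<close>

lemma theta_obj_comp:
  assumes X: "X \<in> S_obj C n" and \<theta>': "monotone_idx \<theta>' m' n" and \<theta>: "monotone_idx \<theta> m m'"
    and c: "\<And>l. l \<le> m \<Longrightarrow> \<theta>' (\<theta> l) = \<psi> l"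
  shows "theta_obj C \<theta> m (theta_obj C \<theta>' m' X) = theta_obj C \<psi> m X"
proof -
  have t: "\<theta> j \<le> \<theta> k" "\<theta> k \<le> m'" if "j \<le> k" "k \<le> m" for j k using \<theta> that by (auto simp: monotone_idx_def)
  have "theta_obj C \<theta> m (theta_obj C \<theta>' m' X) = theta_obj C (\<lambda>l. \<theta>' (\<theta> l)) m X"
  proof (rule sobj.equality)
    show "sA (theta_obj C \<theta> m (theta_obj C \<theta>' m' X)) = sA (theta_obj C (\<lambda>l. \<theta>' (\<theta> l)) m X)"
      using t by (auto simp: theta_obj_def fun_eq_iff)
    show "sH (theta_obj C \<theta> m (theta_obj C \<theta>' m' X)) = sH (theta_obj C (\<lambda>l. \<theta>' (\<theta> l)) m X)"
    proof (intro ext)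
      fix j k
      show "sH (theta_obj C \<theta> m (theta_obj C \<theta>' m' X)) j k = sH (theta_obj C (\<lambda>l. \<theta>' (\<theta> l)) m X) j k"
        using theta_hpath[OF X \<theta>', of "\<theta> j" "\<theta> k" "\<theta> (Suc k)"] t[of j k] t[of k "Suc k"]
        by (simp add: theta_obj_def[of _ \<theta>] theta_obj_def[of _ "\<lambda>l. \<theta>' (\<theta> l)"])
    qed
    show "sV (theta_obj C \<theta> m (theta_obj C \<theta>' m' X)) = sV (theta_obj C (\<lambda>l. \<theta>' (\<theta> l)) m X)"
    proof (intro ext)
      fix j k
      show "sV (theta_obj C \<theta> m (theta_obj C \<theta>' m' X)) j k = sV (theta_obj C (\<lambda>l. \<theta>' (\<theta> l)) m X) j k"
        using theta_vpath[OF X \<theta>', of "\<theta> j" "\<theta> (Suc j)" "\<theta> k"] t[of j "Suc j"] t[of "Suc j" k]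
        by (simp add: theta_obj_def[of _ \<theta>] theta_obj_def[of _ "\<lambda>l. \<theta>' (\<theta> l)"])
    qed
  qed simp
  then show ?thesis using theta_obj_cong[OF c] by simp
qed

lemma theta_mor_comp:
  assumes f: "f \<in> cmor (SS n)" and \<theta>': "monotone_idx \<theta>' m' n" and \<theta>: "monotone_idx \<theta> m m'"
    and c: "\<And>l. l \<le> m \<Longrightarrow> \<theta>' (\<theta> l) = \<psi> l"
  shows "theta_mor C \<theta> m (theta_mor C \<theta>' m' f) = theta_mor C \<psi> m f"
proof -
  have t: "\<theta> j \<le> \<theta> k" "\<theta> k \<le> m'" if "j \<le> k" "k \<le> m" for j k using \<theta> that by (auto simp: monotone_idx_def)
  have s: "sm_src f \<in> S_obj C n" "sm_tgt f \<in> S_obj C n" using f by (simp_all add: S_cat_def)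
  show ?thesis
    by (rule smor.equality) (use theta_obj_comp[OF s(1) \<theta>' \<theta> c] theta_obj_comp[OF s(2) \<theta>' \<theta> c] c t in
      \<open>auto simp: theta_mor_def fun_eq_iff\<close>)
qed

end

section \<open>Objects of \<open>S_obj C n\<close> with a prescribed first row or last
  column\<close>

definition span_fill :: "('o,'h,'v) dblcat \<Rightarrow> 'h \<Rightarrow> 'v \<Rightarrow> 'v \<times> 'h" where
  "span_fill C f u = (SOME vg. issq C f u (fst vg) (snd vg))"

definition cospan_fill :: "('o,'h,'v) dblcat \<Rightarrow> 'v \<Rightarrow> 'h \<Rightarrow> 'h \<times> 'v" where
  "cospan_fill C v g = (SOME fu. issq C (fst fu) (snd fu) v g)"

text \<open>Entry \<open>k\<close> is the arrow from position \<open>(j,k)\<close> down to row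
  \<open>Suc j\<close>. At \<open>k = Suc j\<close> it ends on the diagonal, so it is the arrow to
  the terminal object; further to the right spans are filled. Entries with \<open>k \<le> j\<close>
  lie outside the triangle and carry no meaning.\<close>

primrec vrow :: "('o,'h,'v) dblcat \<Rightarrow> nat \<Rightarrow> (nat \<Rightarrow> 'h) \<Rightarrow> nat \<Rightarrow> 'v" where
  "vrow C j H 0 = undefined"
| "vrow C j H (Suc k) = (if k \<le> j then vterm C (hcod C (H k)) else fst (span_fill C (H k) (vrow C j H k)))"

text \<open>Row \<open>Suc j\<close> starts on the diagonal at column \<open>Suc j\<close>, where
  its arrow has to be the initial one; the later arrows are the bottoms of the squares filled from
  row \<open>j\<close>.\<close>

primrec hrows :: "('o,'h,'v) dblcat \<Rightarrow> (nat \<Rightarrow> 'h) \<Rightarrow> nat \<Rightarrow> nat \<Rightarrow> 'h" where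
  "hrows C h 0 = h"
| "hrows C h (Suc j) = (\<lambda>k. if k \<le> Suc j then hinit C (vcod C (vrow C j (hrows C h j) (Suc k)))
     else snd (span_fill C (hrows C h j k) (vrow C j (hrows C h j) k)))"

text \<open>The recursion climbs from the diagonal: entry \<open>i\<close> is the horizontal arrow
  at \<open>(k - i, k)\<close>, filled against the vertical arrows \<open>V\<close> of column
  \<open>Suc k\<close>.\<close>

primrec hcol :: "('o,'h,'v) dblcat \<Rightarrow> (nat \<Rightarrow> 'v) \<Rightarrow> nat \<Rightarrow> nat \<Rightarrow> 'h" where
  "hcol C V k 0 = hinit C (vdom C (V k))"
| "hcol C V k (Suc i) = fst (cospan_fill C (V (k - Suc i)) (hcol C V k i))"

text \<open>Columns are built from right to left: entry \<open>j\<close> of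
  \<open>vcols C n v e\<close> is the vertical arrow at \<open>(j, n - e)\<close>. The last index of
  \<open>hcol\<close> is the distance of row \<open>Suc j\<close> from the diagonal.\<close>

primrec vcols :: "('o,'h,'v) dblcat \<Rightarrow> nat \<Rightarrow> (nat \<Rightarrow> 'v) \<Rightarrow> nat \<Rightarrow> nat \<Rightarrow> 'v" where
  "vcols C n v 0 = v"
| "vcols C n v (Suc e) = (\<lambda>j. snd (cospan_fill C (vcols C n v e j) (hcol C (vcols C n v e) (n - Suc e) ((n - Suc e) - Suc j))))"

definition mkobj :: "nat \<Rightarrow> (nat \<Rightarrow> nat \<Rightarrow> 'o) \<Rightarrow> (nat \<Rightarrow> nat \<Rightarrow> 'h) \<Rightarrow> (nat \<Rightarrow> nat \<Rightarrow> 'v) \<Rightarrow> ('o,'h,'v) sobj" where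
  "mkobj n A H V = \<lparr>sA = (\<lambda>j k. if j \<le> k \<and> k \<le> n then A j k else undefined),
     sH = (\<lambda>j k. if j \<le> k \<and> k < n then H j k else undefined),
     sV = (\<lambda>j k. if j < k \<and> k \<le> n then V j k else undefined)\<rparr>"

lemma S_objI:
  assumes "\<And>j k. j \<le> k \<Longrightarrow> k \<le> n \<Longrightarrow> A j k \<in> dobj C" "\<And>j. j \<le> n \<Longrightarrow> A j j = zobj C"
    "\<And>j k. j \<le> k \<Longrightarrow> k < n \<Longrightarrow> H j k \<in> hmor C \<and> hdom C (H j k) = A j k \<and> hcod C (H j k) = A j (Suc k)"
    "\<And>j k. j < k \<Longrightarrow> k \<le> n \<Longrightarrow> V j k \<in> vmor C \<and> vdom C (V j k) = A j k \<and> vcod C (V j k) = A (Suc j) k"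
    "\<And>j k. j < k \<Longrightarrow> k < n \<Longrightarrow> issq C (H j k) (V j k) (V j (Suc k)) (H (Suc j) k)"
  shows "mkobj n A H V \<in> S_obj C n"
  unfolding S_obj_def using assms by (auto simp: mkobj_def)

context isostable_dc
begin

lemma span_fill:
  assumes "f \<in> hmor C" "u \<in> vmor C" "hdom C f = vdom C u"
  shows "issq C f u (fst (span_fill C f u)) (snd (span_fill C f u))"
proof -
  obtain v g where "issq C f u v g" using span_square[OF assms] by blast
  then have "issq C f u (fst (v,g)) (snd (v,g))" by simp
  then show ?thesis unfolding span_fill_def by (rule someI)
qed

lemma cospan_fill:
  assumes "g \<in> hmor C" "v \<in> vmor C" "vcod C v = hcod C g"
  shows "issq C (fst (cospan_fill C v g)) (snd (cospan_fill C v g)) v g"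
proof -
  obtain f u where "issq C f u v g" using cospan_square[OF assms] by blast
  then have "issq C (fst (f,u)) (snd (f,u)) v g" by simp
  then show ?thesis unfolding cospan_fill_def by (rule someI)
qed

text \<open>Each row consists of the bottoms of squares filled from the row above.
  \<open>P j\<close> says that row \<open>j\<close> is composable with the expected domains; it
  passes to the next row because neighbouring squares share a vertical side.\<close>

lemma row_object:
  assumes n: "n \<ge> 1" and h: "\<And>k. k < n \<Longrightarrow> h k \<in> hmor C" "\<And>k. Suc k < n \<Longrightarrow> hcod C (h k) = hdom C (h (Suc k))"
    and h0: "hdom C (h 0) = zo"
  shows "\<exists>X\<in>S_obj C n. \<forall>k<n. sH X 0 k = h k"
proof -
  define H where "H = hrows C h"
  define V where "V j = vrow C j (H j)" for j
  define A where "A j k = (if j < k then hcod C (H j (k - 1)) else zo)" for j k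
  define P where "P j \<longleftrightarrow> (\<forall>k. j \<le> k \<and> k < n \<longrightarrow> H j k \<in> hmor C \<and> hdom C (H j k) = A j k)" for j
  have A0: "A 0 k = (if 0 < k then hcod C (h (k - 1)) else zo)" for k by (simp add: A_def H_def)
  have P0: "P 0"
    unfolding P_def
  proof (intro allI impI)
    fix k assume "0 \<le> k \<and> k < n"
    then show "H 0 k \<in> hmor C \<and> hdom C (H 0 k) = A 0 k" using h[of k] h(2)[of "k - 1"] h0 by (cases k) (auto simp: H_def A_def)
  qed
  have Vv: "V j k \<in> vmor C \<and> vdom C (V j k) = A j k \<and>
      (k < n \<longrightarrow> issq C (H j k) (V j k) (V j (Suc k)) (H (Suc j) k)) \<and> (k = Suc j \<longrightarrow> vcod C (V j k) = zo)"
    if P: "P j" and jk: "j < k" "k \<le> n" for j k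
    using jk(1)[unfolded Suc_le_eq[symmetric]] jk(2)
  proof (induction k rule: dec_induct)
    case base
    have hj: "H j j \<in> hmor C" using P base by (simp add: P_def)
    have Vj: "V j (Suc j) = vterm C (hcod C (H j j))" by (simp add: V_def)
    note t = vterm_mor[OF h_ob(2)[OF hj]]
    have "issq C (H j (Suc j)) (V j (Suc j)) (V j (Suc (Suc j))) (H (Suc j) (Suc j))" if lt: "Suc j < n"
    proof -
      have hj': "H j (Suc j) \<in> hmor C" "hdom C (H j (Suc j)) = A j (Suc j)" using P lt by (simp_all add: P_def)
      note s = span_fill[OF hj'(1), of "V j (Suc j)"]
      have s': "issq C (H j (Suc j)) (V j (Suc j)) (V j (Suc (Suc j))) (snd (span_fill C (H j (Suc j)) (V j (Suc j))))"
        using s t hj'(2) by (simp add: Vj A_def V_def)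
      note d = sqD[OF s']
      \<comment> \<open>The first filled square of a row has its lower left corner on the diagonal,
        so its bottom starts at \<open>O\<close> and is the initial arrow that \<open>hrows\<close>
        prescribes.\<close>
      have "snd (span_fill C (H j (Suc j)) (V j (Suc j))) = hinit C (vcod C (V j (Suc (Suc j))))"
        using hinit_unique[OF d(2)] d t by (simp add: Vj)
      moreover have "H (Suc j) (Suc j) = hinit C (vcod C (V j (Suc (Suc j))))" by (simp add: H_def V_def)
      ultimately show ?thesis using s' by simp
    qed
    then show ?case using t by (simp add: Vj A_def)
  next
    case (step k)
    then have IH: "V j k \<in> vmor C" "vdom C (V j k) = A j k" "issq C (H j k) (V j k) (V j (Suc k)) (H (Suc j) k)" by auto
    note d = sqD[OF IH(3)]
    have jk: "j < k" using step by simp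
    have "issq C (H j (Suc k)) (V j (Suc k)) (V j (Suc (Suc k))) (H (Suc j) (Suc k))" if lt: "Suc k < n"
    proof -
      have hk: "H j (Suc k) \<in> hmor C" "hdom C (H j (Suc k)) = A j (Suc k)" using P lt jk by (simp_all add: P_def)
      have "hdom C (H j (Suc k)) = vdom C (V j (Suc k))" using hk(2) d jk by (simp add: A_def)
      note s = span_fill[OF hk(1) d(4) this]
      have "V j (Suc (Suc k)) = fst (span_fill C (H j (Suc k)) (V j (Suc k)))" using jk by (simp add: V_def)
      moreover have "H (Suc j) (Suc k) = snd (span_fill C (H j (Suc k)) (V j (Suc k)))" using jk by (simp add: H_def V_def)
      ultimately show ?thesis using s by simp
    qed
    then show ?case using d jk by (simp add: A_def)
  qed
  have Vcod: "vcod C (V j k) = A (Suc j) k" if P: "P j" and jk: "j < k" "k \<le> n" for j k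
  proof (cases "k = Suc j")
    case True then show ?thesis using Vv[OF P jk] by (simp add: A_def)
  next
    case False
    then obtain l where l: "k = Suc l" "j < l" using jk by (cases k) auto
    then have "issq C (H j l) (V j l) (V j k) (H (Suc j) l)" using Vv[OF P, of l] jk by simp
    from sqD(8)[OF this] show ?thesis using l by (simp add: A_def)
  qed
  have PS: "P (Suc j)" if P: "P j" for j
    unfolding P_def
  proof (intro allI impI)
    fix k assume k: "Suc j \<le> k \<and> k < n"
    then have "issq C (H j k) (V j k) (V j (Suc k)) (H (Suc j) k)" using Vv[OF P, of k] by simp
    note d = sqD[OF this]
    show "H (Suc j) k \<in> hmor C \<and> hdom C (H (Suc j) k) = A (Suc j) k" using d Vcod[OF P, of k] k by simp
  qed
  have P: "P j" for j by (induction j) (use P0 PS in auto)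
  have "mkobj n A H V \<in> S_obj C n"
  proof (rule S_objI)
    fix j k assume jk: "j \<le> k" "k \<le> n"
    have "H j (k - 1) \<in> hmor C" if "j < k"
    proof -
      have "j \<le> k - 1 \<and> k - 1 < n" using that jk by linarith
      then show ?thesis using P[of j] unfolding P_def by blast
    qed
    then show "A j k \<in> dobj C" using zob h_ob(2)[of "H j (k - 1)"] by (simp add: A_def)
  next
    fix j k assume "j \<le> k" "k < n"
    then show "H j k \<in> hmor C \<and> hdom C (H j k) = A j k \<and> hcod C (H j k) = A j (Suc k)" using P[of j] by (simp add: P_def A_def)
  next
    fix j k assume jk: "j < k" "k \<le> n"
    show "V j k \<in> vmor C \<and> vdom C (V j k) = A j k \<and> vcod C (V j k) = A (Suc j) k" using Vv[OF P jk] Vcod[OF P jk] by simp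
  next
    fix j k assume jk: "j < k" "k < n"
    show "issq C (H j k) (V j k) (V j (Suc k)) (H (Suc j) k)" using Vv[OF P, of j k] jk by simp
  qed (simp add: A_def)
  then show ?thesis by (rule bexI[rotated]) (simp add: mkobj_def H_def)
qed

text \<open>Dual to \<open>row_object\<close>: columns are produced from right to left, and each one
  upwards from the diagonal, where the horizontal arrow is initial. Objects are read off as domains
  of the vertical arrows that leave them.\<close>

lemma column_object:
  assumes n: "n \<ge> 1" and v: "\<And>j. j < n \<Longrightarrow> v j \<in> vmor C" "\<And>j. Suc j < n \<Longrightarrow> vcod C (v j) = vdom C (v (Suc j))"
    and v0: "vcod C (v (n - 1)) = zo"
  shows "\<exists>X\<in>S_obj C n. \<forall>j<n. sV X j n = v j"
proof -
  define V where "V j k = vcols C n v (n - k) j" for j k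
  define H where "H j k = hcol C (\<lambda>j. V j (Suc k)) k (k - j)" for j k
  define A where "A j k = (if j < k then vdom C (V j k) else zo)" for j k
  define P where "P k \<longleftrightarrow> (\<forall>j<k. V j k \<in> vmor C \<and> vcod C (V j k) = A (Suc j) k)" for k
  have Vn: "V j n = v j" for j by (simp add: V_def)
  have VS: "V j k = snd (cospan_fill C (V j (Suc k)) (H (Suc j) k))" if "k < n" for j k
  proof -
    have e: "n - k = Suc (n - Suc k)" "n - Suc (n - Suc k) = k" using that by auto
    show ?thesis unfolding V_def H_def e(1) by (simp add: e)
  qed
  have Hd: "H k k = hinit C (vdom C (V k (Suc k)))" for k by (simp add: H_def)
  have HS: "H j k = fst (cospan_fill C (V j (Suc k)) (H (Suc j) k))" if "j < k" for j k
  proof -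
    have e: "k - j = Suc (k - Suc j)" "k - Suc (k - Suc j) = j" using that by auto
    show ?thesis unfolding H_def e(1) by (simp add: e)
  qed
  have Pn: "P n"
    unfolding P_def
  proof (intro allI impI)
    fix j assume j: "j < n"
    show "V j n \<in> vmor C \<and> vcod C (V j n) = A (Suc j) n"
    proof (cases "Suc j < n")
      case True then show ?thesis using v j by (simp add: Vn A_def)
    next
      case False
      then have "j = n - 1" using j by simp
      then show ?thesis using v(1)[OF j] v0 n by (simp add: Vn A_def)
    qed
  qed
  have Hh: "H j k \<in> hmor C \<and> hcod C (H j k) = A j (Suc k) \<and> (j < k \<longrightarrow> issq C (H j k) (V j k) (V j (Suc k)) (H (Suc j) k)) \<and>
      (j = k \<longrightarrow> hdom C (H j k) = zo)"
    if P: "P (Suc k)" and k: "k < n" and jk: "j \<le> k" for j k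
    using jk
  proof (induction rule: inc_induct)
    case base
    have "V k (Suc k) \<in> vmor C" using P by (simp add: P_def)
    then show ?case using hinit_mor[OF v_ob(1)] by (simp add: Hd A_def)
  next
    case (step j)
    have vj: "V j (Suc k) \<in> vmor C" "vcod C (V j (Suc k)) = A (Suc j) (Suc k)" using P step by (simp_all add: P_def)
    have "issq C (H j k) (V j k) (V j (Suc k)) (H (Suc j) k)"
      using cospan_fill[of "H (Suc j) k" "V j (Suc k)"] vj step VS[OF k, of j] HS[of j k] by simp
    note s = this sqD[OF this]
    show ?case using s step by (simp add: A_def)
  qed
  have PS: "P k" if P: "P (Suc k)" and k: "k < n" for k
    unfolding P_def
  proof (intro allI impI)
    fix j assume j: "j < k"
    then have "issq C (H j k) (V j k) (V j (Suc k)) (H (Suc j) k)" using Hh[OF P k, of j] by simp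
    note d = sqD[OF this]
    show "V j k \<in> vmor C \<and> vcod C (V j k) = A (Suc j) k"
    proof (cases "Suc j = k")
      case True then show ?thesis using d Hh[OF P k, of "Suc j"] by (simp add: A_def)
    next
      case False
      then have "issq C (H (Suc j) k) (V (Suc j) k) (V (Suc j) (Suc k)) (H (Suc (Suc j)) k)" using Hh[OF P k, of "Suc j"] j by simp
      from sqD(5)[OF this] show ?thesis using d False j by (simp add: A_def)
    qed
  qed
  have P: "P k" if "k \<le> n" for k using that
  proof (induction rule: inc_induct)
    case base show ?case by (rule Pn)
  next
    case (step k) then show ?case using PS by simp
  qed
  have "mkobj n A H V \<in> S_obj C n"
  proof (rule S_objI)
    fix j k assume jk: "j \<le> k" "k \<le> n"
    then show "A j k \<in> dobj C" using P[of k] zob v_ob(1)[of "V j k"] by (auto simp: A_def P_def)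
  next
    fix j k assume jk: "j \<le> k" "k < n"
    have h: "H j k \<in> hmor C \<and> hcod C (H j k) = A j (Suc k) \<and> (j < k \<longrightarrow> issq C (H j k) (V j k) (V j (Suc k)) (H (Suc j) k)) \<and>
      (j = k \<longrightarrow> hdom C (H j k) = zo)" by (rule Hh[OF P]) (use jk in auto)
    show "H j k \<in> hmor C \<and> hdom C (H j k) = A j k \<and> hcod C (H j k) = A j (Suc k)"
    proof (cases "j = k")
      case True then show ?thesis using h by (simp add: A_def)
    next
      case False
      then have "issq C (H j k) (V j k) (V j (Suc k)) (H (Suc j) k)" using h jk by simp
      from sqD(5)[OF this] show ?thesis using h False jk by (simp add: A_def)
    qed
  next
    fix j k assume jk: "j < k" "k \<le> n"
    then show "V j k \<in> vmor C \<and> vdom C (V j k) = A j k \<and> vcod C (V j k) = A (Suc j) k" using P[of k] by (simp add: P_def A_def)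
  next
    fix j k assume jk: "j < k" "k < n"
    then show "issq C (H j k) (V j k) (V j (Suc k)) (H (Suc j) k)" using Hh[OF P, of k j] by simp
  qed (simp add: A_def)
  then show ?thesis by (rule bexI[rotated]) (simp add: mkobj_def Vn)
qed

end

section \<open>Morphisms of \<open>S_cat C n\<close> with a prescribed first row or last
  column\<close>

primrec ext_row :: "('o,'h,'v) dblcat \<Rightarrow> ('o,'h,'v) sobj \<Rightarrow> ('o,'h,'v) sobj \<Rightarrow> nat \<Rightarrow> (nat \<Rightarrow> 'v) \<Rightarrow> nat \<Rightarrow> 'v" where
  "ext_row C X Y j s 0 = vid C (zobj C)"
| "ext_row C X Y j s (Suc k) = (if k \<le> j then vid C (zobj C) else
     (THE d. issq C (sH X (Suc j) k) (ext_row C X Y j s k) d (sH Y (Suc j) k) \<and>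
        vcomp C d (sV X j (Suc k)) = vcomp C (sV Y j (Suc k)) (s (Suc k))))"

primrec ext_rows :: "('o,'h,'v) dblcat \<Rightarrow> ('o,'h,'v) sobj \<Rightarrow> ('o,'h,'v) sobj \<Rightarrow> (nat \<Rightarrow> 'v) \<Rightarrow> nat \<Rightarrow> nat \<Rightarrow> 'v" where
  "ext_rows C X Y t 0 = t"
| "ext_rows C X Y t (Suc j) = ext_row C X Y j (ext_rows C X Y t j)"

text \<open>As in \<open>hcol\<close>, the index counts steps up from the diagonal: entry
  \<open>i\<close> is the component at \<open>(k - i, k)\<close>, and \<open>s\<close> holds the
  components of column \<open>Suc k\<close>. The description is well defined by
  \<open>square_from_cospan\<close>.\<close>

primrec ext_col :: "('o,'h,'v) dblcat \<Rightarrow> ('o,'h,'v) sobj \<Rightarrow> ('o,'h,'v) sobj \<Rightarrow> nat \<Rightarrow> (nat \<Rightarrow> 'v) \<Rightarrow> nat \<Rightarrow> 'v" where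
  "ext_col C X Y k s 0 = vid C (zobj C)"
| "ext_col C X Y k s (Suc i) = (THE a. issq C (sH X (k - Suc i) k) a (s (k - Suc i)) (sH Y (k - Suc i) k) \<and>
        vcomp C (ext_col C X Y k s i) (sV X (k - Suc i) k) = vcomp C (sV Y (k - Suc i) k) a)"

primrec ext_cols :: "('o,'h,'v) dblcat \<Rightarrow> ('o,'h,'v) sobj \<Rightarrow> ('o,'h,'v) sobj \<Rightarrow> nat \<Rightarrow> (nat \<Rightarrow> 'v) \<Rightarrow> nat \<Rightarrow> nat \<Rightarrow> 'v" where
  "ext_cols C X Y n t 0 = t"
| "ext_cols C X Y n t (Suc e) = (\<lambda>j. ext_col C X Y (n - Suc e) (ext_cols C X Y n t e) (n - Suc e - j))"

context isostable_dc
begin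

text \<open>Row \<open>j\<close> determines row \<open>Suc j\<close>: on the diagonal the components
  are identities, and each further component is the unique right side in
  \<open>square_from_span\<close>.\<close>

lemma row_faithful:
  assumes m: "m \<in> chom (SS n) X Y" "m' \<in> chom (SS n) X Y" and e: "\<And>k. k \<le> n \<Longrightarrow> sm_c m 0 k = sm_c m' 0 k"
  shows "m = m'"
proof (rule S_hom_eqI[OF m])
  note d = S_homD[OF m(1)] and d' = S_homD[OF m(2)]
  note X = S_objD[OF d(1)] and Y = S_objD[OF d(2)]
  have "\<forall>k. j \<le> k \<and> k \<le> n \<longrightarrow> sm_c m j k = sm_c m' j k" for j
  proof (induction j)
    case 0 then show ?case using e by simp
  next
    case (Suc j)
    show ?case
    proof (intro allI impI)
      fix k assume "Suc j \<le> k \<and> k \<le> n"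
      then have jk: "Suc j \<le> k" "k \<le> n" by auto
      then show "sm_c m (Suc j) k = sm_c m' (Suc j) k"
      proof (induction k rule: dec_induct)
        case base then show ?case using S_diag[OF m(1)] S_diag[OF m(2)] by simp
      next
        case (step k)
        then have lt: "j < k" "k < n" "k \<le> n" "j \<le> k" "Suc k \<le> n" "j \<le> Suc k" "j < Suc k" by auto
        have "\<exists>!d. issq C (sH X (Suc j) k) (sm_c m (Suc j) k) d (sH Y (Suc j) k) \<and>
            vcomp C d (sV X j (Suc k)) = vcomp C (sV Y j (Suc k)) (sm_c m j (Suc k))"
          by (rule square_from_span[OF X(9)[OF lt(1,2)] Y(9)[OF lt(1,2)] d(8)[OF lt(4,2)]])
            (use d(5-7)[of "Suc j" k] d(9)[OF lt(1,3)] X(8)[OF lt(1,3)] Y(8)[OF lt(1,3)] step lt in auto)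
        moreover have "issq C (sH X (Suc j) k) (sm_c m (Suc j) k) (sm_c m (Suc j) (Suc k)) (sH Y (Suc j) k)"
          "vcomp C (sm_c m (Suc j) (Suc k)) (sV X j (Suc k)) = vcomp C (sV Y j (Suc k)) (sm_c m j (Suc k))"
          using d(8)[of "Suc j" k] d(9)[OF lt(7,5)] step lt by auto
        moreover have "issq C (sH X (Suc j) k) (sm_c m (Suc j) k) (sm_c m' (Suc j) (Suc k)) (sH Y (Suc j) k)"
          "vcomp C (sm_c m' (Suc j) (Suc k)) (sV X j (Suc k)) = vcomp C (sV Y j (Suc k)) (sm_c m j (Suc k))"
          using d'(8)[of "Suc j" k] d'(9)[OF lt(7,5)] step lt Suc by auto
        ultimately show ?case by blast
      qed
    qed
  qed
  then show "sm_c m j k = sm_c m' j k" if "j \<le> k" "k \<le> n" for j k using that by blast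
qed

text \<open>The existence part of \<open>square_from_span\<close>, applied along each row from left
  to right. The squares of the first row are the hypothesis; those of later rows come with the
  construction.\<close>

lemma row_full:
  assumes X: "X \<in> S_obj C n" and Y: "Y \<in> S_obj C n" and n: "n \<ge> 1"
    and t: "\<And>k. k < n \<Longrightarrow> issq C (sH X 0 k) (t k) (t (Suc k)) (sH Y 0 k)"
  shows "\<exists>m\<in>chom (SS n) X Y. \<forall>k\<le>n. sm_c m 0 k = t k"
proof -
  note dX = S_objD[OF X] and dY = S_objD[OF Y]
  define s where "s = ext_rows C X Y t"
  define R where "R j \<longleftrightarrow> (\<forall>k. j \<le> k \<and> k \<le> n \<longrightarrow> s j k \<in> vmor C \<and> vdom C (s j k) = sA X j k \<and> vcod C (s j k) = sA Y j k) \<and>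
     (\<forall>k. j \<le> k \<and> k < n \<longrightarrow> issq C (sH X j k) (s j k) (s j (Suc k)) (sH Y j k))" for j
  have R0: "R 0"
  proof -
    have "t k \<in> vmor C \<and> vdom C (t k) = sA X 0 k \<and> vcod C (t k) = sA Y 0 k" if "k \<le> n" for k
    proof (cases k)
      case 0 then show ?thesis using sqD[OF t[of 0]] n dX(4)[of 0 0] dY(4)[of 0 0] by simp
    next
      case (Suc l) then show ?thesis using sqD[OF t[of l]] that dX(5)[of 0 l] dY(5)[of 0 l] by simp
    qed
    then show ?thesis using t by (simp add: R_def s_def)
  qed
  have step: "s (Suc j) k \<in> vmor C \<and> vdom C (s (Suc j) k) = sA X (Suc j) k \<and> vcod C (s (Suc j) k) = sA Y (Suc j) k \<and>
      vcomp C (s (Suc j) k) (sV X j k) = vcomp C (sV Y j k) (s j k) \<and>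
      (k < n \<longrightarrow> issq C (sH X (Suc j) k) (s (Suc j) k) (s (Suc j) (Suc k)) (sH Y (Suc j) k) \<and>
        vcomp C (s (Suc j) (Suc k)) (sV X j (Suc k)) = vcomp C (sV Y j (Suc k)) (s j (Suc k)))"
    if R: "R j" and jk: "Suc j \<le> k" "k \<le> n" for j k
    using jk
  proof (induction k rule: dec_induct)
    case base
    then have lt: "j < Suc j" "Suc j \<le> n" "j \<le> Suc j" by auto
    have sj: "s (Suc j) (Suc j) = vid C zo" by (simp add: s_def)
    have sm: "s j (Suc j) \<in> vmor C" "vdom C (s j (Suc j)) = sA X j (Suc j)" "vcod C (s j (Suc j)) = sA Y j (Suc j)" using R lt by (auto simp: R_def)
    have z: "sA X (Suc j) (Suc j) = zo" "sA Y (Suc j) (Suc j) = zo" using dX(2)[OF lt(2)] dY(2)[OF lt(2)] by auto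
    note vz = vid_mor[OF zob]
    \<comment> \<open>Both composites end at \<open>O\<close>, which is vertically terminal.\<close>
    have nat: "vcomp C (vid C zo) (sV X j (Suc j)) = vcomp C (sV Y j (Suc j)) (s j (Suc j))"
      by (rule to_zero_unique) (use vcomp_mor[of "sV X j (Suc j)" "vid C zo"] vcomp_mor[of "s j (Suc j)" "sV Y j (Suc j)"]
        dX(6-8)[OF lt(1,2)] dY(6-8)[OF lt(1,2)] z vz sm in auto)
    have "issq C (sH X (Suc j) (Suc j)) (s (Suc j) (Suc j)) (s (Suc j) (Suc (Suc j))) (sH Y (Suc j) (Suc j)) \<and>
        vcomp C (s (Suc j) (Suc (Suc j))) (sV X j (Suc (Suc j))) = vcomp C (sV Y j (Suc (Suc j))) (s j (Suc (Suc j)))" if k: "Suc j < n"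
    proof -
      have e: "s (Suc j) (Suc (Suc j)) = (THE d. issq C (sH X (Suc j) (Suc j)) (s (Suc j) (Suc j)) d (sH Y (Suc j) (Suc j)) \<and>
          vcomp C d (sV X j (Suc (Suc j))) = vcomp C (sV Y j (Suc (Suc j))) (s j (Suc (Suc j))))" by (simp add: s_def)
      have sq: "issq C (sH X j (Suc j)) (s j (Suc j)) (s j (Suc (Suc j))) (sH Y j (Suc j))" using R k by (simp add: R_def)
      have "\<exists>!d. issq C (sH X (Suc j) (Suc j)) (s (Suc j) (Suc j)) d (sH Y (Suc j) (Suc j)) \<and>
          vcomp C d (sV X j (Suc (Suc j))) = vcomp C (sV Y j (Suc (Suc j))) (s j (Suc (Suc j)))"
        by (rule square_from_span[OF dX(9)[OF lt(1) k] dY(9)[OF lt(1) k] sq])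
          (use nat vz dX(8)[OF lt(1,2)] dY(8)[OF lt(1,2)] z in \<open>simp_all add: sj\<close>)
      from theI'[OF this] show ?thesis unfolding e[symmetric] .
    qed
    then show ?case using nat vz z by (simp add: sj)
  next
    case (step k)
    then have lt: "j < k" "k < n" "k \<le> n" "Suc j \<le> k" "Suc k \<le> n" "j \<le> k" "j < Suc k" by auto
    have IH: "issq C (sH X (Suc j) k) (s (Suc j) k) (s (Suc j) (Suc k)) (sH Y (Suc j) k)"
      "vcomp C (s (Suc j) (Suc k)) (sV X j (Suc k)) = vcomp C (sV Y j (Suc k)) (s j (Suc k))" using step lt by auto
    note d = sqD[OF IH(1)]
    have sk: "s (Suc j) (Suc k) \<in> vmor C" "vdom C (s (Suc j) (Suc k)) = sA X (Suc j) (Suc k)" "vcod C (s (Suc j) (Suc k)) = sA Y (Suc j) (Suc k)"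
      using d dX(5)[OF lt(4,2)] dY(5)[OF lt(4,2)] by auto
    have "issq C (sH X (Suc j) (Suc k)) (s (Suc j) (Suc k)) (s (Suc j) (Suc (Suc k))) (sH Y (Suc j) (Suc k)) \<and>
        vcomp C (s (Suc j) (Suc (Suc k))) (sV X j (Suc (Suc k))) = vcomp C (sV Y j (Suc (Suc k))) (s j (Suc (Suc k)))" if k: "Suc k < n"
    proof -
      have e: "s (Suc j) (Suc (Suc k)) = (THE d. issq C (sH X (Suc j) (Suc k)) (s (Suc j) (Suc k)) d (sH Y (Suc j) (Suc k)) \<and>
          vcomp C d (sV X j (Suc (Suc k))) = vcomp C (sV Y j (Suc (Suc k))) (s j (Suc (Suc k))))" using lt by (simp add: s_def)
      have sq: "issq C (sH X j (Suc k)) (s j (Suc k)) (s j (Suc (Suc k))) (sH Y j (Suc k))" using R k lt by (simp add: R_def)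
      have "\<exists>!d. issq C (sH X (Suc j) (Suc k)) (s (Suc j) (Suc k)) d (sH Y (Suc j) (Suc k)) \<and>
          vcomp C d (sV X j (Suc (Suc k))) = vcomp C (sV Y j (Suc (Suc k))) (s j (Suc (Suc k)))"
        by (rule square_from_span[OF dX(9)[OF lt(7) k] dY(9)[OF lt(7) k] sq sk(1)])
          (use IH(2) sk dX(8)[OF lt(7,5)] dY(8)[OF lt(7,5)] in simp_all)
      from theI'[OF this] show ?thesis unfolding e[symmetric] .
    qed
    then show ?case using sk IH(2) by simp
  qed
  have R: "R j" for j
  proof (induction j)
    case 0 show ?case by (rule R0)
  next
    case (Suc j) then show ?case using step[OF Suc] by (simp add: R_def)
  qed
  have "mkm n X Y s \<in> chom (SS n) X Y"
  proof (rule S_homI[OF X Y])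
    fix j k assume "j \<le> k" "k \<le> n" then show "s j k \<in> vmor C \<and> vdom C (s j k) = sA X j k \<and> vcod C (s j k) = sA Y j k" using R[of j] by (simp add: R_def)
  next
    fix j k assume "j \<le> k" "k < n" then show "issq C (sH X j k) (s j k) (s j (Suc k)) (sH Y j k)" using R[of j] by (simp add: R_def)
  next
    fix j k assume "j < k" "k \<le> n" then show "vcomp C (s (Suc j) k) (sV X j k) = vcomp C (sV Y j k) (s j k)" using step[OF R, of j k] by simp
  qed
  then show ?thesis by (rule bexI[rotated]) (simp add: s_def)
qed

lemma column_faithful:
  assumes m: "m \<in> chom (SS n) X Y" "m' \<in> chom (SS n) X Y" and e: "\<And>j. j \<le> n \<Longrightarrow> sm_c m j n = sm_c m' j n"
  shows "m = m'"
proof (rule S_hom_eqI[OF m])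
  note d = S_homD[OF m(1)] and d' = S_homD[OF m(2)]
  note X = S_objD[OF d(1)] and Y = S_objD[OF d(2)]
  have "\<forall>j\<le>k. sm_c m j k = sm_c m' j k" if "k \<le> n" for k
    using that
  proof (induction rule: inc_induct)
    case base then show ?case using e by simp
  next
    case (step k)
    show ?case
    proof (intro allI impI)
      fix j assume "j \<le> k"
      then show "sm_c m j k = sm_c m' j k"
      proof (induction rule: inc_induct)
        case base then show ?case using S_diag[OF m(1)] S_diag[OF m(2)] step by simp
      next
        case (step j)
        have lt: "j < k" "k < n" "k \<le> n" "j \<le> k" "Suc k \<le> n" "j \<le> Suc k" "j < Suc k" "Suc j \<le> k"
          using step \<open>k < n\<close> by auto
        have "\<exists>!a. issq C (sH X j k) a (sm_c m j (Suc k)) (sH Y j k) \<and>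
            vcomp C (sm_c m (Suc j) k) (sV X j k) = vcomp C (sV Y j k) a"
          by (rule square_from_cospan[OF X(9)[OF lt(1,2)] Y(9)[OF lt(1,2)] d(8)[OF lt(8,2)]])
            (use d(5-7)[OF lt(6,5)] d(9)[OF lt(7,5)] X(7)[OF lt(7,5)] Y(7)[OF lt(7,5)] in auto)
        moreover have "issq C (sH X j k) (sm_c m j k) (sm_c m j (Suc k)) (sH Y j k)"
          "vcomp C (sm_c m (Suc j) k) (sV X j k) = vcomp C (sV Y j k) (sm_c m j k)"
          using d(8)[OF lt(4,2)] d(9)[OF lt(1,3)] by auto
        moreover have "issq C (sH X j k) (sm_c m' j k) (sm_c m j (Suc k)) (sH Y j k)"
          "vcomp C (sm_c m (Suc j) k) (sV X j k) = vcomp C (sV Y j k) (sm_c m' j k)"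
          using d'(8)[OF lt(4,2)] d'(9)[OF lt(1,3)] step.IH \<open>\<forall>j\<le>Suc k. sm_c m j (Suc k) = sm_c m' j (Suc k)\<close> lt by auto
        ultimately show ?case by blast
      qed
    qed
  qed
  then show "sm_c m j k = sm_c m' j k" if "j \<le> k" "k \<le> n" for j k using that by blast
qed

text \<open>A column of vertical arrows contains no squares from which its components could be seen
  to be weak equivalences, so this is a hypothesis. It provides the squares with an initial arrow on
  top at the diagonal, and \<open>vweqI_right\<close> hands the property on from column
  \<open>Suc k\<close> to column \<open>k\<close>.\<close>

lemma column_full:
  assumes X: "X \<in> S_obj C n" and Y: "Y \<in> S_obj C n"
    and t: "\<And>j. j \<le> n \<Longrightarrow> vweq C (t j) \<and> vdom C (t j) = sA X j n \<and> vcod C (t j) = sA Y j n"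
      "\<And>j. j < n \<Longrightarrow> vcomp C (t (Suc j)) (sV X j n) = vcomp C (sV Y j n) (t j)"
  shows "\<exists>m\<in>chom (SS n) X Y. \<forall>j\<le>n. sm_c m j n = t j"
proof -
  note dX = S_objD[OF X] and dY = S_objD[OF Y]
  define s where "s j k = ext_cols C X Y n t (n - k) j" for j k
  define R where "R k \<longleftrightarrow> (\<forall>j\<le>k. vweq C (s j k) \<and> vdom C (s j k) = sA X j k \<and> vcod C (s j k) = sA Y j k) \<and>
     (\<forall>j<k. vcomp C (s (Suc j) k) (sV X j k) = vcomp C (sV Y j k) (s j k))" for k
  have sn: "s j n = t j" for j by (simp add: s_def)
  have sk: "s j k = ext_col C X Y k (\<lambda>j. s j (Suc k)) (k - j)" if "k < n" for j k
  proof -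
    have e: "n - k = Suc (n - Suc k)" "n - Suc (n - Suc k) = k" using that by auto
    show ?thesis unfolding s_def e(1) by (simp add: e)
  qed
  have sd: "s k k = vid C zo" if "k < n" for k using sk[OF that, of k] by simp
  have ss: "s j k = (THE a. issq C (sH X j k) a (s j (Suc k)) (sH Y j k) \<and>
        vcomp C (s (Suc j) k) (sV X j k) = vcomp C (sV Y j k) a)" if "k < n" "j < k" for j k
  proof -
    have e: "k - j = Suc (k - Suc j)" "k - Suc (k - Suc j) = j" using that by auto
    show ?thesis unfolding sk[OF that(1), of j] sk[OF that(1), of "Suc j"] e(1) by (simp add: e)
  qed
  have Rn: "R n" using t by (simp add: R_def sn)
  have col_step: "vweq C (s j k) \<and> vdom C (s j k) = sA X j k \<and> vcod C (s j k) = sA Y j k \<and>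
      issq C (sH X j k) (s j k) (s j (Suc k)) (sH Y j k) \<and>
      (j < k \<longrightarrow> vcomp C (s (Suc j) k) (sV X j k) = vcomp C (sV Y j k) (s j k))"
    if R: "R (Suc k)" and k: "k < n" and jk: "j \<le> k" for j k
    using jk
  proof (induction rule: inc_induct)
    case base
    have z: "sA X k k = zo" "sA Y k k = zo" using dX(2)[of k] dY(2)[of k] k by auto
    have w: "vweq C (s k (Suc k))" "vdom C (s k (Suc k)) = sA X k (Suc k)" "vcod C (s k (Suc k)) = sA Y k (Suc k)" using R by (auto simp: R_def)
    have "sH X k k = hinit C (sA X k (Suc k))" "sH Y k k = hinit C (sA Y k (Suc k))"
      using hinit_unique[OF dX(3)[OF order_refl k]] hinit_unique[OF dY(3)[OF order_refl k]] dX(4,5)[OF order_refl k] dY(4,5)[OF order_refl k] z by auto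
    then have "issq C (sH X k k) (vid C zo) (s k (Suc k)) (sH Y k k)" using w by (simp add: vweq_def)
    then show ?case using vweq_id[OF zob] vid_mor[OF zob] z sd[OF k] by simp
  next
    case (step j)
    have lt: "j < k" "k \<le> n" "j \<le> k" "Suc k \<le> n" "j \<le> Suc k" "j < Suc k" "Suc j \<le> k" using step k by auto
    have b: "vweq C (s j (Suc k))" "vdom C (s j (Suc k)) = sA X j (Suc k)" "vcod C (s j (Suc k)) = sA Y j (Suc k)"
      "vcomp C (s (Suc j) (Suc k)) (sV X j (Suc k)) = vcomp C (sV Y j (Suc k)) (s j (Suc k))" using R lt by (auto simp: R_def)
    have c: "issq C (sH X (Suc j) k) (s (Suc j) k) (s (Suc j) (Suc k)) (sH Y (Suc j) k)" using step.IH by simp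
    have "\<exists>!a. issq C (sH X j k) a (s j (Suc k)) (sH Y j k) \<and> vcomp C (s (Suc j) k) (sV X j k) = vcomp C (sV Y j k) a"
      by (rule square_from_cospan[OF dX(9)[OF lt(1) k] dY(9)[OF lt(1) k] c vweq_mor[OF b(1)]])
        (use b dX(7)[OF lt(6,4)] dY(7)[OF lt(6,4)] in simp_all)
    from theI'[OF this] have a: "issq C (sH X j k) (s j k) (s j (Suc k)) (sH Y j k)" "vcomp C (s (Suc j) k) (sV X j k) = vcomp C (sV Y j k) (s j k)"
      unfolding ss[OF k lt(1), symmetric] by auto
    note da = sqD[OF a(1)]
    show ?case using a vweqI_right[OF a(1) b(1)] da dX(4)[OF lt(3) k] dY(4)[OF lt(3) k] by simp
  qed
  have R: "R k" if "k \<le> n" for k using that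
  proof (induction rule: inc_induct)
    case base show ?case by (rule Rn)
  next
    case (step k) then show ?case using col_step[of k] by (simp add: R_def)
  qed
  have "mkm n X Y s \<in> chom (SS n) X Y"
  proof (rule S_homI[OF X Y])
    fix j k assume "j \<le> k" "k \<le> n" then show "s j k \<in> vmor C \<and> vdom C (s j k) = sA X j k \<and> vcod C (s j k) = sA Y j k"
      using R[of k] vweq_mor by (simp add: R_def)
  next
    fix j k assume "j \<le> k" "k < n" then show "issq C (sH X j k) (s j k) (s j (Suc k)) (sH Y j k)" using col_step[of k j] R[of "Suc k"] by simp
  next
    fix j k assume "j < k" "k \<le> n" then show "vcomp C (s (Suc j) k) (sV X j k) = vcomp C (sV Y j k) (s j k)" using R[of k] by (simp add: R_def)
  qed
  then show ?thesis by (rule bexI[rotated]) (simp add: sn)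
qed

end

text \<open>Read up to equivalence: \<open>G\<close> is the pullback of \<open>U\<close> and
  \<open>Y\<close> over \<open>Z'\<close>, \<open>Q\<close> that of \<open>W\<close> and
  \<open>Y\<close> over \<open>Z'\<close>, and \<open>U\<close> that of \<open>X\<close> and
  \<open>W\<close> over \<open>Z\<close>. As \<open>U\<close> maps to \<open>Z'\<close> through
  \<open>W\<close>, the first two make \<open>G\<close> the pullback of \<open>U\<close> and
  \<open>Q\<close> over \<open>W\<close>; with the third it becomes the pullback of \<open>X\<close>
  and \<open>Q\<close> over \<open>Z\<close>.\<close>

lemma gpd_pullback_paste:
  assumes A: "gpd_pullback G U Y Z' gUo gUm gYo gYm uZo uZm yZo yZm"
    and B: "gpd_pullback Q W Y Z' qWo qWm qYo qYm wZo wZm yZo yZm"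
    and C: "gpd_pullback U X W Z uXo uXm uWo uWm xZo xZm vo vm"
    and GQ: "cfunctor G Q gQo gQm" and p: "cfunctor G X po pm" and r: "cfunctor Q Z ro rm"
    and po: "\<And>g. g \<in> cob G \<Longrightarrow> po g = uXo (gUo g)" and pm: "\<And>m. m \<in> cmor G \<Longrightarrow> pm m = uXm (gUm m)"
    and ro: "\<And>q. q \<in> cob Q \<Longrightarrow> ro q = vo (qWo q)" and rm: "\<And>m. m \<in> cmor Q \<Longrightarrow> rm m = vm (qWm m)"
    and qWo: "\<And>g. g \<in> cob G \<Longrightarrow> qWo (gQo g) = uWo (gUo g)" and qWm: "\<And>m. m \<in> cmor G \<Longrightarrow> qWm (gQm m) = uWm (gUm m)"
    and qYo: "\<And>g. g \<in> cob G \<Longrightarrow> qYo (gQo g) = gYo g" and qYm: "\<And>m. m \<in> cmor G \<Longrightarrow> qYm (gQm m) = gYm m"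
    and uZo: "\<And>u. u \<in> cob U \<Longrightarrow> uZo u = wZo (uWo u)" and uZm: "\<And>m. m \<in> cmor U \<Longrightarrow> uZm m = wZm (uWm m)"
  shows "gpd_pullback G X Q Z po pm gQo gQm xZo xZm ro rm"
proof -
  interpret A: gpd_pullback G U Y Z' gUo gUm gYo gYm uZo uZm yZo yZm by (rule A)
  interpret B: gpd_pullback Q W Y Z' qWo qWm qYo qYm wZo wZm yZo yZm by (rule B)
  interpret C: gpd_pullback U X W Z uXo uXm uWo uWm xZo xZm vo vm by (rule C)
  interpret GQ: cfunctor G Q gQo gQm by (rule GQ)
  interpret p: cfunctor G X po pm by (rule p)
  interpret r: cfunctor Q Z ro rm by (rule r)
  have mor: "m \<in> chom K x y \<Longrightarrow> m \<in> cmor K" for m x y and K :: "('s,'t) catg" by (simp add: chom_def)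
  show ?thesis
  proof (unfold_locales)
    fix w assume w: "w \<in> cob G"
    show "xZo (po w) = ro (gQo w)"
      using po[OF w] ro[OF GQ.F_ob[OF w]] qWo[OF w] C.comm_o[OF A.P1.F_ob[OF w]] by simp
  next
    fix m assume m: "m \<in> cmor G"
    have m1: "m \<in> chom G (cdom G m) (ccod G m)" using m by (simp add: chom_def)
    have "gUm m \<in> cmor U" "gQm m \<in> cmor Q" using A.P1.F_hom[OF m1] GQ.F_hom[OF m1] by (simp_all add: chom_def)
    then show "xZm (pm m) = rm (gQm m)" using pm[OF m] rm qWm[OF m] C.comm_m by simp
  next
    fix x y \<phi> assume x: "x \<in> cob X" and y: "y \<in> cob Q" and \<phi>: "\<phi> \<in> chom Z (xZo x) (ro y)"
    have yW: "qWo y \<in> cob W" using B.P1.F_ob[OF y] .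
    have "\<phi> \<in> chom Z (xZo x) (vo (qWo y))" using \<phi> ro[OF y] by simp
    from C.ess_surj[OF x yW this] obtain u a b where u: "u \<in> cob U" "a \<in> chom X (uXo u) x" "b \<in> chom W (uWo u) (qWo y)"
      "ccomp Z \<phi> (xZm a) = vm b" by blast
    have yY: "qYo y \<in> cob Y" using B.P2.F_ob[OF y] .
    have "wZm b \<in> chom Z' (uZo u) (yZo (qYo y))" using B.F1.F_hom[OF u(3)] uZo[OF u(1)] B.comm_o[OF y] by simp
    from A.ess_surj[OF u(1) yY this] obtain w a' b' where w: "w \<in> cob G" "a' \<in> chom U (gUo w) u" "b' \<in> chom Y (gYo w) (qYo y)"
      "ccomp Z' (wZm b) (uZm a') = yZm b'" by blast
    have a'W: "uWm a' \<in> chom W (uWo (gUo w)) (uWo u)" using C.P2.F_hom[OF w(2)] .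
    have a'X: "uXm a' \<in> chom X (po w) (uXo u)" using C.P1.F_hom[OF w(2)] po[OF w(1)] by simp
    have bw: "ccomp W b (uWm a') \<in> chom W (qWo (gQo w)) (qWo y)" using B.P1.Z.comp_hom[OF a'W u(3)] qWo[OF w(1)] by simp
    have b'q: "b' \<in> chom Y (qYo (gQo w)) (qYo y)" using w(3) qYo[OF w(1)] by simp
    have ag: "wZm (ccomp W b (uWm a')) = yZm b'"
      using B.F1.F_comp[OF a'W u(3)] uZm[OF mor[OF w(2)]] w(4) by simp
    \<comment> \<open>The arrow of \<open>Q\<close> is assembled from its \<open>W\<close>-part,
      supplied by \<open>C\<close> together with the correction \<open>a'\<close>, and its
      \<open>Y\<close>-part, supplied by \<open>A\<close>.\<close>
    from B.fully_faithful[OF GQ.F_ob[OF w(1)] y bw b'q ag] obtain \<beta> where \<beta>: "\<beta> \<in> chom Q (gQo w) y" "qWm \<beta> = ccomp W b (uWm a')" by blast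
    have "ccomp Z \<phi> (xZm (ccomp X a (uXm a'))) = ccomp Z \<phi> (ccomp Z (xZm a) (xZm (uXm a')))"
      using C.F1.F_comp[OF a'X u(2)] by simp
    also have "\<dots> = ccomp Z (ccomp Z \<phi> (xZm a)) (xZm (uXm a'))"
      by (rule C.F1.Z.assoc[OF C.F1.F_hom[OF a'X] C.F1.F_hom[OF u(2)] \<phi>])
    also have "\<dots> = ccomp Z (vm b) (vm (uWm a'))" using u(4) C.comm_m[OF mor[OF w(2)]] by simp
    also have "\<dots> = vm (ccomp W b (uWm a'))" using C.F2.F_comp[OF a'W u(3)] by simp
    also have "\<dots> = rm \<beta>" using \<beta>(2) rm[OF mor[OF \<beta>(1)]] by simp
    finally show "\<exists>w\<in>cob G. \<exists>a\<in>chom X (po w) x. \<exists>b\<in>chom Q (gQo w) y. ccomp Z \<phi> (xZm a) = rm b"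
      using w(1) \<beta>(1) C.P1.Z.comp_hom[OF a'X u(2)] by blast
  next
    fix w w' a b assume w: "w \<in> cob G" "w' \<in> cob G" and a: "a \<in> chom X (po w) (po w')" and b: "b \<in> chom Q (gQo w) (gQo w')"
      and ab: "xZm a = rm b"
    have aU: "a \<in> chom X (uXo (gUo w)) (uXo (gUo w'))" using a po w by simp
    have bW: "qWm b \<in> chom W (uWo (gUo w)) (uWo (gUo w'))" using B.P1.F_hom[OF b] qWo w by simp
    have ab': "xZm a = vm (qWm b)" using ab rm[OF mor[OF b]] by simp
    note CF = C.fully_faithful[OF A.P1.F_ob[OF w(1)] A.P1.F_ob[OF w(2)] aU bW ab']
    obtain u where u: "u \<in> chom U (gUo w) (gUo w')" "uXm u = a" "uWm u = qWm b" using CF by blast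
    have bY: "qYm b \<in> chom Y (gYo w) (gYo w')" using B.P2.F_hom[OF b] qYo w by simp
    have "uZm u = yZm (qYm b)" using uZm[OF mor[OF u(1)]] u(3) B.comm_m[OF mor[OF b]] by simp
    note AF = A.fully_faithful[OF w u(1) bY this]
    obtain c where c: "c \<in> chom G w w'" "gUm c = u" "gYm c = qYm b" using AF by blast
    note BF = B.fully_faithful[OF GQ.F_ob[OF w(1)] GQ.F_ob[OF w(2)] B.P1.F_hom[OF b] B.P2.F_hom[OF b] B.comm_m[OF mor[OF b]]]
    have "qWm (gQm c) = qWm b" "qYm (gQm c) = qYm b" using qWm[OF mor[OF c(1)]] qYm[OF mor[OF c(1)]] c u by simp_all
    then have cb: "gQm c = b" using BF GQ.F_hom[OF c(1)] b by blast
    show "\<exists>!c. c \<in> chom G w w' \<and> pm c = a \<and> gQm c = b"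
    proof (rule ex1I[of _ c])
      show "c \<in> chom G w w' \<and> pm c = a \<and> gQm c = b" using c cb pm[OF mor[OF c(1)]] u by simp
      fix d assume d: "d \<in> chom G w w' \<and> pm d = a \<and> gQm d = b"
      then have dm: "d \<in> cmor G" by (simp add: chom_def)
      have "uXm (gUm d) = a" "uWm (gUm d) = qWm b" using d pm[OF dm] qWm[OF dm] by auto
      then have "gUm d = u" using CF u A.P1.F_hom[of d w w'] d by blast
      moreover have "gYm d = qYm b" using qYm[OF dm] d by simp
      ultimately show "d = c" using AF c d by blast
    qed
  qed
qed

section \<open>The 2-Segal squares of groupoids\<close>

lemma monotone_idx_one:
  assumes "\<theta> 0 \<le> \<theta> 1" "\<theta> 1 \<le> n"
  shows "monotone_idx \<theta> 1 n"
proof -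
  have c: "l = 0 \<or> l = 1" if "l \<le> 1" for l :: nat using that by linarith
  show ?thesis
    unfolding monotone_idx_def
  proof (intro conjI allI impI)
    fix l :: nat assume "l \<le> 1"
    from c[OF this] show "\<theta> l \<le> n" using assms by (elim disjE) simp_all
  next
    fix l l' :: nat assume "l \<le> l' \<and> l' \<le> 1"
    then have "l = l' \<or> (l = 0 \<and> l' = 1)" by linarith
    then show "\<theta> l \<le> \<theta> l'" using assms(1) by (elim disjE) simp_all
  qed
qed

context isostable_dc
begin

lemma theta_sH_step:
  assumes X: "X \<in> S_obj C n" and \<theta>: "monotone_idx \<theta> m n" and jk: "j \<le> k" "k < m" and s: "\<theta> (Suc k) = Suc (\<theta> k)"
  shows "sH (theta_obj C \<theta> m X) j k = sH X (\<theta> j) (\<theta> k)"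
proof -
  have t: "\<theta> j \<le> \<theta> k" "\<theta> (Suc k) \<le> n" using \<theta> jk by (auto simp: monotone_idx_def)
  then have "sH X (\<theta> j) (\<theta> k) \<in> hmor C" "hdom C (sH X (\<theta> j) (\<theta> k)) = sA X (\<theta> j) (\<theta> k)" using S_objD(3,4)[OF X, of "\<theta> j" "\<theta> k"] s by auto
  then show ?thesis using hid_right[of "sH X (\<theta> j) (\<theta> k)"] jk by (simp add: theta_obj_def s hpath_refl)
qed

lemma theta_sV_step:
  assumes X: "X \<in> S_obj C n" and \<theta>: "monotone_idx \<theta> m n" and jk: "j < k" "k \<le> m" and s: "\<theta> (Suc j) = Suc (\<theta> j)"
  shows "sV (theta_obj C \<theta> m X) j k = sV X (\<theta> j) (\<theta> k)"
proof -
  have t: "\<theta> (Suc j) \<le> \<theta> k" "\<theta> k \<le> n" using \<theta> jk by (auto simp: monotone_idx_def)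
  then have "sV X (\<theta> j) (\<theta> k) \<in> vmor C" "vdom C (sV X (\<theta> j) (\<theta> k)) = sA X (\<theta> j) (\<theta> k)" using S_objD(6,7)[OF X, of "\<theta> j" "\<theta> k"] s by auto
  then show ?thesis using vid_right[of "sV X (\<theta> j) (\<theta> k)"] jk by (simp add: theta_obj_def s vpath_refl)
qed

lemma theta_sA: "j \<le> k \<Longrightarrow> k \<le> m \<Longrightarrow> sA (theta_obj C \<theta> m X) j k = sA X (\<theta> j) (\<theta> k)"
  by (simp add: theta_obj_def)

lemma theta_c: "j \<le> k \<Longrightarrow> k \<le> m \<Longrightarrow> sm_c (theta_mor C \<theta> m f) j k = sm_c f (\<theta> j) (\<theta> k)"
  by (simp add: theta_mor_def)

text \<open>The two diagonal components of a morphism in degree 1 are identities, so only one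
  component is left.\<close>

lemma S1_faithful:
  assumes m: "m \<in> chom (SS 1) X Y" "m' \<in> chom (SS 1) X Y" and e: "sm_c m 0 1 = sm_c m' 0 1"
  shows "m = m'"
proof (rule row_faithful[OF m])
  fix k :: nat assume "k \<le> 1"
  then consider "k = 0" | "k = 1" by linarith
  then show "sm_c m 0 k = sm_c m' 0 k" using e S_diag[OF m(1), of 0] S_diag[OF m(2), of 0] by cases auto
qed

lemma row0_init: "X \<in> S_obj C n \<Longrightarrow> j < n \<Longrightarrow> sH X j j = hinit C (sA X j (Suc j))"
  using hinit_unique[of "sH X j j"] S_objD(2)[of X C n j] S_objD(3-5)[of X C n j j] by simp

text \<open>A weak equivalence into the last object of the first row is pulled back through the row
  by filling cospans from right to left; \<open>vweqI_right\<close> keeps the left sides weak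
  equivalences. At the first arrow the square of initial arrows is used instead of a filling, so
  that the new row again starts at \<open>O\<close>.\<close>

lemma chain_transport:
  assumes X: "X \<in> S_obj C n" and n: "n \<ge> 1" and w: "vweq C w" "vcod C w = sA X 0 n"
  shows "\<exists>b \<psi>. \<psi> n = w \<and> \<psi> 0 = vid C zo \<and> hdom C (b 0) = zo \<and> (\<forall>k<n. issq C (b k) (\<psi> k) (\<psi> (Suc k)) (sH X 0 k))"
proof -
  note d = S_objD[OF X]
  have "\<exists>b \<psi>. \<psi> n = w \<and> vweq C (\<psi> k) \<and> vcod C (\<psi> k) = sA X 0 k \<and> (\<forall>l. k \<le> l \<and> l < n \<longrightarrow> issq C (b l) (\<psi> l) (\<psi> (Suc l)) (sH X 0 l))"
    if "k \<le> n" "1 \<le> k" for k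
    using that(1)
  proof (induction rule: inc_induct)
    case base show ?case by (rule exI[of _ "\<lambda>_. undefined"], rule exI[of _ "\<lambda>_. w"]) (use w in auto)
  next
    case (step k)
    then obtain b \<psi> where b: "\<psi> n = w" "vweq C (\<psi> (Suc k))" "vcod C (\<psi> (Suc k)) = sA X 0 (Suc k)"
      "\<And>l. Suc k \<le> l \<Longrightarrow> l < n \<Longrightarrow> issq C (b l) (\<psi> l) (\<psi> (Suc l)) (sH X 0 l)" by blast
    have kn: "0 \<le> k" "k < n" using step by auto
    obtain f u where s: "issq C f u (\<psi> (Suc k)) (sH X 0 k)"
      using cospan_square[OF d(3)[OF kn] vweq_mor[OF b(2)]] b(3) d(5)[OF kn] by auto
    have u: "vweq C u" "vcod C u = sA X 0 k" using vweqI_right[OF s b(2)] sqD(7)[OF s] d(4)[OF kn] by auto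
    show ?case
      by (rule exI[of _ "b(k := f)"], rule exI[of _ "\<psi>(k := u)"]) (use b s u kn in auto)
  qed
  from this[OF n order_refl] obtain b \<psi> where b: "\<psi> n = w" "vweq C (\<psi> 1)" "vcod C (\<psi> 1) = sA X 0 1"
      "\<And>l. 1 \<le> l \<Longrightarrow> l < n \<Longrightarrow> issq C (b l) (\<psi> l) (\<psi> (Suc l)) (sH X 0 l)" by blast
  have o: "vdom C (\<psi> 1) \<in> dobj C" using v_ob(1)[OF vweq_mor[OF b(2)]] .
  have s0: "issq C (hinit C (vdom C (\<psi> 1))) (vid C zo) (\<psi> 1) (sH X 0 0)"
    using b(2,3) row0_init[OF X, of 0] n by (simp add: vweq_def)
  show ?thesis
    by (rule exI[of _ "b(0 := hinit C (vdom C (\<psi> 1)))"], rule exI[of _ "\<psi>(0 := vid C zo)"])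
      (use b s0 hinit_mor(2)[OF o] n in auto)
qed

text \<open>On first rows the statement is about cutting a chain of horizontal arrows at position
  \<open>j\<close>. The subset with only 0 before \<open>j\<close> keeps the second half, entered
  from \<open>O\<close> by an initial arrow, and both halves remember the object at
  \<open>j\<close>, which is the datum in degree 1.\<close>

lemma row_case:
  assumes j: "1 \<le> j" "j \<le> n" and M: "M = Suc (n - j)"
    and \<alpha>: "\<And>l. l \<le> j \<Longrightarrow> \<alpha> l = l" and \<beta>: "\<And>l. l \<le> M \<Longrightarrow> \<beta> l = (if l = 0 then 0 else l + j - 1)"
    and \<phi>: "\<phi> 0 = 0" "\<phi> 1 = j" and \<gamma>: "\<gamma> 0 = 0" "\<gamma> 1 = (1::nat)"
  shows "gpd_pullback (SS n) (SS j) (SS M) (SS 1) (theta_obj C \<alpha> j) (theta_mor C \<alpha> j) (theta_obj C \<beta> M) (theta_mor C \<beta> M)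
     (theta_obj C \<phi> 1) (theta_mor C \<phi> 1) (theta_obj C \<gamma> 1) (theta_mor C \<gamma> 1)"
proof -
  have le1: "l \<le> 1 \<longleftrightarrow> l = 0 \<or> l = 1" for l :: nat by auto
  have mono: "monotone_idx \<alpha> j n" "monotone_idx \<beta> M n" "monotone_idx \<phi> 1 j" "monotone_idx \<gamma> 1 M"
    using j \<alpha> \<beta> monotone_idx_one[of \<phi> j] monotone_idx_one[of \<gamma> M] \<phi> \<gamma> by (auto simp: monotone_idx_def M)
  define \<psi> :: "nat \<Rightarrow> nat" where "\<psi> l = (if l = 0 then 0 else j)" for l
  have c1: "\<alpha> (\<phi> l) = \<psi> l" if "l \<le> 1" for l using that \<alpha> \<phi> unfolding le1 by (auto simp: \<psi>_def)
  have c2: "\<beta> (\<gamma> l) = \<psi> l" if "l \<le> 1" for l using that \<beta> \<gamma> j unfolding le1 by (auto simp: \<psi>_def M)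
  interpret P1: cfunctor "SS n" "SS j" "theta_obj C \<alpha> j" "theta_mor C \<alpha> j" by (rule theta_functor[OF mono(1)])
  interpret P2: cfunctor "SS n" "SS M" "theta_obj C \<beta> M" "theta_mor C \<beta> M" by (rule theta_functor[OF mono(2)])
  interpret F1: cfunctor "SS j" "SS 1" "theta_obj C \<phi> 1" "theta_mor C \<phi> 1" by (rule theta_functor[OF mono(3)])
  interpret F2: cfunctor "SS M" "SS 1" "theta_obj C \<gamma> 1" "theta_mor C \<gamma> 1" by (rule theta_functor[OF mono(4)])
  have commo: "theta_obj C \<phi> 1 (theta_obj C \<alpha> j w) = theta_obj C \<gamma> 1 (theta_obj C \<beta> M w)" if "w \<in> S_obj C n" for w
    using theta_obj_comp[OF that mono(1,3) c1] theta_obj_comp[OF that mono(2,4) c2] by simp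
  have sHa: "sH (theta_obj C \<alpha> j w) 0 k = sH w 0 k" if "w \<in> S_obj C n" "k < j" for w k
    using theta_sH_step[OF that(1) mono(1), of 0 k] that \<alpha> by simp
  have sHb: "sH (theta_obj C \<beta> M w) 0 k = sH w 0 (k + j - 1)" if "w \<in> S_obj C n" "1 \<le> k" "k < M" for w k
    using theta_sH_step[OF that(1) mono(2), of 0 k] that \<beta> j by simp
  show ?thesis
  proof (unfold_locales, unfold S_sels(1))
    fix w assume "w \<in> S_obj C n"
    then show "theta_obj C \<phi> 1 (theta_obj C \<alpha> j w) = theta_obj C \<gamma> 1 (theta_obj C \<beta> M w)" by (rule commo)
  next
    fix m assume "m \<in> cmor (SS n)"
    then show "theta_mor C \<phi> 1 (theta_mor C \<alpha> j m) = theta_mor C \<gamma> 1 (theta_mor C \<beta> M m)"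
      using theta_mor_comp[OF _ mono(1,3) c1] theta_mor_comp[OF _ mono(2,4) c2] by simp
  next
    fix x y z assume x: "x \<in> S_obj C j" and y: "y \<in> S_obj C M" and z: "z \<in> chom (SS 1) (theta_obj C \<phi> 1 x) (theta_obj C \<gamma> 1 y)"
    have z01: "vweq C (sm_c z 0 1)" "vdom C (sm_c z 0 1) = sA x 0 j" "vcod C (sm_c z 0 1) = sA y 0 1"
      using S_vweq[OF z, of 0 1] S_homD(6,7)[OF z, of 0 1] \<phi> \<gamma> by (simp_all add: theta_sA)
    obtain w where w: "vinverse C (sm_c z 0 1) w" "vweq C w" using vweq_inverse[OF z01(1)] by blast
    have wd: "vdom C w = sA y 0 1" "vcod C w = sA x 0 j" "vcomp C (sm_c z 0 1) w = vid C (sA y 0 1)"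
      using w(1) z01 by (auto simp: vinverse_def)
    \<comment> \<open>The isomorphism \<open>z\<close> is vertical and cannot be composed with a
      horizontal chain. The row of \<open>x\<close> is instead replaced by an isomorphic one that
      ends exactly where the row of \<open>y\<close> has its first object after
      \<open>O\<close>.\<close>
    obtain b \<psi> where b: "\<psi> j = w" "\<psi> 0 = vid C zo" "hdom C (b 0) = zo"
      "\<And>k. k < j \<Longrightarrow> issq C (b k) (\<psi> k) (\<psi> (Suc k)) (sH x 0 k)"
      using chain_transport[OF x j(1) w(2) wd(2)] by blast
    \<comment> \<open>Arrow \<open>j\<close> of the concatenation is arrow 1 of \<open>y\<close>:
      arrow 0 of \<open>y\<close> is the initial one and is dropped.\<close>
    define h where "h k = (if k < j then b k else sH y 0 (Suc (k - j)))" for k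
    have "\<exists>X\<in>S_obj C n. \<forall>k<n. sH X 0 k = h k"
    proof (rule row_object)
      fix k assume "k < n"
      then show "h k \<in> hmor C" using sqD(1)[OF b(4)] S_objD(3)[OF y, of 0 "Suc (k - j)"] by (auto simp: h_def M)
    next
      fix k assume k: "Suc k < n"
      consider "Suc k < j" | "Suc k = j" | "j \<le> k" by linarith
      then show "hcod C (h k) = hdom C (h (Suc k))"
      proof cases
        case 1 then show ?thesis using sqD(6)[OF b(4), of k] sqD(5)[OF b(4), of "Suc k"] by (simp add: h_def)
      next
        case 2
        then show ?thesis using sqD(6)[OF b(4), of k] b(1) wd(1) S_objD(4)[OF y, of 0 1] k by (auto simp: h_def M)
      next
        case 3
        then have "Suc (Suc k - j) = Suc (Suc (k - j))" by simp
        then show ?thesis using 3 S_objD(5)[OF y, of 0 "Suc (k - j)"] S_objD(4)[OF y, of 0 "Suc (Suc (k - j))"] k by (simp add: h_def M)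
      qed
    qed (use j b(3) in \<open>auto simp: h_def\<close>)
    then obtain g where g: "g \<in> S_obj C n" "\<And>k. k < n \<Longrightarrow> sH g 0 k = h k" by blast
    note ga = theta_obj_in[OF g(1) mono(1)] and gb = theta_obj_in[OF g(1) mono(2)]
    obtain a where a: "a \<in> chom (SS j) (theta_obj C \<alpha> j g) x" "\<forall>k\<le>j. sm_c a 0 k = \<psi> k"
      using row_full[OF ga x j(1), of \<psi>] b(4) sHa[OF g(1)] g(2) j by (auto simp: h_def)
    have gy: "sH (theta_obj C \<beta> M g) 0 k = sH y 0 k" if k: "k < M" for k
    proof (cases "k = 0")
      case False
      then have e: "\<not> k + j - 1 < j" "Suc (k + j - 1 - j) = k" "k + j - 1 < n" "1 \<le> k" using k j by (auto simp: M)
      show ?thesis unfolding sHb[OF g(1) e(4) k] g(2)[OF e(3)] h_def if_not_P[OF e(1)] e(2) ..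
    next
      case True
      \<comment> \<open>Arrow 0 of the restricted row is a composite across the jump of
        \<open>\<beta>\<close>. It starts at \<open>O\<close>, so it is determined by its
        codomain.\<close>
      have "sA g 0 j = sA y 0 1"
        using S_objD(5)[OF g(1), of 0 "j - 1"] g(2)[of "j - 1"] sqD(6)[OF b(4), of "j - 1"] b(1) wd(1) j by (simp add: h_def)
      then have "sA (theta_obj C \<beta> M g) 0 1 = sA y 0 1" using \<beta>[of 0] \<beta>[of 1] by (simp add: theta_sA M)
      then show ?thesis using row0_init[OF gb, of 0] row0_init[OF y, of 0] True k by simp
    qed
    have "issq C (sH (theta_obj C \<beta> M g) 0 k) (vid C (sA y 0 k)) (vid C (sA y 0 (Suc k))) (sH y 0 k)" if "k < M" for k
      using sq_hid[of "sH y 0 k"] S_objD(3-5)[OF y, of 0 k] gy[OF that] that by simp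
    then obtain b' where b': "b' \<in> chom (SS M) (theta_obj C \<beta> M g) y" "\<forall>k\<le>M. sm_c b' 0 k = vid C (sA y 0 k)"
      using row_full[OF gb y, of "\<lambda>k. vid C (sA y 0 k)"] by (auto simp: M)
    have "ccomp (SS 1) z (theta_mor C \<phi> 1 a) = theta_mor C \<gamma> 1 b'"
    proof (rule S1_faithful)
      show "ccomp (SS 1) z (theta_mor C \<phi> 1 a) \<in> chom (SS 1) (theta_obj C \<phi> 1 (theta_obj C \<alpha> j g)) (theta_obj C \<gamma> 1 y)"
        by (rule F1.Z.comp_hom[OF F1.F_hom[OF a(1)] z])
      show "theta_mor C \<gamma> 1 b' \<in> chom (SS 1) (theta_obj C \<phi> 1 (theta_obj C \<alpha> j g)) (theta_obj C \<gamma> 1 y)"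
        using F2.F_hom[OF b'(1)] commo[OF g(1)] by simp
      show "sm_c (ccomp (SS 1) z (theta_mor C \<phi> 1 a)) 0 1 = sm_c (theta_mor C \<gamma> 1 b') 0 1"
        using a(2) b'(2) b(1) wd(3) \<phi> \<gamma> by (simp add: S_sels theta_c M)
    qed
    then show "\<exists>w\<in>S_obj C n. \<exists>a\<in>chom (SS j) (theta_obj C \<alpha> j w) x. \<exists>b\<in>chom (SS M) (theta_obj C \<beta> M w) y.
       ccomp (SS 1) z (theta_mor C \<phi> 1 a) = theta_mor C \<gamma> 1 b" using g(1) a(1) b'(1) by blast
  next
    fix w w' a b assume w: "w \<in> S_obj C n" "w' \<in> S_obj C n" and a: "a \<in> chom (SS j) (theta_obj C \<alpha> j w) (theta_obj C \<alpha> j w')"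
      and b: "b \<in> chom (SS M) (theta_obj C \<beta> M w) (theta_obj C \<beta> M w')" and ab: "theta_mor C \<phi> 1 a = theta_mor C \<gamma> 1 b"
    have ab1: "sm_c a 0 j = sm_c b 0 1"
      using arg_cong[OF ab, of "\<lambda>m. sm_c m 0 1"] \<phi> \<gamma> by (simp add: theta_c)
    define t where "t k = (if k \<le> j then sm_c a 0 k else sm_c b 0 (Suc (k - j)))" for k
    have tb: "t k = sm_c b 0 (Suc (k - j))" if "j \<le> k" for k using that ab1 by (cases "k = j") (auto simp: t_def)
    have "issq C (sH w 0 k) (t k) (t (Suc k)) (sH w' 0 k)" if k: "k < n" for k
    proof (cases "k < j")
      case True
      then show ?thesis using S_homD(8)[OF a, of 0 k] sHa[OF w(1), of k] sHa[OF w(2), of k] by (simp add: t_def)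
    next
      case False
      then have "Suc (Suc k - j) = Suc (Suc (k - j))" by simp
      then show ?thesis using False S_homD(8)[OF b, of 0 "Suc (k - j)"] sHb[OF w(1), of "Suc (k - j)"] sHb[OF w(2), of "Suc (k - j)"] k
          tb[of k] tb[of "Suc k"] j by (simp add: M)
    qed
    then obtain c where c: "c \<in> chom (SS n) w w'" "\<forall>k\<le>n. sm_c c 0 k = t k" using row_full[OF w, of t] j by auto
    have ca: "theta_mor C \<alpha> j d = a \<longleftrightarrow> (\<forall>k\<le>j. sm_c d 0 k = sm_c a 0 k)" if "d \<in> chom (SS n) w w'" for d
      using row_faithful[OF theta_mor_in[OF that mono(1)] a] \<alpha> by (auto simp: theta_c)
    have cb: "theta_mor C \<beta> M d = b" if d: "d \<in> chom (SS n) w w'" and e: "\<And>k. j \<le> k \<Longrightarrow> k \<le> n \<Longrightarrow> sm_c d 0 k = sm_c b 0 (Suc (k - j))" for d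
    proof (rule row_faithful[OF theta_mor_in[OF d mono(2)] b])
      fix k assume k: "k \<le> M"
      show "sm_c (theta_mor C \<beta> M d) 0 k = sm_c b 0 k"
      proof (cases "k = 0")
        case True
        then show ?thesis using S_diag[OF theta_mor_in[OF d mono(2)], of 0] S_diag[OF b, of 0] by simp
      next
        case False
        then show ?thesis using k \<beta>[OF k] \<beta>[of 0] e[of "k + j - 1"] j by (simp add: theta_c M Suc_diff_le)
      qed
    qed
    show "\<exists>!c. c \<in> chom (SS n) w w' \<and> theta_mor C \<alpha> j c = a \<and> theta_mor C \<beta> M c = b"
    proof (rule ex1I[of _ c])
      show "c \<in> chom (SS n) w w' \<and> theta_mor C \<alpha> j c = a \<and> theta_mor C \<beta> M c = b"
        using c ca[OF c(1)] cb[OF c(1)] tb j by (auto simp: t_def)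
      fix d assume d: "d \<in> chom (SS n) w w' \<and> theta_mor C \<alpha> j d = a \<and> theta_mor C \<beta> M d = b"
      show "d = c"
      proof (rule row_faithful[OF _ c(1)])
        show "d \<in> chom (SS n) w w'" using d by blast
        fix k assume k: "k \<le> n"
        show "sm_c d 0 k = sm_c c 0 k"
        proof (cases "k \<le> j")
          case True then show ?thesis using ca[of d] d c(2) k by (simp add: t_def)
        next
          case False
          have "sm_c (theta_mor C \<beta> M d) 0 (Suc (k - j)) = sm_c b 0 (Suc (k - j))" using d by simp
          then have "sm_c d 0 k = sm_c b 0 (Suc (k - j))" using False k \<beta>[of 0] \<beta>[of "Suc (k - j)"] by (simp add: theta_c M)
          then show ?thesis using c(2) k False by (simp add: t_def)
        qed
      qed
    qed
  qed
qed

text \<open>On last columns the statement is about cutting a chain of vertical arrows at position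
  \<open>i\<close>; both pieces remember the object at \<open>(i,n)\<close>. The gluing isomorphism
  is vertical like the chain, so it is composed into it, and no transport as in
  \<open>row_case\<close> is called for.\<close>

lemma column_case:
  assumes i: "i < n" and M: "M = n - i"
    and \<alpha>: "\<And>l. l \<le> M \<Longrightarrow> \<alpha> l = l + i" and \<beta>: "\<And>l. l \<le> Suc i \<Longrightarrow> \<beta> l = (if l \<le> i then l else n)"
    and \<phi>: "\<phi> 0 = 0" "\<phi> 1 = M" and \<gamma>: "\<gamma> 0 = i" "\<gamma> 1 = Suc i"
  shows "gpd_pullback (SS n) (SS M) (SS (Suc i)) (SS 1) (theta_obj C \<alpha> M) (theta_mor C \<alpha> M) (theta_obj C \<beta> (Suc i)) (theta_mor C \<beta> (Suc i))
     (theta_obj C \<phi> 1) (theta_mor C \<phi> 1) (theta_obj C \<gamma> 1) (theta_mor C \<gamma> 1)"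
proof -
  have le1: "l \<le> 1 \<longleftrightarrow> l = 0 \<or> l = 1" for l :: nat by auto
  have M1: "M \<ge> 1" "M + i = n" using i M by auto
  have mono: "monotone_idx \<alpha> M n" "monotone_idx \<beta> (Suc i) n" "monotone_idx \<phi> 1 M" "monotone_idx \<gamma> 1 (Suc i)"
    using i \<alpha> \<beta> monotone_idx_one[of \<phi> M] monotone_idx_one[of \<gamma> "Suc i"] \<phi> \<gamma> by (auto simp: monotone_idx_def M)
  define \<psi> :: "nat \<Rightarrow> nat" where "\<psi> l = (if l = 0 then i else n)" for l
  have c1: "\<alpha> (\<phi> l) = \<psi> l" if "l \<le> 1" for l using that \<alpha> \<phi> M1 unfolding le1 by (auto simp: \<psi>_def)
  have c2: "\<beta> (\<gamma> l) = \<psi> l" if "l \<le> 1" for l using that \<beta> \<gamma> unfolding le1 by (auto simp: \<psi>_def)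
  interpret P1: cfunctor "SS n" "SS M" "theta_obj C \<alpha> M" "theta_mor C \<alpha> M" by (rule theta_functor[OF mono(1)])
  interpret P2: cfunctor "SS n" "SS (Suc i)" "theta_obj C \<beta> (Suc i)" "theta_mor C \<beta> (Suc i)" by (rule theta_functor[OF mono(2)])
  interpret F1: cfunctor "SS M" "SS 1" "theta_obj C \<phi> 1" "theta_mor C \<phi> 1" by (rule theta_functor[OF mono(3)])
  interpret F2: cfunctor "SS (Suc i)" "SS 1" "theta_obj C \<gamma> 1" "theta_mor C \<gamma> 1" by (rule theta_functor[OF mono(4)])
  have commo: "theta_obj C \<phi> 1 (theta_obj C \<alpha> M w) = theta_obj C \<gamma> 1 (theta_obj C \<beta> (Suc i) w)" if "w \<in> S_obj C n" for w
    using theta_obj_comp[OF that mono(1,3) c1] theta_obj_comp[OF that mono(2,4) c2] by simp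
  have sVa: "sV (theta_obj C \<alpha> M w) l M = sV w (l + i) n" if "w \<in> S_obj C n" "l < M" for w l
    using theta_sV_step[OF that(1) mono(1), of l M] that \<alpha> M1 by simp
  have sVb: "sV (theta_obj C \<beta> (Suc i) w) l (Suc i) = sV w l n" if "w \<in> S_obj C n" "l < i" for w l
    using theta_sV_step[OF that(1) mono(2), of l "Suc i"] that \<beta> by simp
  have sAa: "sA (theta_obj C \<alpha> M w) l M = sA w (l + i) n" if "l \<le> M" for w l using theta_sA[OF that] \<alpha> that M1 by simp
  have sAb: "sA (theta_obj C \<beta> (Suc i) w) l (Suc i) = sA w (if l \<le> i then l else n) n" if "l \<le> Suc i" for w l
    using theta_sA[OF that] \<beta>[OF that] \<beta>[of "Suc i"] by simp
  show ?thesis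
  proof (unfold_locales, unfold S_sels(1))
    fix w assume "w \<in> S_obj C n"
    then show "theta_obj C \<phi> 1 (theta_obj C \<alpha> M w) = theta_obj C \<gamma> 1 (theta_obj C \<beta> (Suc i) w)" by (rule commo)
  next
    fix m assume "m \<in> cmor (SS n)"
    then show "theta_mor C \<phi> 1 (theta_mor C \<alpha> M m) = theta_mor C \<gamma> 1 (theta_mor C \<beta> (Suc i) m)"
      using theta_mor_comp[OF _ mono(1,3) c1] theta_mor_comp[OF _ mono(2,4) c2] by simp
  next
    fix x y z assume x: "x \<in> S_obj C M" and y: "y \<in> S_obj C (Suc i)" and z: "z \<in> chom (SS 1) (theta_obj C \<phi> 1 x) (theta_obj C \<gamma> 1 y)"
    note dx = S_objD[OF x] and dy = S_objD[OF y]
    let ?z = "sm_c z 0 1"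
    have z01: "vweq C ?z" "vdom C ?z = sA x 0 M" "vcod C ?z = sA y i (Suc i)"
      using S_vweq[OF z, of 0 1] S_homD(6,7)[OF z, of 0 1] \<phi> \<gamma> by (simp_all add: theta_sA)
    obtain w where w: "vinverse C ?z w" "vweq C w" using vweq_inverse[OF z01(1)] by blast
    have wd: "w \<in> vmor C" "vdom C w = sA y i (Suc i)" "vcod C w = sA x 0 M" "vinverse C w ?z" "?z \<in> vmor C"
      using w(1) z01 vinverse_sym[OF w(1)] by (auto simp: vinverse_def)
    \<comment> \<open>From position \<open>i\<close> on the objects are those of \<open>x\<close>.
      Hence only the arrow that ends at position \<open>i\<close> is changed, by composing it with
      the inverse \<open>w\<close> of the gluing isomorphism.\<close>
    define v where "v l = (if l < i then (if Suc l = i then vcomp C w (sV y l (Suc i)) else sV y l (Suc i)) else sV x (l - i) M)" for l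
    have vy: "sV y l (Suc i) \<in> vmor C" "vdom C (sV y l (Suc i)) = sA y l (Suc i)" "vcod C (sV y l (Suc i)) = sA y (Suc l) (Suc i)" if "l \<le> i" for l
      using dy(6-8)[of l "Suc i"] that by auto
    have vl: "v l \<in> vmor C \<and> vdom C (v l) = (if l < i then sA y l (Suc i) else sA x (l - i) M) \<and>
        vcod C (v l) = (if Suc l < i then sA y (Suc l) (Suc i) else sA x (Suc l - i) M)" if "l < n" for l
    proof -
      consider "Suc l < i" | "Suc l = i" | "i \<le> l" by linarith
      then show ?thesis
      proof cases
        case 1 then show ?thesis using vy[of l] by (simp add: v_def)
      next
        case 2 then show ?thesis using vy[of l] vcomp_mor[of "sV y l (Suc i)" w] wd by (simp add: v_def)
      next
        case 3 then show ?thesis using dx(6-8)[of "l - i" M] that by (simp add: v_def M Suc_diff_le)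
      qed
    qed
    have "\<exists>X\<in>S_obj C n. \<forall>l<n. sV X l n = v l"
    proof (rule column_object)
      show "1 \<le> n" using i by simp
      show "v l \<in> vmor C" if "l < n" for l using vl[OF that] by simp
      show "vcod C (v l) = vdom C (v (Suc l))" if "Suc l < n" for l using vl[of l] vl[OF that] that by simp
      show "vcod C (v (n - 1)) = zo" using vl[of "n - 1"] dx(2)[of M] i by (simp add: M)
    qed
    then obtain g where g: "g \<in> S_obj C n" "\<And>l. l < n \<Longrightarrow> sV g l n = v l" by blast
    note ga = theta_obj_in[OF g(1) mono(1)] and gb = theta_obj_in[OF g(1) mono(2)]
    have gA: "sA g l n = (if l < i then sA y l (Suc i) else sA x (l - i) M)" if "l \<le> n" for l
    proof (cases "l = n")
      case True then show ?thesis using S_objD(2)[OF g(1), of n] dx(2)[of M] i by (simp add: M)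
    next
      case False
      then show ?thesis using S_objD(7)[OF g(1), of l n] g(2)[of l] vl[of l] that by simp
    qed
    have "\<exists>m\<in>chom (SS M) (theta_obj C \<alpha> M g) x. \<forall>l\<le>M. sm_c m l M = vid C (sA x l M)"
    proof (rule column_full[OF ga x])
      fix l assume l: "l \<le> M"
      show "vweq C (vid C (sA x l M)) \<and> vdom C (vid C (sA x l M)) = sA (theta_obj C \<alpha> M g) l M \<and> vcod C (vid C (sA x l M)) = sA x l M"
        using vweq_id[OF dx(1)[OF l order_refl]] vid_mor[OF dx(1)[OF l order_refl]] sAa[OF l, of g] gA[of "l + i"] l M1 by simp
    next
      fix l assume l: "l < M"
      have "sV (theta_obj C \<alpha> M g) l M = sV x l M" using sVa[OF g(1) l] g(2)[of "l + i"] l M1 by (simp add: v_def)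
      then show "vcomp C (vid C (sA x (Suc l) M)) (sV (theta_obj C \<alpha> M g) l M) = vcomp C (sV x l M) (vid C (sA x l M))"
        using vid_left[of "sV x l M"] vid_right[of "sV x l M"] dx(6-8)[OF l order_refl] by simp
    qed
    then obtain a where a: "a \<in> chom (SS M) (theta_obj C \<alpha> M g) x" "\<forall>l\<le>M. sm_c a l M = vid C (sA x l M)" by blast
    \<comment> \<open>The glued column has the objects of \<open>y\<close> above position
      \<open>i\<close>, so the comparison is an identity there. At \<open>i\<close> it has the
      object of \<open>x\<close>, which \<open>z\<close> carries to that of \<open>y\<close>; below
      it both columns have \<open>O\<close>.\<close>
    define t where "t l = (if l = i then ?z else vid C (sA y l (Suc i)))" for l
    have "\<exists>m\<in>chom (SS (Suc i)) (theta_obj C \<beta> (Suc i) g) y. \<forall>l\<le>Suc i. sm_c m l (Suc i) = t l"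
    proof (rule column_full[OF gb y])
      fix l assume l: "l \<le> Suc i"
      have "sA (theta_obj C \<beta> (Suc i) g) l (Suc i) = (if l = i then sA x 0 M else sA y l (Suc i))"
        using sAb[OF l, of g] gA[of l] gA[of n] l i dx(2)[of M] dy(2)[of "Suc i"] by (auto simp: M le_Suc_eq)
      then show "vweq C (t l) \<and> vdom C (t l) = sA (theta_obj C \<beta> (Suc i) g) l (Suc i) \<and> vcod C (t l) = sA y l (Suc i)"
        using z01 vweq_id[OF dy(1)[OF l order_refl]] vid_mor[OF dy(1)[OF l order_refl]] by (simp add: t_def)
    next
      fix l assume l: "l < Suc i"
      show "vcomp C (t (Suc l)) (sV (theta_obj C \<beta> (Suc i) g) l (Suc i)) = vcomp C (sV y l (Suc i)) (t l)"
      proof (cases "l = i")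
        case True
        have o: "sA y (Suc i) (Suc i) = zo" "sA (theta_obj C \<beta> (Suc i) g) (Suc i) (Suc i) = zo"
          using dy(2)[of "Suc i"] S_objD(2)[OF gb, of "Suc i"] by auto
        have gd: "sV (theta_obj C \<beta> (Suc i) g) i (Suc i) \<in> vmor C" "vdom C (sV (theta_obj C \<beta> (Suc i) g) i (Suc i)) = sA x 0 M"
          "vcod C (sV (theta_obj C \<beta> (Suc i) g) i (Suc i)) = zo"
          using S_objD(6-8)[OF gb, of i "Suc i"] sAb[of i g] gA[of i] i o by auto
        show ?thesis
          by (rule to_zero_unique)
            (use True gd o vcomp_mor[OF gd(1), of "vid C zo"] vcomp_mor[OF wd(5), of "sV y i (Suc i)"] vy[of i] z01 vid_mor[OF zob] in \<open>auto simp: t_def\<close>)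
      next
        case False
        then have li: "l < i" using l by simp
        have e: "sV (theta_obj C \<beta> (Suc i) g) l (Suc i) = v l" using sVb[OF g(1) li] g(2)[of l] li i by simp
        note r = vid_right[OF vy(1)[of l]] vid_left[OF vy(1)[of l]] vy[of l]
        show ?thesis
        proof (cases "Suc l = i")
          case True
          have "vcomp C ?z (vcomp C w (sV y l (Suc i))) = sV y l (Suc i)"
            by (rule inv_cancel_left[OF wd(4)]) (use r True wd in auto)
          then show ?thesis using e True li r by (simp add: t_def v_def)
        next
          case False
          then show ?thesis using e li r by (simp add: t_def v_def)
        qed
      qed
    qed
    then obtain b where b: "b \<in> chom (SS (Suc i)) (theta_obj C \<beta> (Suc i) g) y" "\<forall>l\<le>Suc i. sm_c b l (Suc i) = t l" by blast
    have "ccomp (SS 1) z (theta_mor C \<phi> 1 a) = theta_mor C \<gamma> 1 b"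
    proof (rule S1_faithful)
      show "ccomp (SS 1) z (theta_mor C \<phi> 1 a) \<in> chom (SS 1) (theta_obj C \<phi> 1 (theta_obj C \<alpha> M g)) (theta_obj C \<gamma> 1 y)"
        by (rule F1.Z.comp_hom[OF F1.F_hom[OF a(1)] z])
      show "theta_mor C \<gamma> 1 b \<in> chom (SS 1) (theta_obj C \<phi> 1 (theta_obj C \<alpha> M g)) (theta_obj C \<gamma> 1 y)"
        using F2.F_hom[OF b(1)] commo[OF g(1)] by simp
      show "sm_c (ccomp (SS 1) z (theta_mor C \<phi> 1 a)) 0 1 = sm_c (theta_mor C \<gamma> 1 b) 0 1"
        using a(2) b(2) z01 vid_right[OF wd(5)] \<phi> \<gamma> by (simp add: S_sels theta_c t_def)
    qed
    then show "\<exists>w\<in>S_obj C n. \<exists>a\<in>chom (SS M) (theta_obj C \<alpha> M w) x. \<exists>b\<in>chom (SS (Suc i)) (theta_obj C \<beta> (Suc i) w) y.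
       ccomp (SS 1) z (theta_mor C \<phi> 1 a) = theta_mor C \<gamma> 1 b" using g(1) a(1) b(1) by blast
  next
    fix w w' a b assume w: "w \<in> S_obj C n" "w' \<in> S_obj C n" and a: "a \<in> chom (SS M) (theta_obj C \<alpha> M w) (theta_obj C \<alpha> M w')"
      and b: "b \<in> chom (SS (Suc i)) (theta_obj C \<beta> (Suc i) w) (theta_obj C \<beta> (Suc i) w')" and ab: "theta_mor C \<phi> 1 a = theta_mor C \<gamma> 1 b"
    have ab1: "sm_c a 0 M = sm_c b i (Suc i)"
      using arg_cong[OF ab, of "\<lambda>m. sm_c m 0 1"] \<phi> \<gamma> by (simp add: theta_c)
    define t where "t l = (if l < i then sm_c b l (Suc i) else sm_c a (l - i) M)" for l
    have tb: "t l = sm_c b l (Suc i)" if "l \<le> i" for l using that ab1 by (cases "l = i") (auto simp: t_def)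
    have "\<exists>m\<in>chom (SS n) w w'. \<forall>l\<le>n. sm_c m l n = t l"
    proof (rule column_full[OF w])
      fix l assume l: "l \<le> n"
      show "vweq C (t l) \<and> vdom C (t l) = sA w l n \<and> vcod C (t l) = sA w' l n"
      proof (cases "l < i")
        case True
        then show ?thesis using S_vweq[OF b, of l "Suc i"] S_homD(6,7)[OF b, of l "Suc i"] sAb[of l w] sAb[of l w'] by (simp add: t_def)
      next
        case False
        then show ?thesis using S_vweq[OF a, of "l - i" M] S_homD(6,7)[OF a, of "l - i" M] sAa[of "l - i" w] sAa[of "l - i" w'] l M1 by (simp add: t_def)
      qed
    next
      fix l assume l: "l < n"
      show "vcomp C (t (Suc l)) (sV w l n) = vcomp C (sV w' l n) (t l)"
      proof (cases "l < i")
        case True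
        then show ?thesis using S_homD(9)[OF b, of l "Suc i"] sVb[OF w(1) True] sVb[OF w(2) True] tb[of l] tb[of "Suc l"] by simp
      next
        case False
        then show ?thesis using S_homD(9)[OF a, of "l - i" M] sVa[OF w(1), of "l - i"] sVa[OF w(2), of "l - i"] l M1
          by (simp add: t_def Suc_diff_le)
      qed
    qed
    then obtain c where c: "c \<in> chom (SS n) w w'" "\<forall>l\<le>n. sm_c c l n = t l" by blast
    have ca: "theta_mor C \<alpha> M d = a \<longleftrightarrow> (\<forall>l\<le>M. sm_c d (l + i) n = sm_c a l M)" if "d \<in> chom (SS n) w w'" for d
      using column_faithful[OF theta_mor_in[OF that mono(1)] a] \<alpha> M1 by (auto simp: theta_c)
    have cb: "theta_mor C \<beta> (Suc i) d = b" if d: "d \<in> chom (SS n) w w'" and e: "\<And>l. l \<le> i \<Longrightarrow> sm_c d l n = sm_c b l (Suc i)" for d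
    proof (rule column_faithful[OF theta_mor_in[OF d mono(2)] b])
      fix l assume l: "l \<le> Suc i"
      show "sm_c (theta_mor C \<beta> (Suc i) d) l (Suc i) = sm_c b l (Suc i)"
      proof (cases "l = Suc i")
        case True
        then show ?thesis using S_diag[OF theta_mor_in[OF d mono(2)], of "Suc i"] S_diag[OF b, of "Suc i"] by simp
      next
        case False
        then show ?thesis using l \<beta>[OF l] \<beta>[of "Suc i"] e[of l] by (simp add: theta_c)
      qed
    qed
    show "\<exists>!c. c \<in> chom (SS n) w w' \<and> theta_mor C \<alpha> M c = a \<and> theta_mor C \<beta> (Suc i) c = b"
    proof (rule ex1I[of _ c])
      have "theta_mor C \<alpha> M c = a" using ca[OF c(1)] c(2) M1 by (simp add: t_def)
      moreover have "theta_mor C \<beta> (Suc i) c = b" by (rule cb[OF c(1)]) (use c(2) tb i in simp)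
      ultimately show "c \<in> chom (SS n) w w' \<and> theta_mor C \<alpha> M c = a \<and> theta_mor C \<beta> (Suc i) c = b" using c(1) by blast
      fix d assume d: "d \<in> chom (SS n) w w' \<and> theta_mor C \<alpha> M d = a \<and> theta_mor C \<beta> (Suc i) d = b"
      show "d = c"
      proof (rule column_faithful[OF _ c(1)])
        show "d \<in> chom (SS n) w w'" using d by blast
        fix l assume l: "l \<le> n"
        show "sm_c d l n = sm_c c l n"
        proof (cases "l < i")
          case False
          have "\<forall>l\<le>M. sm_c d (l + i) n = sm_c a l M" using ca[of d] d by blast
          then have "sm_c d (l - i + i) n = sm_c a (l - i) M" using l M1 by simp
          then show ?thesis using c(2) l False by (simp add: t_def)
        next
          case True
          have "sm_c (theta_mor C \<beta> (Suc i) d) l (Suc i) = sm_c b l (Suc i)" using d by simp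
          then have "sm_c d l n = sm_c b l (Suc i)" using True \<beta>[of l] \<beta>[of "Suc i"] by (simp add: theta_c)
          then show ?thesis using c(2) l True by (simp add: t_def)
        qed
      qed
    qed
  qed
qed

text \<open>The degrees stand for subsets of \<open>{..n}\<close>: \<open>U\<close> for
  \<open>{i..n}\<close>, \<open>W\<close> for \<open>{i}\<close> with \<open>{j..n}\<close>,
  \<open>Suc i\<close> for \<open>{..i}\<close> with \<open>n\<close>, \<open>N\<close> for the
  outer subset. Cutting the outer simplices at \<open>i\<close> is \<open>column_case\<close>, once
  for \<open>{..n}\<close> and once for the outer subset; cutting \<open>{i..n}\<close> at
  \<open>j\<close> is \<open>row_case\<close>. Pasting these three gives the square for the pair
  \<open>i\<close>, \<open>j\<close>.\<close>

lemma general_case: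
  assumes ij: "i < j" "j \<le> n" and M: "M = j - i" and N: "N = Suc (n - M)"
    and \<alpha>: "\<And>l. l \<le> M \<Longrightarrow> \<alpha> l = l + i" and \<beta>: "\<And>l. l \<le> N \<Longrightarrow> \<beta> l = (if l \<le> i then l else l + M - 1)"
    and \<phi>: "\<phi> 0 = 0" "\<phi> 1 = M" and \<gamma>: "\<gamma> 0 = i" "\<gamma> 1 = Suc i"
  shows "gpd_pullback (SS n) (SS M) (SS N) (SS 1) (theta_obj C \<alpha> M) (theta_mor C \<alpha> M) (theta_obj C \<beta> N) (theta_mor C \<beta> N)
     (theta_obj C \<phi> 1) (theta_mor C \<phi> 1) (theta_obj C \<gamma> 1) (theta_mor C \<gamma> 1)"
proof -
  have le1: "l \<le> 1 \<longleftrightarrow> l = 0 \<or> l = 1" for l :: nat by auto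
  define U where "U = n - i"
  define W where "W = Suc (n - j)"
  have ar: "M \<ge> 1" "M \<le> U" "W = Suc (U - M)" "W = N - i" "i < n" "i < N" "N + M = Suc n" "U + i = n" "W + i = N" "W + M = Suc U" "M + i \<le> n"
    using ij by (auto simp: M N U_def W_def)
  define gU :: "nat \<Rightarrow> nat" where "gU l = l + i" for l
  define gY :: "nat \<Rightarrow> nat" where "gY l = (if l \<le> i then l else n)" for l
  define uZ :: "nat \<Rightarrow> nat" where "uZ l = (if l = 0 then 0 else U)" for l
  define qY :: "nat \<Rightarrow> nat" where "qY l = (if l \<le> i then l else N)" for l
  define wZ :: "nat \<Rightarrow> nat" where "wZ l = (if l = 0 then 0 else W)" for l
  define uX :: "nat \<Rightarrow> nat" where "uX l = l" for l
  define uW :: "nat \<Rightarrow> nat" where "uW l = (if l = 0 then 0 else l + M - 1)" for l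
  define vZ :: "nat \<Rightarrow> nat" where "vZ l = l" for l
  have A: "gpd_pullback (SS n) (SS U) (SS (Suc i)) (SS 1) (theta_obj C gU U) (theta_mor C gU U) (theta_obj C gY (Suc i)) (theta_mor C gY (Suc i))
     (theta_obj C uZ 1) (theta_mor C uZ 1) (theta_obj C gU 1) (theta_mor C gU 1)"
    by (rule column_case) (use ar in \<open>simp_all add: gU_def gY_def uZ_def U_def\<close>)
  have B: "gpd_pullback (SS N) (SS W) (SS (Suc i)) (SS 1) (theta_obj C gU W) (theta_mor C gU W) (theta_obj C qY (Suc i)) (theta_mor C qY (Suc i))
     (theta_obj C wZ 1) (theta_mor C wZ 1) (theta_obj C gU 1) (theta_mor C gU 1)"
    by (rule column_case) (use ar in \<open>simp_all add: gU_def qY_def wZ_def\<close>)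
  have Cc: "gpd_pullback (SS U) (SS M) (SS W) (SS 1) (theta_obj C uX M) (theta_mor C uX M) (theta_obj C uW W) (theta_mor C uW W)
     (theta_obj C \<phi> 1) (theta_mor C \<phi> 1) (theta_obj C vZ 1) (theta_mor C vZ 1)"
    by (rule row_case) (use ar \<phi> in \<open>simp_all add: uX_def uW_def vZ_def\<close>)
  have mono: "monotone_idx \<alpha> M n" "monotone_idx \<beta> N n" "monotone_idx \<gamma> 1 N" "monotone_idx gU U n" "monotone_idx gU W N"
     "monotone_idx uX M U" "monotone_idx uW W U" "monotone_idx vZ 1 W" "monotone_idx uZ 1 U" "monotone_idx wZ 1 W"
     "monotone_idx qY (Suc i) N" "monotone_idx gY (Suc i) n"
    using ar \<alpha> \<beta> \<gamma> monotone_idx_one[of \<gamma> N]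
    by (auto simp: monotone_idx_def gU_def gY_def uZ_def qY_def wZ_def uX_def uW_def vZ_def)
  have c1: "gU (uX l) = \<alpha> l" if "l \<le> M" for l using that \<alpha> by (simp add: gU_def uX_def)
  have c2: "gU (vZ l) = \<gamma> l" if "l \<le> 1" for l using that \<gamma> unfolding le1 by (auto simp: gU_def vZ_def)
  have c3: "\<beta> (gU l) = gU (uW l)" if "l \<le> W" for l using that \<beta>[of "l + i"] ar by (auto simp: gU_def uW_def)
  have c4: "\<beta> (qY l) = gY l" if "l \<le> Suc i" for l using that \<beta>[of l] \<beta>[of N] ar by (auto simp: qY_def gY_def)
  have c5: "uW (wZ l) = uZ l" if "l \<le> 1" for l using that ar unfolding le1 by (auto simp: uW_def wZ_def uZ_def)
  show ?thesis
  proof (rule gpd_pullback_paste[OF A B Cc theta_functor[OF mono(2)] theta_functor[OF mono(1)] theta_functor[OF mono(3)]], unfold S_sels(1))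
    fix g assume g: "g \<in> S_obj C n"
    show "theta_obj C \<alpha> M g = theta_obj C uX M (theta_obj C gU U g)" using theta_obj_comp[OF g mono(4,6) c1] by simp
    show "theta_obj C gU W (theta_obj C \<beta> N g) = theta_obj C uW W (theta_obj C gU U g)"
      using theta_obj_comp[OF g mono(2,5) c3] theta_obj_comp[OF g mono(4,7) refl] by simp
    show "theta_obj C qY (Suc i) (theta_obj C \<beta> N g) = theta_obj C gY (Suc i) g" by (rule theta_obj_comp[OF g mono(2,11) c4])
  next
    fix m assume m: "m \<in> cmor (SS n)"
    show "theta_mor C \<alpha> M m = theta_mor C uX M (theta_mor C gU U m)" using theta_mor_comp[OF m mono(4,6) c1] by simp
    show "theta_mor C gU W (theta_mor C \<beta> N m) = theta_mor C uW W (theta_mor C gU U m)"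
      using theta_mor_comp[OF m mono(2,5) c3] theta_mor_comp[OF m mono(4,7) refl] by simp
    show "theta_mor C qY (Suc i) (theta_mor C \<beta> N m) = theta_mor C gY (Suc i) m" by (rule theta_mor_comp[OF m mono(2,11) c4])
  next
    fix q assume q: "q \<in> S_obj C N"
    show "theta_obj C \<gamma> 1 q = theta_obj C vZ 1 (theta_obj C gU W q)" using theta_obj_comp[OF q mono(5,8) c2] by simp
  next
    fix m assume m: "m \<in> cmor (SS N)"
    show "theta_mor C \<gamma> 1 m = theta_mor C vZ 1 (theta_mor C gU W m)" using theta_mor_comp[OF m mono(5,8) c2] by simp
  next
    fix u assume u: "u \<in> S_obj C U"
    show "theta_obj C uZ 1 u = theta_obj C wZ 1 (theta_obj C uW W u)" using theta_obj_comp[OF u mono(7,10) c5] by simp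
  next
    fix m assume m: "m \<in> cmor (SS U)"
    show "theta_mor C uZ 1 m = theta_mor C wZ 1 (theta_mor C uW W m)" using theta_mor_comp[OF m mono(7,10) c5] by simp
  qed
qed

end

section \<open>The index maps of the subsets in the 2-Segal condition\<close>

lemma incl_idx_eq:
  assumes S: "sorted_list_of_set S = xs" "distinct xs" and T: "sorted_list_of_set T = ys" and r: "r < length xs" "xs ! r = ys ! l"
  shows "incl_idx S T l = r"
  unfolding incl_idx_def S T
proof (rule Least_equality)
  show "xs ! r = ys ! l" by (rule r)
  fix y assume "xs ! y = ys ! l"
  then show "r \<le> y" using r S(2) by (metis le_less_linear less_trans nat_neq_iff nth_eq_iff_index_eq)
qed

theorem theorem3p30:
  fixes C :: "('o,'h,'v) dblcat"
  assumes "isostable C"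
  shows "two_segal (BS_space C) (BS_op C)"
proof -
  interpret isostable_dc C by unfold_locales (rule assms)
  show ?thesis
    unfolding two_segal_def Let_def
  proof (intro allI impI)
    fix n i j :: nat assume "3 \<le> n" and "i < j \<and> j \<le> n"
    then have ij: "i < j" "j \<le> n" by auto
    let ?O = "{..i} \<union> {j..n}"
    define M where "M = j - i"
    define N where "N = Suc (n - M)"
    have cards: "card {..n} - 1 = n" "card {i..j} - 1 = M" "card ?O - 1 = N" "card {i,j} - 1 = 1"
    proof -
      have "card ?O = card {..i} + card {j..n}" by (rule card_Un_disjoint) (use ij in auto)
      then show "card ?O - 1 = N" using ij by (simp add: N_def M_def)
    qed (use ij in \<open>auto simp: M_def\<close>)
    have slos: "sorted_list_of_set (set xs) = xs" if "sorted xs" "distinct xs" for xs :: "nat list"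
      using that by (rule sorted_list_of_set.idem_if_sorted_distinct)
    have l1: "sorted_list_of_set {..n} = [0..<Suc n]"
      using slos[of "[0..<Suc n]"] by (simp add: atLeast0LessThan lessThan_Suc_atMost del: upt_Suc)
    have l2: "sorted_list_of_set {i..j} = [i..<Suc j]"
      using slos[of "[i..<Suc j]"] by (simp add: atLeastLessThanSuc_atLeastAtMost del: upt_Suc)
    have l3: "sorted_list_of_set {i,j} = [i,j]" using slos[of "[i,j]"] ij by simp
    let ?o = "[0..<Suc i] @ [j..<Suc n]"
    have so: "sorted ?o" "distinct ?o" "set ?o = ?O" using ij by (auto simp: sorted_append simp del: upt_Suc)
    have l4: "sorted_list_of_set ?O = ?o" using slos[OF so(1,2)] unfolding so(3) .
    have lo: "length ?o = Suc N" using ij by (simp add: N_def M_def)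
    \<comment> \<open>The list omits the \<open>M - 1\<close> numbers strictly between
      \<open>i\<close> and \<open>j\<close>, which is the shift from position \<open>Suc i\<close>
      on.\<close>
    have ol: "?o ! l = (if l \<le> i then l else l + M - 1)" if "l \<le> N" for l
    proof (cases "l \<le> i")
      case True then show ?thesis by (simp add: nth_append del: upt_Suc)
    next
      case False then show ?thesis using that ij by (simp add: nth_append N_def M_def del: upt_Suc)
    qed
    have pb: "gpd_pullback (SS n) (SS M) (SS N) (SS 1) (theta_obj C (incl_idx {..n} {i..j}) M) (theta_mor C (incl_idx {..n} {i..j}) M)
       (theta_obj C (incl_idx {..n} ?O) N) (theta_mor C (incl_idx {..n} ?O) N)
       (theta_obj C (incl_idx {i..j} {i,j}) 1) (theta_mor C (incl_idx {i..j} {i,j}) 1)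
       (theta_obj C (incl_idx ?O {i,j}) 1) (theta_mor C (incl_idx ?O {i,j}) 1)"
    proof (rule general_case[OF ij M_def N_def])
      fix l assume "l \<le> M"
      then show "incl_idx {..n} {i..j} l = l + i"
        by (intro incl_idx_eq[OF l1 _ l2]) (use ij in \<open>simp_all add: M_def del: upt_Suc\<close>)
    next
      fix l assume l: "l \<le> N"
      have "l + M - 1 < Suc n" using l ij by (simp add: N_def M_def)
      then have "(if l \<le> i then l else l + M - 1) < Suc n" using ij by simp
      then show "incl_idx {..n} ?O l = (if l \<le> i then l else l + M - 1)"
        by (intro incl_idx_eq[OF l1 _ l4]) (use ol[OF l] in \<open>simp_all del: upt_Suc\<close>)
    next
      show "incl_idx {i..j} {i,j} 0 = 0" by (rule incl_idx_eq[OF l2 _ l3]) (use ij in \<open>simp_all del: upt_Suc\<close>)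
      show "incl_idx {i..j} {i,j} 1 = M" by (rule incl_idx_eq[OF l2 _ l3]) (use ij in \<open>simp_all add: M_def del: upt_Suc\<close>)
      show "incl_idx ?O {i,j} 0 = i"
        by (rule incl_idx_eq[OF l4 so(2) l3]) (use ij lo ol[of i] in \<open>simp_all add: N_def M_def del: upt_Suc\<close>)
      show "incl_idx ?O {i,j} 1 = Suc i"
        by (rule incl_idx_eq[OF l4 so(2) l3]) (use ij lo ol[of "Suc i"] in \<open>simp_all add: N_def M_def del: upt_Suc\<close>)
    qed
    show "homotopy_pullback (BS_space C (card {..n} - 1)) (BS_space C (card {i..j} - 1)) (BS_space C (card ?O - 1)) (BS_space C (card {i,j} - 1))
       (face_map (BS_op C) {..n} {i..j}) (face_map (BS_op C) {..n} ?O) (face_map (BS_op C) {i..j} {i,j}) (face_map (BS_op C) ?O {i,j})"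
      unfolding face_map_def cards BS_space_def BS_op_def by (rule gpd_pullback.pullback[OF pb])
  qed
qed

end
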